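(* Let $1\to G\to G'\to G''\to1$ be a diffeological extension of diffeological groups. Then we obtain a long exact sequence of diffeological homotopy groups of the Milnor classifying spaces $$\dots\to\pi_{n+1}(BG'')\to\pi_n(BG)\to\pi_n(BG')\to\pi_n(BG'')\to\pi_{n-1}(BG)\to\dots.$$
   Context: Diffeology. A diffeology on a set $X$ is a collection of maps $p\colon U\to X$ ("plots"), $U$ open in some $\mathbb{R}^n$, $n\ge 0$, that contains constant maps, is closed under precomposition with smooth maps between open subsets of Euclidean spaces, and contains every map that is locally a plot. A map is smooth if its composition with every plot is a plot. Subsets, products, quotients carry the subset, product, quotient diffeologies; $[0,1]\subseteq\mathbb{R}$ has the subset diffeology; spaces of smooth maps carry the functional diffeology. A diffeological group is a group with a diffeology for which multiplication and inversion are smooth. A diffeological extension is a short exact sequence $1\to G\to G'\to G''\to1$ of smooth homomorphisms of diffeological groups in which $G\to G'$ is an induction (a diffeomorphism onto its image with the subset diffeology) and $G'\to G''$ is a subduction ($G''$ has the quotient diffeology). Diffeological homotopy groups. $\pi_0(X)$ is the set of smooth path components of $X$; for $k\geq1$, $\pi_k(X,x)=\pi_0(\Omega^k(X,x))$, where $\Omega(X,x)$ is the space of smooth paths $\mathbb{R}\to X$ sending $0$ and $1$ to $x$, with the functional diffeology, and $\Omega^{k}(X,x)=\Omega(\Omega^{k-1}(X,x),\text{constant loop})$. Base points are suppressed. Milnor construction. Let $S_G\subseteq[0,1]^{\mathbb{N}}\times G^{\mathbb{N}}$ be the set of $(t_i,g_i)_{i\in\mathbb{N}}$ with only finitely many $t_i\ne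 0$ and $\sum_i t_i=1$, with the subset diffeology of the product diffeology. Define $(t_i,g_i)\sim(t_i',g_i')$ iff $t_i=t_i'$ for all $i$ and $g_i=g_i'$ whenever $t_i=t'_i\neq0$. $EG:=S_G/\!\sim$ with the quotient diffeology, with elements $(t_ig_i)$; $G$ acts on $EG$ by $h\cdot(t_ig_i)=(t_ig_ih^{-1})$, and $BG:=EG/G$ with the quotient diffeology. *)

theory Defs
  imports "HOL-Analysis.Analysis" "HOL-Algebra.Coset"
begin

section \<open>Smooth functions on open subsets of Euclidean spaces\<close>

text \<open>
  Plots have domains in \<^term>\<open>Euclidean_space n\<close> for varying \<open>n\<close>, so points of \<open>n\<close>-space are
  the functions \<^typ>\<open>nat \<Rightarrow> real\<close> vanishing from \<open>n\<close> on. For \<open>i < n\<close>, the map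
  \<open>s \<mapsto> f (x(i := s))\<close> is the restriction of \<open>f\<close> to the \<open>i\<close>-th coordinate line through \<open>x\<close>.
\<close>

fun Ck_on :: "nat \<Rightarrow> nat \<Rightarrow> (nat \<Rightarrow> real) set \<Rightarrow> ((nat \<Rightarrow> real) \<Rightarrow> real) \<Rightarrow> bool" where
  "Ck_on 0 n U f \<longleftrightarrow> continuous_map (subtopology (Euclidean_space n) U) euclideanreal f"
| "Ck_on (Suc k) n U f \<longleftrightarrow>
     continuous_map (subtopology (Euclidean_space n) U) euclideanreal f \<and>
     (\<exists>f'. \<forall>i<n. Ck_on k n U (f' i) \<and>
        (\<forall>x\<in>U. ((\<lambda>s. f (x(i := s))) has_real_derivative f' i x) (at (x i))))"

definition smooth_fun :: "nat \<Rightarrow> (nat \<Rightarrow> real) set \<Rightarrow> ((nat \<Rightarrow> real) \<Rightarrow> real) \<Rightarrow> bool" where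
  "smooth_fun n U f \<longleftrightarrow> openin (Euclidean_space n) U \<and> (\<forall>k. Ck_on k n U f)"

definition smooth_euclid ::
  "nat \<Rightarrow> (nat \<Rightarrow> real) set \<Rightarrow> nat \<Rightarrow> ((nat \<Rightarrow> real) \<Rightarrow> (nat \<Rightarrow> real)) \<Rightarrow> bool" where
  "smooth_euclid n U m f \<longleftrightarrow>
     openin (Euclidean_space n) U \<and> f ` U \<subseteq> topspace (Euclidean_space m) \<and>
     (\<forall>j<m. smooth_fun n U (\<lambda>x. f x j))"

section \<open>Diffeological spaces\<close>

text \<open>\<open>plot D n U p\<close>: the restriction of \<open>p\<close> to \<open>U\<close>, open in \<open>n\<close>-space, is a plot of \<open>D\<close>.\<close>

record 'a diff_space =
  points :: "'a set"
  plot :: "nat \<Rightarrow> (nat \<Rightarrow> real) set \<Rightarrow> ((nat \<Rightarrow> real) \<Rightarrow> 'a) \<Rightarrow> bool"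

text \<open>
  The last clause is the locality axiom. As \<open>q\<close> need only agree with \<open>p\<close> on \<open>V\<close>, it also says that
  being a plot does not depend on the values of \<open>p\<close> outside \<open>U\<close>.
\<close>

definition diffeology :: "'a diff_space \<Rightarrow> bool" where
  "diffeology D \<longleftrightarrow>
     (\<forall>n U p. plot D n U p \<longrightarrow> openin (Euclidean_space n) U \<and> p ` U \<subseteq> points D) \<and>
     (\<forall>n U x. openin (Euclidean_space n) U \<and> x \<in> points D \<longrightarrow> plot D n U (\<lambda>_. x)) \<and>
     (\<forall>n U p m V f. plot D n U p \<and> smooth_euclid m V n f \<and> f ` V \<subseteq> U \<longrightarrow> plot D m V (p \<circ> f)) \<and>
     (\<forall>n U p. openin (Euclidean_space n) U \<and>
        (\<forall>u\<in>U. \<exists>V q. openin (Euclidean_space n) V \<and> u \<in> V \<and> V \<subseteq> U \<and>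
            plot D n V q \<and> (\<forall>v\<in>V. q v = p v))
        \<longrightarrow> plot D n U p)"

definition smooth_map :: "'a diff_space \<Rightarrow> 'b diff_space \<Rightarrow> ('a \<Rightarrow> 'b) \<Rightarrow> bool" where
  "smooth_map D E f \<longleftrightarrow>
     f ` points D \<subseteq> points E \<and> (\<forall>n U p. plot D n U p \<longrightarrow> plot E n U (f \<circ> p))"

definition diffeomorphism :: "'a diff_space \<Rightarrow> 'b diff_space \<Rightarrow> ('a \<Rightarrow> 'b) \<Rightarrow> bool" where
  "diffeomorphism D E f \<longleftrightarrow>
     bij_betw f (points D) (points E) \<and> smooth_map D E f \<and>
     smooth_map E D (inv_into (points D) f)"

definition euclid_diff :: "nat \<Rightarrow> (nat \<Rightarrow> real) diff_space" where
  "euclid_diff m = \<lparr>points = topspace (Euclidean_space m), plot = (\<lambda>n U p. smooth_euclid n U m p)\<rparr>"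

definition real_diff :: "real diff_space" where
  "real_diff = \<lparr>points = UNIV, plot = smooth_fun\<rparr>"

definition subset_diff :: "'a diff_space \<Rightarrow> 'a set \<Rightarrow> 'a diff_space" where
  "subset_diff D A =
     \<lparr>points = points D \<inter> A, plot = (\<lambda>n U p. plot D n U p \<and> p ` U \<subseteq> A)\<rparr>"

definition prod_diff :: "'a diff_space \<Rightarrow> 'b diff_space \<Rightarrow> ('a \<times> 'b) diff_space" where
  "prod_diff D E =
     \<lparr>points = points D \<times> points E,
      plot = (\<lambda>n U p. plot D n U (fst \<circ> p) \<and> plot E n U (snd \<circ> p))\<rparr>"

definition power_diff :: "'a diff_space \<Rightarrow> (nat \<Rightarrow> 'a) diff_space" where
  "power_diff D =
     \<lparr>points = {x. \<forall>i. x i \<in> points D}, plot = (\<lambda>n U p. \<forall>i. plot D n U (\<lambda>u. p u i))\<rparr>"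

text \<open>
  The quotient diffeology on the image of \<open>f\<close>: plots are the maps that locally lift along \<open>f\<close> to
  plots of \<open>D\<close>. For injective \<open>f\<close> this just transports the diffeology of \<open>D\<close> along \<open>f\<close>.
\<close>

definition image_diff :: "'a diff_space \<Rightarrow> ('a \<Rightarrow> 'b) \<Rightarrow> 'b diff_space" where
  "image_diff D f =
     \<lparr>points = f ` points D,
      plot = (\<lambda>n U q. openin (Euclidean_space n) U \<and>
        (\<forall>u\<in>U. \<exists>V p. openin (Euclidean_space n) V \<and> u \<in> V \<and> V \<subseteq> U \<and>
            plot D n V p \<and> (\<forall>v\<in>V. q v = f (p v))))\<rparr>"

definition quotient_diff :: "'a diff_space \<Rightarrow> ('a \<times> 'a) set \<Rightarrow> 'a set diff_space" where
  "quotient_diff D r = image_diff D (\<lambda>x. r `` {x})"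

definition functional_diff :: "'a diff_space \<Rightarrow> 'b diff_space \<Rightarrow> ('a \<Rightarrow> 'b) diff_space" where
  "functional_diff D E =
     (let C = {f \<in> extensional (points D). smooth_map D E f}
      in \<lparr>points = C,
          plot = (\<lambda>n U p. openin (Euclidean_space n) U \<and> p ` U \<subseteq> C \<and>
            smooth_map (prod_diff (subset_diff (euclid_diff n) U) D) E (\<lambda>(u, x). p u x))\<rparr>)"

definition diff_induction :: "'a diff_space \<Rightarrow> 'b diff_space \<Rightarrow> ('a \<Rightarrow> 'b) \<Rightarrow> bool" where
  "diff_induction D E f \<longleftrightarrow>
     smooth_map D E f \<and> diffeomorphism D (subset_diff E (f ` points D)) f"

definition diff_subduction :: "'a diff_space \<Rightarrow> 'b diff_space \<Rightarrow> ('a \<Rightarrow> 'b) \<Rightarrow> bool" where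
  "diff_subduction D E f \<longleftrightarrow> smooth_map D E f \<and> image_diff D f = E"

section \<open>Diffeological groups and extensions\<close>

definition diffeological_group :: "'a monoid \<Rightarrow> 'a diff_space \<Rightarrow> bool" where
  "diffeological_group G D \<longleftrightarrow>
     group G \<and> diffeology D \<and> points D = carrier G \<and>
     smooth_map (prod_diff D D) D (\<lambda>(x, y). x \<otimes>\<^bsub>G\<^esub> y) \<and>
     smooth_map D D (\<lambda>x. inv\<^bsub>G\<^esub> x)"

definition diffeological_extension ::
  "'a monoid \<Rightarrow> 'a diff_space \<Rightarrow> 'b monoid \<Rightarrow> 'b diff_space \<Rightarrow> 'c monoid \<Rightarrow> 'c diff_space \<Rightarrow>
   ('a \<Rightarrow> 'b) \<Rightarrow> ('b \<Rightarrow> 'c) \<Rightarrow> bool" where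
  "diffeological_extension G D G' D' G'' D'' i p \<longleftrightarrow>
     diffeological_group G D \<and> diffeological_group G' D' \<and> diffeological_group G'' D'' \<and>
     i \<in> hom G G' \<and> smooth_map D D' i \<and>
     p \<in> hom G' G'' \<and> smooth_map D' D'' p \<and>
     inj_on i (carrier G) \<and> i ` carrier G = kernel G' G'' p \<and> p ` carrier G' = carrier G'' \<and>
     diff_induction D D' i \<and> diff_subduction D' D'' p"

section \<open>Diffeological homotopy groups\<close>

definition path_rel :: "'a diff_space \<Rightarrow> ('a \<times> 'a) set" where
  "path_rel D =
     {(x, y). x \<in> points D \<and> y \<in> points D \<and>
        (\<exists>\<gamma>. smooth_map real_diff D \<gamma> \<and> \<gamma> 0 = x \<and> \<gamma> 1 = y)}"

definition pi0 :: "'a diff_space \<Rightarrow> 'a set set" where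
  "pi0 D = points D // path_rel D"

definition loop_diff :: "'a diff_space \<Rightarrow> 'a \<Rightarrow> (real \<Rightarrow> 'a) diff_space" where
  "loop_diff D x = subset_diff (functional_diff real_diff D) {\<gamma>. \<gamma> 0 = x \<and> \<gamma> 1 = x}"

text \<open>
  The type of the \<open>k\<close>-fold iterated loops depends on \<open>k\<close>; the following type contains a copy of
  each of them, \<open>Loop\<close> identifying a path of \<open>k\<close>-fold loops with a \<open>(k+1)\<close>-fold loop.
\<close>

datatype 'a iter_loop = Point 'a | Loop "real \<Rightarrow> 'a iter_loop"

fun const_loop :: "'a \<Rightarrow> nat \<Rightarrow> 'a iter_loop" where
  "const_loop x 0 = Point x"
| "const_loop x (Suc k) = Loop (\<lambda>_. const_loop x k)"

fun iter_loop_diff :: "'a diff_space \<Rightarrow> 'a \<Rightarrow> nat \<Rightarrow> 'a iter_loop diff_space" where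
  "iter_loop_diff D x 0 = image_diff D Point"
| "iter_loop_diff D x (Suc k) = image_diff (loop_diff (iter_loop_diff D x k) (const_loop x k)) Loop"

definition homotopy_set :: "'a diff_space \<Rightarrow> 'a \<Rightarrow> nat \<Rightarrow> 'a iter_loop set set" where
  "homotopy_set D x k = pi0 (iter_loop_diff D x k)"

definition homotopy_unit :: "'a diff_space \<Rightarrow> 'a \<Rightarrow> nat \<Rightarrow> 'a iter_loop set" where
  "homotopy_unit D x k = path_rel (iter_loop_diff D x k) `` {const_loop x k}"

text \<open>
  Loops are concatenated after reparametrising by a smooth function that is \<open>0\<close> up to \<open>1/4\<close> and \<open>1\<close>
  from \<open>3/4\<close> on, so that the result is again smooth. The choice of this function does not affect
  homotopy classes.
\<close>

definition flat_fun :: "real \<Rightarrow> real" where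
  "flat_fun t = (if t \<le> 0 then 0 else exp (- 1 / t))"

definition smashing_fun :: "real \<Rightarrow> real" where
  "smashing_fun t = flat_fun (t - 1/4) / (flat_fun (t - 1/4) + flat_fun (3/4 - t))"

definition concat_path :: "(real \<Rightarrow> 'a) \<Rightarrow> (real \<Rightarrow> 'a) \<Rightarrow> (real \<Rightarrow> 'a)" where
  "concat_path \<alpha> \<beta> =
     (\<lambda>t. if t \<le> 1/2 then \<alpha> (smashing_fun (2 * t)) else \<beta> (smashing_fun (2 * t - 1)))"

text \<open>Meaningful for \<open>k \<ge> 1\<close> only.\<close>

definition homotopy_group :: "'a diff_space \<Rightarrow> 'a \<Rightarrow> nat \<Rightarrow> 'a iter_loop set monoid" where
  "homotopy_group D x k =
     \<lparr>carrier = homotopy_set D x k,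
      monoid.mult = (\<lambda>c d. path_rel (iter_loop_diff D x k) ``
        {Loop (concat_path \<alpha> \<beta>) | \<alpha> \<beta>. Loop \<alpha> \<in> c \<and> Loop \<beta> \<in> d}),
      one = homotopy_unit D x k\<rparr>"

text \<open>The map induced by \<open>f\<close> from the homotopy of its source at \<open>x\<close> to that of \<open>E\<close> at \<open>f x\<close>.\<close>

definition homotopy_map ::
  "'b diff_space \<Rightarrow> ('a \<Rightarrow> 'b) \<Rightarrow> 'a \<Rightarrow> nat \<Rightarrow> 'a iter_loop set \<Rightarrow> 'b iter_loop set" where
  "homotopy_map E f x k c = path_rel (iter_loop_diff E (f x) k) `` (map_iter_loop f ` c)"

section \<open>The Milnor construction\<close>

definition milnor_set :: "'a monoid \<Rightarrow> ((nat \<Rightarrow> real) \<times> (nat \<Rightarrow> 'a)) set" where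
  "milnor_set G =
     {(t, g). (\<forall>i. t i \<in> {0..1}) \<and> (\<forall>i. g i \<in> carrier G) \<and>
        finite {i. t i \<noteq> 0} \<and> (\<Sum>i | t i \<noteq> 0. t i) = 1}"

definition milnor_diff :: "'a monoid \<Rightarrow> 'a diff_space \<Rightarrow> ((nat \<Rightarrow> real) \<times> (nat \<Rightarrow> 'a)) diff_space" where
  "milnor_diff G D =
     subset_diff (prod_diff (power_diff (subset_diff real_diff {0..1})) (power_diff D)) (milnor_set G)"

definition milnor_rel ::
  "'a monoid \<Rightarrow> (((nat \<Rightarrow> real) \<times> (nat \<Rightarrow> 'a)) \<times> ((nat \<Rightarrow> real) \<times> (nat \<Rightarrow> 'a))) set" where
  "milnor_rel G =
     {((t, g), (t', g')). (t, g) \<in> milnor_set G \<and> (t', g') \<in> milnor_set G \<and>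
        (\<forall>i. t i = t' i) \<and> (\<forall>i. t i \<noteq> 0 \<longrightarrow> g i = g' i)}"

type_synonym 'a EG = "((nat \<Rightarrow> real) \<times> (nat \<Rightarrow> 'a)) set"

type_synonym 'a BG = "'a EG set"

definition EG_diff :: "'a monoid \<Rightarrow> 'a diff_space \<Rightarrow> 'a EG diff_space" where
  "EG_diff G D = quotient_diff (milnor_diff G D) (milnor_rel G)"

text \<open>
  The action of \<open>G\<close>, and below the maps induced by homomorphisms, are defined on representatives;
  taking the image under the equivalence relation completes the result to a full class.
\<close>

definition EG_act :: "'a monoid \<Rightarrow> 'a \<Rightarrow> 'a EG \<Rightarrow> 'a EG" where
  "EG_act G h c = milnor_rel G `` ((\<lambda>(t, g). (t, \<lambda>i. g i \<otimes>\<^bsub>G\<^esub> inv\<^bsub>G\<^esub> h)) ` c)"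

definition EG_orbit_rel :: "'a monoid \<Rightarrow> 'a diff_space \<Rightarrow> ('a EG \<times> 'a EG) set" where
  "EG_orbit_rel G D = {(c, d). c \<in> points (EG_diff G D) \<and> (\<exists>h\<in>carrier G. d = EG_act G h c)}"

definition BG_diff :: "'a monoid \<Rightarrow> 'a diff_space \<Rightarrow> 'a BG diff_space" where
  "BG_diff G D = quotient_diff (EG_diff G D) (EG_orbit_rel G D)"

definition EG_map :: "'b monoid \<Rightarrow> ('a \<Rightarrow> 'b) \<Rightarrow> 'a EG \<Rightarrow> 'b EG" where
  "EG_map H f c = milnor_rel H `` ((\<lambda>(t, g). (t, f \<circ> g)) ` c)"

definition BG_map :: "'b monoid \<Rightarrow> 'b diff_space \<Rightarrow> ('a \<Rightarrow> 'b) \<Rightarrow> 'a BG \<Rightarrow> 'b BG" where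
  "BG_map H E f b = EG_orbit_rel H E `` (EG_map H f ` b)"

section \<open>Long exact sequences of homotopy groups\<close>

definition exact_at :: "'a set \<Rightarrow> ('a \<Rightarrow> 'b) \<Rightarrow> 'b set \<Rightarrow> ('b \<Rightarrow> 'c) \<Rightarrow> 'c \<Rightarrow> bool" where
  "exact_at A f B g c0 \<longleftrightarrow> f ` A = {b \<in> B. g b = c0}"

text \<open>
  For smooth maps \<open>f\<close> from \<open>X\<close> to \<open>Y\<close> and \<open>g\<close> from \<open>Y\<close> to \<open>Z\<close>, with base points \<open>x\<close>, \<open>f x\<close> and
  \<open>g (f x)\<close>: the maps induced by \<open>f\<close> and \<open>g\<close> in degree \<open>n\<close> and the connecting maps \<open>\<delta> n\<close> from
  degree \<open>n + 1\<close> of \<open>Z\<close> to degree \<open>n\<close> of \<open>X\<close> form a long exact sequence, of groups as far as both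
  ends of a map have positive degree and of pointed sets down to degree \<open>0\<close>.
\<close>

definition long_exact_homotopy_sequence ::
  "'a diff_space \<Rightarrow> 'b diff_space \<Rightarrow> 'c diff_space \<Rightarrow> ('a \<Rightarrow> 'b) \<Rightarrow> ('b \<Rightarrow> 'c) \<Rightarrow> 'a \<Rightarrow>
   (nat \<Rightarrow> 'c iter_loop set \<Rightarrow> 'a iter_loop set) \<Rightarrow> bool" where
  "long_exact_homotopy_sequence X Y Z f g x \<delta> \<longleftrightarrow>
     (\<forall>n. homotopy_map Y f x n \<in> homotopy_set X x n \<rightarrow> homotopy_set Y (f x) n) \<and>
     (\<forall>n. homotopy_map Z g (f x) n \<in> homotopy_set Y (f x) n \<rightarrow> homotopy_set Z (g (f x)) n) \<and>
     (\<forall>n. \<delta> n \<in> homotopy_set Z (g (f x)) (n + 1) \<rightarrow> homotopy_set X x n) \<and>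
     (\<forall>n\<ge>1. group_hom (homotopy_group X x n) (homotopy_group Y (f x) n) (homotopy_map Y f x n)) \<and>
     (\<forall>n\<ge>1. group_hom (homotopy_group Y (f x) n) (homotopy_group Z (g (f x)) n)
        (homotopy_map Z g (f x) n)) \<and>
     (\<forall>n\<ge>1. group_hom (homotopy_group Z (g (f x)) (n + 1)) (homotopy_group X x n) (\<delta> n)) \<and>
     (\<forall>n. exact_at (homotopy_set X x n) (homotopy_map Y f x n)
        (homotopy_set Y (f x) n) (homotopy_map Z g (f x) n) (homotopy_unit Z (g (f x)) n)) \<and>
     (\<forall>n. exact_at (homotopy_set Y (f x) (n + 1)) (homotopy_map Z g (f x) (n + 1))
        (homotopy_set Z (g (f x)) (n + 1)) (\<delta> n) (homotopy_unit X x n)) \<and>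
     (\<forall>n. exact_at (homotopy_set Z (g (f x)) (n + 1)) (\<delta> n)
        (homotopy_set X x n) (homotopy_map Y f x n) (homotopy_unit Y (f x) n))"

end

theory Submission
  imports Defs
begin

text \<open>
  The total space \<open>EG\<close> is smoothly contractible and \<open>EG \<rightarrow> BG\<close> is a principal \<open>G\<close>-bundle in the sense that
  plots lift locally and two lifts of a plot differ by a plot of \<open>G\<close>; so is \<open>G' \<rightarrow> G''\<close> for the action of
  \<open>G\<close> by left translations. Such a bundle is trivial over \<open>\<real>\<^sup>n\<close>, hence has the homotopy lifting property, and
  this property passes to loop spaces: the lift of a homotopy of loops is corrected on the two faces by the
  action of loops in the structure group. Therefore exactness and the connecting maps in all degrees reduce to
  the statements about \<open>\<pi>\<^sub>1\<close> of the base and \<open>\<pi>\<^sub>0\<close> of the fibre, applied to iterated loop spaces. For \<open>EG \<rightarrow> BG\<close>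
  the connecting map is a natural bijection from \<open>\<pi>\<^sub>n\<^sub>+\<^sub>1(BG)\<close> onto \<open>\<pi>\<^sub>n(G)\<close>, and it carries the sequence of the
  extension, with its own connecting map \<open>\<pi>\<^sub>n\<^sub>+\<^sub>1(G'') \<rightarrow> \<pi>\<^sub>n(G)\<close>, to the sequence of classifying spaces. As \<open>BG\<close> is
  connected, nothing is left to prove in degree \<open>0\<close> beyond the surjectivity of \<open>\<pi>\<^sub>0(G') \<rightarrow> \<pi>\<^sub>0(G'')\<close>.
\<close>

section \<open>Smooth functions\<close>

text \<open>The maps between classifying spaces are never shown to be fibrations:
  \<open>BG_map\<close> is compared one degree lower with \<open>G \<rightarrow> G'\<close>, so
  exactness is proved for bundles with a structure group and then transported along bijections.

  Division \<open>dv\<close> belongs to the structure of a principal action because loop spaces are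
  handled without local sections: action, division and homotopy lifting are what passes to loops,
  the first two pointwise. Lifting is stated over all R^m because a homotopy of loops parametrised
  by R^m is a homotopy parametrised by R^m x R.

  A connecting map turns concatenation in the base into the pointwise product in the structure
  group. In positive degrees this product agrees with concatenation, which makes the composite
  \<delta> multiplicative.

  Paths are maps on all of R that need not rest at 0 and 1. Hence pieces are joined, and parameters
  are kept in [0, 1], by means of \<open>smashing_fun\<close>; the same function is the cutoff used
  to trivialise bundles and to move weights in \<open>EG\<close>.\<close>

abbreviation "Eu n \<equiv> topspace (Euclidean_space n)"

lemma mem_Eu: "x \<in> Eu n \<longleftrightarrow> (\<forall>i\<ge>n. x i = 0)"
  by (simp add: topspace_Euclidean_space)

abbreviation "eopen n \<equiv> openin (Euclidean_space n)"

lemma Euclidean_space_top_of_set: "Euclidean_space n = top_of_set (Eu n)"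
  by (simp add: Euclidean_space_def euclidean_product_topology)

lemma Eu_upd [simp]: "x \<in> Eu n \<Longrightarrow> i < n \<Longrightarrow> x(i := s) \<in> Eu n"
  by (auto simp: mem_Eu)

lemma openin_Eu_sub: "eopen n U \<Longrightarrow> U \<subseteq> Eu n"
  by (simp add: openin_subset)

lemma openin_Eu_iff:
  "eopen n U \<longleftrightarrow>
    U \<subseteq> Eu n \<and> (\<forall>x\<in>U. \<exists>d>0. \<forall>y\<in>Eu n. (\<forall>i<n. \<bar>y i - x i\<bar> < d) \<longrightarrow> y \<in> U)"
proof safe
  show "x \<in> Eu n" if "eopen n U" "x \<in> U" for x
    using that openin_subset by blast
next
  fix x assume U: "eopen n U" and x: "x \<in> U"
  then obtain T where T: "openin (product_topology (\<lambda>i::nat. euclidean :: real topology) UNIV) T" "U = T \<inter> Eu n"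
    unfolding Euclidean_space_def openin_subtopology by auto
  obtain X where X: "finite {i. X i \<noteq> (UNIV::real set)}" "\<And>i. open (X i)" "\<And>i. x i \<in> X i" "Pi\<^sub>E UNIV X \<subseteq> T"
    using T x unfolding openin_product_topology_alt by fastforce
  have "\<exists>d>0. \<forall>y. \<bar>y - x i\<bar> < d \<longrightarrow> y \<in> X i" for i
    using X(2)[of i] X(3)[of i] unfolding open_dist dist_real_def by auto
  then obtain d where d: "\<And>i. d i > 0" "\<And>i y. \<bar>y - x i\<bar> < d i \<Longrightarrow> y \<in> X i"
    by metis
  \<comment> \<open>The 1 keeps the minimum defined and positive when no coordinate is
    restricted.\<close>
  define e where "e = Min (insert 1 (d ` {i. X i \<noteq> UNIV}))"
  have "e > 0" using X(1) d(1) by (auto simp: e_def)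
  moreover have "y \<in> U" if y: "y \<in> Eu n" "\<forall>i<n. \<bar>y i - x i\<bar> < e" for y
  proof -
    have "y i \<in> X i" for i
    proof (cases "X i = UNIV")
      case False
      then have ei: "e \<le> d i" using X(1) by (simp add: e_def)
      have "\<bar>y i - x i\<bar> < e"
      proof (cases "i < n")
        case False
        then show ?thesis using y(1) x T(2) \<open>e > 0\<close> by (auto simp: mem_Eu)
      qed (use y in auto)
      then show ?thesis using d(2) ei by force
    qed auto
    then show ?thesis using X(4) T(2) y(1) by auto
  qed
  ultimately show "\<exists>d>0. \<forall>y\<in>Eu n. (\<forall>i<n. \<bar>y i - x i\<bar> < d) \<longrightarrow> y \<in> U" by blast
next
  assume sub: "U \<subseteq> Eu n" and *: "\<forall>x\<in>U. \<exists>d>0. \<forall>y\<in>Eu n. (\<forall>i<n. \<bar>y i - x i\<bar> < d) \<longrightarrow> y \<in> U"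
  have "\<exists>T. eopen n T \<and> x \<in> T \<and> T \<subseteq> U" if x: "x \<in> U" for x
  proof -
    obtain d where d: "d > 0" "\<And>y. y \<in> Eu n \<Longrightarrow> (\<forall>i<n. \<bar>y i - x i\<bar> < d) \<Longrightarrow> y \<in> U"
      using * x by blast
    define X where "X i = (if i < n then ball (x i) d else UNIV)" for i
    have "openin (product_topology (\<lambda>i::nat. euclidean :: real topology) UNIV) (Pi\<^sub>E UNIV X)"
    proof (rule product_topology_basis)
      show "openin euclidean (X i)" for i by (simp add: X_def)
      show "finite {i. X i \<noteq> topspace euclidean}"
        by (rule finite_subset[of _ "{..<n}"]) (auto simp: X_def)
    qed
    then have "eopen n (Pi\<^sub>E UNIV X \<inter> Eu n)"
      unfolding Euclidean_space_def openin_subtopology by auto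
    moreover have "x \<in> Pi\<^sub>E UNIV X \<inter> Eu n" using x sub d(1) by (auto simp: X_def)
    moreover have "Pi\<^sub>E UNIV X \<inter> Eu n \<subseteq> U"
    proof
      fix y assume y: "y \<in> Pi\<^sub>E UNIV X \<inter> Eu n"
      have "\<bar>y i - x i\<bar> < d" if "i < n" for i
      proof -
        have "y i \<in> X i" using y by auto
        then show ?thesis using that by (simp add: X_def dist_real_def abs_minus_commute)
      qed
      with y show "y \<in> U" by (intro d(2)) auto
    qed
    ultimately show ?thesis by blast
  qed
  then show "eopen n U"
    using openin_subopen by blast
qed

lemma openin_EuE:
  assumes "eopen n U" "x \<in> U"
  obtains d where "d > 0" "\<And>y. y \<in> Eu n \<Longrightarrow> (\<And>i. i < n \<Longrightarrow> \<bar>y i - x i\<bar> < d) \<Longrightarrow> y \<in> U"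
  using assms unfolding openin_Eu_iff by blast

text \<open>The derivatives in \<open>Ck_on\<close> are taken along coordinate lines, which leave
  \<open>U\<close>; this says that they stay inside near the base point.\<close>

lemma openin_Eu_line:
  assumes "eopen n U" "x \<in> U" "i < n"
  shows "\<forall>\<^sub>F s in nhds (x i). x(i := s) \<in> U"
proof -
  obtain d where d: "d > 0" "\<And>y. y \<in> Eu n \<Longrightarrow> (\<And>i. i < n \<Longrightarrow> \<bar>y i - x i\<bar> < d) \<Longrightarrow> y \<in> U"
    by (rule openin_EuE[OF assms(1,2)]) blast
  have "x \<in> Eu n" using assms openin_Eu_sub by blast
  then have "x(i := s) \<in> U" if "dist s (x i) < d" for s
    using that assms d(1) by (intro d(2)) (auto simp: dist_real_def)
  then show ?thesis using d(1) unfolding eventually_nhds_metric by blast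
qed

lemma cont_Eu_iff:
  "U \<subseteq> Eu n \<Longrightarrow> continuous_map (subtopology (Euclidean_space n) U) euclideanreal f \<longleftrightarrow> continuous_on U f"
  by (subst Euclidean_space_top_of_set) (simp add: subtopology_subtopology Int_absorb1)

lemma continuous_on_coord [continuous_intros]: "continuous_on U (\<lambda>x::nat \<Rightarrow> real. x i)"
  by (rule continuous_on_subset[OF continuous_on_product_coordinates]) auto

lemma continuous_on_EuD:
  assumes "eopen n U" "continuous_on U f" "x \<in> U" "e > (0::real)"
  obtains d where "d > 0" "\<And>y. y \<in> Eu n \<Longrightarrow> (\<And>i. i < n \<Longrightarrow> \<bar>y i - x i\<bar> < d) \<Longrightarrow> y \<in> U \<and> \<bar>f y - f x\<bar> < e"
proof -
  have sub: "U \<subseteq> Eu n" using assms openin_Eu_sub by blast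
  have "openin (subtopology (Euclidean_space n) U) {y \<in> U. f y \<in> ball (f x) e}"
    using openin_continuous_map_preimage[of "subtopology (Euclidean_space n) U" euclideanreal f "ball (f x) e"]
      assms(2) sub by (simp only: cont_Eu_iff topspace_subtopology Int_absorb1 open_openin[symmetric] open_ball simp_thms)
  then have "eopen n {y \<in> U. f y \<in> ball (f x) e}"
    by (simp add: openin_open_subtopology[OF assms(1)])
  moreover have "x \<in> {y \<in> U. f y \<in> ball (f x) e}" using assms by simp
  ultimately obtain d where "d > 0" "\<And>y. y \<in> Eu n \<Longrightarrow> (\<And>i. i < n \<Longrightarrow> \<bar>y i - x i\<bar> < d) \<Longrightarrow> y \<in> {y \<in> U. f y \<in> ball (f x) e}"
    by (rule openin_EuE) blast
  then show ?thesis
    by (intro that[of d]) (auto simp: dist_real_def abs_minus_commute)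
qed

section \<open>Functions of class C^k on open sets\<close>

lemma Ck_on_cont: "U \<subseteq> Eu n \<Longrightarrow> Ck_on k n U f \<Longrightarrow> continuous_on U f"
  by (cases k) (auto simp: cont_Eu_iff)

lemma Ck_on_Suc_iff:
  assumes "U \<subseteq> Eu n"
  shows "Ck_on (Suc k) n U f \<longleftrightarrow> continuous_on U f \<and>
     (\<exists>f'. \<forall>i<n. Ck_on k n U (f' i) \<and>
        (\<forall>x\<in>U. ((\<lambda>s. f (x(i := s))) has_real_derivative f' i x) (at (x i))))"
  using assms by (simp add: cont_Eu_iff)

declare Ck_on.simps(2) [simp del]

text \<open>The functions may differ outside \<open>U\<close>, where coordinate lines lead; as
  \<open>U\<close> is open, a derivative at a point of \<open>U\<close> sees only values in
  \<open>U\<close>.\<close>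

lemma Ck_on_cong:
  assumes "eopen n U" "\<And>x. x \<in> U \<Longrightarrow> f x = g x" "Ck_on k n U f"
  shows "Ck_on k n U g"
proof -
  have sub: "U \<subseteq> Eu n" using assms openin_Eu_sub by blast
  have c: "continuous_on U g"
    using Ck_on_cont[OF sub assms(3)] assms(2) by (simp cong: continuous_on_cong)
  show ?thesis
  proof (cases k)
    case 0
    then show ?thesis using c by (simp add: cont_Eu_iff sub)
  next
    case (Suc k')
    have *: "((\<lambda>s. g (x(i := s))) has_real_derivative D) (at (x i))"
      if "((\<lambda>s. f (x(i := s))) has_real_derivative D) (at (x i))" "x \<in> U" "i < n" for i x D
    proof -
      have "\<forall>\<^sub>F s in nhds (x i). f (x(i := s)) = g (x(i := s))"
        using openin_Eu_line[OF assms(1) that(2,3)] by eventually_elim (use assms(2) in auto)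
      from DERIV_cong_ev[OF refl this refl] that(1) show ?thesis by blast
    qed
    obtain f' where "\<forall>i<n. Ck_on k' n U (f' i) \<and>
        (\<forall>x\<in>U. ((\<lambda>s. f (x(i := s))) has_real_derivative f' i x) (at (x i)))"
      using assms(3)[unfolded Suc Ck_on_Suc_iff[OF sub]] by (elim conjE exE)
    then show ?thesis using c *
      unfolding Suc Ck_on_Suc_iff[OF sub] by (intro conjI exI[of _ f']) auto
  qed
qed

lemma Ck_on_subset: "U \<subseteq> Eu n \<Longrightarrow> V \<subseteq> U \<Longrightarrow> Ck_on k n U f \<Longrightarrow> Ck_on k n V f"
proof (induction k arbitrary: f)
  case 0
  then show ?case by (auto simp: cont_Eu_iff intro: continuous_on_subset)
next
  case (Suc k)
  have V: "V \<subseteq> Eu n" using Suc by blast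
  from Suc.prems(3) obtain f' where "continuous_on U f" "\<forall>i<n. Ck_on k n U (f' i) \<and>
      (\<forall>x\<in>U. ((\<lambda>s. f (x(i := s))) has_real_derivative f' i x) (at (x i)))"
    unfolding Ck_on_Suc_iff[OF Suc.prems(1)] by (elim conjE exE)
  with Suc.IH[OF Suc.prems(1,2)] continuous_on_subset[OF _ Suc.prems(2)] Suc.prems(2) show ?case
    unfolding Ck_on_Suc_iff[OF V] by (intro conjI exI[of _ f']) blast+
qed

lemma Ck_on_SucD: "U \<subseteq> Eu n \<Longrightarrow> Ck_on (Suc k) n U f \<Longrightarrow> Ck_on k n U f"
proof (induction k arbitrary: f)
  case 0
  then show ?case by (simp add: Ck_on_Suc_iff cont_Eu_iff)
next
  case (Suc k)
  from Suc.prems(2) obtain f' where "continuous_on U f" "\<forall>i<n. Ck_on (Suc k) n U (f' i) \<and>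
      (\<forall>x\<in>U. ((\<lambda>s. f (x(i := s))) has_real_derivative f' i x) (at (x i)))"
    unfolding Ck_on_Suc_iff[OF Suc.prems(1), of "Suc k"] by (elim conjE exE)
  with Suc.IH[OF Suc.prems(1)] show ?case
    unfolding Ck_on_Suc_iff[OF Suc.prems(1), of k] by (intro conjI exI[of _ f']) auto
qed

text \<open>The derivative witnesses on different neighbourhoods are unrelated. \<open>deriv\<close>
  gives one function on all of \<open>U\<close> that agrees with each of them, and the induction
  hypothesis applies to it.\<close>

lemma Ck_on_local:
  assumes U: "eopen n U"
    and "\<And>u. u \<in> U \<Longrightarrow> \<exists>V. eopen n V \<and> u \<in> V \<and> V \<subseteq> U \<and> Ck_on k n V f"
  shows "Ck_on k n U f"
  using assms(2)
proof (induction k arbitrary: f)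
  have sub: "U \<subseteq> Eu n" using U openin_Eu_sub by blast
  have cont: "continuous_on U f"
    if *: "\<And>u. u \<in> U \<Longrightarrow> \<exists>V. eopen n V \<and> u \<in> V \<and> V \<subseteq> U \<and> Ck_on k n V f" for f k
  proof -
    obtain V where V: "\<And>u. u \<in> U \<Longrightarrow> eopen n (V u) \<and> u \<in> V u \<and> V u \<subseteq> U \<and> Ck_on k n (V u) f"
      using bchoice[of U "\<lambda>u V. eopen n V \<and> u \<in> V \<and> V \<subseteq> U \<and> Ck_on k n V f"] * by blast
    have "continuous_map (subtopology (Euclidean_space n) U) euclideanreal f"
    proof (rule pasting_lemma[where I = U and T = V and f = "\<lambda>_. f"])
      fix u assume u: "u \<in> U"
      then show "openin (subtopology (Euclidean_space n) U) (V u)"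
        using V by (simp add: openin_open_subtopology U)
      have "V u \<subseteq> Eu n" using V[OF u] sub by blast
      then show "continuous_map (subtopology (subtopology (Euclidean_space n) U) (V u)) euclideanreal f"
        using V[OF u] Ck_on_cont[OF \<open>V u \<subseteq> Eu n\<close>] by (auto simp: subtopology_subtopology Int_absorb1 cont_Eu_iff)
    qed (use V in auto)
    then show ?thesis by (simp add: cont_Eu_iff sub)
  qed
  {
    case 0
    then show ?case using cont[of 0 f] by (simp add: cont_Eu_iff sub)
  next
    case (Suc k)
    let ?D = "\<lambda>i x. deriv (\<lambda>s. f (x(i := s))) (x i)"
    have D: "Ck_on k n V (?D i) \<and> (\<forall>x\<in>V. ((\<lambda>s. f (x(i := s))) has_real_derivative ?D i x) (at (x i)))"
      if V: "eopen n V" "Ck_on (Suc k) n V f" and i: "i < n" for V i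
    proof -
      have "V \<subseteq> Eu n" using V openin_Eu_sub by blast
      from V(2)[unfolded Ck_on_Suc_iff[OF this]] obtain f' where
        f': "Ck_on k n V (f' i)" "\<And>x. x \<in> V \<Longrightarrow> ((\<lambda>s. f (x(i := s))) has_real_derivative f' i x) (at (x i))"
        using i by blast
      have eq: "f' i x = ?D i x" if "x \<in> V" for x
        using DERIV_imp_deriv[OF f'(2)[OF that]] by simp
      show ?thesis using Ck_on_cong[OF V(1) eq f'(1)] f'(2) eq by simp
    qed
    have "Ck_on k n U (?D i)" if "i < n" for i
    proof (rule Suc.IH)
      fix u assume "u \<in> U"
      from Suc.prems[OF this] obtain V where V: "eopen n V" "u \<in> V" "V \<subseteq> U" "Ck_on (Suc k) n V f"
        by blast
      with D[OF V(1,4) that] show "\<exists>V. eopen n V \<and> u \<in> V \<and> V \<subseteq> U \<and> Ck_on k n V (?D i)"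
        by blast
    qed
    moreover have "((\<lambda>s. f (x(i := s))) has_real_derivative ?D i x) (at (x i))" if "i < n" "x \<in> U" for i x
    proof -
      from Suc.prems[OF that(2)] obtain V where V: "eopen n V" "x \<in> V" "V \<subseteq> U" "Ck_on (Suc k) n V f"
        by blast
      with D[OF V(1,4) that(1)] show ?thesis by blast
    qed
    ultimately show ?case unfolding Ck_on_Suc_iff[OF sub] using cont[OF Suc.prems]
      by (intro conjI exI[of _ ?D]) auto
  }
qed

lemma Ck_on_const: "U \<subseteq> Eu n \<Longrightarrow> Ck_on k n U (\<lambda>_. c)"
proof (induction k arbitrary: c)
  case (Suc k)
  show ?case unfolding Ck_on_Suc_iff[OF Suc.prems]
    by (intro conjI exI[of _ "\<lambda>i x. 0"]) (use Suc.IH[OF Suc.prems] in auto)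
qed (simp add: cont_Eu_iff)

lemma Ck_on_coord: "U \<subseteq> Eu n \<Longrightarrow> Ck_on k n U (\<lambda>x. x j)"
proof (induction k)
  case (Suc k)
  show ?case unfolding Ck_on_Suc_iff[OF Suc.prems]
    by (intro conjI exI[of _ "\<lambda>i x. if i = j then 1 else 0"])
       (auto intro!: Ck_on_const[OF Suc.prems] continuous_intros derivative_eq_intros)
qed (auto simp: cont_Eu_iff intro: continuous_intros)

lemma Ck_on_add: "U \<subseteq> Eu n \<Longrightarrow> Ck_on k n U f \<Longrightarrow> Ck_on k n U g \<Longrightarrow> Ck_on k n U (\<lambda>x. f x + g x)"
proof (induction k arbitrary: f g)
  case (Suc k)
  note iff = Ck_on_Suc_iff[OF Suc.prems(1)]
  from Suc.prems(2) obtain f' where f': "continuous_on U f"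
    "\<forall>i<n. Ck_on k n U (f' i) \<and> (\<forall>x\<in>U. ((\<lambda>s. f (x(i := s))) has_real_derivative f' i x) (at (x i)))"
    unfolding iff by blast
  from Suc.prems(3) obtain g' where g': "continuous_on U g"
    "\<forall>i<n. Ck_on k n U (g' i) \<and> (\<forall>x\<in>U. ((\<lambda>s. g (x(i := s))) has_real_derivative g' i x) (at (x i)))"
    unfolding iff by blast
  show ?case unfolding iff
    using f' g' Suc.IH[OF Suc.prems(1)]
    by (intro conjI exI[of _ "\<lambda>i x. f' i x + g' i x"]) (auto intro!: continuous_intros DERIV_add)
qed (auto simp: cont_Eu_iff intro: continuous_intros)

lemma Ck_on_mult: "U \<subseteq> Eu n \<Longrightarrow> Ck_on k n U f \<Longrightarrow> Ck_on k n U g \<Longrightarrow> Ck_on k n U (\<lambda>x. f x * g x)"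
proof (induction k arbitrary: f g)
  case (Suc k)
  note iff = Ck_on_Suc_iff[OF Suc.prems(1)]
  from Suc.prems(2) obtain f' where f': "continuous_on U f"
    "\<forall>i<n. Ck_on k n U (f' i) \<and> (\<forall>x\<in>U. ((\<lambda>s. f (x(i := s))) has_real_derivative f' i x) (at (x i)))"
    unfolding iff by blast
  from Suc.prems(3) obtain g' where g': "continuous_on U g"
    "\<forall>i<n. Ck_on k n U (g' i) \<and> (\<forall>x\<in>U. ((\<lambda>s. g (x(i := s))) has_real_derivative g' i x) (at (x i)))"
    unfolding iff by blast
  have fg: "Ck_on k n U f" "Ck_on k n U g" using Suc.prems Ck_on_SucD by blast+
  show ?case unfolding iff
  proof (intro conjI exI[of _ "\<lambda>i x. f' i x * g x + f x * g' i x"] allI impI ballI)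
    fix i assume i: "i < n"
    show "Ck_on k n U (\<lambda>x. f' i x * g x + f x * g' i x)"
      using f' g' fg i Suc.IH[OF Suc.prems(1)] Suc.prems(1) by (auto intro!: Ck_on_add)
    fix x assume "x \<in> U"
    then show "((\<lambda>s. f (x(i := s)) * g (x(i := s))) has_real_derivative f' i x * g x + f x * g' i x) (at (x i))"
      using f' g' i by (auto intro!: derivative_eq_intros)
  qed (use f' g' in \<open>auto intro!: continuous_intros\<close>)
qed (auto simp: cont_Eu_iff intro: continuous_intros)

lemma Ck_on_inverse:
  "U \<subseteq> Eu n \<Longrightarrow> Ck_on k n U f \<Longrightarrow> (\<And>x. x \<in> U \<Longrightarrow> f x \<noteq> 0) \<Longrightarrow> Ck_on k n U (\<lambda>x. inverse (f x))"
proof (induction k)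
  case (Suc k)
  note iff = Ck_on_Suc_iff[OF Suc.prems(1)]
  from Suc.prems(2) obtain f' where f': "continuous_on U f"
    "\<forall>i<n. Ck_on k n U (f' i) \<and> (\<forall>x\<in>U. ((\<lambda>s. f (x(i := s))) has_real_derivative f' i x) (at (x i)))"
    unfolding iff by blast
  have inv: "Ck_on k n U (\<lambda>x. inverse (f x))" using Suc Ck_on_SucD by blast
  show ?case unfolding iff
  \<comment> \<open>The derivative is written with products and constants only, so that
    \<open>Ck_on_mult\<close>, \<open>Ck_on_const\<close> and the induction hypothesis give its
    regularity.\<close>
  proof (intro conjI exI[of _ "\<lambda>i x. ((-1) * f' i x) * (inverse (f x) * inverse (f x))"] allI impI ballI)
    fix i assume i: "i < n"
    show "Ck_on k n U (\<lambda>x. ((-1) * f' i x) * (inverse (f x) * inverse (f x)))"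
      using f' inv i Suc.prems(1) by (intro Ck_on_mult Ck_on_const) auto
    fix x assume x: "x \<in> U"
    then have "((\<lambda>s. f (x(i := s))) has_real_derivative f' i x) (at (x i))" using f' i by blast
    from DERIV_inverse'[OF this] show "((\<lambda>s. inverse (f (x(i := s)))) has_real_derivative ((-1) * f' i x) * (inverse (f x) * inverse (f x))) (at (x i))"
      using Suc.prems(3)[OF x] by (simp add: algebra_simps)
  qed (use f' Suc.prems(3) in \<open>auto intro!: continuous_intros\<close>)
qed (auto simp: cont_Eu_iff intro: continuous_intros)

lemma Ck_on_sum: "U \<subseteq> Eu n \<Longrightarrow> (\<And>j. j \<in> J \<Longrightarrow> Ck_on k n U (f j)) \<Longrightarrow> Ck_on k n U (\<lambda>x. \<Sum>j\<in>J. f j x)"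
  by (induction J rule: infinite_finite_induct) (auto intro!: Ck_on_const Ck_on_add)

text \<open>
  The point moves along the curve one coordinate at a time, so that each increment of \<open>f\<close> is given
  by the mean value theorem in a single variable.
\<close>

lemma deriv_along_curve:
  assumes V: "eopen m V"
    and cont: "\<And>j. j < m \<Longrightarrow> continuous_on V (f' j)"
    and f': "\<And>x j. x \<in> V \<Longrightarrow> j < m \<Longrightarrow> ((\<lambda>s. f (x(j := s))) has_real_derivative f' j x) (at (x j))"
    and y: "\<And>s. y s \<in> Eu m" "y s0 \<in> V"
    and y': "\<And>j. j < m \<Longrightarrow> ((\<lambda>s. y s j) has_real_derivative y' j) (at s0)"
  shows "((\<lambda>s. f (y s)) has_real_derivative (\<Sum>j<m. f' j (y s0) * y' j)) (at s0)"
proof -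
  define z where "z l s = (\<lambda>i. if i < l then y s i else y s0 i)" for l s
  have z_Eu: "z l s \<in> Eu m" for l s
    using y(1)[of s] y(1)[of s0] by (auto simp: z_def mem_Eu)
  have near: "\<forall>\<^sub>F s in at s0. \<forall>i<m. \<bar>y s i - y s0 i\<bar> < d" if "d > 0" for d
  proof -
    have "\<forall>\<^sub>F s in at s0. \<bar>y s i - y s0 i\<bar> < d" if "i < m" for i
    proof -
      have "isCont (\<lambda>s. y s i) s0" using y'[OF that] DERIV_isCont by blast
      then show ?thesis using \<open>d > 0\<close>
        by (simp add: isCont_def tendsto_iff dist_real_def)
    qed
    then have "\<forall>\<^sub>F s in at s0. \<forall>i\<in>{..<m}. \<bar>y s i - y s0 i\<bar> < d"
      by (intro eventually_ball_finite) auto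
    then show ?thesis by (simp add: Ball_def)
  qed
  have "((\<lambda>s. f (z l s)) has_real_derivative (\<Sum>j<l. f' j (y s0) * y' j)) (at s0)" if "l \<le> m" for l
    using that
  proof (induction l)
    case 0
    then show ?case by (simp add: z_def)
  next
    case (Suc l)
    then have l: "l < m" by simp
    have zl: "z (Suc l) s = (z l s)(l := y s l)" "z l s = (z l s)(l := y s0 l)" for s
      by (auto simp: z_def fun_eq_iff)
    define g where "g s = f (z (Suc l) s) - f (z l s)" for s
    \<comment> \<open>The difference quotient of the increment in direction \<open>l\<close>. Its
      expected limit is filled in where the denominator vanishes, so that \<open>gc\<close> holds
      for every \<open>s\<close>.\<close>
    define c where "c s = (if y s l = y s0 l then f' l (y s0) else g s / (y s l - y s0 l))" for s
    have g0: "g s0 = 0" by (simp add: g_def z_def)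
    have gc: "g s = c s * (y s l - y s0 l)" for s
    proof (cases "y s l = y s0 l")
      case True
      then have "z (Suc l) s = z l s" using zl[of s] by metis
      then show ?thesis using True by (simp add: g_def)
    qed (simp add: c_def)
    have "(c \<longlongrightarrow> f' l (y s0)) (at s0)"
      unfolding tendsto_iff
    proof (intro allI impI)
      fix e :: real assume e: "e > 0"
      obtain d where d: "d > 0" "\<And>x. x \<in> Eu m \<Longrightarrow> (\<And>i. i < m \<Longrightarrow> \<bar>x i - y s0 i\<bar> < d) \<Longrightarrow> x \<in> V \<and> \<bar>f' l x - f' l (y s0)\<bar> < e"
        by (rule continuous_on_EuD[OF V cont[OF l] y(2) e]) blast
      show "\<forall>\<^sub>F s in at s0. dist (c s) (f' l (y s0)) < e"
        using near[OF d(1)]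
      proof eventually_elim
        case (elim s)
        have ok: "(z l s)(l := t) \<in> V \<and> \<bar>f' l ((z l s)(l := t)) - f' l (y s0)\<bar> < e"
          if "\<bar>t - y s0 l\<bar> < d" for t
        proof (rule d(2))
          show "(z l s)(l := t) \<in> Eu m" using z_Eu l by simp
          show "\<bar>((z l s)(l := t)) i - y s0 i\<bar> < d" if "i < m" for i
            using elim that \<open>\<bar>t - y s0 l\<bar> < d\<close> d(1) by (auto simp: z_def)
        qed
        show ?case
        proof (cases "y s l = y s0 l")
          case True
          then show ?thesis using e by (simp add: c_def)
        next
          case False
          \<comment> \<open>The mean value theorem needs an ordered interval, and the sign of
            \<open>y s l - y s0 l\<close> is unknown.\<close>
          define a b where "a = min (y s l) (y s0 l)" and "b = max (y s l) (y s0 l)"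
          have ab: "a < b" "\<And>t. a \<le> t \<Longrightarrow> t \<le> b \<Longrightarrow> \<bar>t - y s0 l\<bar> < d"
            using False elim l by (fastforce simp: a_def b_def min_def max_def split: if_splits)+
          let ?h = "\<lambda>t. f ((z l s)(l := t))"
          have "\<And>t. a \<le> t \<Longrightarrow> t \<le> b \<Longrightarrow> (?h has_real_derivative f' l ((z l s)(l := t))) (at t)"
            using f'[OF _ l] ok ab(2) by fastforce
          then obtain t where t: "a < t" "t < b" "?h b - ?h a = (b - a) * f' l ((z l s)(l := t))"
            using MVT2[OF ab(1), of ?h "\<lambda>t. f' l ((z l s)(l := t))"] by blast
          have "g s = ?h (y s l) - ?h (y s0 l)" unfolding g_def using zl by metis
          then have "c s = f' l ((z l s)(l := t))"
            using t(3) False unfolding c_def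
            by (cases "y s l < y s0 l") (auto simp: a_def b_def min_def max_def field_simps)
          then show ?thesis using ok[OF ab(2)[of t]] t by (simp add: dist_real_def)
        qed
      qed
    qed
    moreover have "((\<lambda>s. (y s l - y s0 l) / (s - s0)) \<longlongrightarrow> y' l) (at s0)"
      using y'[OF l] by (simp add: has_field_derivative_iff)
    ultimately have "((\<lambda>s. c s * ((y s l - y s0 l) / (s - s0))) \<longlongrightarrow> f' l (y s0) * y' l) (at s0)"
      by (rule tendsto_mult)
    then have "(g has_real_derivative f' l (y s0) * y' l) (at s0)"
      by (simp add: has_field_derivative_iff g0 gc)
    from DERIV_add[OF Suc.IH this] l show ?case by (simp add: g_def)
  qed
  from this[of m] have "((\<lambda>s. f (z m s)) has_real_derivative (\<Sum>j<m. f' j (y s0) * y' j)) (at s0)"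
    by simp
  moreover have "z m = y"
    using y(1) y(1)[of s0] by (auto simp: z_def mem_Eu fun_eq_iff)
  ultimately show ?thesis by simp
qed

text \<open>By the chain rule the derivatives of the composite are sums of products of some
  \<open>f' j (g x)\<close> with derivatives of \<open>g\<close>; these involve \<open>f'\<close>
  only up to order \<open>k\<close>, which is what the induction supplies.\<close>

lemma Ck_on_compose:
  assumes U: "eopen n U" and V: "eopen m V"
    and gm: "g ` U \<subseteq> V"
    and g: "\<And>j. j < m \<Longrightarrow> Ck_on k n U (\<lambda>x. g x j)"
    and f: "Ck_on k m V f"
  shows "Ck_on k n U (\<lambda>x. f (g x))"
  using f g
proof (induction k arbitrary: f)
  have sub: "U \<subseteq> Eu n" "V \<subseteq> Eu m" using U V openin_Eu_sub by blast+
  have cont: "continuous_on U (\<lambda>x. f (g x))"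
    if f: "Ck_on k m V f" and g: "\<And>j. j < m \<Longrightarrow> Ck_on k n U (\<lambda>x. g x j)" for f k
  proof -
    have "continuous_on U (\<lambda>x. g x j)" for j
    proof (cases "j < m")
      case True
      show ?thesis by (rule Ck_on_cont[OF sub(1) g[OF True]])
    next
      case False
      have "g x j = 0" if "x \<in> U" for x
      proof -
        have "g x \<in> Eu m" using gm sub(2) that by blast
        then show ?thesis using False by (simp add: mem_Eu)
      qed
      then show ?thesis by (simp cong: continuous_on_cong)
    qed
    then have "continuous_on U g" by (rule continuous_on_coordinatewise_then_product)
    then show ?thesis
      by (rule continuous_on_compose2[OF Ck_on_cont[OF sub(2) f] _ gm])
  qed
  {
    case 0
    then show ?case using cont[of 0] by (simp add: cont_Eu_iff sub)
  next
    case (Suc k)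
    obtain f' where "\<forall>j<m. Ck_on k m V (f' j) \<and>
        (\<forall>x\<in>V. ((\<lambda>s. f (x(j := s))) has_real_derivative f' j x) (at (x j)))"
      using Suc.prems(1)[unfolded Ck_on_Suc_iff[OF sub(2)]] by (elim conjE exE)
    then have f': "\<And>j. j < m \<Longrightarrow> Ck_on k m V (f' j)"
      "\<And>x j. x \<in> V \<Longrightarrow> j < m \<Longrightarrow> ((\<lambda>s. f (x(j := s))) has_real_derivative f' j x) (at (x j))"
      by blast+
    have "\<forall>j. \<exists>g'. j < m \<longrightarrow> (\<forall>i<n. Ck_on k n U (g' i) \<and>
        (\<forall>x\<in>U. ((\<lambda>s. g (x(i := s)) j) has_real_derivative g' i x) (at (x i))))"
      using Suc.prems(2) unfolding Ck_on_Suc_iff[OF sub(1)] by simp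
    from choice[OF this] obtain g' where "\<forall>j. j < m \<longrightarrow> (\<forall>i<n. Ck_on k n U (g' j i) \<and>
        (\<forall>x\<in>U. ((\<lambda>s. g (x(i := s)) j) has_real_derivative g' j i x) (at (x i))))" ..
    note G = this
    have g': "Ck_on k n U (g' j i)" if "j < m" "i < n" for i j
      using G[rule_format, OF that] by (rule conjunct1)
    have g'': "((\<lambda>s. g (x(i := s)) j) has_real_derivative g' j i x) (at (x i))" if "j < m" "i < n" "x \<in> U" for i j x
      using G[rule_format, OF that(1,2)] that(3) by (elim conjE) (drule (1) bspec)
    show ?case unfolding Ck_on_Suc_iff[OF sub(1)]
    proof (intro conjI exI[of _ "\<lambda>i x. \<Sum>j<m. f' j (g x) * g' j i x"] allI impI ballI)
      show "continuous_on U (\<lambda>x. f (g x))" by (rule cont[OF Suc.prems])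
      fix i assume i: "i < n"
      have "Ck_on k n U (\<lambda>x. f' j (g x))" if "j < m" for j
        by (rule Suc.IH[OF f'(1)[OF that]]) (rule Ck_on_SucD[OF sub(1) Suc.prems(2)])
      then show "Ck_on k n U (\<lambda>x. \<Sum>j<m. f' j (g x) * g' j i x)"
        by (intro Ck_on_sum Ck_on_mult sub(1) g'[OF _ i]) simp_all
      fix x assume x: "x \<in> U"
      \<comment> \<open>Off \<open>U\<close> the values of \<open>g\<close> need not lie in m-space,
        but \<open>deriv_along_curve\<close> wants a curve that stays there; the curve is frozen at
        \<open>g x\<close> where the coordinate line has left \<open>U\<close>.\<close>
      define y where "y s = (if x(i := s) \<in> U then g (x(i := s)) else g x)" for s
      have yx: "y (x i) = g x" using x by (simp add: y_def)
      have ev: "\<forall>\<^sub>F s in nhds (x i). y s = g (x(i := s))"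
        using openin_Eu_line[OF U x i] by eventually_elim (simp add: y_def)
      have "((\<lambda>s. f (y s)) has_real_derivative (\<Sum>j<m. f' j (y (x i)) * g' j i x)) (at (x i))"
      proof (rule deriv_along_curve[OF V])
        show "continuous_on V (f' j)" if "j < m" for j using f'(1)[OF that] Ck_on_cont sub by blast
        have gV: "g u \<in> V" if "u \<in> U" for u using gm that by blast
        show "y s \<in> Eu m" for s
          unfolding y_def by (cases "x(i := s) \<in> U") (use gV[OF x] gV sub(2) in \<open>simp_all add: subset_iff\<close>)
        show "y (x i) \<in> V" unfolding yx by (rule gV[OF x])
        show "((\<lambda>s. y s j) has_real_derivative g' j i x) (at (x i))" if "j < m" for j
        proof -
          have "\<forall>\<^sub>F s in nhds (x i). y s j = g (x(i := s)) j"
            using ev by eventually_elim simp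
          from DERIV_cong_ev[OF refl this refl] g''[OF that i x] show ?thesis by simp
        qed
      qed (rule f'(2))
      then have "((\<lambda>s. f (y s)) has_real_derivative (\<Sum>j<m. f' j (g x) * g' j i x)) (at (x i))"
        by (simp only: yx)
      moreover have "\<forall>\<^sub>F s in nhds (x i). f (y s) = f (g (x(i := s)))"
        using ev by eventually_elim simp
      ultimately show "((\<lambda>s. f (g (x(i := s)))) has_real_derivative (\<Sum>j<m. f' j (g x) * g' j i x)) (at (x i))"
        by (rule DERIV_cong_ev[OF refl _ refl, THEN iffD1, rotated])
    qed
  }
qed

section \<open>Smooth functions and smooth maps between Euclidean open sets\<close>

lemma smooth_fun_openin: "smooth_fun n U f \<Longrightarrow> eopen n U"
  by (simp add: smooth_fun_def)

lemma smooth_fun_const: "eopen n U \<Longrightarrow> smooth_fun n U (\<lambda>_. c)"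
  by (simp add: smooth_fun_def Ck_on_const openin_Eu_sub)

lemma smooth_fun_coord: "eopen n U \<Longrightarrow> smooth_fun n U (\<lambda>x. x j)"
  by (simp add: smooth_fun_def Ck_on_coord openin_Eu_sub)

lemma smooth_fun_add: "smooth_fun n U f \<Longrightarrow> smooth_fun n U g \<Longrightarrow> smooth_fun n U (\<lambda>x. f x + g x)"
  by (simp add: smooth_fun_def Ck_on_add openin_Eu_sub)

lemma smooth_fun_mult: "smooth_fun n U f \<Longrightarrow> smooth_fun n U g \<Longrightarrow> smooth_fun n U (\<lambda>x. f x * g x)"
  by (simp add: smooth_fun_def Ck_on_mult openin_Eu_sub)

lemma smooth_fun_inverse:
  "smooth_fun n U f \<Longrightarrow> (\<And>x. x \<in> U \<Longrightarrow> f x \<noteq> 0) \<Longrightarrow> smooth_fun n U (\<lambda>x. inverse (f x))"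
  by (simp add: smooth_fun_def Ck_on_inverse openin_Eu_sub)

lemma smooth_fun_subset:
  "smooth_fun n U f \<Longrightarrow> eopen n V \<Longrightarrow> V \<subseteq> U \<Longrightarrow> smooth_fun n V f"
  unfolding smooth_fun_def using Ck_on_subset[OF openin_Eu_sub] by blast

lemma smooth_fun_cong:
  "smooth_fun n U f \<Longrightarrow> (\<And>x. x \<in> U \<Longrightarrow> f x = g x) \<Longrightarrow> smooth_fun n U g"
  unfolding smooth_fun_def using Ck_on_cong by blast

lemma smooth_fun_local:
  assumes "eopen n U"
    and loc: "\<And>u. u \<in> U \<Longrightarrow> \<exists>V q. eopen n V \<and> u \<in> V \<and> V \<subseteq> U \<and> smooth_fun n V q \<and> (\<forall>v\<in>V. q v = f v)"
  shows "smooth_fun n U f"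
proof -
  have "Ck_on k n U f" for k
  proof (rule Ck_on_local[OF assms(1)])
    fix u assume "u \<in> U"
    from loc[OF this] obtain V q where V: "eopen n V" "u \<in> V" "V \<subseteq> U" "smooth_fun n V q" "\<forall>v\<in>V. q v = f v"
      by blast
    then have "smooth_fun n V f" by (blast intro: smooth_fun_cong)
    with V show "\<exists>V. eopen n V \<and> u \<in> V \<and> V \<subseteq> U \<and> Ck_on k n V f"
      unfolding smooth_fun_def by blast
  qed
  then show ?thesis using assms(1) by (simp add: smooth_fun_def)
qed

lemma smooth_fun_preimage:
  assumes "smooth_fun n U f" "open S"
  shows "eopen n {x \<in> U. f x \<in> S}"
proof -
  have U: "eopen n U" and "Ck_on 0 n U f" using assms by (simp_all add: smooth_fun_def)
  then have "continuous_map (subtopology (Euclidean_space n) U) euclideanreal f" by simp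
  from openin_continuous_map_preimage[OF this, of S] assms(2)
  have "openin (subtopology (Euclidean_space n) U) {x \<in> topspace (subtopology (Euclidean_space n) U). f x \<in> S}" by simp
  moreover have "topspace (subtopology (Euclidean_space n) U) = U"
    using openin_Eu_sub[OF U] by auto
  ultimately have "openin (subtopology (Euclidean_space n) U) {x \<in> U. f x \<in> S}" by (simp only:)
  then show ?thesis by (simp only: openin_open_subtopology[OF U])
qed

lemma smooth_fun_compose:
  assumes "smooth_euclid n U m g" "smooth_fun m V f" "g ` U \<subseteq> V"
  shows "smooth_fun n U (\<lambda>x. f (g x))"
proof -
  have U: "eopen n U" and V: "eopen m V"
    using assms by (simp_all add: smooth_euclid_def smooth_fun_def)
  have "Ck_on k n U (\<lambda>x. f (g x))" for k
    by (rule Ck_on_compose[OF U V assms(3)])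
      (use assms in \<open>simp_all add: smooth_euclid_def smooth_fun_def\<close>)
  then show ?thesis using U by (simp add: smooth_fun_def)
qed

lemma smooth_euclid_compose:
  assumes "smooth_euclid n U m g" "smooth_euclid m V l f" "g ` U \<subseteq> V"
  shows "smooth_euclid n U l (\<lambda>x. f (g x))"
  unfolding smooth_euclid_def
proof (intro conjI allI impI)
  show "eopen n U" using assms(1) by (simp add: smooth_euclid_def)
  show "(\<lambda>x. f (g x)) ` U \<subseteq> Eu l"
    using assms(2,3) unfolding smooth_euclid_def by blast
  show "smooth_fun n U (\<lambda>x. f (g x) j)" if "j < l" for j
    by (rule smooth_fun_compose[OF assms(1) _ assms(3)]) (use assms(2) that in \<open>simp add: smooth_euclid_def\<close>)
qed

lemma smooth_euclid_id: "eopen n U \<Longrightarrow> smooth_euclid n U n (\<lambda>x. x)"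
  by (auto simp: smooth_euclid_def smooth_fun_coord dest: openin_Eu_sub)

lemma smooth_euclid_preimage:
  assumes g: "smooth_euclid n U m g" and V: "eopen m V"
  shows "eopen n {x \<in> U. g x \<in> V}"
proof (subst openin_subopen, clarify)
  fix x assume x: "x \<in> U" "g x \<in> V"
  have U: "eopen n U" using g by (simp add: smooth_euclid_def)
  have gE: "g y \<in> Eu m" if "y \<in> U" for y using g that by (auto simp: smooth_euclid_def)
  obtain d where d: "d > 0" "\<And>y. y \<in> Eu m \<Longrightarrow> (\<And>i. i < m \<Longrightarrow> \<bar>y i - g x i\<bar> < d) \<Longrightarrow> y \<in> V"
    using openin_EuE[OF V x(2)] by blast
  \<comment> \<open>The factor \<open>U\<close> is there for \<open>m = 0\<close>, where the
    intersection over the empty family is \<open>UNIV\<close>.\<close>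
  let ?T = "U \<inter> (\<Inter>j\<in>{..<m}. {y \<in> U. g y j \<in> {g x j - d<..<g x j + d}})"
  have "eopen n {y \<in> U. g y j \<in> {g x j - d<..<g x j + d}}" if "j < m" for j
    using g that by (intro smooth_fun_preimage) (auto simp: smooth_euclid_def)
  then have "eopen n ?T"
    by (cases "m = 0") (auto intro!: openin_Int[OF U] openin_Inter simp: U)
  moreover have "?T \<subseteq> {y \<in> U. g y \<in> V}"
  proof
    fix y assume y: "y \<in> ?T"
    have "\<bar>g y i - g x i\<bar> < d" if "i < m" for i
    proof -
      have "g y i \<in> {g x i - d<..<g x i + d}" using y that by blast
      then show ?thesis by auto
    qed
    then have "g y \<in> V" using d(2)[OF gE] y by blast
    then show "y \<in> {y \<in> U. g y \<in> V}" using y by blast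
  qed
  moreover have "x \<in> ?T" using x d(1) by auto
  ultimately show "\<exists>T. eopen n T \<and> x \<in> T \<and> T \<subseteq> {x \<in> U. g x \<in> V}" by blast
qed

section \<open>Calculus of diffeological spaces\<close>

lemma diffeology_plot:
  assumes "diffeology D"
  shows plot_openin: "\<And>n U p. plot D n U p \<Longrightarrow> eopen n U"
    and plot_points: "\<And>n U p u. plot D n U p \<Longrightarrow> u \<in> U \<Longrightarrow> p u \<in> points D"
    and plot_const: "\<And>n U x. eopen n U \<Longrightarrow> x \<in> points D \<Longrightarrow> plot D n U (\<lambda>_. x)"
    and plot_compose: "\<And>n U p m V f. plot D n U p \<Longrightarrow> smooth_euclid m V n f \<Longrightarrow> f ` V \<subseteq> U \<Longrightarrow> plot D m V (\<lambda>v. p (f v))"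
proof -
  note A = assms[unfolded diffeology_def]
  show "\<And>n U p. plot D n U p \<Longrightarrow> eopen n U"
    using A[THEN conjunct1] by blast
  show "\<And>n U p u. plot D n U p \<Longrightarrow> u \<in> U \<Longrightarrow> p u \<in> points D"
    using A[THEN conjunct1] by blast
  show "\<And>n U x. eopen n U \<Longrightarrow> x \<in> points D \<Longrightarrow> plot D n U (\<lambda>_. x)"
    using A[THEN conjunct2, THEN conjunct1] by simp
  show "plot D m V (\<lambda>v. p (f v))" if "plot D n U p" "smooth_euclid m V n f" "f ` V \<subseteq> U" for n U p m V f
    using A[THEN conjunct2, THEN conjunct2, THEN conjunct1, rule_format, OF conjI, OF that(1) conjI, OF that(2,3)]
    by (simp add: comp_def)
qed

abbreviation plot_near where
  "plot_near D n U p u \<equiv> \<exists>V q. eopen n V \<and> u \<in> V \<and> V \<subseteq> U \<and> plot D n V q \<and> (\<forall>v\<in>V. q v = p v)"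

lemma plot_local:
  assumes "diffeology D" "eopen n U"
    and "\<And>u. u \<in> U \<Longrightarrow> plot_near D n U p u"
  shows "plot D n U p"
proof -
  note A = assms(1)[unfolded diffeology_def, THEN conjunct2, THEN conjunct2, THEN conjunct2]
  show ?thesis
    by (rule A[rule_format, OF conjI, OF assms(2)]) (use assms(3) in simp)
qed

lemma plot_cong:
  assumes "diffeology D" "plot D n U q" "\<And>u. u \<in> U \<Longrightarrow> q u = p u"
  shows "plot D n U p"
proof (rule plot_local[OF assms(1)])
  show U: "eopen n U" by (rule plot_openin[OF assms(1,2)])
  show "plot_near D n U p u"
    if "u \<in> U" for u
    by (intro exI[of _ U] exI[of _ q] conjI U that order_refl assms(2) ballI assms(3))
qed

lemma plot_subset:
  assumes "diffeology D" "plot D n U p" "eopen n V" "V \<subseteq> U"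
  shows "plot D n V p"
  using plot_compose[OF assms(1,2) smooth_euclid_id[OF assms(3)]] assms(4) by auto

lemma diffeologyI:
  assumes "\<And>n U p. plot D n U p \<Longrightarrow> eopen n U"
    and "\<And>n U p u. plot D n U p \<Longrightarrow> u \<in> U \<Longrightarrow> p u \<in> points D"
    and "\<And>n U x. eopen n U \<Longrightarrow> x \<in> points D \<Longrightarrow> plot D n U (\<lambda>_. x)"
    and "\<And>n U p m V f. plot D n U p \<Longrightarrow> smooth_euclid m V n f \<Longrightarrow> f ` V \<subseteq> U \<Longrightarrow> plot D m V (\<lambda>v. p (f v))"
    and "\<And>n U p. eopen n U \<Longrightarrow>
        (\<And>u. u \<in> U \<Longrightarrow> plot_near D n U p u) \<Longrightarrow> plot D n U p"
  shows "diffeology D"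
  unfolding diffeology_def
proof (intro conjI allI impI)
  fix n U p m V f
  assume "plot D n U p \<and> smooth_euclid m V n f \<and> f ` V \<subseteq> U"
  then show "plot D m V (p \<circ> f)" using assms(4)[of n U p m V f] by (simp add: comp_def)
next
  fix n U p
  assume *: "eopen n U \<and> (\<forall>u\<in>U. plot_near D n U p u)"
  show "plot D n U p" by (rule assms(5)) (use * in blast)+
qed (simp_all add: assms(1,3) image_subset_iff assms(2))

lemma diffeology_real: "diffeology real_diff"
proof (rule diffeologyI)
  fix n U p m V f assume "plot real_diff n U p" "smooth_euclid m V n f" "f ` V \<subseteq> U"
  then show "plot real_diff m V (\<lambda>v. p (f v))" by (simp add: real_diff_def smooth_fun_compose)
next
  fix n U p assume *: "eopen n U"
    "\<And>u. u \<in> U \<Longrightarrow> plot_near real_diff n U p u"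
  show "plot real_diff n U p"
    using smooth_fun_local[OF *(1), of p] *(2) by (simp add: real_diff_def)
qed (simp_all add: real_diff_def smooth_fun_openin smooth_fun_const)

lemma diffeology_euclid: "diffeology (euclid_diff m)"
proof (rule diffeologyI)
  fix n U p k V f assume "plot (euclid_diff m) n U p" "smooth_euclid k V n f" "f ` V \<subseteq> U"
  then show "plot (euclid_diff m) k V (\<lambda>v. p (f v))" by (simp add: euclid_diff_def smooth_euclid_compose)
next
  fix n U p assume U: "eopen n U"
    and loc: "\<And>u. u \<in> U \<Longrightarrow> plot_near (euclid_diff m) n U p u"
  have "smooth_fun n U (\<lambda>x. p x j)" if "j < m" for j
  proof (rule smooth_fun_local[OF U])
    fix u assume "u \<in> U"
    from loc[OF this] obtain V q where V: "eopen n V" "u \<in> V" "V \<subseteq> U" "plot (euclid_diff m) n V q" "\<forall>v\<in>V. q v = p v"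
      by blast
    then have "smooth_fun n V (\<lambda>x. q x j)" using that by (simp add: euclid_diff_def smooth_euclid_def)
    with V show "\<exists>V q. eopen n V \<and> u \<in> V \<and> V \<subseteq> U \<and> smooth_fun n V q \<and> (\<forall>v\<in>V. q v = p v j)"
      by (intro exI[of _ V] exI[of _ "\<lambda>x. q x j"]) simp
  qed
  moreover have "p u \<in> Eu m" if "u \<in> U" for u
  proof -
    from loc[OF that] obtain V q where "u \<in> V" "plot (euclid_diff m) n V q" "q u = p u" by blast
    then have "q ` V \<subseteq> Eu m" by (simp add: euclid_diff_def smooth_euclid_def)
    then show ?thesis using \<open>u \<in> V\<close> \<open>q u = p u\<close> by (metis image_subset_iff)
  qed
  ultimately show "plot (euclid_diff m) n U p"
    using U by (auto simp: euclid_diff_def smooth_euclid_def)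
qed (auto simp: euclid_diff_def smooth_euclid_def smooth_fun_const)

lemma diffeology_subset:
  assumes D: "diffeology D" shows "diffeology (subset_diff D A)"
proof (rule diffeologyI)
  fix n U p assume U: "eopen n U"
    and loc: "\<And>u. u \<in> U \<Longrightarrow> plot_near (subset_diff D A) n U p u"
  have "plot D n U p"
  proof (rule plot_local[OF D U])
    fix u assume "u \<in> U"
    from loc[OF this] obtain V q where "eopen n V" "u \<in> V" "V \<subseteq> U" "plot (subset_diff D A) n V q" "\<forall>v\<in>V. q v = p v"
      by blast
    then show "plot_near D n U p u"
      by (intro exI[of _ V] exI[of _ q]) (simp add: subset_diff_def)
  qed
  moreover have "p u \<in> A" if "u \<in> U" for u
  proof -
    from loc[OF that] obtain V q where "u \<in> V" "plot (subset_diff D A) n V q" "q u = p u" by blast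
    then have "q ` V \<subseteq> A" by (simp add: subset_diff_def)
    then show ?thesis using \<open>u \<in> V\<close> \<open>q u = p u\<close> by (metis image_subset_iff)
  qed
  ultimately show "plot (subset_diff D A) n U p" by (simp add: subset_diff_def image_subset_iff)
next
  fix n U p m V f assume "plot (subset_diff D A) n U p" "smooth_euclid m V n f" "f ` V \<subseteq> U"
  then show "plot (subset_diff D A) m V (\<lambda>v. p (f v))"
    using plot_compose[OF D, of n U p m V f] by (simp add: subset_diff_def) blast
qed (use plot_openin[OF D] plot_points[OF D] plot_const[OF D] in \<open>auto simp: subset_diff_def\<close>)

lemma diffeology_prod:
  assumes D: "diffeology D" and E: "diffeology E" shows "diffeology (prod_diff D E)"
proof (rule diffeologyI)
  fix n U p assume U: "eopen n U"
    and loc: "\<And>u. u \<in> U \<Longrightarrow> plot_near (prod_diff D E) n U p u"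
  have "plot D n U (fst \<circ> p)"
  proof (rule plot_local[OF D U])
    fix u assume "u \<in> U"
    from loc[OF this] obtain V q where "eopen n V" "u \<in> V" "V \<subseteq> U" "plot (prod_diff D E) n V q" "\<forall>v\<in>V. q v = p v"
      by blast
    then show "plot_near D n U (\<lambda>v. (fst \<circ> p) v) u"
      by (intro exI[of _ V] exI[of _ "fst \<circ> q"]) (simp add: prod_diff_def)
  qed
  moreover have "plot E n U (snd \<circ> p)"
  proof (rule plot_local[OF E U])
    fix u assume "u \<in> U"
    from loc[OF this] obtain V q where "eopen n V" "u \<in> V" "V \<subseteq> U" "plot (prod_diff D E) n V q" "\<forall>v\<in>V. q v = p v"
      by blast
    then show "plot_near E n U (\<lambda>v. (snd \<circ> p) v) u"
      by (intro exI[of _ V] exI[of _ "snd \<circ> q"]) (simp add: prod_diff_def)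
  qed
  ultimately show "plot (prod_diff D E) n U p" by (simp add: prod_diff_def)
next
  fix n U p u assume "plot (prod_diff D E) n U p" "u \<in> U"
  then show "p u \<in> points (prod_diff D E)"
    using plot_points[OF D, of n U "fst \<circ> p" u] plot_points[OF E, of n U "snd \<circ> p" u]
    by (simp add: prod_diff_def mem_Times_iff)
next
  fix n U p m V f assume *: "plot (prod_diff D E) n U p" "smooth_euclid m V n f" "f ` V \<subseteq> U"
  then show "plot (prod_diff D E) m V (\<lambda>v. p (f v))"
    using plot_compose[OF D _ *(2,3), of "fst \<circ> p"] plot_compose[OF E _ *(2,3), of "snd \<circ> p"]
    by (simp add: prod_diff_def comp_def)
qed (use plot_openin[OF D] plot_const[OF D] plot_const[OF E] in \<open>auto simp: prod_diff_def comp_def\<close>)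

lemma diffeology_power:
  assumes D: "diffeology D" shows "diffeology (power_diff D)"
proof (rule diffeologyI)
  fix n U p assume U: "eopen n U"
    and loc: "\<And>u. u \<in> U \<Longrightarrow> plot_near (power_diff D) n U p u"
  have "plot D n U (\<lambda>u. p u i)" for i
  proof (rule plot_local[OF D U])
    fix u assume "u \<in> U"
    from loc[OF this] obtain V q where "eopen n V" "u \<in> V" "V \<subseteq> U" "plot (power_diff D) n V q" "\<forall>v\<in>V. q v = p v"
      by blast
    then show "plot_near D n U (\<lambda>v. p v i) u"
      by (intro exI[of _ V] exI[of _ "\<lambda>v. q v i"]) (simp add: power_diff_def)
  qed
  then show "plot (power_diff D) n U p" by (simp add: power_diff_def)
next
  fix n U p m V f assume *: "plot (power_diff D) n U p" "smooth_euclid m V n f" "f ` V \<subseteq> U"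
  then show "plot (power_diff D) m V (\<lambda>v. p (f v))"
    using plot_compose[OF D _ *(2,3), of "\<lambda>u. p u i" for i] unfolding power_diff_def by simp
next
  fix n U p u assume p: "plot (power_diff D) n U p" and u: "u \<in> U"
  have "p u i \<in> points D" for i
    by (rule plot_points[OF D _ u, of n "\<lambda>u. p u i"]) (use p in \<open>simp add: power_diff_def\<close>)
  then show "p u \<in> points (power_diff D)" by (simp add: power_diff_def)
qed (use plot_openin[OF D] plot_const[OF D] in \<open>auto simp: power_diff_def\<close>)

lemma diffeology_image:
  assumes D: "diffeology D" shows "diffeology (image_diff D f)"
proof (rule diffeologyI)
  fix n U p u assume "plot (image_diff D f) n U p" "u \<in> U"
  then obtain V q where "u \<in> V" "plot D n V q" "\<forall>v\<in>V. p v = f (q v)"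
    unfolding image_diff_def by auto
  then show "p u \<in> points (image_diff D f)"
    using plot_points[OF D] by (auto simp: image_diff_def)
next
  fix n U x assume U: "eopen n U" and "x \<in> points (image_diff D f)"
  then obtain y where "y \<in> points D" "x = f y" by (auto simp: image_diff_def)
  then show "plot (image_diff D f) n U (\<lambda>_. x)"
    using U plot_const[OF D U] by (auto simp: image_diff_def intro!: exI[of _ U] exI[of _ "\<lambda>_. y"])
next
  fix n U p m V g assume p: "plot (image_diff D f) n U p" and g: "smooth_euclid m V n g" and gV: "g ` V \<subseteq> U"
  have V: "eopen m V" using g by (simp add: smooth_euclid_def)
  show "plot (image_diff D f) m V (\<lambda>v. p (g v))"
    unfolding image_diff_def diff_space.simps
  proof (intro conjI V ballI)
    fix v assume v: "v \<in> V"
    then have "g v \<in> U" using gV by blast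
    then obtain W r where W: "eopen n W" "g v \<in> W" "W \<subseteq> U" "plot D n W r" "\<forall>w\<in>W. p w = f (r w)"
      using p unfolding image_diff_def diff_space.simps by blast
    let ?V = "{x \<in> V. g x \<in> W}"
    have V': "eopen m ?V" by (rule smooth_euclid_preimage[OF g W(1)])
    have "smooth_euclid m ?V n g"
      using g V' by (auto simp: smooth_euclid_def intro: smooth_fun_subset)
    then have "plot D m ?V (\<lambda>v. r (g v))"
      by (rule plot_compose[OF D W(4)]) auto
    then show "\<exists>W r. eopen m W \<and> v \<in> W \<and> W \<subseteq> V \<and> plot D m W r \<and> (\<forall>w\<in>W. p (g w) = f (r w))"
      using V' v W by (intro exI[of _ ?V] exI[of _ "\<lambda>v. r (g v)"]) auto
  qed
next
  fix n U p assume U: "eopen n U"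
    and loc: "\<And>u. u \<in> U \<Longrightarrow> plot_near (image_diff D f) n U p u"
  show "plot (image_diff D f) n U p"
    unfolding image_diff_def diff_space.simps
  proof (intro conjI U ballI)
    fix u assume "u \<in> U"
    from loc[OF this] obtain V q where V: "eopen n V" "u \<in> V" "V \<subseteq> U" "plot (image_diff D f) n V q" "\<forall>v\<in>V. q v = p v"
      by blast
    then obtain W r where "eopen n W" "u \<in> W" "W \<subseteq> V" "plot D n W r" "\<forall>v\<in>W. q v = f (r v)"
      unfolding image_diff_def diff_space.simps by blast
    with V show "\<exists>W r. eopen n W \<and> u \<in> W \<and> W \<subseteq> U \<and> plot D n W r \<and> (\<forall>v\<in>W. p v = f (r v))"
      by (intro exI[of _ W] exI[of _ r]) (simp, metis subsetD subset_trans)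
  qed
qed (simp add: image_diff_def)

section \<open>Smooth maps into and out of subsets, products and quotients\<close>

lemma smooth_mapI:
  assumes "\<And>x. x \<in> points D \<Longrightarrow> f x \<in> points E"
    and "\<And>n U p. plot D n U p \<Longrightarrow> plot E n U (\<lambda>u. f (p u))"
  shows "smooth_map D E f"
  using assms by (auto simp: smooth_map_def comp_def)

lemma smooth_map_plot: "smooth_map D E f \<Longrightarrow> plot D n U p \<Longrightarrow> plot E n U (\<lambda>u. f (p u))"
  by (simp add: smooth_map_def comp_def)

lemma smooth_map_points: "smooth_map D E f \<Longrightarrow> x \<in> points D \<Longrightarrow> f x \<in> points E"
  by (auto simp: smooth_map_def)

lemma smooth_map_compose:
  assumes g: "smooth_map B C g" and f: "smooth_map A B f"
  shows "smooth_map A C (\<lambda>x. g (f x))"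
  by (rule smooth_mapI)
    (rule smooth_map_points[OF g smooth_map_points[OF f]] smooth_map_plot[OF g smooth_map_plot[OF f]], assumption)+

lemma smooth_map_id: "smooth_map A A (\<lambda>x. x)"
  by (auto simp: smooth_map_def comp_def)

lemma smooth_map_const:
  "diffeology A \<Longrightarrow> diffeology B \<Longrightarrow> c \<in> points B \<Longrightarrow> smooth_map A B (\<lambda>_. c)"
  by (auto intro!: smooth_mapI intro: plot_const plot_openin)

lemma smooth_map_cong:
  assumes "diffeology A" "diffeology B" "smooth_map A B f" "\<And>x. x \<in> points A \<Longrightarrow> f x = g x"
  shows "smooth_map A B g"
proof (rule smooth_mapI)
  show "g x \<in> points B" if "x \<in> points A" for x
    using smooth_map_points[OF assms(3) that] assms(4)[OF that] by simp
  show "plot B n U (\<lambda>u. g (p u))" if p: "plot A n U p" for n U p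
    by (rule plot_cong[OF assms(2) smooth_map_plot[OF assms(3) p]])
       (rule assms(4)[OF plot_points[OF assms(1) p]])
qed

lemma points_prod [simp]: "points (prod_diff A B) = points A \<times> points B"
  by (simp add: prod_diff_def)

lemma points_real [simp]: "points real_diff = UNIV"
  by (simp add: real_diff_def)

lemma points_euclid [simp]: "points (euclid_diff n) = Eu n"
  by (simp add: euclid_diff_def)

lemma points_subset [simp]: "points (subset_diff A S) = points A \<inter> S"
  by (simp add: subset_diff_def)

lemma points_image [simp]: "points (image_diff A f) = f ` points A"
  by (simp add: image_diff_def)

lemma plot_prod: "plot (prod_diff A B) n U p \<longleftrightarrow> plot A n U (\<lambda>u. fst (p u)) \<and> plot B n U (\<lambda>u. snd (p u))"
  by (simp add: prod_diff_def comp_def)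

lemma plot_subset_iff: "plot (subset_diff A S) n U p \<longleftrightarrow> plot A n U p \<and> p ` U \<subseteq> S"
  by (simp add: subset_diff_def)

lemma plot_euclid: "plot (euclid_diff m) n U p \<longleftrightarrow> smooth_euclid n U m p"
  by (simp add: euclid_diff_def)

lemma plot_real: "plot real_diff n U p \<longleftrightarrow> smooth_fun n U p"
  by (simp add: real_diff_def)

lemma smooth_map_pair:
  "smooth_map A B f \<Longrightarrow> smooth_map A C g \<Longrightarrow> smooth_map A (prod_diff B C) (\<lambda>x. (f x, g x))"
  by (auto intro!: smooth_mapI dest: smooth_map_points smooth_map_plot simp: plot_prod)

lemma smooth_map_fst: "smooth_map A (prod_diff B C) f \<Longrightarrow> smooth_map A B (\<lambda>x. fst (f x))"
  by (auto intro!: smooth_mapI dest: smooth_map_points smooth_map_plot simp: plot_prod mem_Times_iff)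

lemma smooth_map_snd: "smooth_map A (prod_diff B C) f \<Longrightarrow> smooth_map A C (\<lambda>x. snd (f x))"
  by (auto intro!: smooth_mapI dest: smooth_map_points smooth_map_plot simp: plot_prod mem_Times_iff)

lemma smooth_map_prod:
  assumes "smooth_map A B f" "smooth_map C E g"
  shows "smooth_map (prod_diff A C) (prod_diff B E) (\<lambda>z. (f (fst z), g (snd z)))"
  by (intro smooth_map_pair smooth_map_compose[OF assms(1)] smooth_map_compose[OF assms(2)])
    (rule smooth_map_fst[OF smooth_map_id] smooth_map_snd[OF smooth_map_id])+

lemma smooth_map_into_subset:
  assumes "diffeology A" "smooth_map A B f" "\<And>x. x \<in> points A \<Longrightarrow> f x \<in> S"
  shows "smooth_map A (subset_diff B S) f"
  using assms(3) smooth_map_points[OF assms(2)] smooth_map_plot[OF assms(2)] plot_points[OF assms(1)]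
  by (auto intro!: smooth_mapI simp: plot_subset_iff)

lemma smooth_map_out_subset: "smooth_map A (subset_diff B S) f \<Longrightarrow> smooth_map A B f"
  by (auto simp: smooth_map_def subset_diff_def)

lemma smooth_map_from_subset: "smooth_map A B f \<Longrightarrow> smooth_map (subset_diff A S) B f"
  by (auto simp: smooth_map_def subset_diff_def)

lemma smooth_map_from_image:
  assumes A: "diffeology A" and B: "diffeology B" and f: "smooth_map A B (\<lambda>x. f (j x))"
  shows "smooth_map (image_diff A j) B f"
proof (rule smooth_mapI)
  show "f x \<in> points B" if "x \<in> points (image_diff A j)" for x
    using smooth_map_points[OF f] that by auto
  fix n U p assume p: "plot (image_diff A j) n U p"
  show "plot B n U (\<lambda>u. f (p u))"
  proof (rule plot_local[OF B])
    show "eopen n U" using p by (simp add: image_diff_def)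
    fix u assume "u \<in> U"
    then obtain V q where V: "eopen n V" "u \<in> V" "V \<subseteq> U" "plot A n V q" "\<forall>v\<in>V. p v = j (q v)"
      using p unfolding image_diff_def by auto
    from smooth_map_plot[OF f V(4)] V
    show "plot_near B n U (\<lambda>v. f (p v)) u"
      by (intro exI[of _ V] exI[of _ "\<lambda>v. f (j (q v))"]) auto
  qed
qed

lemma smooth_map_proj_image: "diffeology A \<Longrightarrow> smooth_map A (image_diff A j) j"
  by (rule smooth_mapI) (auto simp: image_diff_def dest: plot_openin)

lemma smooth_map_into_image:
  "diffeology B \<Longrightarrow> smooth_map A B f \<Longrightarrow> smooth_map A (image_diff B j) (\<lambda>x. j (f x))"
  by (rule smooth_map_compose[OF smooth_map_proj_image])

lemma smooth_map_inv_image: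
  assumes B: "diffeology B" and j: "inj_on j (points B)"
  shows "smooth_map (image_diff B j) B (inv_into (points B) j)"
proof (rule smooth_map_from_image[OF B B])
  show "smooth_map B B (\<lambda>x. inv_into (points B) j (j x))"
    by (rule smooth_map_cong[OF B B smooth_map_id]) (simp add: j)
qed

text \<open>Products of quotient maps are again quotient maps, since plots lift locally in each factor.\<close>

lemma smooth_map_from_prod_image:
  assumes A: "diffeology A" and B: "diffeology B" and C: "diffeology C"
    and f: "smooth_map (prod_diff A B) C (\<lambda>z. f (i (fst z), j (snd z)))"
  shows "smooth_map (prod_diff (image_diff A i) (image_diff B j)) C f"
proof (rule smooth_mapI)
  show "f x \<in> points C" if "x \<in> points (prod_diff (image_diff A i) (image_diff B j))" for x
    using smooth_map_points[OF f] that by auto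
  fix n U p assume p: "plot (prod_diff (image_diff A i) (image_diff B j)) n U p"
  show "plot C n U (\<lambda>u. f (p u))"
  proof (rule plot_local[OF C])
    show "eopen n U" using p by (simp add: image_diff_def prod_diff_def)
    fix u assume u: "u \<in> U"
    from p u obtain V q where V: "eopen n V" "u \<in> V" "V \<subseteq> U" "plot A n V q" "\<forall>v\<in>V. fst (p v) = i (q v)"
      unfolding image_diff_def prod_diff_def by auto
    from p u obtain W r where W: "eopen n W" "u \<in> W" "W \<subseteq> U" "plot B n W r" "\<forall>v\<in>W. snd (p v) = j (r v)"
      unfolding image_diff_def prod_diff_def by auto
    have VW: "eopen n (V \<inter> W)" using V W by blast
    have "plot (prod_diff A B) n (V \<inter> W) (\<lambda>v. (q v, r v))"
      using plot_subset[OF A V(4) VW] plot_subset[OF B W(4) VW] by (simp add: plot_prod)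
    from smooth_map_plot[OF f this] have "plot C n (V \<inter> W) (\<lambda>v. f (i (q v), j (r v)))" by simp
    moreover have "f (i (q v), j (r v)) = f (p v)" if "v \<in> V \<inter> W" for v
    proof -
      have "fst (p v) = i (q v)" "snd (p v) = j (r v)" using that V(5) W(5) by blast+
      then show ?thesis by (metis prod.collapse)
    qed
    ultimately show "plot_near C n U (\<lambda>v. f (p v)) u"
      using VW V W by (intro exI[of _ "V \<inter> W"] exI[of _ "\<lambda>v. f (i (q v), j (r v))"]) auto
  qed
qed

text \<open>Lets an ordinary space occur as a factor in \<open>smooth_map_from_prod_image\<close>,
  which expects image diffeologies on both sides.\<close>

lemma image_diff_ident [simp]:
  assumes A: "diffeology A" shows "image_diff A (\<lambda>x. x) = A"
proof -
  have "plot (image_diff A (\<lambda>x. x)) n U p \<longleftrightarrow> plot A n U p" for n U p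
    using smooth_map_plot[OF smooth_map_proj_image[OF A, of "\<lambda>x. x"], of n U p]
      smooth_map_plot[OF smooth_map_from_image[OF A A, of "\<lambda>x. x" "\<lambda>x. x", OF smooth_map_id], of n U p] by blast
  then have "plot (image_diff A (\<lambda>x. x)) = plot A" by (intro ext) blast
  then show ?thesis by (cases A) (simp add: image_diff_def)
qed

section \<open>The functional diffeology\<close>

lemma points_functional: "points (functional_diff A B) = {f \<in> extensional (points A). smooth_map A B f}"
  by (simp add: functional_diff_def Let_def)

lemma plot_functional:
  "plot (functional_diff A B) n U p \<longleftrightarrow> eopen n U \<and> (\<forall>u\<in>U. p u \<in> points (functional_diff A B)) \<and>
     smooth_map (prod_diff (subset_diff (euclid_diff n) U) A) B (\<lambda>z. p (fst z) (snd z))"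
  by (auto simp: functional_diff_def Let_def case_prod_unfold)

lemma diffeology_functional:
  assumes A: "diffeology A" and B: "diffeology B" shows "diffeology (functional_diff A B)"
proof (rule diffeologyI)
  fix n U x assume U: "eopen n U" and x: "x \<in> points (functional_diff A B)"
  then have "smooth_map A B x" by (simp add: points_functional)
  from smooth_map_compose[OF this smooth_map_snd[OF smooth_map_id]]
  show "plot (functional_diff A B) n U (\<lambda>_. x)"
    using U x by (simp add: plot_functional)
next
  fix n U p m V f assume p: "plot (functional_diff A B) n U p" and f: "smooth_euclid m V n f" and fV: "f ` V \<subseteq> U"
  have "smooth_map (subset_diff (euclid_diff m) V) (subset_diff (euclid_diff n) U) f"
  proof (rule smooth_mapI)
    show "f x \<in> points (subset_diff (euclid_diff n) U)" if "x \<in> points (subset_diff (euclid_diff m) V)" for x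
      using that fV f by (auto simp: smooth_euclid_def)
    show "plot (subset_diff (euclid_diff n) U) k W (\<lambda>u. f (p u))" if "plot (subset_diff (euclid_diff m) V) k W p" for k W p
      using that fV smooth_euclid_compose[OF _ f] by (simp add: plot_subset_iff plot_euclid) blast
  qed
  then have "smooth_map (prod_diff (subset_diff (euclid_diff m) V) A) (prod_diff (subset_diff (euclid_diff n) U) A)
      (\<lambda>z. (f (fst z), snd z))"
    by (rule smooth_map_prod[OF _ smooth_map_id])
  moreover have "smooth_map (prod_diff (subset_diff (euclid_diff n) U) A) B (\<lambda>z. p (fst z) (snd z))"
    using p by (simp add: plot_functional)
  ultimately have "smooth_map (prod_diff (subset_diff (euclid_diff m) V) A) B (\<lambda>z. p (f (fst z)) (snd z))"
    using smooth_map_compose[of _ B "\<lambda>z. p (fst z) (snd z)" _ "\<lambda>z. (f (fst z), snd z)"] by simp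
  then show "plot (functional_diff A B) m V (\<lambda>v. p (f v))"
    using p f fV by (auto simp: plot_functional smooth_euclid_def)
next
  fix n U p assume U: "eopen n U"
    and loc: "\<And>u. u \<in> U \<Longrightarrow> plot_near (functional_diff A B) n U p u"
  have pp: "p u \<in> points (functional_diff A B)" if u: "u \<in> U" for u
  proof -
    from loc[OF u] obtain V q where "u \<in> V" "plot (functional_diff A B) n V q" "\<forall>v\<in>V. q v = p v" by blast
    then show ?thesis by (auto simp: plot_functional)
  qed
  have "smooth_map (prod_diff (subset_diff (euclid_diff n) U) A) B (\<lambda>z. p (fst z) (snd z))"
  proof (rule smooth_mapI)
    show "p (fst z) (snd z) \<in> points B" if "z \<in> points (prod_diff (subset_diff (euclid_diff n) U) A)" for z
      using that pp[of "fst z"] by (auto simp: points_functional dest: smooth_map_points)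
    fix m W r assume r: "plot (prod_diff (subset_diff (euclid_diff n) U) A) m W r"
    then have r1: "smooth_euclid m W n (\<lambda>w. fst (r w))" "\<And>w. w \<in> W \<Longrightarrow> fst (r w) \<in> U" and r2: "plot A m W (\<lambda>w. snd (r w))"
      by (auto simp: plot_prod plot_subset_iff plot_euclid)
    show "plot B m W (\<lambda>w. p (fst (r w)) (snd (r w)))"
    proof (rule plot_local[OF B])
      show "eopen m W" using r2 plot_openin[OF A] by blast
      fix w assume w: "w \<in> W"
      from loc[OF r1(2)[OF w]] obtain V q where V: "eopen n V" "fst (r w) \<in> V" "V \<subseteq> U" "plot (functional_diff A B) n V q" "\<forall>v\<in>V. q v = p v"
        by blast
      let ?W = "{w \<in> W. fst (r w) \<in> V}"
      have W': "eopen m ?W" by (rule smooth_euclid_preimage[OF r1(1) V(1)])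
      have "plot (prod_diff (subset_diff (euclid_diff n) V) A) m ?W r"
        using plot_subset[OF A r2 W'] plot_subset[OF diffeology_euclid, of n m W "\<lambda>w. fst (r w)" ?W] r1(1) W'
        by (auto simp: plot_prod plot_subset_iff plot_euclid)
      moreover have "smooth_map (prod_diff (subset_diff (euclid_diff n) V) A) B (\<lambda>z. q (fst z) (snd z))"
        using V(4) by (simp add: plot_functional)
      ultimately have "plot B m ?W (\<lambda>w. q (fst (r w)) (snd (r w)))"
        using smooth_map_plot[of _ B "\<lambda>z. q (fst z) (snd z)" m ?W r] by simp
      then show "plot_near B m W (\<lambda>v. p (fst (r v)) (snd (r v))) w"
        using W' w V by (intro exI[of _ ?W] exI[of _ "\<lambda>w. q (fst (r w)) (snd (r w))"]) auto
    qed
  qed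
  then show "plot (functional_diff A B) n U p" using U pp by (simp add: plot_functional)
qed (auto simp: plot_functional)

text \<open>With \<open>smooth_map_uncurry\<close> this forms the exponential law, which replaces
  families of paths by maps of several variables.\<close>

lemma smooth_map_curry:
  assumes A: "diffeology A" and B: "diffeology B"
    and f: "smooth_map (prod_diff A B) C (\<lambda>z. f (fst z) (snd z))"
    and ext: "\<And>a. a \<in> points A \<Longrightarrow> f a \<in> extensional (points B)"
  shows "smooth_map A (functional_diff B C) f"
proof (rule smooth_mapI)
  have pt: "f a \<in> points (functional_diff B C)" if a: "a \<in> points A" for a
  proof -
    have "smooth_map B (prod_diff A B) (\<lambda>b. (a, b))"
      using a by (intro smooth_map_pair smooth_map_const[OF B A] smooth_map_id)
    from smooth_map_compose[OF f this] show ?thesis using ext[OF a] by (simp add: points_functional)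
  qed
  then show "f a \<in> points (functional_diff B C)" if "a \<in> points A" for a using that .
  fix n U p assume p: "plot A n U p"
  have "smooth_map (subset_diff (euclid_diff n) U) A p"
  proof (rule smooth_mapI)
    show "p x \<in> points A" if "x \<in> points (subset_diff (euclid_diff n) U)" for x
      using that plot_points[OF A p] by simp
    show "plot A m V (\<lambda>u. p (q u))" if "plot (subset_diff (euclid_diff n) U) m V q" for m V q
      using that plot_compose[OF A p] by (simp add: plot_subset_iff plot_euclid)
  qed
  then have "smooth_map (prod_diff (subset_diff (euclid_diff n) U) B) (prod_diff A B) (\<lambda>z. (p (fst z), snd z))"
    by (rule smooth_map_prod[OF _ smooth_map_id])
  from smooth_map_compose[OF f this]
  show "plot (functional_diff B C) n U (\<lambda>u. f (p u))"
    using plot_openin[OF A p] pt plot_points[OF A p] by (simp add: plot_functional)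
qed

lemma smooth_map_uncurry:
  assumes A: "diffeology A" and B: "diffeology B" and f: "smooth_map A (functional_diff B C) f"
  shows "smooth_map (prod_diff A B) C (\<lambda>z. f (fst z) (snd z))"
proof (rule smooth_mapI)
  show "f (fst z) (snd z) \<in> points C" if "z \<in> points (prod_diff A B)" for z
    using smooth_map_points[OF f, of "fst z"] that by (auto simp: points_functional dest: smooth_map_points)
  fix n U p assume p: "plot (prod_diff A B) n U p"
  then have U: "eopen n U" using plot_openin diffeology_prod[OF A B] by blast
  have "plot (functional_diff B C) n U (\<lambda>u. f (fst (p u)))"
    using smooth_map_plot[OF f, of n U "\<lambda>u. fst (p u)"] p by (simp add: plot_prod)
  then have *: "smooth_map (prod_diff (subset_diff (euclid_diff n) U) B) C (\<lambda>z. f (fst (p (fst z))) (snd z))"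
    by (simp add: plot_functional)
  \<comment> \<open>The family is evaluated along the graph of the second component of
    \<open>p\<close>.\<close>
  have "plot (prod_diff (subset_diff (euclid_diff n) U) B) n U (\<lambda>u. (u, snd (p u)))"
    using p smooth_euclid_id[OF U] by (simp add: plot_prod plot_subset_iff plot_euclid)
  from smooth_map_plot[OF * this] show "plot C n U (\<lambda>u. f (fst (p u)) (snd (p u)))" by simp
qed

section \<open>Real-valued smooth maps and the smashing function\<close>

lemma smooth_map_realI:
  assumes "\<And>n U p. plot A n U p \<Longrightarrow> smooth_fun n U (\<lambda>u. f (p u))"
  shows "smooth_map A real_diff f"
  by (rule smooth_mapI) (simp_all add: plot_real assms)

lemma smooth_map_realD: "smooth_map A real_diff f \<Longrightarrow> plot A n U p \<Longrightarrow> smooth_fun n U (\<lambda>u. f (p u))"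
  using smooth_map_plot[of A real_diff f n U p] by (simp add: plot_real)

lemma smooth_map_add:
  "smooth_map A real_diff f \<Longrightarrow> smooth_map A real_diff g \<Longrightarrow> smooth_map A real_diff (\<lambda>x. f x + g x)"
  by (intro smooth_map_realI smooth_fun_add) (rule smooth_map_realD, assumption+)+

lemma smooth_map_mult:
  "smooth_map A real_diff f \<Longrightarrow> smooth_map A real_diff g \<Longrightarrow> smooth_map A real_diff (\<lambda>x. f x * g x)"
  by (intro smooth_map_realI smooth_fun_mult) (rule smooth_map_realD, assumption+)+

lemma smooth_map_uminus:
  "smooth_map A real_diff f \<Longrightarrow> smooth_map A real_diff (\<lambda>x. - f x)"
proof (rule smooth_map_realI)
  fix n U p assume "smooth_map A real_diff f" "plot A n U p"
  then have f: "smooth_fun n U (\<lambda>u. f (p u))" by (rule smooth_map_realD)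
  from smooth_fun_mult[OF smooth_fun_const[OF smooth_fun_openin[OF f], of "-1"] f]
  show "smooth_fun n U (\<lambda>u. - f (p u))" by simp
qed

lemma smooth_map_diff:
  assumes "smooth_map A real_diff f" "smooth_map A real_diff g"
  shows "smooth_map A real_diff (\<lambda>x. f x - g x)"
  using smooth_map_add[OF assms(1) smooth_map_uminus[OF assms(2)]] by simp

text \<open>\<open>F\<close> lists a function together with all its derivatives, so the induction on
  the order only shifts the index. The passage through 1-dimensional space is needed to apply the
  chain rule for maps between Euclidean spaces.\<close>

lemma smooth_fun_real_compose:
  assumes F: "\<And>k t. (F k has_real_derivative F (Suc k) t) (at t)"
    and f: "smooth_fun n U f"
  shows "smooth_fun n U (\<lambda>u. F 0 (f u))"
proof -
  have "Ck_on k 1 (Eu 1) (\<lambda>x. F j (x 0))" for k j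
  proof (induction k arbitrary: j)
    have cont: "continuous_on (Eu 1) (\<lambda>x. F j (x 0))" for j
    proof -
      have "continuous_on UNIV (F j)"
        by (intro continuous_at_imp_continuous_on ballI DERIV_isCont[OF F])
      then show ?thesis by (rule continuous_on_compose2) (auto intro: continuous_on_coord)
    qed
    {
      case 0
      show ?case using cont by (simp only: Ck_on.simps(1) cont_Eu_iff[OF order_refl])
    next
      case (Suc k)
      show ?case
        unfolding Ck_on_Suc_iff[OF order_refl]
        by (intro conjI cont exI[of _ "\<lambda>i x. F (Suc j) (x 0)"]) (use Suc[of "Suc j"] F in simp)
    }
  qed
  then have "smooth_fun 1 (Eu 1) (\<lambda>x. F 0 (x 0))" by (simp add: smooth_fun_def)
  moreover have "smooth_euclid n U 1 (\<lambda>u i. if i = 0 then f u else 0)"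
    using f smooth_fun_openin[OF f] by (auto simp: smooth_euclid_def mem_Eu)
  ultimately show ?thesis
    using smooth_fun_compose[of n U 1 "\<lambda>u i. if i = 0 then f u else 0" "Eu 1" "\<lambda>x. F 0 (x 0)"]
    by (simp add: image_subset_iff mem_Eu)
qed

text \<open>With x = 1/t, differentiating \<open>p(x) exp(-x)\<close> with respect to t gives
  \<open>x^2 (p(x) - p'(x)) exp(-x)\<close>. The recursion therefore produces the polynomial factors
  of the derivatives of \<open>exp (- 1 / t)\<close>.\<close>

fun flat_poly :: "nat \<Rightarrow> real poly" where
  "flat_poly 0 = 1"
| "flat_poly (Suc k) = [:0, 0, 1:] * (flat_poly k - pderiv (flat_poly k))"

definition flat_deriv :: "nat \<Rightarrow> real \<Rightarrow> real" where
  "flat_deriv k t = (if t \<le> 0 then 0 else poly (flat_poly k) (1/t) * exp (- 1 / t))"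

lemma poly_times_exp_tendsto_0: "((\<lambda>x::real. poly q x * exp (- x)) \<longlongrightarrow> 0) at_top"
proof -
  have "((\<lambda>x. \<Sum>i\<le>degree q. coeff q i * (x ^ i / exp x)) \<longlongrightarrow> (\<Sum>i\<le>degree q. coeff q i * 0)) at_top"
    by (intro tendsto_sum tendsto_mult tendsto_const tendsto_power_div_exp_0)
  then show ?thesis by (simp add: poly_altdef exp_minus divide_inverse sum_distrib_right mult.assoc)
qed

lemma flat_deriv_has_derivative: "(flat_deriv k has_real_derivative flat_deriv (Suc k) t) (at t)"
proof -
  consider "t < 0" | "t = 0" | "t > 0" by linarith
  then show ?thesis
  proof cases
    case 1
    have "((\<lambda>_. 0) has_real_derivative 0) (at t)" by simp
    moreover have "\<forall>\<^sub>F s in nhds t. flat_deriv k s = 0"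
      using eventually_nhds_in_open[of "{..<0}" t] 1 by (auto simp: flat_deriv_def elim: eventually_mono)
    ultimately show ?thesis using 1 DERIV_cong_ev[of t t "flat_deriv k" "\<lambda>_. 0" 0 0] by (simp add: flat_deriv_def)
  next
    case 3
    have "((\<lambda>s. poly (flat_poly k) (1/s) * exp (- 1 / s)) has_real_derivative flat_deriv (Suc k) t) (at t)"
      using 3 by (auto intro!: derivative_eq_intros DERIV_chain2[OF poly_DERIV] simp: flat_deriv_def field_simps)
    moreover have "\<forall>\<^sub>F s in nhds t. flat_deriv k s = poly (flat_poly k) (1/s) * exp (- 1 / s)"
      using eventually_nhds_in_open[of "{0<..}" t] 3 by (auto simp: flat_deriv_def elim: eventually_mono)
    ultimately show ?thesis
      using DERIV_cong_ev[of t t "flat_deriv k" "\<lambda>s. poly (flat_poly k) (1/s) * exp (- 1 / s)" _ _] by simp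
  next
    case 2
    \<comment> \<open>The extra factor is the division by \<open>h\<close> in the difference
      quotient at 0, expressed in the variable \<open>1/h\<close>.\<close>
    let ?q = "[:0, 1:] * flat_poly k"
    have "((\<lambda>h. flat_deriv k h / h) \<longlongrightarrow> 0) (at_right 0)"
    proof (rule Lim_transform_eventually)
      show "((\<lambda>h. poly ?q (inverse h) * exp (- inverse h)) \<longlongrightarrow> 0) (at_right 0)"
        by (rule filterlim_compose[OF poly_times_exp_tendsto_0 filterlim_inverse_at_top_right])
      show "\<forall>\<^sub>F h in at_right 0. poly ?q (inverse h) * exp (- inverse h) = flat_deriv k h / h"
        by (rule eventually_at_rightI[of 0 1]) (auto simp: flat_deriv_def divide_inverse)
    qed
    moreover have "((\<lambda>h. flat_deriv k h / h) \<longlongrightarrow> 0) (at_left 0)"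
      by (rule tendsto_eventually) (auto simp: flat_deriv_def intro: eventually_at_leftI[of "-1"])
    ultimately have "((\<lambda>h. flat_deriv k h / h) \<longlongrightarrow> 0) (at 0)"
      by (simp add: filterlim_split_at)
    then show ?thesis using 2 by (simp add: has_field_derivative_iff flat_deriv_def)
  qed
qed

lemma smooth_fun_flat: "smooth_fun n U f \<Longrightarrow> smooth_fun n U (\<lambda>u. flat_fun (f u))"
proof -
  have "flat_deriv 0 = flat_fun" by (auto simp: flat_deriv_def flat_fun_def fun_eq_iff)
  then show "smooth_fun n U f \<Longrightarrow> smooth_fun n U (\<lambda>u. flat_fun (f u))"
    using smooth_fun_real_compose[of flat_deriv, OF flat_deriv_has_derivative] by simp
qed

lemma flat_fun_nonneg: "flat_fun t \<ge> 0" and flat_fun_pos_iff: "flat_fun t > 0 \<longleftrightarrow> t > 0"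
  by (auto simp: flat_fun_def)

lemma flat_fun_mono: "s \<le> t \<Longrightarrow> flat_fun s \<le> flat_fun t"
  by (auto simp: flat_fun_def frac_le)

text \<open>As 1/4 < 3/4, at least one of the two arguments of \<open>flat_fun\<close> is positive
  at each \<open>t\<close>.\<close>

lemma smashing_denom_pos: "flat_fun (t - 1/4) + flat_fun (3/4 - t) > 0"
  using flat_fun_nonneg[of "t - 1/4"] flat_fun_nonneg[of "3/4 - t"]
    flat_fun_pos_iff[of "t - 1/4"] flat_fun_pos_iff[of "3/4 - t"] by linarith

lemma smashing_eq_0 [simp]: "t \<le> 1/4 \<Longrightarrow> smashing_fun t = 0"
  by (simp add: smashing_fun_def flat_fun_def)

lemma smashing_eq_1 [simp]: "t \<ge> 3/4 \<Longrightarrow> smashing_fun t = 1"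
  using smashing_denom_pos[of t] by (simp add: smashing_fun_def flat_fun_def)

lemma smashing_half [simp]: "smashing_fun (1/2) = 1/2"
  by (simp add: smashing_fun_def flat_fun_def)

lemma smashing_nonneg [simp]: "smashing_fun t \<ge> 0"
  using smashing_denom_pos[of t] flat_fun_nonneg[of "t - 1/4"] by (simp add: smashing_fun_def)

lemma smashing_le_1 [simp]: "smashing_fun t \<le> 1"
  using smashing_denom_pos[of t] flat_fun_nonneg[of "3/4 - t"] by (simp add: smashing_fun_def)

text \<open>The quotient has the form a/(a+b) with a increasing and b decreasing in
  \<open>t\<close>; after cross-multiplication the common term cancels.\<close>

lemma smashing_mono: "s \<le> t \<Longrightarrow> smashing_fun s \<le> smashing_fun t"
proof -
  assume "s \<le> t"
  then have *: "flat_fun (s - 1/4) \<le> flat_fun (t - 1/4)" "flat_fun (3/4 - t) \<le> flat_fun (3/4 - s)"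
    by (simp_all add: flat_fun_mono)
  have "flat_fun (s - 1/4) * flat_fun (3/4 - t) \<le> flat_fun (t - 1/4) * flat_fun (3/4 - s)"
    using * flat_fun_nonneg by (intro mult_mono) auto
  then show ?thesis
    using smashing_denom_pos[of s] smashing_denom_pos[of t]
    by (simp add: smashing_fun_def divide_simps algebra_simps)
qed

lemma smooth_fun_smashing:
  assumes f: "smooth_fun n U f" shows "smooth_fun n U (\<lambda>u. smashing_fun (f u))"
proof -
  have c: "smooth_fun n U (\<lambda>_. c)" for c by (rule smooth_fun_const[OF smooth_fun_openin[OF f]])
  have "smooth_fun n U (\<lambda>u. f u + (- (1/4)))" by (rule smooth_fun_add[OF f c])
  then have lo: "smooth_fun n U (\<lambda>u. flat_fun (f u - 1/4))" using smooth_fun_flat by fastforce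
  have "smooth_fun n U (\<lambda>u. 3/4 + (-1) * f u)" by (rule smooth_fun_add[OF c smooth_fun_mult[OF c f]])
  then have hi: "smooth_fun n U (\<lambda>u. flat_fun (3/4 - f u))" using smooth_fun_flat by fastforce
  have "smooth_fun n U (\<lambda>u. inverse (flat_fun (f u - 1/4) + flat_fun (3/4 - f u)))"
    by (rule smooth_fun_inverse[OF smooth_fun_add[OF lo hi] less_imp_neq[OF smashing_denom_pos, symmetric]])
  from smooth_fun_mult[OF lo this] show ?thesis
    unfolding smashing_fun_def divide_inverse[of "flat_fun _"] .
qed

lemma smooth_map_smashing:
  "smooth_map A real_diff f \<Longrightarrow> smooth_map A real_diff (\<lambda>x. smashing_fun (f x))"
  by (intro smooth_map_realI smooth_fun_smashing) (rule smooth_map_realD)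

lemmas smooth_intros = smooth_map_add smooth_map_mult smooth_map_uminus smooth_map_diff smooth_map_smashing
  smooth_map_id smooth_map_fst smooth_map_snd smooth_map_pair smooth_map_const
  diffeology_real diffeology_prod diffeology_euclid diffeology_subset

lemma smooth_map_real_const: "diffeology A \<Longrightarrow> smooth_map A real_diff (\<lambda>_. c)"
  by (rule smooth_map_const) (simp_all add: diffeology_real)

lemmas smooth_real_intros = smooth_map_real_const smooth_intros

text \<open>Openness in the D-topology, the finest topology for which all plots are
  continuous.\<close>

definition dopen :: "'a diff_space \<Rightarrow> 'a set \<Rightarrow> bool" where
  "dopen A S \<longleftrightarrow> (\<forall>n U p. plot A n U p \<longrightarrow> eopen n {u \<in> U. p u \<in> S})"

lemma dopen_preimage: "smooth_map A real_diff g \<Longrightarrow> open T \<Longrightarrow> dopen A {x. g x \<in> T}"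
  unfolding dopen_def
proof (intro allI impI)
  fix n U p assume g: "smooth_map A real_diff g" and T: "open T" and p: "plot A n U p"
  from smooth_fun_preimage[OF smooth_map_realD[OF g p] T]
  show "eopen n {u \<in> U. p u \<in> {x. g x \<in> T}}" by simp
qed

lemma dopen_Int: "dopen A S \<Longrightarrow> dopen A T \<Longrightarrow> dopen A (S \<inter> T)"
  unfolding dopen_def
proof (intro allI impI)
  fix n U p
  assume S: "\<forall>n U p. plot A n U p \<longrightarrow> eopen n {u \<in> U. p u \<in> S}"
    and T: "\<forall>n U p. plot A n U p \<longrightarrow> eopen n {u \<in> U. p u \<in> T}" and p: "plot A n U p"
  have eq: "{u \<in> U. p u \<in> S \<inter> T} = {u \<in> U. p u \<in> S} \<inter> {u \<in> U. p u \<in> T}" by blast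
  show "eopen n {u \<in> U. p u \<in> S \<inter> T}"
    unfolding eq by (rule openin_Int[OF S[rule_format, OF p] T[rule_format, OF p]])
qed

lemma dopen_UNIV: "diffeology A \<Longrightarrow> dopen A UNIV"
  by (simp add: dopen_def plot_openin)

lemma dopen_INT:
  assumes A: "diffeology A" and I: "finite I" "\<And>i. i \<in> I \<Longrightarrow> dopen A (S i)"
  shows "dopen A (\<Inter>i\<in>I. S i)"
  using I by (induction I rule: finite_induct) (simp_all add: dopen_UNIV A dopen_Int)

lemma smooth_map_local:
  assumes A: "diffeology A" and X: "diffeology X"
    and loc: "\<And>x. x \<in> points A \<Longrightarrow> \<exists>S. x \<in> S \<and> dopen A S \<and> smooth_map (subset_diff A S) X f"
  shows "smooth_map A X f"
proof (rule smooth_mapI)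
  show "f x \<in> points X" if "x \<in> points A" for x
  proof -
    from loc[OF that] obtain S where "x \<in> S" "smooth_map (subset_diff A S) X f" by blast
    then show ?thesis using smooth_map_points[of "subset_diff A S" X f x] that by simp
  qed
  fix n U p assume p: "plot A n U p"
  show "plot X n U (\<lambda>u. f (p u))"
  proof (rule plot_local[OF X plot_openin[OF A p]])
    fix u assume u: "u \<in> U"
    from loc[OF plot_points[OF A p u]] obtain S where S: "p u \<in> S" "dopen A S" "smooth_map (subset_diff A S) X f" by blast
    let ?V = "{u \<in> U. p u \<in> S}"
    have V: "eopen n ?V" using S(2) p by (simp add: dopen_def)
    have "plot (subset_diff A S) n ?V p"
      using plot_subset[OF A p V] by (auto simp: plot_subset_iff)
    from smooth_map_plot[OF S(3) this] V u S(1)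
    show "plot_near X n U (\<lambda>v. f (p v)) u"
      by (intro exI[of _ ?V] exI[of _ "\<lambda>u. f (p u)"]) auto
  qed
qed

text \<open>Since \<open>a < b\<close>, the two D-open sets \<open>g < b\<close> and
  \<open>a < g\<close> cover \<open>A\<close>, and smoothness is local.\<close>

lemma smooth_map_glue:
  assumes A: "diffeology A" and X: "diffeology X" and g: "smooth_map A real_diff g" and ab: "a < b"
    and lo: "smooth_map (subset_diff A {x. g x < b}) X f"
    and hi: "smooth_map (subset_diff A {x. a < g x}) X f"
  shows "smooth_map A X f"
proof (rule smooth_map_local[OF A X])
  fix x assume "x \<in> points A"
  show "\<exists>S. x \<in> S \<and> dopen A S \<and> smooth_map (subset_diff A S) X f"
  proof (cases "g x < b")
    case True
    then show ?thesis using dopen_preimage[OF g, of "{..<b}"] lo by (intro exI[of _ "{x. g x < b}"]) simp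
  next
    case False
    then show ?thesis using dopen_preimage[OF g, of "{a<..}"] hi ab by (intro exI[of _ "{x. a < g x}"]) simp
  qed
qed

section \<open>Paths and loops\<close>

text \<open>For t between 3/8 and 5/8 both halves rest at the common point, because there 2t is at
  least 3/4 and 2t - 1 at most 1/4. Each of the two formulas thus remains valid a little beyond 1/2,
  and the pieces overlap.\<close>

lemma smooth_concat_param:
  assumes A: "diffeology A" and X: "diffeology X"
    and f: "smooth_map (prod_diff A real_diff) X (\<lambda>z. f (fst z) (snd z))"
    and g: "smooth_map (prod_diff A real_diff) X (\<lambda>z. g (fst z) (snd z))"
    and fg: "\<And>a. a \<in> points A \<Longrightarrow> f a 1 = g a 0"
  shows "smooth_map (prod_diff A real_diff) X (\<lambda>z. concat_path (f (fst z)) (g (fst z)) (snd z))"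
proof (rule smooth_map_glue[where g = snd and a = "3/8" and b = "5/8"])
  let ?P = "prod_diff A real_diff"
  have f': "smooth_map ?P X (\<lambda>z. f (fst z) (smashing_fun (2 * snd z)))"
  proof -
    have "smooth_map ?P ?P (\<lambda>z. (fst z, smashing_fun (2 * snd z)))" by (rule A smooth_real_intros)+
    from smooth_map_compose[OF f this] show ?thesis by simp
  qed
  have g': "smooth_map ?P X (\<lambda>z. g (fst z) (smashing_fun (2 * snd z - 1)))"
  proof -
    have "smooth_map ?P ?P (\<lambda>z. (fst z, smashing_fun (2 * snd z - 1)))" by (rule A smooth_real_intros)+
    from smooth_map_compose[OF g this] show ?thesis by simp
  qed
  show "smooth_map (subset_diff ?P {x. snd x < 5/8}) X (\<lambda>z. concat_path (f (fst z)) (g (fst z)) (snd z))"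
    by (rule smooth_map_cong[OF _ X smooth_map_from_subset[OF f']])
       (auto simp: fg A diffeology_subset diffeology_prod diffeology_real concat_path_def)
  show "smooth_map (subset_diff ?P {x. 3/8 < snd x}) X (\<lambda>z. concat_path (f (fst z)) (g (fst z)) (snd z))"
    by (rule smooth_map_cong[OF _ X smooth_map_from_subset[OF g']])
       (auto simp: fg A diffeology_subset diffeology_prod diffeology_real concat_path_def)
  show "smooth_map ?P real_diff snd" by (rule smooth_map_snd[OF smooth_map_id])
  show "diffeology ?P" by (rule A smooth_real_intros)+
qed (simp_all add: X)

lemma smooth_concat:
  assumes X: "diffeology X" and f: "smooth_map real_diff X f" and g: "smooth_map real_diff X g"
    and fg: "f 1 = g 0"
  shows "smooth_map real_diff X (concat_path f g)"
proof -
  have "smooth_map (prod_diff real_diff real_diff) X (\<lambda>z. concat_path f g (snd z))"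
    by (rule smooth_concat_param[OF diffeology_real X smooth_map_compose[OF f smooth_map_snd[OF smooth_map_id]]
          smooth_map_compose[OF g smooth_map_snd[OF smooth_map_id]]]) (rule fg)
  moreover have "smooth_map real_diff (prod_diff real_diff real_diff) (\<lambda>t. (0, t))" by (rule smooth_real_intros)+
  ultimately show ?thesis using smooth_map_compose by fastforce
qed

lemma concat_path_0 [simp]: "concat_path f g 0 = f 0"
  and concat_path_1 [simp]: "concat_path f g 1 = g 1"
  by (simp_all add: concat_path_def)

lemma concat_path_comp: "concat_path (\<lambda>t. h (f t)) (\<lambda>t. h (g t)) = (\<lambda>t. h (concat_path f g t))"
  by (simp add: concat_path_def fun_eq_iff)

section \<open>Path components\<close>

lemma path_relI:
  assumes "smooth_map real_diff D \<gamma>" "\<gamma> 0 = x" "\<gamma> 1 = y"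
  shows "(x, y) \<in> path_rel D"
  using smooth_map_points[OF assms(1), of 0] smooth_map_points[OF assms(1), of 1] assms
  by (auto simp: path_rel_def)

lemma path_relE:
  assumes "(x, y) \<in> path_rel D"
  obtains \<gamma> where "smooth_map real_diff D \<gamma>" "\<gamma> 0 = x" "\<gamma> 1 = y"
  using assms by (auto simp: path_rel_def)

lemma equiv_path_rel:
  assumes D: "diffeology D" shows "equiv (points D) (path_rel D)"
proof (rule equivI)
  show "path_rel D \<subseteq> points D \<times> points D" by (auto simp: path_rel_def)
  show "refl_on (points D) (path_rel D)"
  proof (rule refl_onI)
    show "(x, x) \<in> path_rel D" if "x \<in> points D" for x
      by (rule path_relI[of _ "\<lambda>_. x"]) (use that D in \<open>auto intro: smooth_map_const diffeology_real\<close>)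
  qed
  show "sym (path_rel D)"
  proof (rule symI)
    fix x y assume "(x, y) \<in> path_rel D"
    then obtain \<gamma> where \<gamma>: "smooth_map real_diff D \<gamma>" "\<gamma> 0 = x" "\<gamma> 1 = y" by (rule path_relE)
    have "smooth_map real_diff D (\<lambda>t. \<gamma> (1 - t))"
      by (rule smooth_map_compose[OF \<gamma>(1)]) ((rule smooth_real_intros)+)
    then show "(y, x) \<in> path_rel D" by (rule path_relI) (simp_all add: \<gamma>)
  qed
  show "trans (path_rel D)"
  proof (rule transI)
    fix x y z assume "(x, y) \<in> path_rel D" "(y, z) \<in> path_rel D"
    then obtain \<gamma> \<gamma>' where \<gamma>: "smooth_map real_diff D \<gamma>" "\<gamma> 0 = x" "\<gamma> 1 = y"
      and \<gamma>': "smooth_map real_diff D \<gamma>'" "\<gamma>' 0 = y" "\<gamma>' 1 = z" by (meson path_relE)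
    have "smooth_map real_diff D (concat_path \<gamma> \<gamma>')"
      by (rule smooth_concat[OF D]) (simp_all add: \<gamma> \<gamma>')
    then show "(x, z) \<in> path_rel D" by (rule path_relI) (simp_all add: \<gamma> \<gamma>')
  qed
qed

lemma path_rel_refl: "diffeology D \<Longrightarrow> x \<in> points D \<Longrightarrow> (x, x) \<in> path_rel D"
  using equiv_path_rel by (blast dest: equivE refl_onD)

lemma path_rel_sym: "diffeology D \<Longrightarrow> (x, y) \<in> path_rel D \<Longrightarrow> (y, x) \<in> path_rel D"
  using equiv_path_rel by (blast dest: equivE symD)

lemma path_rel_trans: "diffeology D \<Longrightarrow> (x, y) \<in> path_rel D \<Longrightarrow> (y, z) \<in> path_rel D \<Longrightarrow> (x, z) \<in> path_rel D"
  using equiv_path_rel by (blast dest: equivE transD)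

lemma path_rel_smooth_map:
  assumes "smooth_map D E f" "(x, y) \<in> path_rel D" shows "(f x, f y) \<in> path_rel E"
proof -
  from assms(2) obtain \<gamma> where \<gamma>: "smooth_map real_diff D \<gamma>" "\<gamma> 0 = x" "\<gamma> 1 = y" by (rule path_relE)
  from smooth_map_compose[OF assms(1) \<gamma>(1)] show ?thesis by (rule path_relI) (simp_all add: \<gamma>)
qed

lemma path_rel_points: "(x, y) \<in> path_rel D \<Longrightarrow> x \<in> points D \<and> y \<in> points D"
  by (simp add: path_rel_def)

lemma path_rel_image:
  assumes A: "diffeology A" and j: "inj_on j (points A)"
  shows "(u, v) \<in> path_rel (image_diff A j) \<longleftrightarrow> (\<exists>a b. u = j a \<and> v = j b \<and> (a, b) \<in> path_rel A)"
proof
  assume uv: "(u, v) \<in> path_rel (image_diff A j)"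
  then obtain a b where ab: "u = j a" "v = j b" "a \<in> points A" "b \<in> points A"
    by (auto dest!: path_rel_points)
  from path_rel_smooth_map[OF smooth_map_inv_image[OF A j] uv]
  have "(a, b) \<in> path_rel A" by (simp add: ab j)
  with ab show "\<exists>a b. u = j a \<and> v = j b \<and> (a, b) \<in> path_rel A" by blast
qed (use path_rel_smooth_map[OF smooth_map_proj_image[OF A]] in blast)

section \<open>Loop spaces\<close>

lemma diffeology_loop: "diffeology X \<Longrightarrow> diffeology (loop_diff X x)"
  unfolding loop_diff_def by (intro diffeology_subset diffeology_functional diffeology_real)

lemma points_loop: "\<alpha> \<in> points (loop_diff X x) \<longleftrightarrow> smooth_map real_diff X \<alpha> \<and> \<alpha> 0 = x \<and> \<alpha> 1 = x"
  by (auto simp: loop_diff_def points_functional)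

lemma smooth_map_loopI:
  assumes A: "diffeology A" and f: "smooth_map (prod_diff A real_diff) X (\<lambda>z. f (fst z) (snd z))"
    and "\<And>a. a \<in> points A \<Longrightarrow> f a 0 = x" "\<And>a. a \<in> points A \<Longrightarrow> f a 1 = x"
  shows "smooth_map A (loop_diff X x) f"
  unfolding loop_diff_def
  by (intro smooth_map_into_subset[OF A] smooth_map_curry[OF A diffeology_real f])
     (simp_all add: assms extensional_UNIV)

lemma smooth_map_loopD:
  assumes A: "diffeology A" and f: "smooth_map A (loop_diff X x) f"
  shows "smooth_map (prod_diff A real_diff) X (\<lambda>z. f (fst z) (snd z))"
    and "\<And>a. a \<in> points A \<Longrightarrow> f a 0 = x" "\<And>a. a \<in> points A \<Longrightarrow> f a 1 = x"
  using smooth_map_uncurry[OF A diffeology_real] f smooth_map_points[OF f]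
  by (auto simp: loop_diff_def dest: smooth_map_out_subset)

lemma smooth_map_real_swap_const:
  "smooth_map real_diff X \<alpha> \<Longrightarrow> diffeology A \<Longrightarrow> smooth_map (prod_diff A real_diff) X (\<lambda>z. \<alpha> (snd z))"
  by (erule smooth_map_compose) (rule smooth_map_snd[OF smooth_map_id])

text \<open>The exponential law: a path in the loop space is a map of two real variables, pinned on
  the lines \<open>t = 0\<close> and \<open>t = 1\<close> for every real \<open>s\<close>.\<close>

lemma loop_rel_iff:
  assumes X: "diffeology X"
  shows "(\<alpha>, \<beta>) \<in> path_rel (loop_diff X x) \<longleftrightarrow>
    (\<exists>H. smooth_map (prod_diff real_diff real_diff) X (\<lambda>z. H (fst z) (snd z)) \<and> H 0 = \<alpha> \<and> H 1 = \<beta> \<and>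
      (\<forall>s. H s 0 = x \<and> H s 1 = x))"
proof
  assume "(\<alpha>, \<beta>) \<in> path_rel (loop_diff X x)"
  then obtain H where H: "smooth_map real_diff (loop_diff X x) H" "H 0 = \<alpha>" "H 1 = \<beta>" by (rule path_relE)
  with smooth_map_loopD[OF diffeology_real H(1)]
  show "\<exists>H. smooth_map (prod_diff real_diff real_diff) X (\<lambda>z. H (fst z) (snd z)) \<and> H 0 = \<alpha> \<and> H 1 = \<beta> \<and>
      (\<forall>s. H s 0 = x \<and> H s 1 = x)"
    by (intro exI[of _ H]) auto
next
  assume "\<exists>H. smooth_map (prod_diff real_diff real_diff) X (\<lambda>z. H (fst z) (snd z)) \<and> H 0 = \<alpha> \<and> H 1 = \<beta> \<and>
      (\<forall>s. H s 0 = x \<and> H s 1 = x)"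
  then obtain H where H: "smooth_map (prod_diff real_diff real_diff) X (\<lambda>z. H (fst z) (snd z))"
    "H 0 = \<alpha>" "H 1 = \<beta>" "\<And>s. H s 0 = x" "\<And>s. H s 1 = x" by blast
  from smooth_map_loopI[OF diffeology_real H(1), of x] H(4,5)
  have "smooth_map real_diff (loop_diff X x) H" by blast
  then show "(\<alpha>, \<beta>) \<in> path_rel (loop_diff X x)" by (rule path_relI) (simp_all add: H)
qed

text \<open>The real line is convex, so reparametrisations with the same end points are homotopic.\<close>

lemma loop_rel_reparam:
  assumes X: "diffeology X" and P: "smooth_map real_diff X P"
    and c: "smooth_map real_diff real_diff c" and d: "smooth_map real_diff real_diff d"
    and cd: "c 0 = d 0" "c 1 = d 1" and x: "P (c 0) = x" "P (c 1) = x"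
  shows "(\<lambda>t. P (c t), \<lambda>t. P (d t)) \<in> path_rel (loop_diff X x)"
  unfolding loop_rel_iff[OF X]
proof (intro exI[of _ "\<lambda>s t. P ((1 - s) * c t + s * d t)"] conjI allI)
  let ?RR = "prod_diff real_diff real_diff"
  have "smooth_map ?RR real_diff (\<lambda>z. c (snd z))" "smooth_map ?RR real_diff (\<lambda>z. d (snd z))"
    by (intro smooth_map_real_swap_const c d diffeology_real)+
  then have "smooth_map ?RR real_diff (\<lambda>z. (1 - fst z) * c (snd z) + fst z * d (snd z))"
    by - (rule smooth_real_intros | assumption)+
  from smooth_map_compose[OF P this]
  show "smooth_map ?RR X (\<lambda>z. P ((1 - fst z) * c (snd z) + fst z * d (snd z))) " .
  show "P ((1 - s) * c 0 + s * d 0) = x" "P ((1 - s) * c 1 + s * d 1) = x" for s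
    using x cd by (simp_all add: algebra_simps)
qed simp_all

lemma loop_rel_concat:
  assumes X: "diffeology X" and \<alpha>: "(\<alpha>, \<alpha>') \<in> path_rel (loop_diff X x)" and \<beta>: "(\<beta>, \<beta>') \<in> path_rel (loop_diff X x)"
  shows "(concat_path \<alpha> \<beta>, concat_path \<alpha>' \<beta>') \<in> path_rel (loop_diff X x)"
proof -
  obtain H where H: "smooth_map (prod_diff real_diff real_diff) X (\<lambda>z. H (fst z) (snd z))" "H 0 = \<alpha>" "H 1 = \<alpha>'"
      "\<And>s. H s 0 = x" "\<And>s. H s 1 = x"
    using \<alpha> unfolding loop_rel_iff[OF X] by blast
  obtain K where K: "smooth_map (prod_diff real_diff real_diff) X (\<lambda>z. K (fst z) (snd z))" "K 0 = \<beta>" "K 1 = \<beta>'"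
      "\<And>s. K s 0 = x" "\<And>s. K s 1 = x"
    using \<beta> unfolding loop_rel_iff[OF X] by blast
  show ?thesis unfolding loop_rel_iff[OF X]
    by (intro exI[of _ "\<lambda>s. concat_path (H s) (K s)"] conjI smooth_concat_param[OF diffeology_real X H(1) K(1)])
       (simp_all add: H K)
qed

lemma loop_rel_smashing:
  assumes X: "diffeology X" and \<alpha>: "\<alpha> \<in> points (loop_diff X x)"
  shows "(\<alpha>, \<lambda>t. \<alpha> (smashing_fun t)) \<in> path_rel (loop_diff X x)"
  using \<alpha> unfolding points_loop
  by (intro loop_rel_reparam[OF X, of \<alpha> "\<lambda>t. t" smashing_fun] smooth_map_smashing smooth_map_id) auto

text \<open>\<open>smashing_fun\<close> maps R into [0, 1], so after reparametrisation only the
  values on the unit interval are left. The behaviour of a loop outside [0, 1] does not affect its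
  class.\<close>

lemma loop_rel_agree:
  assumes X: "diffeology X" and \<alpha>: "\<alpha> \<in> points (loop_diff X x)" and \<beta>: "\<beta> \<in> points (loop_diff X x)"
    and eq: "\<And>t. 0 \<le> t \<Longrightarrow> t \<le> 1 \<Longrightarrow> \<alpha> t = \<beta> t"
  shows "(\<alpha>, \<beta>) \<in> path_rel (loop_diff X x)"
proof -
  have "(\<lambda>t. \<alpha> (smashing_fun t)) = (\<lambda>t. \<beta> (smashing_fun t))" by (simp add: eq)
  then show ?thesis
    using loop_rel_smashing[OF X \<alpha>] path_rel_sym[OF diffeology_loop[OF X] loop_rel_smashing[OF X \<beta>]]
      path_rel_trans[OF diffeology_loop[OF X]] by metis
qed

lemma concat_loop:
  assumes X: "diffeology X" and "\<alpha> \<in> points (loop_diff X x)" "\<beta> \<in> points (loop_diff X x)"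
  shows "concat_path \<alpha> \<beta> \<in> points (loop_diff X x)"
  using assms smooth_concat[OF X, of \<alpha> \<beta>] by (simp add: points_loop)

lemma const_in_loop: "diffeology X \<Longrightarrow> x \<in> points X \<Longrightarrow> (\<lambda>_. x) \<in> points (loop_diff X x)"
  by (simp add: points_loop smooth_map_const diffeology_real)

section \<open>Group laws for loops up to homotopy\<close>

context
  fixes X :: "'a diff_space" and x :: 'a
  assumes X: "diffeology X"
begin

text \<open>Concatenation is carried out among the real parameters and \<open>P\<close> is applied
  afterwards; on the line any two paths with the same ends are homotopic. The unit and inverse laws
  are instances.\<close>

lemma loop_concat_reparam:
  assumes P: "smooth_map real_diff X P" and c: "smooth_map real_diff real_diff c" and d: "smooth_map real_diff real_diff d"
    and e: "smooth_map real_diff real_diff e"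
    and cd: "c 1 = d 0" "e 0 = c 0" "e 1 = d 1" and x: "P (e 0) = x" "P (e 1) = x"
  shows "(concat_path (\<lambda>t. P (c t)) (\<lambda>t. P (d t)), \<lambda>t. P (e t)) \<in> path_rel (loop_diff X x)"
  unfolding concat_path_comp
  by (rule loop_rel_reparam[OF X P smooth_concat[OF diffeology_real c d cd(1)] e]) (use cd x in simp_all)

lemma loop_concat_unit_right:
  assumes \<alpha>: "\<alpha> \<in> points (loop_diff X x)"
  shows "(concat_path \<alpha> (\<lambda>_. x), \<alpha>) \<in> path_rel (loop_diff X x)"
  using loop_concat_reparam[of \<alpha> "\<lambda>t. t" "\<lambda>_. 1" "\<lambda>t. t"] \<alpha>
  by (simp add: points_loop smooth_real_intros)

lemma loop_concat_unit_left:
  assumes \<alpha>: "\<alpha> \<in> points (loop_diff X x)"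
  shows "(concat_path (\<lambda>_. x) \<alpha>, \<alpha>) \<in> path_rel (loop_diff X x)"
  using loop_concat_reparam[of \<alpha> "\<lambda>_. 0" "\<lambda>t. t" "\<lambda>t. t"] \<alpha>
  by (simp add: points_loop smooth_real_intros)

lemma loop_reverse:
  assumes \<alpha>: "\<alpha> \<in> points (loop_diff X x)"
  shows "(\<lambda>t. \<alpha> (1 - t)) \<in> points (loop_diff X x)"
  using \<alpha> smooth_map_compose[of real_diff X \<alpha> real_diff "\<lambda>t. 1 - t"]
  by (simp add: points_loop smooth_real_intros)

lemma loop_concat_reverse:
  assumes \<alpha>: "\<alpha> \<in> points (loop_diff X x)"
  shows "(concat_path (\<lambda>t. \<alpha> (1 - t)) \<alpha>, \<lambda>_. x) \<in> path_rel (loop_diff X x)"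
  using loop_concat_reparam[of \<alpha> "\<lambda>t. 1 - t" "\<lambda>t. t" "\<lambda>_. 1"] \<alpha>
  by (simp add: points_loop smooth_real_intros)

text \<open>
  On the unit interval the three loops are, up to reparametrisation, the restrictions of the single
  path \<open>P = \<alpha> * (\<beta> * \<gamma>)\<close> to \<open>[0, 1/2]\<close>, \<open>[1/2, 3/4]\<close> and \<open>[3/4, 1]\<close>; the last two meet at \<open>3/4\<close>
  because \<^term>\<open>smashing_fun (1/2) = 1/2\<close>.
\<close>

lemma loop_concat_assoc:
  assumes \<alpha>: "\<alpha> \<in> points (loop_diff X x)" and \<beta>: "\<beta> \<in> points (loop_diff X x)" and \<gamma>: "\<gamma> \<in> points (loop_diff X x)"
  shows "(concat_path (concat_path \<alpha> \<beta>) \<gamma>, concat_path \<alpha> (concat_path \<beta> \<gamma>)) \<in> path_rel (loop_diff X x)"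
proof -
  let ?R = "path_rel (loop_diff X x)"
  note L = diffeology_loop[OF X, of x]
  note s = smooth_real_intros
  define P where "P = concat_path \<alpha> (concat_path \<beta> \<gamma>)"
  have PL: "P \<in> points (loop_diff X x)" unfolding P_def by (intro concat_loop X \<alpha> \<beta> \<gamma>)
  then have P: "smooth_map real_diff X P" "P 0 = x" "P 1 = x" by (simp_all add: points_loop)
  have ends: "\<alpha> 0 = x" "\<alpha> 1 = x" "\<beta> 0 = x" "\<beta> 1 = x" "\<gamma> 0 = x" "\<gamma> 1 = x"
    using \<alpha> \<beta> \<gamma> by (simp_all add: points_loop)
  let ?a = "\<lambda>t. 1/2 * t :: real" let ?b = "\<lambda>t. 1/2 + 1/4 * t :: real" let ?c = "\<lambda>t. 3/4 + 1/4 * t :: real"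
  have sm: "smooth_map real_diff real_diff ?a" "smooth_map real_diff real_diff ?b" "smooth_map real_diff real_diff ?c"
    by (rule s)+
  have mid: "P (1/2) = x" by (simp add: P_def concat_path_def ends)
  have mid': "P (3/4) = x" by (simp add: P_def concat_path_def ends)
  have Pa: "(\<lambda>t. P (?a t)) \<in> points (loop_diff X x)" and Pb: "(\<lambda>t. P (?b t)) \<in> points (loop_diff X x)"
    and Pc: "(\<lambda>t. P (?c t)) \<in> points (loop_diff X x)"
    using smooth_map_compose[OF P(1) sm(1)] smooth_map_compose[OF P(1) sm(2)] smooth_map_compose[OF P(1) sm(3)]
      P(2,3) mid mid' by (simp_all add: points_loop)
  have "(\<alpha>, \<lambda>t. P (?a t)) \<in> ?R"
  proof -
    have "(\<lambda>t. \<alpha> (smashing_fun t), \<lambda>t. P (?a t)) \<in> ?R"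
      using path_rel_points[OF loop_rel_smashing[OF X \<alpha>]] Pa
      by (intro loop_rel_agree X) (auto simp: P_def concat_path_def)
    then show ?thesis using path_rel_trans[OF L loop_rel_smashing[OF X \<alpha>]] by blast
  qed
  moreover have "(\<beta>, \<lambda>t. P (?b t)) \<in> ?R"
  proof -
    \<comment> \<open>Unfolding \<open>concat_path\<close> twice at \<open>1/2 + 1/4 * t\<close>
      leads to this parameter of \<open>\<beta>\<close>.\<close>
    let ?d = "\<lambda>t. smashing_fun (2 * smashing_fun (1/2 * t))"
    have d: "smooth_map real_diff real_diff ?d" by (rule s)+
    have bd: "(\<beta>, \<lambda>t. \<beta> (?d t)) \<in> ?R"
      using \<beta> d by (intro loop_rel_reparam[OF X, of \<beta> "\<lambda>t. t" ?d] smooth_map_id) (auto simp: points_loop)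
    have eq: "\<beta> (?d t) = P (?b t)" if t: "0 \<le> t" "t \<le> 1" for t
    proof -
      have "smashing_fun (t/2) \<le> 1/2" using smashing_mono[of "t/2" "1/2"] t by simp
      moreover have "2 * (1/2 + 1/4 * t) - 1 = t / 2" by simp
      \<comment> \<open>At \<open>t = 0\<close> the point 1/2 belongs to the first branch of
        \<open>P\<close>, so the formula for \<open>t > 0\<close> does not apply; both sides are
        \<open>x\<close>.\<close>
      moreover have "P (?b 0) = \<beta> (?d 0)" using mid ends by simp
      ultimately show ?thesis using t
        by (cases "t = 0") (simp_all add: P_def concat_path_def)
    qed
    have "(\<lambda>t. \<beta> (?d t), \<lambda>t. P (?b t)) \<in> ?R"
      using path_rel_points[OF bd] Pb eq by (intro loop_rel_agree X) auto
    then show ?thesis using path_rel_trans[OF L bd] by blast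
  qed
  moreover have "(\<gamma>, \<lambda>t. P (?c t)) \<in> ?R"
  proof -
    let ?d = "\<lambda>t. smashing_fun (2 * smashing_fun (1/2 + 1/2 * t) - 1)"
    have d: "smooth_map real_diff real_diff ?d" by (rule s)+
    have gd: "(\<gamma>, \<lambda>t. \<gamma> (?d t)) \<in> ?R"
      using \<gamma> d by (intro loop_rel_reparam[OF X, of \<gamma> "\<lambda>t. t" ?d] smooth_map_id) (auto simp: points_loop)
    have eq: "\<gamma> (?d t) = P (?c t)" if t: "0 \<le> t" "t \<le> 1" for t
    proof -
      have m: "smashing_fun (1/2 + t/2) \<ge> 1/2" using smashing_mono[of "1/2" "1/2 + t/2"] t by simp
      have e: "2 * (3/4 + 1/4 * t) - 1 = 1/2 + t / 2" by simp
      have "concat_path \<beta> \<gamma> (smashing_fun (1/2 + t/2)) = \<gamma> (?d t)"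
      \<comment> \<open>At the value 1/2 the concatenation takes its first branch and ends at
        \<open>\<beta> 1\<close>, which agrees with \<open>\<gamma> 0\<close>.\<close>
      proof (cases "smashing_fun (1/2 + t/2) = 1/2")
        case True
        then show ?thesis by (simp add: concat_path_def ends)
      next
        case False
        then show ?thesis using m by (simp add: concat_path_def)
      qed
      moreover have "P (?c t) = concat_path \<beta> \<gamma> (smashing_fun (1/2 + t/2))"
        unfolding P_def concat_path_def[of \<alpha>] e using t by simp
      ultimately show ?thesis by simp
    qed
    have "(\<lambda>t. \<gamma> (?d t), \<lambda>t. P (?c t)) \<in> ?R"
      using path_rel_points[OF gd] Pc eq by (intro loop_rel_agree X) auto
    then show ?thesis using path_rel_trans[OF L gd] by blast
  qed
  ultimately have 1: "(concat_path (concat_path \<alpha> \<beta>) \<gamma>,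
      concat_path (concat_path (\<lambda>t. P (?a t)) (\<lambda>t. P (?b t))) (\<lambda>t. P (?c t))) \<in> ?R"
    by (intro loop_rel_concat X)
  have ab: "smooth_map real_diff real_diff (concat_path ?a ?b)"
    by (rule smooth_concat[OF diffeology_real sm(1,2)]) simp
  have 2: "(concat_path (\<lambda>t. P (concat_path ?a ?b t)) (\<lambda>t. P (?c t)), \<lambda>t. P t) \<in> ?R"
    by (rule loop_concat_reparam[OF P(1) ab sm(3) smooth_map_id]) (simp_all add: P(2,3))
  show ?thesis
    using path_rel_trans[OF L 1[unfolded concat_path_comp[of P ?a ?b]] 2] by (simp add: P_def)
qed

end

section \<open>Principal fibrations\<close>

lemma smooth_map_into_euclid:
  assumes A: "diffeology A" and f: "\<And>a. a \<in> points A \<Longrightarrow> f a \<in> Eu m"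
    and c: "\<And>j. j < m \<Longrightarrow> smooth_map A real_diff (\<lambda>a. f a j)"
  shows "smooth_map A (euclid_diff m) f"
proof (rule smooth_mapI)
  show "f x \<in> points (euclid_diff m)" if "x \<in> points A" for x using f[OF that] by simp
  fix n U p assume p: "plot A n U p"
  have "smooth_fun n U (\<lambda>u. f (p u) j)" if "j < m" for j
    by (rule smooth_map_realD[OF c[OF that] p])
  then show "plot (euclid_diff m) n U (\<lambda>u. f (p u))"
    unfolding plot_euclid smooth_euclid_def
    using plot_openin[OF A p] f[OF plot_points[OF A p]] by blast
qed

lemma smooth_map_coord: "smooth_map (euclid_diff m) real_diff (\<lambda>x. x j)"
proof (rule smooth_map_realI)
  fix n U p assume p: "plot (euclid_diff m) n U p"
  then have U: "eopen n U" and pE: "p ` U \<subseteq> Eu m" by (simp_all add: plot_euclid smooth_euclid_def)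
  show "smooth_fun n U (\<lambda>u. p u j)"
  proof (cases "j < m")
    case True
    then show ?thesis using p by (simp add: plot_euclid smooth_euclid_def)
  next
    case False
    then have "p u j = 0" if "u \<in> U" for u using pE that by (force simp: mem_Eu image_subset_iff)
    then show ?thesis by (intro smooth_fun_cong[OF smooth_fun_const[OF U, of 0]]) simp
  qed
qed

lemma smooth_map_euclid_split:
  "smooth_map (euclid_diff (Suc m)) (prod_diff (euclid_diff m) real_diff) (\<lambda>z. (z(m := 0), z m))"
proof (intro smooth_map_pair smooth_map_coord smooth_map_into_euclid diffeology_euclid)
  show "a(m := 0) \<in> Eu m" if "a \<in> points (euclid_diff (Suc m))" for a using that by (auto simp: mem_Eu Suc_le_eq)
  show "smooth_map (euclid_diff (Suc m)) real_diff (\<lambda>a. (a(m := 0)) j)" if "j < m" for j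
    using that smooth_map_coord[of "Suc m" j] by simp
qed

lemma smooth_map_euclid_join:
  "smooth_map (prod_diff (euclid_diff m) real_diff) (euclid_diff (Suc m)) (\<lambda>z. (fst z)(m := snd z))"
proof (rule smooth_map_into_euclid)
  show "diffeology (prod_diff (euclid_diff m) real_diff)" by (rule smooth_real_intros)+
  show "(fst a)(m := snd a) \<in> Eu (Suc m)" if "a \<in> points (prod_diff (euclid_diff m) real_diff)" for a
    using that by (auto simp: mem_Eu)
  show "smooth_map (prod_diff (euclid_diff m) real_diff) real_diff (\<lambda>a. ((fst a)(m := snd a)) j)" for j
  proof (cases "j = m")
    case True
    then show ?thesis by (simp add: smooth_map_snd[OF smooth_map_id])
  next
    case False
    then show ?thesis using smooth_map_compose[OF smooth_map_coord smooth_map_fst[OF smooth_map_id], of m real_diff j] by simp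
  qed
qed

definition lifts_homotopies :: "'e diff_space \<Rightarrow> 'b diff_space \<Rightarrow> ('e \<Rightarrow> 'b) \<Rightarrow> 'p diff_space \<Rightarrow> bool" where
  "lifts_homotopies E B q P \<longleftrightarrow>
     (\<forall>h f. smooth_map (prod_diff P real_diff) B h \<longrightarrow> smooth_map P E f \<longrightarrow> (\<forall>u\<in>points P. q (f u) = h (u, 0)) \<longrightarrow>
       (\<exists>H. smooth_map (prod_diff P real_diff) E H \<and> (\<forall>u\<in>points P. H (u, 0) = f u \<and> (\<forall>s. q (H (u, s)) = h (u, s)))))"

text \<open>A homotopy over \<open>Q\<close> is pulled back along the retraction \<open>k\<close>,
  lifted over \<open>P\<close> and restricted along \<open>j\<close>. It serves to move the property
  from \<open>euclid_diff\<close> to R and to R^m x R.\<close>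

lemma lifts_homotopies_retract:
  assumes P: "lifts_homotopies E B q P" and E: "diffeology E" and Q: "diffeology Q"
    and j: "smooth_map Q P j" and k: "smooth_map P Q k" and kj: "\<And>x. x \<in> points Q \<Longrightarrow> k (j x) = x"
  shows "lifts_homotopies E B q Q"
  unfolding lifts_homotopies_def
proof (intro allI impI)
  fix h f assume h: "smooth_map (prod_diff Q real_diff) B h" and f: "smooth_map Q E f"
    and qf: "\<forall>u\<in>points Q. q (f u) = h (u, 0)"
  have "smooth_map (prod_diff P real_diff) (prod_diff Q real_diff) (\<lambda>z. (k (fst z), snd z))"
    by (rule smooth_map_prod[OF k smooth_map_id])
  from smooth_map_compose[OF h this] have h': "smooth_map (prod_diff P real_diff) B (\<lambda>z. h (k (fst z), snd z))" .
  have "\<forall>u\<in>points P. q (f (k u)) = h (k (fst (u, 0)), snd (u, 0::real))"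
    using qf smooth_map_points[OF k] by simp
  with P[unfolded lifts_homotopies_def, rule_format, OF h' smooth_map_compose[OF f k]]
  obtain H where H: "smooth_map (prod_diff P real_diff) E H"
    "\<And>u. u \<in> points P \<Longrightarrow> H (u, 0) = f (k u) \<and> (\<forall>s. q (H (u, s)) = h (k u, s))" by auto
  show "\<exists>H. smooth_map (prod_diff Q real_diff) E H \<and> (\<forall>u\<in>points Q. H (u, 0) = f u \<and> (\<forall>s. q (H (u, s)) = h (u, s)))"
    using smooth_map_compose[OF H(1) smooth_map_prod[OF j smooth_map_id]] H(2)[OF smooth_map_points[OF j]] kj
    by (intro exI[of _ "\<lambda>z. H (j (fst z), snd z)"]) simp
qed

text \<open>\<open>dv x y\<close> is the element that carries \<open>x\<close> to \<open>y\<close>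
  within a fibre. Since it recovers the acting element, identities in \<open>G\<close> are read off
  from \<open>E\<close> (see \<open>mul_eq\<close>, \<open>smooth_mul\<close>,
  \<open>mul_one\<close>). Conditions in the form of equations and smoothness of \<open>act\<close>
  and \<open>dv\<close> can be checked pointwise for loops.\<close>

locale principal_action =
  fixes G :: "'g diff_space" and mul :: "'g \<Rightarrow> 'g \<Rightarrow> 'g" and one :: 'g
    and E :: "'e diff_space" and B :: "'b diff_space"
    and act :: "'g \<Rightarrow> 'e \<Rightarrow> 'e" and dv :: "'e \<Rightarrow> 'e \<Rightarrow> 'g" and q :: "'e \<Rightarrow> 'b"
  assumes dG: "diffeology G" and dE: "diffeology E" and dB: "diffeology B"
    and q: "smooth_map E B q"
    and act: "smooth_map (prod_diff G E) E (\<lambda>z. act (fst z) (snd z))"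
    and dv: "smooth_map (subset_diff (prod_diff E E) {z. q (fst z) = q (snd z)}) G (\<lambda>z. dv (fst z) (snd z))"
    and one_in: "one \<in> points G"
    and mul_in: "g \<in> points G \<Longrightarrow> h \<in> points G \<Longrightarrow> mul g h \<in> points G"
    and act_one: "x \<in> points E \<Longrightarrow> act one x = x"
    and act_mul: "g \<in> points G \<Longrightarrow> h \<in> points G \<Longrightarrow> x \<in> points E \<Longrightarrow> act (mul g h) x = act g (act h x)"
    and q_act: "g \<in> points G \<Longrightarrow> x \<in> points E \<Longrightarrow> q (act g x) = q x"
    and act_dv: "x \<in> points E \<Longrightarrow> y \<in> points E \<Longrightarrow> q x = q y \<Longrightarrow> act (dv x y) x = y"
    and dv_act: "g \<in> points G \<Longrightarrow> x \<in> points E \<Longrightarrow> dv x (act g x) = g"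
begin

lemma smooth_act:
  assumes "smooth_map A G f" "smooth_map A E g" shows "smooth_map A E (\<lambda>a. act (f a) (g a))"
  using smooth_map_compose[OF act smooth_map_pair[OF assms]] by simp

lemma smooth_dv:
  assumes A: "diffeology A" and f: "smooth_map A E f" and g: "smooth_map A E g"
    and "\<And>a. a \<in> points A \<Longrightarrow> q (f a) = q (g a)"
  shows "smooth_map A G (\<lambda>a. dv (f a) (g a))"
  using smooth_map_compose[OF dv smooth_map_into_subset[OF A smooth_map_pair[OF f g]]] assms(4) by simp

lemma act_in: "g \<in> points G \<Longrightarrow> x \<in> points E \<Longrightarrow> act g x \<in> points E"
  using smooth_map_points[OF act, of "(g, x)"] by simp

lemma dv_in: "x \<in> points E \<Longrightarrow> y \<in> points E \<Longrightarrow> q x = q y \<Longrightarrow> dv x y \<in> points G"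
  using smooth_map_points[OF dv, of "(x, y)"] by simp

lemma dv_self: "x \<in> points E \<Longrightarrow> dv x x = one"
  using dv_act[OF one_in, of x] act_one by simp

lemma mul_eq: "g \<in> points G \<Longrightarrow> h \<in> points G \<Longrightarrow> x \<in> points E \<Longrightarrow> mul g h = dv x (act g (act h x))"
  using dv_act[OF mul_in, of g h x] act_mul by simp

lemma smooth_mul:
  assumes x: "x \<in> points E" and A: "diffeology A" and f: "smooth_map A G f" and g: "smooth_map A G g"
  shows "smooth_map A G (\<lambda>a. mul (f a) (g a))"
proof (rule smooth_map_cong[OF A dG])
  have c: "smooth_map A E (\<lambda>_. x)" by (rule smooth_map_const[OF A dE x])
  show "smooth_map A G (\<lambda>a. dv x (act (f a) (act (g a) x)))"
    by (rule smooth_dv[OF A c smooth_act[OF f smooth_act[OF g c]]])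
       (simp add: q_act act_in x smooth_map_points[OF f] smooth_map_points[OF g])
  show "dv x (act (f a) (act (g a) x)) = mul (f a) (g a)" if "a \<in> points A" for a
    using mul_eq[OF smooth_map_points[OF f that] smooth_map_points[OF g that] x] by simp
qed

lemma mul_one: "x \<in> points E \<Longrightarrow> g \<in> points G \<Longrightarrow> mul g one = g"
  and one_mul: "x \<in> points E \<Longrightarrow> g \<in> points G \<Longrightarrow> mul one g = g"
  by (simp_all add: mul_eq one_in act_one act_in dv_act)

end

text \<open>The property is required for all \<open>m\<close> together because forming loops
  consumes a parameter: lifting over R^m for loop spaces uses lifting over R^m x R below.\<close>

locale pfib = principal_action +
  assumes hlp: "lifts_homotopies E B q (euclid_diff m)"
begin

lemma hlp_real: "lifts_homotopies E B q real_diff"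
proof (rule lifts_homotopies_retract[OF hlp[of 1] dE diffeology_real])
  show "smooth_map real_diff (euclid_diff 1) (\<lambda>s i. if i = 0 then s else 0)"
    by (rule smooth_map_into_euclid) (auto simp: diffeology_real mem_Eu smooth_map_id)
  show "smooth_map (euclid_diff 1) real_diff (\<lambda>z. z 0)" by (rule smooth_map_coord)
qed simp

lemma hlp_euclid_real: "lifts_homotopies E B q (prod_diff (euclid_diff m) real_diff)"
proof (rule lifts_homotopies_retract[OF hlp[of "Suc m"] dE _ smooth_map_euclid_join smooth_map_euclid_split])
  show "diffeology (prod_diff (euclid_diff m) real_diff)" by (rule smooth_real_intros)+
qed (auto simp: mem_Eu fun_eq_iff)

text \<open>Homotopy lifting over the one-point space R^0.\<close>

lemma path_lifting:
  assumes b: "smooth_map real_diff B b" and e: "e \<in> points E" "q e = b 0"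
  obtains y where "smooth_map real_diff E y" "y 0 = e" "\<And>t. q (y t) = b t"
proof -
  let ?P = "euclid_diff 0"
  have "smooth_map (prod_diff ?P real_diff) B (\<lambda>z. b (snd z))"
    by (rule smooth_map_real_swap_const[OF b diffeology_euclid])
  moreover have "smooth_map ?P E (\<lambda>_. e)" by (rule smooth_map_const[OF diffeology_euclid dE e(1)])
  ultimately obtain H where H: "smooth_map (prod_diff ?P real_diff) E H"
    "\<And>u. u \<in> points ?P \<Longrightarrow> H (u, 0) = e \<and> (\<forall>s. q (H (u, s)) = b s)"
    using hlp[of 0, unfolded lifts_homotopies_def, rule_format, of "\<lambda>z. b (snd z)" "\<lambda>_. e"] e by auto
  have "smooth_map real_diff (prod_diff ?P real_diff) (\<lambda>t. (\<lambda>_. 0, t))"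
    by (intro smooth_map_pair smooth_map_const smooth_map_id diffeology_real diffeology_euclid) (simp add: mem_Eu)
  from smooth_map_compose[OF H(1) this] H(2)[of "\<lambda>_. 0"] show ?thesis
    by (intro that[of "\<lambda>t. H (\<lambda>_. 0, t)"]) (auto simp: mem_Eu)
qed

end

section \<open>Loop spaces of principal fibrations\<close>

lemma smooth_eval:
  assumes A: "diffeology A" and X: "diffeology X" and f: "smooth_map A (loop_diff X x) f" and g: "smooth_map A real_diff g"
  shows "smooth_map A X (\<lambda>a. f a (g a))"
  using smooth_map_compose[OF smooth_map_loopD(1)[OF diffeology_loop[OF X] smooth_map_id] smooth_map_pair[OF f g]] by simp

context pfib
begin

text \<open>The algebraic conditions hold at each time separately, and the smoothness conditions
  follow from the exponential law. The content is homotopy lifting, where the lift must again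
  consist of loops at \<open>e\<close>.\<close>

lemma pfib_loop:
  assumes e: "e \<in> points E"
  shows "pfib (loop_diff G one) (\<lambda>g h t. mul (g t) (h t)) (\<lambda>_. one) (loop_diff E e) (loop_diff B (q e))
    (\<lambda>g x t. act (g t) (x t)) (\<lambda>x y t. dv (x t) (y t)) (\<lambda>x t. q (x t))"
proof
  let ?G = "loop_diff G one" and ?E = "loop_diff E e" and ?B = "loop_diff B (q e)"
  show LG: "diffeology ?G" and LE: "diffeology ?E" and LB: "diffeology ?B"
    by (rule diffeology_loop dG dE dB)+
  have ptG: "g t \<in> points G" if "g \<in> points ?G" for g t
    using that smooth_map_points[of real_diff G g t] by (simp add: points_loop)
  have ptE: "x t \<in> points E" if "x \<in> points ?E" for x t
    using that smooth_map_points[of real_diff E x t] by (simp add: points_loop)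
  have endG: "g 0 = one" "g 1 = one" if "g \<in> points ?G" for g using that by (simp_all add: points_loop)
  have endE: "x 0 = e" "x 1 = e" if "x \<in> points ?E" for x using that by (simp_all add: points_loop)
  show "smooth_map ?E ?B (\<lambda>x t. q (x t))"
  proof (rule smooth_map_loopI[OF LE])
    show "smooth_map (prod_diff ?E real_diff) B (\<lambda>z. q (fst z (snd z)))"
      by (rule smooth_map_compose[OF q smooth_map_loopD(1)[OF LE smooth_map_id]])
  qed (simp_all add: endE)
  show "smooth_map (prod_diff ?G ?E) ?E (\<lambda>z t. act (fst z t) (snd z t))"
  proof (rule smooth_map_loopI)
    show "smooth_map (prod_diff (prod_diff ?G ?E) real_diff) E (\<lambda>z. act (fst (fst z) (snd z)) (snd (fst z) (snd z)))"
    proof (rule smooth_act)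
      have d: "diffeology (prod_diff (prod_diff ?G ?E) real_diff)" by (intro diffeology_prod LG LE diffeology_real)
      show "smooth_map (prod_diff (prod_diff ?G ?E) real_diff) G (\<lambda>z. fst (fst z) (snd z))"
        by (rule smooth_eval[OF d dG]) (rule smooth_map_fst smooth_map_snd smooth_map_id)+
      show "smooth_map (prod_diff (prod_diff ?G ?E) real_diff) E (\<lambda>z. snd (fst z) (snd z))"
        by (rule smooth_eval[OF d dE]) (rule smooth_map_fst smooth_map_snd smooth_map_id)+
    qed
  qed (auto simp: endG endE act_one e diffeology_prod LG LE)
  show "smooth_map (subset_diff (prod_diff ?E ?E) {z. (\<lambda>t. q (fst z t)) = (\<lambda>t. q (snd z t))}) ?G (\<lambda>z t. dv (fst z t) (snd z t))"
    (is "smooth_map ?S _ _")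
  proof (rule smooth_map_loopI)
    show dS: "diffeology ?S" by (intro diffeology_subset diffeology_prod LE)
    show "smooth_map (prod_diff ?S real_diff) G (\<lambda>z. dv (fst (fst z) (snd z)) (snd (fst z) (snd z)))"
    proof (rule smooth_dv)
      show d: "diffeology (prod_diff ?S real_diff)" by (intro diffeology_prod dS diffeology_real)
      have s: "smooth_map (prod_diff ?S real_diff) (prod_diff ?E ?E) fst"
        by (rule smooth_map_out_subset[OF smooth_map_fst[OF smooth_map_id]])
      show "smooth_map (prod_diff ?S real_diff) E (\<lambda>z. fst (fst z) (snd z))"
        by (rule smooth_eval[OF d dE smooth_map_fst[OF s] smooth_map_snd[OF smooth_map_id]])
      show "smooth_map (prod_diff ?S real_diff) E (\<lambda>z. snd (fst z) (snd z))"
        by (rule smooth_eval[OF d dE smooth_map_snd[OF s] smooth_map_snd[OF smooth_map_id]])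
    qed (auto simp: fun_eq_iff)
  qed (auto simp: endE dv_self e)
  show "(\<lambda>_. one) \<in> points ?G" by (rule const_in_loop[OF dG one_in])
  show "(\<lambda>t. mul (g t) (h t)) \<in> points ?G" if "g \<in> points ?G" "h \<in> points ?G" for g h
    using that smooth_mul[OF e diffeology_real, of g h] mul_one[OF e one_in] by (simp add: points_loop)
  show "lifts_homotopies ?E ?B (\<lambda>x t. q (x t)) (euclid_diff m)" for m
    unfolding lifts_homotopies_def
  proof (intro allI impI)
    fix h f assume h: "smooth_map (prod_diff (euclid_diff m) real_diff) ?B h" and f: "smooth_map (euclid_diff m) ?E f"
      and "\<forall>u\<in>points (euclid_diff m). (\<lambda>t. q (f u t)) = h (u, 0)"
    then have qf: "q (f u t) = h (u, 0) t" if "u \<in> Eu m" for u t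
      using that by (metis points_euclid)
    let ?P = "prod_diff (euclid_diff m) real_diff"
    note dP = diffeology_prod[OF diffeology_euclid[of m] diffeology_real]
    note dPR = diffeology_prod[OF dP diffeology_real]
    note s = smooth_real_intros
    have fE: "f u 0 = e" "f u 1 = e" "f u t \<in> points E" if "u \<in> Eu m" for u t
      using endE ptE smooth_map_points[OF f] that by simp_all
    have hB: "h (u, s) 0 = q e" "h (u, s) 1 = q e" if "u \<in> Eu m" for u s
      using smooth_map_points[OF h, of "(u, s)"] that by (simp_all add: points_loop)
    \<comment> \<open>Here \<open>z = ((u, \<tau>), s)\<close>: the loop parameter
      \<open>\<tau>\<close> joins the parameter space, and the homotopy parameter \<open>s\<close>
      remains the direction of lifting.\<close>
    have "smooth_map (prod_diff ?P real_diff) B (\<lambda>z. h (fst (fst z), snd z) (snd (fst z)))"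
    proof (rule smooth_eval[OF dPR dB smooth_map_compose[OF h]])
      show "smooth_map (prod_diff ?P real_diff) ?P (\<lambda>z. (fst (fst z), snd z))" by (rule s)+
      show "smooth_map (prod_diff ?P real_diff) real_diff (\<lambda>z. snd (fst z))" by (rule s)+
    qed
    moreover have "smooth_map ?P E (\<lambda>z. f (fst z) (snd z))" by (rule smooth_map_loopD(1)[OF diffeology_euclid f])
    ultimately obtain H where H: "smooth_map (prod_diff ?P real_diff) E H"
      and H': "\<And>u \<tau>. u \<in> Eu m \<Longrightarrow> H ((u, \<tau>), 0) = f u \<tau>" "\<And>u \<tau> s. u \<in> Eu m \<Longrightarrow> q (H ((u, \<tau>), s)) = h (u, s) \<tau>"
      using hlp_euclid_real[of m, unfolded lifts_homotopies_def, rule_format,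
          of "\<lambda>z. h (fst (fst z), snd z) (snd (fst z))" "\<lambda>z. f (fst z) (snd z)"] qf by auto
    have HE: "H ((u, \<tau>), s) \<in> points E" if "u \<in> Eu m" for u \<tau> s
      using smooth_map_points[OF H, of "((u, \<tau>), s)"] that by simp
    text \<open>
      \<open>H\<close> need not be constant on the faces \<open>\<tau> = 0\<close> and \<open>\<tau> = 1\<close>. Evaluating the correction on a face
      at \<open>s * (1 - \<tau>)\<close> and \<open>s * \<tau>\<close> makes it trivial on the opposite face and for \<open>s = 0\<close>.
    \<close>
    define K where "K z = act (dv (H ((fst (fst z), 0), snd z * (1 - snd (fst z)))) e) (H z)" for z
    have K: "smooth_map (prod_diff ?P real_diff) E K"
      unfolding K_def
    proof (intro smooth_act H smooth_dv dPR smooth_map_const dE e)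
      show "smooth_map (prod_diff ?P real_diff) E (\<lambda>z. H ((fst (fst z), 0), snd z * (1 - snd (fst z))))"
        by (rule smooth_map_compose[OF H]) (rule s UNIV_I | simp)+
      show "q (H ((fst (fst z), 0), snd z * (1 - snd (fst z)))) = q e" if "z \<in> points (prod_diff ?P real_diff)" for z
        using that H'(2) hB by auto
    qed
    have Kq: "q (K ((u, \<tau>), s)) = h (u, s) \<tau>" if "u \<in> Eu m" for u \<tau> s
      using H'(2) hB that HE by (simp add: K_def q_act dv_in e)
    have KE: "K ((u, \<tau>), s) \<in> points E" if "u \<in> Eu m" for u \<tau> s
      using smooth_map_points[OF K, of "((u, \<tau>), s)"] that by simp
    have K0: "K ((u, \<tau>), 0) = f u \<tau>" if "u \<in> Eu m" for u \<tau>
      using that by (simp add: K_def H' fE dv_self act_one e)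
    have K1: "K ((u, 0), s) = e" if "u \<in> Eu m" for u s
      using that H'(2) hB HE by (simp add: K_def act_dv e)
    define L where "L z = act (dv (K ((fst (fst z), 1), snd z * snd (fst z))) e) (K z)" for z
    have L: "smooth_map (prod_diff ?P real_diff) E L"
      unfolding L_def
    proof (intro smooth_act K smooth_dv dPR smooth_map_const dE e)
      show "smooth_map (prod_diff ?P real_diff) E (\<lambda>z. K ((fst (fst z), 1), snd z * snd (fst z)))"
        by (rule smooth_map_compose[OF K]) (rule s UNIV_I | simp)+
      show "q (K ((fst (fst z), 1), snd z * snd (fst z))) = q e" if "z \<in> points (prod_diff ?P real_diff)" for z
        using that Kq hB by auto
    qed
    have Lq: "q (L ((u, \<tau>), s)) = h (u, s) \<tau>" if "u \<in> Eu m" for u \<tau> s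
      using Kq hB that KE by (simp add: L_def q_act dv_in e)
    have L0: "L ((u, \<tau>), 0) = f u \<tau>" if "u \<in> Eu m" for u \<tau>
      using that by (simp add: L_def K0 fE dv_self act_one e)
    \<comment> \<open>On \<open>\<tau> = 0\<close> the second correction is computed from
      \<open>K ((u, 1), 0) = f u 1 = e\<close>; it is trivial and keeps the face that
      \<open>K\<close> has already repaired.\<close>
    have L1: "L ((u, 0), s) = e" if "u \<in> Eu m" for u s
      using that by (simp add: L_def K0 K1 fE dv_self act_one e)
    have L2: "L ((u, 1), s) = e" if "u \<in> Eu m" for u s
      using that Kq hB KE by (simp add: L_def act_dv e)
    have "smooth_map ?P ?E (\<lambda>z \<tau>. L ((fst z, \<tau>), snd z))"
    proof (rule smooth_map_loopI[OF dP])
      show "smooth_map (prod_diff ?P real_diff) E (\<lambda>z. L ((fst (fst z), snd z), snd (fst z)))"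
        by (rule smooth_map_compose[OF L]) (rule s)+
    qed (auto simp: L1 L2)
    then show "\<exists>H. smooth_map ?P ?E H \<and> (\<forall>u\<in>points (euclid_diff m). H (u, 0) = f u \<and> (\<forall>s. (\<lambda>t. q (H (u, s) t)) = h (u, s)))"
      by (intro exI[of _ "\<lambda>z \<tau>. L ((fst z, \<tau>), snd z)"]) (simp add: L0 Lq)
  qed
  show "(\<lambda>t. act one (x t)) = x" if "x \<in> points ?E" for x by (simp add: act_one ptE that)
  show "(\<lambda>t. act (mul (g t) (h t)) (x t)) = (\<lambda>t. act (g t) (act (h t) (x t)))"
    if "g \<in> points ?G" "h \<in> points ?G" "x \<in> points ?E" for g h x
    by (simp add: act_mul ptE ptG that)
  show "(\<lambda>t. q (act (g t) (x t))) = (\<lambda>t. q (x t))" if "g \<in> points ?G" "x \<in> points ?E" for g x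
    by (simp add: q_act ptE ptG that)
  show "(\<lambda>t. dv (x t) (act (g t) (x t))) = g" if "g \<in> points ?G" "x \<in> points ?E" for g x
    by (simp add: dv_act ptE ptG that)
  show "(\<lambda>t. act (dv (x t) (y t)) (x t)) = y"
    if "x \<in> points ?E" "y \<in> points ?E" "(\<lambda>t. q (x t)) = (\<lambda>t. q (y t))" for x y
    using fun_cong[OF that(3)] by (simp add: act_dv ptE that(1,2))
qed

end

lemma lifts_homotopies_image:
  assumes L: "lifts_homotopies E B q P" and P: "diffeology P" and E: "diffeology E" and B: "diffeology B"
    and jE: "inj_on jE (points E)" and jB: "inj_on jB (points B)"
    and q: "\<And>x. x \<in> points E \<Longrightarrow> q' (jE x) = jB (q x)" and qB: "\<And>x. x \<in> points E \<Longrightarrow> q x \<in> points B"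
  shows "lifts_homotopies (image_diff E jE) (image_diff B jB) q' P"
  unfolding lifts_homotopies_def
proof (intro allI impI)
  let ?k = "inv_into (points E) jE" and ?l = "inv_into (points B) jB"
  fix h f assume h: "smooth_map (prod_diff P real_diff) (image_diff B jB) h" and f: "smooth_map P (image_diff E jE) f"
    and qf: "\<forall>u\<in>points P. q' (f u) = h (u, 0)"
  have fk: "jE (?k (f u)) = f u" "?k (f u) \<in> points E" if "u \<in> points P" for u
    using smooth_map_points[OF f that] by (auto simp: f_inv_into_f inv_into_into)
  have hl: "jB (?l (h (u, s))) = h (u, s)" if "u \<in> points P" for u s
    using smooth_map_points[OF h, of "(u, s)"] that by (auto simp: f_inv_into_f)
  note h' = smooth_map_compose[OF smooth_map_inv_image[OF B jB] h]
  note f' = smooth_map_compose[OF smooth_map_inv_image[OF E jE] f]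
  have "\<forall>u\<in>points P. q (?k (f u)) = ?l (h (u, 0))"
  proof
    fix u assume u: "u \<in> points P"
    have "jB (q (?k (f u))) = h (u, 0)" using q[OF fk(2)[OF u]] fk(1)[OF u] qf u by simp
    then show "q (?k (f u)) = ?l (h (u, 0))" using qB[OF fk(2)[OF u]] jB by (metis inv_into_f_f)
  qed
  with L[unfolded lifts_homotopies_def, rule_format, OF h' f']
  obtain H where H: "smooth_map (prod_diff P real_diff) E H"
    "\<And>u. u \<in> points P \<Longrightarrow> H (u, 0) = ?k (f u) \<and> (\<forall>s. q (H (u, s)) = ?l (h (u, s)))" by auto
  have "q' (jE (H (u, s))) = h (u, s)" if "u \<in> points P" for u s
    using q[of "H (u, s)"] smooth_map_points[OF H(1), of "(u, s)"] that H(2)[OF that] hl[OF that] by simp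
  then show "\<exists>H. smooth_map (prod_diff P real_diff) (image_diff E jE) H \<and>
      (\<forall>u\<in>points P. H (u, 0) = f u \<and> (\<forall>s. q' (H (u, s)) = h (u, s)))"
    using smooth_map_into_image[OF E H(1), of jE] H(2) fk by (intro exI[of _ "\<lambda>z. jE (H z)"]) simp
qed

text \<open>Transport of structure along injections, needed because each stage of
  \<open>iter_loop_diff\<close> is wrapped in \<open>Point\<close> or \<open>Loop\<close>.\<close>

lemma pfib_image:
  fixes one :: 'g
  assumes "pfib G mul one E B act dv q"
    and jG: "inj_on jG (points G)" and jE: "inj_on jE (points E)" and jB: "inj_on jB (points B)"
    and mul': "\<And>g h. g \<in> points G \<Longrightarrow> h \<in> points G \<Longrightarrow> mul' (jG g) (jG h) = jG (mul g h)"
    and act': "\<And>g x. g \<in> points G \<Longrightarrow> x \<in> points E \<Longrightarrow> act' (jG g) (jE x) = jE (act g x)"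
    and dv': "\<And>x y. x \<in> points E \<Longrightarrow> y \<in> points E \<Longrightarrow> q x = q y \<Longrightarrow> dv' (jE x) (jE y) = jG (dv x y)"
    and q': "\<And>x. x \<in> points E \<Longrightarrow> q' (jE x) = jB (q x)"
  shows "pfib (image_diff G jG) mul' (jG one) (image_diff E jE) (image_diff B jB) act' dv' q'"
proof -
  interpret pfib G mul one E B act dv q by fact
  let ?G = "image_diff G jG" and ?E = "image_diff E jE" and ?B = "image_diff B jB"
  have qB: "q x \<in> points B" if "x \<in> points E" for x by (rule smooth_map_points[OF q that])
  have q_eq: "q x = q y" if "x \<in> points E" "y \<in> points E" "q' (jE x) = q' (jE y)" for x y
    using that qB jB by (simp add: q' inj_on_eq_iff)
  show ?thesis
  proof
    show LG: "diffeology ?G" and LE: "diffeology ?E" and LB: "diffeology ?B" by (rule diffeology_image dG dE dB)+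
    show "smooth_map ?E ?B q'"
      by (rule smooth_map_from_image[OF dE LB], rule smooth_map_cong[OF dE LB smooth_map_into_image[OF dB q]])
         (simp add: q')
    show "smooth_map (prod_diff ?G ?E) ?E (\<lambda>z. act' (fst z) (snd z))"
    proof (rule smooth_map_from_prod_image[OF dG dE LE],
        rule smooth_map_cong[OF diffeology_prod[OF dG dE] LE smooth_map_into_image[OF dE act]])
      show "jE (act (fst x) (snd x)) = act' (fst (jG (fst x), jE (snd x))) (snd (jG (fst x), jE (snd x)))"
        if "x \<in> points (prod_diff G E)" for x using that by (auto simp: act')
    qed
    let ?S = "subset_diff (prod_diff ?E ?E) {z. q' (fst z) = q' (snd z)}"
    let ?k = "inv_into (points E) jE"
    have k: "jE (?k x) = x" "?k x \<in> points E" if "x \<in> points ?E" for x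
      using that by (auto simp: f_inv_into_f inv_into_into)
    have dS: "diffeology ?S" by (intro diffeology_subset diffeology_prod LE)
    have kq: "q (?k (fst z)) = q (?k (snd z))" if "z \<in> points ?S" for z
      using that k[of "fst z"] k[of "snd z"] by (intro q_eq) auto
    have "smooth_map ?S ?E (\<lambda>z. fst z)"
      by (rule smooth_map_fst[OF smooth_map_from_subset[OF smooth_map_id]])
    note k1 = smooth_map_compose[OF smooth_map_inv_image[OF dE jE] this]
    have "smooth_map ?S ?E (\<lambda>z. snd z)"
      by (rule smooth_map_snd[OF smooth_map_from_subset[OF smooth_map_id]])
    note k2 = smooth_map_compose[OF smooth_map_inv_image[OF dE jE] this]
    show "smooth_map ?S ?G (\<lambda>z. dv' (fst z) (snd z))"
    proof (rule smooth_map_cong[OF dS LG smooth_map_into_image[OF dG smooth_dv[OF dS k1 k2 kq]]])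
      fix z assume z: "z \<in> points ?S"
      then have "fst z \<in> points ?E" "snd z \<in> points ?E" by auto
      then show "jG (dv (?k (fst z)) (?k (snd z))) = dv' (fst z) (snd z)"
        using dv'[OF _ _ kq[OF z]] k by metis
    qed
    show "jG one \<in> points ?G" using one_in by simp
    show "mul' g h \<in> points ?G" if "g \<in> points ?G" "h \<in> points ?G" for g h
      using that mul_in by (auto simp: mul')
    show "act' (jG one) x = x" if "x \<in> points ?E" for x
      using that one_in by (auto simp: act' act_one)
    show "act' (mul' g h) x = act' g (act' h x)" if "g \<in> points ?G" "h \<in> points ?G" "x \<in> points ?E" for g h x
      using that mul_in act_in by (auto simp: act' mul' act_mul)
    show "q' (act' g x) = q' x" if "g \<in> points ?G" "x \<in> points ?E" for g x
      using that act_in by (auto simp: act' q' q_act)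
    show "act' (dv' x y) x = y" if xy: "x \<in> points ?E" "y \<in> points ?E" "q' x = q' y" for x y
    proof -
      obtain a b where ab: "a \<in> points E" "x = jE a" "b \<in> points E" "y = jE b" using xy by auto
      then have "q a = q b" using q_eq xy by blast
      then show ?thesis using ab by (simp add: dv' act' dv_in act_dv)
    qed
    show "dv' x (act' g x) = g" if "g \<in> points ?G" "x \<in> points ?E" for g x
      using that act_in by (auto simp: act' dv' q_act dv_act)
    show "lifts_homotopies ?E ?B q' (euclid_diff m)" for m
      by (rule lifts_homotopies_image[OF hlp diffeology_euclid dE dB jE jB q' qB])
  qed
qed

text \<open>The binary counterpart of \<open>map_iter_loop\<close>: two iterated loops of equal
  depth are combined pointwise. Elements of different depth do not occur within one degree, so the
  value there is left undefined.\<close>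

primrec il2 :: "('a \<Rightarrow> 'b \<Rightarrow> 'c) \<Rightarrow> 'a iter_loop \<Rightarrow> 'b iter_loop \<Rightarrow> 'c iter_loop" where
  "il2 f (Point a) = (\<lambda>y. case y of Point b \<Rightarrow> Point (f a b) | Loop \<beta> \<Rightarrow> undefined)"
| "il2 f (Loop \<alpha>) = (\<lambda>y. case y of Point b \<Rightarrow> undefined | Loop \<beta> \<Rightarrow> Loop (\<lambda>t. il2 f (\<alpha> t) (\<beta> t)))"

lemma map_iter_loop_const [simp]: "map_iter_loop f (const_loop x k) = const_loop (f x) k"
  by (induction k) (simp_all add: comp_def)

text \<open>Membership of the constant loop is carried through the induction because
  \<open>pfib_loop\<close> needs a base point of the total space at every stage.\<close>

lemma pfib_iter_loop:
  fixes one :: 'g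
  assumes p: "pfib G mul one E B act dv q" and e: "e \<in> points E"
  shows "pfib (iter_loop_diff G one k) (il2 mul) (const_loop one k) (iter_loop_diff E e k) (iter_loop_diff B (q e) k)
      (il2 act) (il2 dv) (map_iter_loop q) \<and> const_loop e k \<in> points (iter_loop_diff E e k)"
proof (induction k)
  case 0
  show ?case using e by (auto intro!: pfib_image[OF p] inj_onI)
next
  case (Suc k)
  then interpret pfib "iter_loop_diff G one k" "il2 mul" "const_loop one k" "iter_loop_diff E e k" "iter_loop_diff B (q e) k"
    "il2 act" "il2 dv" "map_iter_loop q" by blast
  have c: "const_loop e k \<in> points (iter_loop_diff E e k)" using Suc by blast
  from pfib_image[OF pfib_loop[OF c], of Loop Loop Loop "il2 mul" "il2 act" "il2 dv" "map_iter_loop q"] const_in_loop[OF dE c]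
  show ?case by (auto simp: inj_on_def comp_def)
qed

section \<open>Homotopy groups\<close>

lemma diffeology_iter_loop: "diffeology X \<Longrightarrow> diffeology (iter_loop_diff X x k)"
  by (induction k) (simp_all add: diffeology_image diffeology_loop)

lemma const_loop_in: "diffeology X \<Longrightarrow> x \<in> points X \<Longrightarrow> const_loop x k \<in> points (iter_loop_diff X x k)"
  by (induction k) (simp_all add: const_in_loop diffeology_iter_loop)

lemma smooth_map_iter_loop:
  assumes X: "diffeology X" and Y: "diffeology Y" and f: "smooth_map X Y f"
  shows "smooth_map (iter_loop_diff X x k) (iter_loop_diff Y (f x) k) (map_iter_loop f)"
proof (induction k)
  case 0
  have "smooth_map X (image_diff Y Point) (\<lambda>a. Point (f a))" by (rule smooth_map_into_image[OF Y f])
  then show ?case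
    unfolding iter_loop_diff.simps by (intro smooth_map_from_image[OF X diffeology_image[OF Y]]) simp
next
  case (Suc k)
  let ?X = "iter_loop_diff X x k" and ?Y = "iter_loop_diff Y (f x) k"
  note dX = diffeology_iter_loop[OF X, of x k] and dY = diffeology_iter_loop[OF Y, of "f x" k]
  have "smooth_map (loop_diff ?X (const_loop x k)) (loop_diff ?Y (const_loop (f x) k)) (\<lambda>\<alpha> t. map_iter_loop f (\<alpha> t))"
  proof (rule smooth_map_loopI[OF diffeology_loop[OF dX]])
    show "smooth_map (prod_diff (loop_diff ?X (const_loop x k)) real_diff) ?Y (\<lambda>z. map_iter_loop f (fst z (snd z)))"
      by (rule smooth_map_compose[OF Suc smooth_map_loopD(1)[OF diffeology_loop[OF dX] smooth_map_id]])
  qed (auto simp: points_loop)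
  from smooth_map_into_image[OF diffeology_loop[OF dY] this, of Loop]
  show ?case
    by (auto intro!: smooth_map_from_image diffeology_image diffeology_loop dX dY simp: comp_def)
qed

abbreviation hcls :: "'a diff_space \<Rightarrow> 'a \<Rightarrow> nat \<Rightarrow> 'a iter_loop \<Rightarrow> 'a iter_loop set" where
  "hcls X x k u \<equiv> path_rel (iter_loop_diff X x k) `` {u}"

lemma path_class_eq_iff:
  "diffeology D \<Longrightarrow> u \<in> points D \<Longrightarrow> v \<in> points D \<Longrightarrow> path_rel D `` {u} = path_rel D `` {v} \<longleftrightarrow> (u, v) \<in> path_rel D"
  by (rule eq_equiv_class_iff[OF equiv_path_rel])

lemma path_class_eq: "diffeology D \<Longrightarrow> (u, v) \<in> path_rel D \<Longrightarrow> path_rel D `` {u} = path_rel D `` {v}"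
  by (rule equiv_class_eq[OF equiv_path_rel])

text \<open>Induced maps, products and connecting maps are defined by saturating a set of
  representatives. This reduces each of them to its value at a single representative.\<close>

lemma path_class_of_set:
  assumes D: "diffeology D" and a: "a \<in> S" and S: "\<And>s. s \<in> S \<Longrightarrow> (a, s) \<in> path_rel D"
  shows "path_rel D `` S = path_rel D `` {a}"
  using a S path_rel_trans[OF D] by blast

lemma homotopy_setE:
  assumes "c \<in> homotopy_set X x k"
  obtains u where "u \<in> points (iter_loop_diff X x k)" "c = hcls X x k u"
  using assms by (auto simp: homotopy_set_def pi0_def quotient_def)

lemma hcls_in: "u \<in> points (iter_loop_diff X x k) \<Longrightarrow> hcls X x k u \<in> homotopy_set X x k"
  by (simp add: homotopy_set_def pi0_def quotientI)

lemma homotopy_map_hcls: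
  assumes X: "diffeology X" and Y: "diffeology Y" and f: "smooth_map X Y f" and u: "u \<in> points (iter_loop_diff X x k)"
  shows "homotopy_map Y f x k (hcls X x k u) = hcls Y (f x) k (map_iter_loop f u)"
  unfolding homotopy_map_def
proof (rule path_class_of_set[OF diffeology_iter_loop[OF Y]])
  show "map_iter_loop f u \<in> map_iter_loop f ` hcls X x k u"
    using path_rel_refl[OF diffeology_iter_loop[OF X] u] by blast
qed (use path_rel_smooth_map[OF smooth_map_iter_loop[OF X Y f]] in blast)

lemma homotopy_unit_eq: "homotopy_unit X x k = hcls X x k (const_loop x k)"
  by (simp add: homotopy_unit_def)

lemma homotopy_map_in:
  assumes "diffeology X" "diffeology Y" "smooth_map X Y f" "c \<in> homotopy_set X x k"
  shows "homotopy_map Y f x k c \<in> homotopy_set Y (f x) k"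
proof -
  obtain u where u: "u \<in> points (iter_loop_diff X x k)" "c = hcls X x k u" using assms(4) by (rule homotopy_setE)
  then show ?thesis
    using homotopy_map_hcls[OF assms(1-3) u(1)] smooth_map_points[OF smooth_map_iter_loop[OF assms(1-3)] u(1)]
    by (simp add: hcls_in)
qed

lemma loop_hcls_iff:
  assumes X: "diffeology X"
  shows "(Loop \<alpha>, u) \<in> path_rel (iter_loop_diff X x (Suc k)) \<longleftrightarrow>
    (\<exists>\<beta>. u = Loop \<beta> \<and> (\<alpha>, \<beta>) \<in> path_rel (loop_diff (iter_loop_diff X x k) (const_loop x k)))"
  using path_rel_image[of "loop_diff (iter_loop_diff X x k) (const_loop x k)" Loop "Loop \<alpha>" u]
    diffeology_loop[OF diffeology_iter_loop[OF X]] by (auto simp: inj_on_def)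

lemma homotopy_set_SucE:
  assumes "c \<in> homotopy_set X x (Suc k)"
  obtains \<alpha> where "\<alpha> \<in> points (loop_diff (iter_loop_diff X x k) (const_loop x k))" "c = hcls X x (Suc k) (Loop \<alpha>)"
  using assms by (auto elim!: homotopy_setE)

lemma hcls_Loop_in:
  "\<alpha> \<in> points (loop_diff (iter_loop_diff X x k) (const_loop x k)) \<Longrightarrow> hcls X x (Suc k) (Loop \<alpha>) \<in> homotopy_set X x (Suc k)"
  by (rule hcls_in) simp

lemma hcls_Loop_eq:
  assumes X: "diffeology X" and "(\<alpha>, \<beta>) \<in> path_rel (loop_diff (iter_loop_diff X x k) (const_loop x k))"
  shows "hcls X x (Suc k) (Loop \<alpha>) = hcls X x (Suc k) (Loop \<beta>)"
  by (rule path_class_eq[OF diffeology_iter_loop[OF X]]) (use assms in \<open>simp only: loop_hcls_iff[OF X], blast\<close>)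

lemma mult_hcls:
  assumes X: "diffeology X"
    and \<alpha>: "\<alpha> \<in> points (loop_diff (iter_loop_diff X x k) (const_loop x k))"
    and \<beta>: "\<beta> \<in> points (loop_diff (iter_loop_diff X x k) (const_loop x k))"
  shows "hcls X x (Suc k) (Loop \<alpha>) \<otimes>\<^bsub>homotopy_group X x (Suc k)\<^esub> hcls X x (Suc k) (Loop \<beta>) =
    hcls X x (Suc k) (Loop (concat_path \<alpha> \<beta>))"
proof -
  let ?I = "iter_loop_diff X x k"
  let ?L = "loop_diff ?I (const_loop x k)"
  let ?S = "{Loop (concat_path \<alpha>' \<beta>') | \<alpha>' \<beta>'. Loop \<alpha>' \<in> hcls X x (Suc k) (Loop \<alpha>) \<and> Loop \<beta>' \<in> hcls X x (Suc k) (Loop \<beta>)}"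
  have dI: "diffeology ?I" by (rule diffeology_iter_loop[OF X])
  have dL: "diffeology ?L" by (rule diffeology_loop[OF dI])
  have iff: "Loop \<alpha>' \<in> hcls X x (Suc k) (Loop \<alpha>) \<longleftrightarrow> (\<alpha>, \<alpha>') \<in> path_rel ?L" for \<alpha> \<alpha>'
    by (simp only: Image_singleton_iff loop_hcls_iff[OF X] iter_loop.inject) blast
  have "path_rel (iter_loop_diff X x (Suc k)) `` ?S = hcls X x (Suc k) (Loop (concat_path \<alpha> \<beta>))"
  proof (rule path_class_of_set[OF diffeology_iter_loop[OF X]])
    show "Loop (concat_path \<alpha> \<beta>) \<in> ?S"
      unfolding iff using path_rel_refl[OF dL \<alpha>] path_rel_refl[OF dL \<beta>] by blast
    fix s assume "s \<in> ?S"
    then obtain \<alpha>' \<beta>' where s: "s = Loop (concat_path \<alpha>' \<beta>')" "(\<alpha>, \<alpha>') \<in> path_rel ?L" "(\<beta>, \<beta>') \<in> path_rel ?L"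
      unfolding iff by blast
    from loop_rel_concat[OF dI s(2,3)] show "(Loop (concat_path \<alpha> \<beta>), s) \<in> path_rel (iter_loop_diff X x (Suc k))"
      unfolding loop_hcls_iff[OF X] s(1) by blast
  qed
  then show ?thesis by (simp add: homotopy_group_def)
qed

lemma group_homotopy_group:
  assumes X: "diffeology X" and x: "x \<in> points X"
  shows "group (homotopy_group X x (Suc k))"
proof (rule groupI)
  let ?I = "iter_loop_diff X x k" and ?G = "homotopy_group X x (Suc k)"
  let ?L = "loop_diff ?I (const_loop x k)"
  have dI: "diffeology ?I" by (rule diffeology_iter_loop[OF X])
  note c = concat_loop[OF dI]
  note m = mult_hcls[OF X]
  have carr: "carrier ?G = homotopy_set X x (Suc k)" by (simp add: homotopy_group_def)
  have one: "\<one>\<^bsub>?G\<^esub> = hcls X x (Suc k) (Loop (\<lambda>_. const_loop x k))"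
    by (simp add: homotopy_group_def homotopy_unit_def)
  have k: "(\<lambda>_. const_loop x k) \<in> points ?L" by (rule const_in_loop[OF dI const_loop_in[OF X x]])
  show "\<one>\<^bsub>?G\<^esub> \<in> carrier ?G" unfolding carr one by (rule hcls_Loop_in[OF k])
  fix a assume "a \<in> carrier ?G"
  then obtain \<alpha> where \<alpha>: "\<alpha> \<in> points ?L" "a = hcls X x (Suc k) (Loop \<alpha>)"
    unfolding carr by (rule homotopy_set_SucE)
  show "\<one>\<^bsub>?G\<^esub> \<otimes>\<^bsub>?G\<^esub> a = a"
    unfolding one \<alpha>(2) m[OF k \<alpha>(1)] by (rule hcls_Loop_eq[OF X loop_concat_unit_left[OF dI \<alpha>(1)]])
  have r: "(\<lambda>t. \<alpha> (1 - t)) \<in> points ?L" by (rule loop_reverse[OF dI \<alpha>(1)])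
  show "\<exists>y\<in>carrier ?G. y \<otimes>\<^bsub>?G\<^esub> a = \<one>\<^bsub>?G\<^esub>"
    unfolding carr
  proof (rule bexI[OF _ hcls_Loop_in[OF r]])
    show "hcls X x (Suc k) (Loop (\<lambda>t. \<alpha> (1 - t))) \<otimes>\<^bsub>?G\<^esub> a = \<one>\<^bsub>?G\<^esub>"
      unfolding one \<alpha>(2) m[OF r \<alpha>(1)] by (rule hcls_Loop_eq[OF X loop_concat_reverse[OF dI \<alpha>(1)]])
  qed
  fix b assume "b \<in> carrier ?G"
  then obtain \<beta> where \<beta>: "\<beta> \<in> points ?L" "b = hcls X x (Suc k) (Loop \<beta>)"
    unfolding carr by (rule homotopy_set_SucE)
  show "a \<otimes>\<^bsub>?G\<^esub> b \<in> carrier ?G"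
    unfolding carr \<alpha>(2) \<beta>(2) m[OF \<alpha>(1) \<beta>(1)] by (rule hcls_Loop_in[OF c[OF \<alpha>(1) \<beta>(1)]])
  fix d assume "d \<in> carrier ?G"
  then obtain \<gamma> where \<gamma>: "\<gamma> \<in> points ?L" "d = hcls X x (Suc k) (Loop \<gamma>)"
    unfolding carr by (rule homotopy_set_SucE)
  show "a \<otimes>\<^bsub>?G\<^esub> b \<otimes>\<^bsub>?G\<^esub> d = a \<otimes>\<^bsub>?G\<^esub> (b \<otimes>\<^bsub>?G\<^esub> d)"
    unfolding \<alpha>(2) \<beta>(2) \<gamma>(2) m[OF \<alpha>(1) \<beta>(1)] m[OF \<beta>(1) \<gamma>(1)] m[OF c[OF \<alpha>(1) \<beta>(1)] \<gamma>(1)] m[OF \<alpha>(1) c[OF \<beta>(1) \<gamma>(1)]]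
    by (rule hcls_Loop_eq[OF X loop_concat_assoc[OF dI \<alpha>(1) \<beta>(1) \<gamma>(1)]])
qed

lemma carrier_homotopy_group [simp]: "carrier (homotopy_group X x k) = homotopy_set X x k"
  by (simp add: homotopy_group_def)

lemma group_hom_homotopy_map:
  assumes X: "diffeology X" and Y: "diffeology Y" and f: "smooth_map X Y f" and x: "x \<in> points X"
  shows "group_hom (homotopy_group X x (Suc k)) (homotopy_group Y (f x) (Suc k)) (homotopy_map Y f x (Suc k))"
proof (intro group_hom.intro group_hom_axioms.intro group_homotopy_group X Y x smooth_map_points[OF f])
  let ?f = "homotopy_map Y f x (Suc k)"
  let ?L = "loop_diff (iter_loop_diff X x k) (const_loop x k)"
  note F = smooth_map_iter_loop[OF X Y f, of x]
  have fl: "?f (hcls X x (Suc k) (Loop \<alpha>)) = hcls Y (f x) (Suc k) (Loop (\<lambda>t. map_iter_loop f (\<alpha> t)))"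
    and fp: "(\<lambda>t. map_iter_loop f (\<alpha> t)) \<in> points (loop_diff (iter_loop_diff Y (f x) k) (const_loop (f x) k))"
    if "\<alpha> \<in> points ?L" for \<alpha>
    using homotopy_map_hcls[OF X Y f, of "Loop \<alpha>" x "Suc k"] that smooth_map_points[OF F, of "Loop \<alpha>" "Suc k"]
    by (auto simp: comp_def)
  show "?f \<in> hom (homotopy_group X x (Suc k)) (homotopy_group Y (f x) (Suc k))"
  proof (rule homI)
    show "?f c \<in> carrier (homotopy_group Y (f x) (Suc k))" if "c \<in> carrier (homotopy_group X x (Suc k))" for c
      using homotopy_map_in[OF X Y f] that by simp
    fix c d assume "c \<in> carrier (homotopy_group X x (Suc k))" "d \<in> carrier (homotopy_group X x (Suc k))"
    then obtain \<alpha> \<beta> where \<alpha>: "\<alpha> \<in> points ?L" "c = hcls X x (Suc k) (Loop \<alpha>)"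
      and \<beta>: "\<beta> \<in> points ?L" "d = hcls X x (Suc k) (Loop \<beta>)"
      unfolding carrier_homotopy_group by (meson homotopy_set_SucE)
    have ab: "concat_path \<alpha> \<beta> \<in> points ?L" by (rule concat_loop[OF diffeology_iter_loop[OF X] \<alpha>(1) \<beta>(1)])
    show "?f (c \<otimes>\<^bsub>homotopy_group X x (Suc k)\<^esub> d) = ?f c \<otimes>\<^bsub>homotopy_group Y (f x) (Suc k)\<^esub> ?f d"
      unfolding \<alpha>(2) \<beta>(2) mult_hcls[OF X \<alpha>(1) \<beta>(1)] fl[OF ab] fl[OF \<alpha>(1)] fl[OF \<beta>(1)]
        mult_hcls[OF Y fp[OF \<alpha>(1)] fp[OF \<beta>(1)]] concat_path_comp ..
  qed
qed

section \<open>The connecting map of a principal fibration\<close>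

context pfib
begin

text \<open>The pointwise quotient \<open>dv (y t) (z t)\<close> is a path in \<open>G\<close>
  starting at \<open>one\<close>. Letting it act on the fixed point \<open>y 1\<close> gives a path
  in the fibre from \<open>y 1\<close> to \<open>z 1\<close>.\<close>

lemma lift_ends_same:
  assumes y: "smooth_map real_diff E y" and z: "smooth_map real_diff E z" and e: "y 0 = e" "z 0 = e"
    and eq: "\<And>t. q (y t) = q (z t)" and q1: "q (y 1) = q e"
  shows "(dv e (y 1), dv e (z 1)) \<in> path_rel G"
proof (rule path_relI)
  have yE: "y t \<in> points E" and zE: "z t \<in> points E" for t
    using smooth_map_points[OF y] smooth_map_points[OF z] by simp_all
  have eE: "e \<in> points E" using yE[of 0] e by simp
  note c = smooth_map_const[OF diffeology_real dE]
  show "smooth_map real_diff G (\<lambda>t. dv e (act (dv (y t) (z t)) (y 1)))"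
    by (intro smooth_dv diffeology_real c smooth_act eE yE y z eq) (simp add: q_act dv_in yE zE eq q1[symmetric])
  show "dv e (act (dv (y 0) (z 0)) (y 1)) = dv e (y 1)" by (simp add: e dv_self eE act_one yE)
  show "dv e (act (dv (y 1) (z 1)) (y 1)) = dv e (z 1)" by (simp add: act_dv yE zE eq)
qed

text \<open>The homotopy is lifted with constant start \<open>e\<close>. Its end edge
  \<open>K (s, 1)\<close> runs inside the fibre, while its sides at \<open>s = 0\<close> and
  \<open>s = 1\<close> lie over the same loops as \<open>y\<close> and \<open>z\<close>, so
  \<open>lift_ends_same\<close> compares them.\<close>

lemma lift_ends:
  assumes y: "smooth_map real_diff E y" and z: "smooth_map real_diff E z" and e: "y 0 = e" "z 0 = e"
    and rel: "(\<lambda>t. q (y t), \<lambda>t. q (z t)) \<in> path_rel (loop_diff B (q e))"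
  shows "(dv e (y 1), dv e (z 1)) \<in> path_rel G"
proof -
  obtain H where H: "smooth_map (prod_diff real_diff real_diff) B (\<lambda>z. H (fst z) (snd z))"
    "H 0 = (\<lambda>t. q (y t))" "H 1 = (\<lambda>t. q (z t))" "\<And>s. H s 0 = q e" "\<And>s. H s 1 = q e"
    using rel unfolding loop_rel_iff[OF dB] by blast
  have eE: "e \<in> points E" using smooth_map_points[OF y, of 0] e by simp
  note c = smooth_map_const[OF diffeology_real dE eE]
  \<comment> \<open>Lifting proceeds in the loop direction \<open>t\<close>, with \<open>s\<close>
    as the parameter; the prescribed edge is therefore \<open>t = 0\<close>.\<close>
  have "\<forall>u\<in>points real_diff. q e = H (fst (u, 0)) (snd (u, 0))" by (simp add: H)
  with hlp_real[unfolded lifts_homotopies_def, rule_format, OF H(1) c]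
  obtain K where K: "smooth_map (prod_diff real_diff real_diff) E K" "\<And>s. K (s, 0) = e" "\<And>s t. q (K (s, t)) = H s t"
    by auto
  have sm: "smooth_map real_diff (prod_diff real_diff real_diff) (\<lambda>t. (a, t))"
      "smooth_map real_diff (prod_diff real_diff real_diff) (\<lambda>t. (t, a))" for a
    by (rule smooth_real_intros)+
  have Ks: "smooth_map real_diff E (\<lambda>t. K (s, t))" for s by (rule smooth_map_compose[OF K(1) sm(1)])
  have "(dv e (K (0, 1)), dv e (K (1, 1))) \<in> path_rel G"
    by (rule path_relI[OF smooth_dv[OF diffeology_real c smooth_map_compose[OF K(1) sm(2)]]]) (simp_all add: K H)
  moreover have "(dv e (y 1), dv e (K (0, 1))) \<in> path_rel G"
    by (rule lift_ends_same[OF y Ks]) (use H(2) H(5)[of 0] in \<open>simp_all add: e K\<close>)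
  moreover have "(dv e (K (1, 1)), dv e (z 1)) \<in> path_rel G"
    by (rule lift_ends_same[OF Ks z]) (use H(3) H(5)[of 1] in \<open>simp_all add: e K\<close>)
  ultimately show ?thesis using path_rel_trans[OF dG] by meson
qed

definition "connect e C = path_rel G `` {dv e (y 1) | y. smooth_map real_diff E y \<and> y 0 = e \<and> (\<lambda>t. q (y t)) \<in> C}"

lemma lift_loop_in:
  assumes "smooth_map real_diff E y" "y 0 = e" "q (y 1) = q e"
  shows "(\<lambda>t. q (y t)) \<in> points (loop_diff B (q e))"
  using smooth_map_compose[OF q assms(1)] assms by (simp add: points_loop)

lemma connect_class:
  assumes y: "smooth_map real_diff E y" "y 0 = e" "q (y 1) = q e"
  shows "connect e (path_rel (loop_diff B (q e)) `` {\<lambda>t. q (y t)}) = path_rel G `` {dv e (y 1)}"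
  unfolding connect_def
proof (rule path_class_of_set[OF dG])
  have "(\<lambda>t. q (y t), \<lambda>t. q (y t)) \<in> path_rel (loop_diff B (q e))"
    by (rule path_rel_refl[OF diffeology_loop[OF dB] lift_loop_in[OF y]])
  with y show "dv e (y 1) \<in> {dv e (z 1) | z. smooth_map real_diff E z \<and> z 0 = e \<and>
      (\<lambda>t. q (z t)) \<in> path_rel (loop_diff B (q e)) `` {\<lambda>t. q (y t)}}" by blast
qed (use lift_ends[OF y(1) _ y(2)] in blast)

lemma loop_lift:
  assumes \<beta>: "\<beta> \<in> points (loop_diff B (q e))" and e: "e \<in> points E"
  obtains y where "smooth_map real_diff E y" "y 0 = e" "q (y 1) = q e" "\<beta> = (\<lambda>t. q (y t))"
proof -
  have \<beta>': "smooth_map real_diff B \<beta>" "\<beta> 0 = q e" "\<beta> 1 = q e" using \<beta> by (simp_all add: points_loop)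
  from path_lifting[OF \<beta>'(1) e \<beta>'(2)[symmetric]] obtain y where
    "smooth_map real_diff E y" "y 0 = e" "\<And>t. q (y t) = \<beta> t" by metis
  then show ?thesis using \<beta>'(3) by (intro that[of y]) auto
qed

text \<open>Multiplying \<open>y\<close> by the inverse of a path from \<open>one\<close> to its end
  displacement closes it up without changing its projection. The inverse of
  \<open>\<gamma> t\<close> is expressed as \<open>dv (act (\<gamma> t) e) e\<close>.\<close>

lemma lift_closed:
  assumes y: "smooth_map real_diff E y" "y 0 = e" "q (y 1) = q e" and rel: "(one, dv e (y 1)) \<in> path_rel G"
  obtains z where "z \<in> points (loop_diff E e)" "(\<lambda>t. q (z t)) = (\<lambda>t. q (y t))"
proof -
  obtain \<gamma> where \<gamma>: "smooth_map real_diff G \<gamma>" "\<gamma> 0 = one" "\<gamma> 1 = dv e (y 1)" using rel by (rule path_relE)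
  have eE: "e \<in> points E" and yE: "y t \<in> points E" for t using smooth_map_points[OF y(1)] y(2) by auto
  have \<gamma>G: "\<gamma> t \<in> points G" for t using smooth_map_points[OF \<gamma>(1)] by simp
  note c = smooth_map_const[OF diffeology_real dE eE]
  have inG: "dv (act (\<gamma> t) e) e \<in> points G" for t by (intro dv_in act_in \<gamma>G eE q_act)
  define z where "z t = act (dv (act (\<gamma> t) e) e) (y t)" for t
  have "smooth_map real_diff E z"
    unfolding z_def by (intro smooth_act smooth_dv diffeology_real c \<gamma>(1) y(1)) (simp add: q_act \<gamma>G eE)
  moreover have "z 0 = e" by (simp add: z_def \<gamma> act_one eE dv_self y)
  moreover have "act (\<gamma> 1) e = y 1" by (simp add: \<gamma> act_dv eE yE y)
  then have "z 1 = e" by (simp add: z_def act_dv yE eE y)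
  ultimately show ?thesis
    by (intro that[of z]) (simp_all add: points_loop z_def q_act inG yE)
qed

lemma fibre_path:
  assumes x: "x \<in> points E" and e: "e \<in> points E" and rel: "(q x, q e) \<in> path_rel B"
  obtains g where "g \<in> points G" "(x, act g e) \<in> path_rel E"
proof -
  obtain \<gamma> where \<gamma>: "smooth_map real_diff B \<gamma>" "\<gamma> 0 = q x" "\<gamma> 1 = q e" using rel by (rule path_relE)
  from path_lifting[OF \<gamma>(1) x] \<gamma>(2) obtain y where y: "smooth_map real_diff E y" "y 0 = x" "\<And>t. q (y t) = \<gamma> t" by metis
  have y1: "y 1 \<in> points E" using smooth_map_points[OF y(1)] by simp
  have "act (dv e (y 1)) e = y 1" by (rule act_dv[OF e y1]) (simp add: y \<gamma>)
  then show ?thesis using path_relI[OF y(1,2) refl] dv_in[OF e y1] y \<gamma> by (intro that[of "dv e (y 1)"]) simp_all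
qed

text \<open>The lift of \<open>q y * q z\<close> is \<open>y\<close> followed by the translate of \<open>z\<close> that starts where \<open>y\<close> ends.\<close>

lemma lift_concat:
  assumes y: "smooth_map real_diff E y" "y 0 = e" "q (y 1) = q e"
    and z: "smooth_map real_diff E z" "z 0 = e" "q (z 1) = q e"
  obtains w where "smooth_map real_diff E w" "w 0 = e" "q (w 1) = q e"
    "(\<lambda>t. q (w t)) = concat_path (\<lambda>t. q (y t)) (\<lambda>t. q (z t))" "dv e (w 1) = mul (dv e (y 1)) (dv e (z 1))"
proof -
  let ?g = "dv e (y 1)"
  have yE: "y t \<in> points E" and zE: "z t \<in> points E" for t
    using smooth_map_points[OF y(1)] smooth_map_points[OF z(1)] by simp_all
  have e: "e \<in> points E" using yE[of 0] y by simp
  have g: "?g \<in> points G" by (simp add: dv_in e yE y)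
  have h: "dv e (z 1) \<in> points G" by (simp add: dv_in e zE z)
  define w where "w = concat_path y (\<lambda>t. act ?g (z t))"
  have "smooth_map real_diff E (\<lambda>t. act ?g (z t))"
    by (intro smooth_act smooth_map_const diffeology_real dG g z)
  then have "smooth_map real_diff E w"
    unfolding w_def by (intro smooth_concat dE y) (simp_all add: z act_dv e yE y)
  moreover have "w 1 = act ?g (act (dv e (z 1)) e)" by (simp add: w_def act_dv e zE z)
  then have "dv e (w 1) = mul ?g (dv e (z 1))" using mul_eq[OF g h e] by simp
  moreover have "(\<lambda>t. q (w t)) = concat_path (\<lambda>t. q (y t)) (\<lambda>t. q (z t))"
    by (auto simp: w_def concat_path_def fun_eq_iff q_act g zE)
  moreover have "q (w 1) = q e" by (simp add: w_def q_act g zE z)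
  ultimately show ?thesis using y(2) by (intro that[of w]) (simp_all add: w_def)
qed

end

text \<open>Identifies the action of an iterated loop on the constant loop with the map induced by
  the orbit map.\<close>

lemma il2_const:
  assumes "g \<in> points (iter_loop_diff X x k)"
  shows "il2 f g (const_loop y k) = map_iter_loop (\<lambda>a. f a y) g"
  using assms
proof (induction k arbitrary: g)
  case 0
  then show ?case by auto
next
  case (Suc k)
  then obtain \<alpha> where \<alpha>: "g = Loop \<alpha>" "\<alpha> \<in> points (loop_diff (iter_loop_diff X x k) (const_loop x k))" by auto
  then have "\<alpha> t \<in> points (iter_loop_diff X x k)" for t
    using smooth_map_points[of real_diff "iter_loop_diff X x k" \<alpha> t] by (simp add: points_loop)
  then show ?case using Suc.IH by (simp add: \<alpha> comp_def)
qed

text \<open>The product that the group law of \<open>G\<close> induces on homotopy classes; it makes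
  sense in degree 0 as well, where loops cannot be concatenated.\<close>

definition pointwise_mult :: "'g diff_space \<Rightarrow> 'g \<Rightarrow> ('g \<Rightarrow> 'g \<Rightarrow> 'g) \<Rightarrow> nat \<Rightarrow> 'g iter_loop set \<Rightarrow> 'g iter_loop set \<Rightarrow> 'g iter_loop set" where
  "pointwise_mult G u mul k c d = path_rel (iter_loop_diff G u k) `` {il2 mul g h | g h. g \<in> c \<and> h \<in> d}"

context pfib
begin

text \<open>The connecting map from degree \<open>k + 1\<close> of the base to degree
  \<open>k\<close> of the structure group is \<open>connect\<close> for the fibration of k-fold loop
  spaces. The classes of its base consist of bare paths, so the constructor \<open>Loop\<close> is
  stripped.\<close>

definition "connecting e k c = pfib.connect (iter_loop_diff G one k) (iter_loop_diff E e k)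
    (il2 dv) (map_iter_loop q) (const_loop e k) {\<beta>. Loop \<beta> \<in> c}"

context
  fixes e
  assumes e: "e \<in> points E"
begin

interpretation L: pfib "iter_loop_diff G one k" "il2 mul" "const_loop one k" "iter_loop_diff E e k" "iter_loop_diff B (q e) k"
    "il2 act" "il2 dv" "map_iter_loop q" for k
  using pfib_iter_loop[OF pfib_axioms e] by blast

lemma const_loop_E: "const_loop e k \<in> points (iter_loop_diff E e k)"
  by (rule const_loop_in[OF dE e])

lemma hcls_loops: "{\<beta>. Loop \<beta> \<in> hcls B (q e) (Suc k) (Loop \<alpha>)} =
    path_rel (loop_diff (iter_loop_diff B (q e) k) (const_loop (q e) k)) `` {\<alpha>}"
  by (simp only: Image_singleton_iff loop_hcls_iff[OF dB] iter_loop.inject) blast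

lemma connecting_class:
  assumes y: "smooth_map real_diff (iter_loop_diff E e k) y" "y 0 = const_loop e k" "map_iter_loop q (y 1) = const_loop (q e) k"
  shows "connecting e k (hcls B (q e) (Suc k) (Loop (\<lambda>t. map_iter_loop q (y t)))) = hcls G one k (il2 dv (const_loop e k) (y 1))"
  unfolding connecting_def hcls_loops
  using L.connect_class[OF y(1,2)] y(3) by simp

lemma connecting_lift:
  assumes "c \<in> homotopy_set B (q e) (Suc k)"
  obtains y where "smooth_map real_diff (iter_loop_diff E e k) y" "y 0 = const_loop e k" "map_iter_loop q (y 1) = const_loop (q e) k"
    "c = hcls B (q e) (Suc k) (Loop (\<lambda>t. map_iter_loop q (y t)))"
    "connecting e k c = hcls G one k (il2 dv (const_loop e k) (y 1))"
    "il2 dv (const_loop e k) (y 1) \<in> points (iter_loop_diff G one k)"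
proof -
  from assms obtain \<beta> where \<beta>: "\<beta> \<in> points (loop_diff (iter_loop_diff B (q e) k) (const_loop (q e) k))"
    "c = hcls B (q e) (Suc k) (Loop \<beta>)" by (rule homotopy_set_SucE)
  from L.loop_lift[OF _ const_loop_E, of \<beta> k] \<beta>(1) obtain y where y: "smooth_map real_diff (iter_loop_diff E e k) y"
    "y 0 = const_loop e k" "map_iter_loop q (y 1) = const_loop (q e) k" "\<beta> = (\<lambda>t. map_iter_loop q (y t))"
    by auto
  have "il2 dv (const_loop e k) (y 1) \<in> points (iter_loop_diff G one k)"
    by (rule L.dv_in[OF const_loop_E]) (use smooth_map_points[OF y(1)] y(3) in auto)
  then show ?thesis using y \<beta>(2) connecting_class[OF y(1-3)] by (intro that[of y]) auto
qed

lemma connecting_in: "c \<in> homotopy_set B (q e) (Suc k) \<Longrightarrow> connecting e k c \<in> homotopy_set G one k"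
  using connecting_lift hcls_in by metis

text \<open>Exactness at \<pi>_(k+1)(B): by \<open>lift_closed\<close> a loop with trivial
  displacement has a closed lift, and a closed lift has displacement \<open>one\<close>.\<close>

lemma connecting_unit_iff:
  assumes c: "c \<in> homotopy_set B (q e) (Suc k)"
  shows "connecting e k c = homotopy_unit G one k \<longleftrightarrow> c \<in> homotopy_map B q e (Suc k) ` homotopy_set E e (Suc k)"
proof
  assume u: "connecting e k c = homotopy_unit G one k"
  from connecting_lift[OF c] obtain y where y: "smooth_map real_diff (iter_loop_diff E e k) y" "y 0 = const_loop e k"
    "map_iter_loop q (y 1) = const_loop (q e) k" "c = hcls B (q e) (Suc k) (Loop (\<lambda>t. map_iter_loop q (y t)))"
    "connecting e k c = hcls G one k (il2 dv (const_loop e k) (y 1))"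
    "il2 dv (const_loop e k) (y 1) \<in> points (iter_loop_diff G one k)" .
  have "(const_loop one k, il2 dv (const_loop e k) (y 1)) \<in> path_rel (iter_loop_diff G one k)"
    using u y(5,6) path_class_eq_iff[OF L.dG L.one_in y(6)] by (simp add: homotopy_unit_eq)
  with L.lift_closed[OF y(1,2)] y(3) obtain z where z: "z \<in> points (loop_diff (iter_loop_diff E e k) (const_loop e k))"
    "(\<lambda>t. map_iter_loop q (z t)) = (\<lambda>t. map_iter_loop q (y t))" by auto
  then have "c = homotopy_map B q e (Suc k) (hcls E e (Suc k) (Loop z))"
    using homotopy_map_hcls[OF dE dB q, of "Loop z" e "Suc k"] y(4) by (simp add: comp_def)
  then show "c \<in> homotopy_map B q e (Suc k) ` homotopy_set E e (Suc k)" using hcls_Loop_in[OF z(1)] by blast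
next
  assume "c \<in> homotopy_map B q e (Suc k) ` homotopy_set E e (Suc k)"
  then obtain z where z: "z \<in> points (loop_diff (iter_loop_diff E e k) (const_loop e k))"
    "c = homotopy_map B q e (Suc k) (hcls E e (Suc k) (Loop z))" by (auto elim!: homotopy_set_SucE)
  then have "c = hcls B (q e) (Suc k) (Loop (\<lambda>t. map_iter_loop q (z t)))"
    using homotopy_map_hcls[OF dE dB q, of "Loop z" e "Suc k"] by (simp add: comp_def)
  moreover have "smooth_map real_diff (iter_loop_diff E e k) z" "z 0 = const_loop e k" "z 1 = const_loop e k"
    using z(1) by (simp_all add: points_loop)
  ultimately show "connecting e k c = homotopy_unit G one k"
    using connecting_class[of k z] L.dv_self[OF const_loop_E, of k] by (simp add: homotopy_unit_eq)
qed

lemma smooth_orbit: "smooth_map G E (\<lambda>g. act g e)"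
  by (intro smooth_act smooth_map_id smooth_map_const dG dE e)

lemma orbit_hcls:
  assumes "g \<in> points (iter_loop_diff G one k)"
  shows "homotopy_map E (\<lambda>g. act g e) one k (hcls G one k g) = hcls E e k (il2 act g (const_loop e k))"
  using homotopy_map_hcls[OF dG dE smooth_orbit assms] by (simp add: il2_const[OF assms] act_one e)

text \<open>Exactness at \<pi>_k(G): a path in \<open>E\<close> from the base point to its translate
  by \<open>g\<close> shows that \<open>g\<close> dies in \<open>E\<close>, and it is also the lift
  of a loop whose displacement is \<open>g\<close>.\<close>

lemma connecting_image:
  "connecting e k ` homotopy_set B (q e) (Suc k) =
    {d \<in> homotopy_set G one k. homotopy_map E (\<lambda>g. act g e) one k d = homotopy_unit E e k}"
proof (intro equalityI subsetI)
  fix d assume "d \<in> connecting e k ` homotopy_set B (q e) (Suc k)"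
  then obtain c where c: "c \<in> homotopy_set B (q e) (Suc k)" "d = connecting e k c" by blast
  from connecting_lift[OF c(1)] obtain y where y: "smooth_map real_diff (iter_loop_diff E e k) y" "y 0 = const_loop e k"
    "map_iter_loop q (y 1) = const_loop (q e) k" "c = hcls B (q e) (Suc k) (Loop (\<lambda>t. map_iter_loop q (y t)))"
    "connecting e k c = hcls G one k (il2 dv (const_loop e k) (y 1))"
    "il2 dv (const_loop e k) (y 1) \<in> points (iter_loop_diff G one k)" .
  have "il2 act (il2 dv (const_loop e k) (y 1)) (const_loop e k) = y 1"
    by (rule L.act_dv[OF const_loop_E]) (use smooth_map_points[OF y(1)] y(3) in auto)
  moreover have "hcls E e k (const_loop e k) = hcls E e k (y 1)"
    by (rule path_class_eq[OF L.dE path_relI[OF y(1,2)]]) simp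
  ultimately have "homotopy_map E (\<lambda>g. act g e) one k d = homotopy_unit E e k"
    using orbit_hcls[OF y(6)] c(2) y(5) by (simp add: homotopy_unit_eq)
  then show "d \<in> {d \<in> homotopy_set G one k. homotopy_map E (\<lambda>g. act g e) one k d = homotopy_unit E e k}"
    using connecting_in c by simp
next
  fix d assume "d \<in> {d \<in> homotopy_set G one k. homotopy_map E (\<lambda>g. act g e) one k d = homotopy_unit E e k}"
  then have d: "d \<in> homotopy_set G one k" "homotopy_map E (\<lambda>g. act g e) one k d = homotopy_unit E e k" by auto
  from d(1) obtain g where g: "g \<in> points (iter_loop_diff G one k)" "d = hcls G one k g" by (rule homotopy_setE)
  let ?x = "il2 act g (const_loop e k)"
  have x: "?x \<in> points (iter_loop_diff E e k)" by (rule L.act_in[OF g(1) const_loop_E])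
  have "hcls E e k (const_loop e k) = hcls E e k ?x" using d(2) orbit_hcls[OF g(1)] g(2) by (simp add: homotopy_unit_eq)
  then have "(const_loop e k, ?x) \<in> path_rel (iter_loop_diff E e k)"
    using path_class_eq_iff[OF L.dE const_loop_E x] by blast
  then obtain y where y: "smooth_map real_diff (iter_loop_diff E e k) y" "y 0 = const_loop e k" "y 1 = ?x" by (rule path_relE)
  have q1: "map_iter_loop q (y 1) = const_loop (q e) k" using L.q_act[OF g(1) const_loop_E] y(3) by simp
  have "il2 dv (const_loop e k) (y 1) = g" using L.dv_act[OF g(1) const_loop_E] y(3) by simp
  then have "d = connecting e k (hcls B (q e) (Suc k) (Loop (\<lambda>t. map_iter_loop q (y t))))"
    using connecting_class[OF y(1,2) q1] g(2) by simp
  moreover have "hcls B (q e) (Suc k) (Loop (\<lambda>t. map_iter_loop q (y t))) \<in> homotopy_set B (q e) (Suc k)"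
    using L.lift_loop_in[OF y(1,2)] q1 by (intro hcls_Loop_in) simp
  ultimately show "d \<in> connecting e k ` homotopy_set B (q e) (Suc k)" by blast
qed

text \<open>Exactness at \<pi>_k(E): if the projection of a point can be joined to the base point,
  lifting that path moves the point into the orbit of the base point.\<close>

lemma orbit_image:
  "homotopy_map E (\<lambda>g. act g e) one k ` homotopy_set G one k =
    {c \<in> homotopy_set E e k. homotopy_map B q e k c = homotopy_unit B (q e) k}"
proof (intro equalityI subsetI)
  fix c assume "c \<in> homotopy_map E (\<lambda>g. act g e) one k ` homotopy_set G one k"
  then obtain g where g: "g \<in> points (iter_loop_diff G one k)"
    "c = homotopy_map E (\<lambda>g. act g e) one k (hcls G one k g)" by (auto elim!: homotopy_setE)
  let ?x = "il2 act g (const_loop e k)"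
  have x: "?x \<in> points (iter_loop_diff E e k)" by (rule L.act_in[OF g(1) const_loop_E])
  have "homotopy_map B q e k c = homotopy_unit B (q e) k"
    using homotopy_map_hcls[OF dE dB q x] L.q_act[OF g(1) const_loop_E] orbit_hcls[OF g(1)] g(2)
    by (simp add: homotopy_unit_eq)
  then show "c \<in> {c \<in> homotopy_set E e k. homotopy_map B q e k c = homotopy_unit B (q e) k}"
    using hcls_in[OF x] orbit_hcls[OF g(1)] g(2) by simp
next
  fix c assume "c \<in> {c \<in> homotopy_set E e k. homotopy_map B q e k c = homotopy_unit B (q e) k}"
  then have c: "c \<in> homotopy_set E e k" "homotopy_map B q e k c = homotopy_unit B (q e) k" by auto
  from c(1) obtain x where x: "x \<in> points (iter_loop_diff E e k)" "c = hcls E e k x" by (rule homotopy_setE)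
  have qx: "map_iter_loop q x \<in> points (iter_loop_diff B (q e) k)" by (rule smooth_map_points[OF L.q x(1)])
  have "hcls B (q e) k (map_iter_loop q x) = hcls B (q e) k (const_loop (q e) k)"
    using c(2) homotopy_map_hcls[OF dE dB q x(1)] x(2) by (simp add: homotopy_unit_eq)
  then have "(map_iter_loop q x, map_iter_loop q (const_loop e k)) \<in> path_rel (iter_loop_diff B (q e) k)"
    using path_class_eq_iff[OF L.dB qx, of "const_loop (q e) k"] smooth_map_points[OF L.q const_loop_E, of k] by simp
  from L.fibre_path[OF x(1) const_loop_E this] obtain g where g: "g \<in> points (iter_loop_diff G one k)"
    "(x, il2 act g (const_loop e k)) \<in> path_rel (iter_loop_diff E e k)" .
  then have "c = homotopy_map E (\<lambda>g. act g e) one k (hcls G one k g)"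
    using path_class_eq[OF L.dE g(2)] orbit_hcls[OF g(1)] x(2) by simp
  then show "c \<in> homotopy_map E (\<lambda>g. act g e) one k ` homotopy_set G one k" using hcls_in[OF g(1)] by blast
qed

lemma il2_mul_rel:
  assumes "(g, g') \<in> path_rel (iter_loop_diff G one k)" "(h, h') \<in> path_rel (iter_loop_diff G one k)"
  shows "(il2 mul g h, il2 mul g' h') \<in> path_rel (iter_loop_diff G one k)"
proof -
  obtain \<gamma> where \<gamma>: "smooth_map real_diff (iter_loop_diff G one k) \<gamma>" "\<gamma> 0 = g" "\<gamma> 1 = g'" using assms(1) by (rule path_relE)
  obtain \<eta> where \<eta>: "smooth_map real_diff (iter_loop_diff G one k) \<eta>" "\<eta> 0 = h" "\<eta> 1 = h'" using assms(2) by (rule path_relE)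
  from L.smooth_mul[OF const_loop_E diffeology_real \<gamma>(1) \<eta>(1)] show ?thesis by (rule path_relI) (simp_all add: \<gamma> \<eta>)
qed

lemma pointwise_mult_hcls:
  assumes g: "g \<in> points (iter_loop_diff G one k)" and h: "h \<in> points (iter_loop_diff G one k)"
  shows "pointwise_mult G one mul k (hcls G one k g) (hcls G one k h) = hcls G one k (il2 mul g h)"
  unfolding pointwise_mult_def
proof (rule path_class_of_set[OF L.dG])
  show "il2 mul g h \<in> {il2 mul g' h' | g' h'. g' \<in> hcls G one k g \<and> h' \<in> hcls G one k h}"
    using path_rel_refl[OF L.dG g] path_rel_refl[OF L.dG h] by blast
qed (use il2_mul_rel in blast)

text \<open>\<open>lift_concat\<close> applied to k-fold loop spaces. Displacements multiply in the
  structure group, so the product on the right is pointwise, and the statement includes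
  \<open>k = 0\<close>.\<close>

lemma connecting_mult:
  assumes c: "c \<in> homotopy_set B (q e) (Suc k)" and d: "d \<in> homotopy_set B (q e) (Suc k)"
  shows "connecting e k (c \<otimes>\<^bsub>homotopy_group B (q e) (Suc k)\<^esub> d) = pointwise_mult G one mul k (connecting e k c) (connecting e k d)"
proof -
  from connecting_lift[OF c] obtain y where y: "smooth_map real_diff (iter_loop_diff E e k) y" "y 0 = const_loop e k"
    "map_iter_loop q (y 1) = const_loop (q e) k" "c = hcls B (q e) (Suc k) (Loop (\<lambda>t. map_iter_loop q (y t)))"
    "connecting e k c = hcls G one k (il2 dv (const_loop e k) (y 1))"
    "il2 dv (const_loop e k) (y 1) \<in> points (iter_loop_diff G one k)" .
  from connecting_lift[OF d] obtain z where z: "smooth_map real_diff (iter_loop_diff E e k) z" "z 0 = const_loop e k"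
    "map_iter_loop q (z 1) = const_loop (q e) k" "d = hcls B (q e) (Suc k) (Loop (\<lambda>t. map_iter_loop q (z t)))"
    "connecting e k d = hcls G one k (il2 dv (const_loop e k) (z 1))"
    "il2 dv (const_loop e k) (z 1) \<in> points (iter_loop_diff G one k)" .
  have qy: "map_iter_loop q (y 1) = map_iter_loop q (const_loop e k)" and qz: "map_iter_loop q (z 1) = map_iter_loop q (const_loop e k)"
    using y(3) z(3) by simp_all
  from L.lift_concat[OF y(1,2) qy z(1,2) qz] obtain w where w: "smooth_map real_diff (iter_loop_diff E e k) w" "w 0 = const_loop e k"
    "map_iter_loop q (w 1) = const_loop (q e) k"
    "(\<lambda>t. map_iter_loop q (w t)) = concat_path (\<lambda>t. map_iter_loop q (y t)) (\<lambda>t. map_iter_loop q (z t))"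
    "il2 dv (const_loop e k) (w 1) = il2 mul (il2 dv (const_loop e k) (y 1)) (il2 dv (const_loop e k) (z 1))" by auto
  have "c \<otimes>\<^bsub>homotopy_group B (q e) (Suc k)\<^esub> d = hcls B (q e) (Suc k) (Loop (\<lambda>t. map_iter_loop q (w t)))"
    unfolding y(4) z(4) w(4)
    by (rule mult_hcls[OF dB]) (use L.lift_loop_in[OF y(1,2) qy] L.lift_loop_in[OF z(1,2) qz] in simp_all)
  then show ?thesis
    using connecting_class[OF w(1-3)] pointwise_mult_hcls[OF y(6) z(6)] y(5) z(5) w(5) by simp
qed

text \<open>Eckmann-Hilton: \<open>\<alpha> * \<beta>\<close> is the pointwise product of \<open>\<alpha> * 1\<close> and \<open>1 * \<beta>\<close>.\<close>

lemma pointwise_mult_eq: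
  assumes c: "c \<in> homotopy_set G one (Suc k)" and d: "d \<in> homotopy_set G one (Suc k)"
  shows "pointwise_mult G one mul (Suc k) c d = c \<otimes>\<^bsub>homotopy_group G one (Suc k)\<^esub> d"
proof -
  let ?I = "iter_loop_diff G one k" and ?u = "const_loop one k"
  obtain \<alpha> where \<alpha>: "\<alpha> \<in> points (loop_diff ?I ?u)" "c = hcls G one (Suc k) (Loop \<alpha>)" using c by (rule homotopy_set_SucE)
  obtain \<beta> where \<beta>: "\<beta> \<in> points (loop_diff ?I ?u)" "d = hcls G one (Suc k) (Loop \<beta>)" using d by (rule homotopy_set_SucE)
  have ev: "\<alpha> t \<in> points ?I" "\<beta> t \<in> points ?I" for t
    using smooth_map_points[of real_diff ?I \<alpha> t] smooth_map_points[of real_diff ?I \<beta> t] \<alpha>(1) \<beta>(1)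
    by (simp_all add: points_loop)
  have "(Loop (concat_path \<alpha> (\<lambda>_. ?u)), Loop \<alpha>) \<in> path_rel (iter_loop_diff G one (Suc k))"
    "(Loop (concat_path (\<lambda>_. ?u) \<beta>), Loop \<beta>) \<in> path_rel (iter_loop_diff G one (Suc k))"
    unfolding loop_hcls_iff[OF dG]
    using loop_concat_unit_right[OF L.dG \<alpha>(1)] loop_concat_unit_left[OF L.dG \<beta>(1)] by blast+
  from il2_mul_rel[OF this]
  have "(Loop (\<lambda>t. il2 mul (concat_path \<alpha> (\<lambda>_. ?u) t) (concat_path (\<lambda>_. ?u) \<beta> t)), il2 mul (Loop \<alpha>) (Loop \<beta>))
      \<in> path_rel (iter_loop_diff G one (Suc k))" by simp
  moreover have "(\<lambda>t. il2 mul (concat_path \<alpha> (\<lambda>_. ?u) t) (concat_path (\<lambda>_. ?u) \<beta> t)) = concat_path \<alpha> \<beta>"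
    by (simp add: concat_path_def fun_eq_iff L.mul_one[OF const_loop_E] L.one_mul[OF const_loop_E] ev)
  ultimately have "(Loop (concat_path \<alpha> \<beta>), il2 mul (Loop \<alpha>) (Loop \<beta>)) \<in> path_rel (iter_loop_diff G one (Suc k))" by simp
  from path_class_eq[OF L.dG this] show ?thesis
    unfolding \<alpha>(2) \<beta>(2) mult_hcls[OF dG \<alpha>(1) \<beta>(1)]
    by (subst pointwise_mult_hcls) (use \<alpha>(1) \<beta>(1) in auto)
qed

end

end

lemma set_iter_loop_points:
  "u \<in> points (iter_loop_diff X x k) \<Longrightarrow> set_iter_loop u \<subseteq> points X"
proof (induction k arbitrary: u)
  case 0
  then show ?case by auto
next
  case (Suc k)
  then obtain \<alpha> where \<alpha>: "u = Loop \<alpha>" "\<alpha> \<in> points (loop_diff (iter_loop_diff X x k) (const_loop x k))" by auto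
  have "set_iter_loop (\<alpha> t) \<subseteq> points X" for t
    using \<alpha>(2) smooth_map_points[of real_diff "iter_loop_diff X x k" \<alpha> t] by (intro Suc.IH) (simp add: points_loop)
  then show ?case by (auto simp: \<alpha>(1))
qed

lemma map_iter_loop_cong_points:
  assumes "u \<in> points (iter_loop_diff X x k)" "\<And>a. a \<in> points X \<Longrightarrow> f a = g a"
  shows "map_iter_loop f u = map_iter_loop g u"
  by (rule iter_loop.map_cong0) (use set_iter_loop_points[OF assms(1)] assms(2) in blast)

text \<open>Compatibility is demanded only on pairs in the same fibre, because it is applied to
  division, which has meaning only there.\<close>

lemma il2_natural:
  assumes F: "\<And>a b. a \<in> points X \<Longrightarrow> b \<in> points X \<Longrightarrow> q a = q b \<Longrightarrow> F (\<Phi> a) (\<Phi> b) = \<phi> (f a b)"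
    and "u \<in> points (iter_loop_diff X x k)" "v \<in> points (iter_loop_diff X x k)" "map_iter_loop q u = map_iter_loop q v"
  shows "il2 F (map_iter_loop \<Phi> u) (map_iter_loop \<Phi> v) = map_iter_loop \<phi> (il2 f u v)"
  using assms(2-4)
proof (induction k arbitrary: u v)
  case 0
  then show ?case by (auto simp: F)
next
  case (Suc k)
  then obtain \<alpha> \<beta> where \<alpha>: "u = Loop \<alpha>" "\<alpha> \<in> points (loop_diff (iter_loop_diff X x k) (const_loop x k))"
    and \<beta>: "v = Loop \<beta>" "\<beta> \<in> points (loop_diff (iter_loop_diff X x k) (const_loop x k))" by auto
  have "il2 F (map_iter_loop \<Phi> (\<alpha> t)) (map_iter_loop \<Phi> (\<beta> t)) = map_iter_loop \<phi> (il2 f (\<alpha> t) (\<beta> t))" for t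
  proof (rule Suc.IH)
    show "\<alpha> t \<in> points (iter_loop_diff X x k)" "\<beta> t \<in> points (iter_loop_diff X x k)"
      using \<alpha>(2) \<beta>(2) smooth_map_points[of real_diff "iter_loop_diff X x k" \<alpha> t]
        smooth_map_points[of real_diff "iter_loop_diff X x k" \<beta> t] by (simp_all add: points_loop)
    show "map_iter_loop q (\<alpha> t) = map_iter_loop q (\<beta> t)"
      using Suc.prems(3) by (simp add: \<alpha>(1) \<beta>(1) comp_def fun_eq_iff)
  qed
  then show ?case by (simp add: \<alpha>(1) \<beta>(1) comp_def)
qed

text \<open>\<open>\<Phi>\<close> carries lifts to lifts. By equivariance the displacement of the
  image path is \<open>\<phi>\<close> of the old one; compatibility with division is deduced from
  that of the action by means of \<open>dv_act\<close>.\<close>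

lemma connecting_natural:
  fixes one :: 'g and one2 :: 'h
  assumes P1: "pfib G mul one E B act dv q" and P2: "pfib G2 mul2 one2 E2 B2 act2 dv2 q2"
    and \<phi>: "smooth_map G G2 \<phi>" and \<Phi>: "smooth_map E E2 \<Phi>" and f: "smooth_map B B2 f"
    and act: "\<And>g x. g \<in> points G \<Longrightarrow> x \<in> points E \<Longrightarrow> \<Phi> (act g x) = act2 (\<phi> g) (\<Phi> x)"
    and q: "\<And>x. x \<in> points E \<Longrightarrow> q2 (\<Phi> x) = f (q x)"
    and e: "e \<in> points E" and c: "c \<in> homotopy_set B (q e) (Suc k)" and one: "\<phi> one = one2"
  shows "pfib.connecting G2 one2 E2 dv2 q2 (\<Phi> e) k (homotopy_map B2 f (q e) (Suc k) c) =
    homotopy_map G2 \<phi> one k (pfib.connecting G one E dv q e k c)"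
proof -
  interpret A: pfib G mul one E B act dv q by fact
  interpret A2: pfib G2 mul2 one2 E2 B2 act2 dv2 q2 by fact
  note \<Phi>e = smooth_map_points[OF \<Phi> e]
  note \<Phi>k = smooth_map_iter_loop[OF A.dE A2.dE \<Phi>, of e k]
  from A.connecting_lift[OF e c] obtain y where y: "smooth_map real_diff (iter_loop_diff E e k) y" "y 0 = const_loop e k"
    "map_iter_loop q (y 1) = const_loop (q e) k" "c = hcls B (q e) (Suc k) (Loop (\<lambda>t. map_iter_loop q (y t)))"
    "A.connecting e k c = hcls G one k (il2 dv (const_loop e k) (y 1))"
    "il2 dv (const_loop e k) (y 1) \<in> points (iter_loop_diff G one k)" .
  have yE: "y t \<in> points (iter_loop_diff E e k)" for t using smooth_map_points[OF y(1)] by simp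
  have qy: "map_iter_loop q2 (map_iter_loop \<Phi> (y t)) = map_iter_loop f (map_iter_loop q (y t))" for t
    unfolding iter_loop.map_comp by (rule map_iter_loop_cong_points[OF yE]) (simp add: q)
  have y1: "map_iter_loop q2 (map_iter_loop \<Phi> (y 1)) = const_loop (q2 (\<Phi> e)) k"
    unfolding qy y(3) by (simp add: q e)
  have L: "(\<lambda>t. map_iter_loop q (y t)) \<in> points (loop_diff (iter_loop_diff B (q e) k) (const_loop (q e) k))"
    using smooth_map_compose[OF smooth_map_iter_loop[OF A.dE A.dB A.q] y(1)] y(2,3) by (simp add: points_loop)
  have "homotopy_map B2 f (q e) (Suc k) c = hcls B2 (q2 (\<Phi> e)) (Suc k) (Loop (\<lambda>t. map_iter_loop q2 (map_iter_loop \<Phi> (y t))))"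
    using homotopy_map_hcls[OF A.dB A2.dB f, of "Loop (\<lambda>t. map_iter_loop q (y t))" "q e" "Suc k"] L
    by (simp add: y(4) comp_def qy q e)
  moreover have "A2.connecting (\<Phi> e) k (hcls B2 (q2 (\<Phi> e)) (Suc k) (Loop (\<lambda>t. map_iter_loop q2 (map_iter_loop \<Phi> (y t))))) =
      hcls G2 one2 k (il2 dv2 (const_loop (\<Phi> e) k) (map_iter_loop \<Phi> (y 1)))"
    by (rule A2.connecting_class[OF \<Phi>e smooth_map_compose[OF \<Phi>k y(1)] _ y1]) (simp add: y(2))
  moreover have "il2 dv2 (map_iter_loop \<Phi> (const_loop e k)) (map_iter_loop \<Phi> (y 1)) = map_iter_loop \<phi> (il2 dv (const_loop e k) (y 1))"
  proof (rule il2_natural[OF _ const_loop_in[OF A.dE e] yE])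
    fix a b assume ab: "a \<in> points E" "b \<in> points E" "q a = q b"
    have "dv2 (\<Phi> a) (act2 (\<phi> (dv a b)) (\<Phi> a)) = \<phi> (dv a b)"
      by (intro A2.dv_act smooth_map_points[OF \<phi>] smooth_map_points[OF \<Phi>] A.dv_in ab)
    then show "dv2 (\<Phi> a) (\<Phi> b) = \<phi> (dv a b)" by (simp add: act[symmetric] A.dv_in ab A.act_dv)
  qed (simp add: y(3))
  ultimately show ?thesis
    using homotopy_map_hcls[OF A.dG A2.dG \<phi> y(6)] y(5) one by simp
qed

section \<open>Contractible spaces\<close>

definition smoothly_homotopic :: "'a diff_space \<Rightarrow> 'b diff_space \<Rightarrow> ('a \<Rightarrow> 'b) \<Rightarrow> ('a \<Rightarrow> 'b) \<Rightarrow> bool" where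
  "smoothly_homotopic A X f g \<longleftrightarrow> (\<exists>H. smooth_map (prod_diff A real_diff) X (\<lambda>z. H (fst z) (snd z)) \<and>
     (\<forall>a\<in>points A. H a 0 = f a \<and> H a 1 = g a))"

definition contractible_diff :: "'a diff_space \<Rightarrow> bool" where
  "contractible_diff X \<longleftrightarrow> (\<exists>c. smoothly_homotopic X X (\<lambda>x. x) (\<lambda>_. c))"

lemma smoothly_homotopicI:
  assumes "smooth_map (prod_diff A real_diff) X (\<lambda>z. H (fst z) (snd z))"
    "\<And>a. a \<in> points A \<Longrightarrow> H a 0 = f a" "\<And>a. a \<in> points A \<Longrightarrow> H a 1 = g a"
  shows "smoothly_homotopic A X f g"
  unfolding smoothly_homotopic_def using assms by blast

lemma smoothly_homotopic_trans:
  assumes A: "diffeology A" and X: "diffeology X"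
    and "smoothly_homotopic A X f g" "smoothly_homotopic A X g h"
  shows "smoothly_homotopic A X f h"
proof -
  obtain H where H: "smooth_map (prod_diff A real_diff) X (\<lambda>z. H (fst z) (snd z))"
      "\<And>a. a \<in> points A \<Longrightarrow> H a 0 = f a \<and> H a 1 = g a"
    using assms(3) unfolding smoothly_homotopic_def by blast
  obtain K where K: "smooth_map (prod_diff A real_diff) X (\<lambda>z. K (fst z) (snd z))"
      "\<And>a. a \<in> points A \<Longrightarrow> K a 0 = g a \<and> K a 1 = h a"
    using assms(4) unfolding smoothly_homotopic_def by blast
  have "smooth_map (prod_diff A real_diff) X (\<lambda>z. concat_path (H (fst z)) (K (fst z)) (snd z))"
    by (rule smooth_concat_param[OF A X H(1) K(1)]) (simp add: H(2) K(2))
  then show ?thesis by (rule smoothly_homotopicI) (simp_all add: H(2) K(2))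
qed

text \<open>
  A contraction \<open>K\<close> of \<open>X\<close> moves the base point \<open>x\<close> along the path \<open>K x\<close>. Since \<open>bump\<close> vanishes at \<open>0\<close>
  and \<open>1\<close>, the homotopy \<open>s \<mapsto> K (\<alpha> (smashing_fun t)) (s * bump t)\<close> keeps end points fixed, and it ends at the
  loop \<open>t \<mapsto> K x (bump t)\<close>, which does not depend on \<open>\<alpha>\<close>.
\<close>

lemma contractible_loop:
  assumes X: "diffeology X" and c: "contractible_diff X" and x: "x \<in> points X"
  shows "contractible_diff (loop_diff X x)"
proof -
  obtain K c where K: "smooth_map (prod_diff X real_diff) X (\<lambda>z. K (fst z) (snd z))"
      "\<And>a. a \<in> points X \<Longrightarrow> K a 0 = a" "\<And>a. a \<in> points X \<Longrightarrow> K a 1 = c"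
    using c unfolding contractible_diff_def smoothly_homotopic_def by blast
  let ?L = "loop_diff X x"
  let ?LR = "prod_diff (prod_diff ?L real_diff) real_diff"
  note L = diffeology_loop[OF X, of x]
  have dLR: "diffeology (prod_diff ?L real_diff)" "diffeology ?LR" by (intro diffeology_prod L diffeology_real)+
  note s = dLR(2) smooth_real_intros
  define bump where "bump t = smashing_fun (4 * t) * smashing_fun (4 - 4 * t)" for t
  have bump0: "bump 0 = 0" "bump 1 = 0" by (simp_all add: bump_def)
  \<comment> \<open>Either the reparametrised loop rests at \<open>x\<close>, or \<open>t\<close>
    lies between 1/4 and 3/4, where \<open>bump t = 1\<close> and the contraction has reached
    \<open>c\<close>.\<close>
  have mid: "K (\<alpha> (smashing_fun t)) (bump t) = K x (bump t)" if "\<alpha> \<in> points ?L" for \<alpha> t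
  proof -
    have \<alpha>: "smooth_map real_diff X \<alpha>" "\<alpha> 0 = x" "\<alpha> 1 = x" using that by (simp_all add: points_loop)
    consider "t \<le> 1/4" | "1/4 \<le> t" "t \<le> 3/4" | "t \<ge> 3/4" by linarith
    then show ?thesis
    proof cases
      case 2
      then have "bump t = 1" by (simp add: bump_def)
      then show ?thesis using K(3) smooth_map_points[OF \<alpha>(1)] x by simp
    qed (simp_all add: \<alpha>)
  qed
  have s1: "smooth_map ?LR ?L (\<lambda>z. fst (fst z))" and s2: "smooth_map ?LR real_diff (\<lambda>z. snd (fst z))"
    and s3: "smooth_map ?LR real_diff (\<lambda>z. snd z)" by (rule s)+
  have "smoothly_homotopic ?L ?L (\<lambda>\<alpha>. \<alpha>) (\<lambda>\<alpha> t. \<alpha> (smashing_fun t))"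
  proof (rule smoothly_homotopicI[where H = "\<lambda>\<alpha> s t. \<alpha> ((1 - s) * t + s * smashing_fun t)"])
    show "smooth_map (prod_diff ?L real_diff) ?L (\<lambda>z t. fst z ((1 - snd z) * t + snd z * smashing_fun t))"
    proof (rule smooth_map_loopI[OF dLR(1) smooth_eval[OF dLR(2) X s1]])
      show "smooth_map ?LR real_diff (\<lambda>z. (1 - snd (fst z)) * snd z + snd (fst z) * smashing_fun (snd z))" by (rule s)+
    qed (auto simp: points_loop)
  qed simp_all
  moreover have "smoothly_homotopic ?L ?L (\<lambda>\<alpha> t. \<alpha> (smashing_fun t)) (\<lambda>\<alpha> t. K x (bump t))"
  proof (rule smoothly_homotopicI[where H = "\<lambda>\<alpha> s t. K (\<alpha> (smashing_fun t)) (s * bump t)"])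
    have "smooth_map ?LR (prod_diff X real_diff) (\<lambda>z. (fst (fst z) (smashing_fun (snd z)), snd (fst z) * bump (snd z)))"
      unfolding bump_def
      by (rule smooth_map_pair[OF smooth_eval[OF dLR(2) X s1 smooth_map_smashing[OF s3]]]) (rule s)+
    from smooth_map_compose[OF K(1) this]
    show "smooth_map (prod_diff ?L real_diff) ?L (\<lambda>z t. K (fst z (smashing_fun t)) (snd z * bump t))"
      by (intro smooth_map_loopI[OF dLR(1)]) (auto simp: points_loop bump0 K(2) x)
    fix \<alpha> assume "\<alpha> \<in> points ?L"
    then show "(\<lambda>t. K (\<alpha> (smashing_fun t)) (0 * bump t)) = (\<lambda>t. \<alpha> (smashing_fun t))"
      using smooth_map_points[of real_diff X \<alpha>] by (simp add: points_loop K(2))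
  qed (simp add: mid)
  \<comment> \<open>The remaining loop runs along the path \<open>K x\<close> and back, so it is
    shrunk by scaling the parameter to 0.\<close>
  moreover have "smoothly_homotopic ?L ?L (\<lambda>\<alpha> t. K x (bump t)) (\<lambda>_ _. x)"
  proof (rule smoothly_homotopicI[where H = "\<lambda>\<alpha> s t. K x ((1 - s) * bump t)"])
    have "smooth_map ?LR (prod_diff X real_diff) (\<lambda>z. (x, (1 - snd (fst z)) * bump (snd z)))"
      unfolding bump_def by (rule smooth_map_pair[OF smooth_map_const[OF dLR(2) X x]]) (rule s)+
    from smooth_map_compose[OF K(1) this]
    show "smooth_map (prod_diff ?L real_diff) ?L (\<lambda>z t. K x ((1 - snd z) * bump t))"
      by (intro smooth_map_loopI[OF dLR(1)]) (auto simp: bump0 K(2) x)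
  qed (simp_all add: K(2) x)
  ultimately show ?thesis
    unfolding contractible_diff_def using smoothly_homotopic_trans[OF L L] by meson
qed

lemma contractible_image:
  assumes X: "diffeology X" and j: "inj_on j (points X)" and c: "contractible_diff X"
  shows "contractible_diff (image_diff X j)"
proof -
  obtain K c where K: "smooth_map (prod_diff X real_diff) X (\<lambda>z. K (fst z) (snd z))"
      "\<And>a. a \<in> points X \<Longrightarrow> K a 0 = a" "\<And>a. a \<in> points X \<Longrightarrow> K a 1 = c"
    using c unfolding contractible_diff_def smoothly_homotopic_def by blast
  let ?k = "inv_into (points X) j"
  have "smooth_map (prod_diff (image_diff X j) real_diff) (prod_diff X real_diff) (\<lambda>z. (?k (fst z), snd z))"
    by (rule smooth_map_prod[OF smooth_map_inv_image[OF X j] smooth_map_id])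
  from smooth_map_into_image[OF X smooth_map_compose[OF K(1) this], of j]
  have "smoothly_homotopic (image_diff X j) (image_diff X j) (\<lambda>x. x) (\<lambda>_. j c)"
    by (intro smoothly_homotopicI[where H = "\<lambda>a s. j (K (?k a) s)"]) (auto simp: j K)
  then show ?thesis unfolding contractible_diff_def by blast
qed

lemma contractible_iter_loop:
  assumes X: "diffeology X" and c: "contractible_diff X" and x: "x \<in> points X"
  shows "contractible_diff (iter_loop_diff X x k)"
proof (induction k)
  case 0
  show ?case by (simp add: contractible_image X c inj_on_def)
next
  case (Suc k)
  show ?case
    using contractible_image[OF diffeology_loop[OF diffeology_iter_loop[OF X]] _
        contractible_loop[OF diffeology_iter_loop[OF X] Suc const_loop_in[OF X x]], of Loop]
    by (simp add: inj_on_def)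
qed

lemma contractible_path_rel:
  assumes X: "diffeology X" and c: "contractible_diff X" and xy: "x \<in> points X" "y \<in> points X"
  shows "(x, y) \<in> path_rel X"
proof -
  obtain K c where K: "smooth_map (prod_diff X real_diff) X (\<lambda>z. K (fst z) (snd z))"
      "\<And>a. a \<in> points X \<Longrightarrow> K a 0 = a" "\<And>a. a \<in> points X \<Longrightarrow> K a 1 = c"
    using c unfolding contractible_diff_def smoothly_homotopic_def by blast
  have "(a, c) \<in> path_rel X" if a: "a \<in> points X" for a
  proof (rule path_relI)
    have "smooth_map real_diff (prod_diff X real_diff) (\<lambda>t. (a, t))"
      by (intro smooth_map_pair smooth_map_const diffeology_real X a smooth_map_id)
    from smooth_map_compose[OF K(1) this] show "smooth_map real_diff X (\<lambda>t. K a t)" by simp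
  qed (simp_all add: K a)
  then show ?thesis using xy path_rel_sym[OF X] path_rel_trans[OF X] by meson
qed

lemma homotopy_set_contractible:
  assumes X: "diffeology X" and c: "contractible_diff X" and x: "x \<in> points X"
  shows "homotopy_set X x k = {homotopy_unit X x k}"
proof -
  have u: "homotopy_unit X x k \<in> homotopy_set X x k"
    unfolding homotopy_unit_eq by (rule hcls_in[OF const_loop_in[OF X x]])
  moreover have "d = homotopy_unit X x k" if "d \<in> homotopy_set X x k" for d
  proof -
    from that obtain v where v: "v \<in> points (iter_loop_diff X x k)" "d = hcls X x k v" by (rule homotopy_setE)
    then show ?thesis unfolding homotopy_unit_eq v(2)
      by (intro path_class_eq diffeology_iter_loop X contractible_path_rel contractible_iter_loop c x v(1) const_loop_in)
  qed
  ultimately show ?thesis by blast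
qed

section \<open>Triviality of principal bundles over Euclidean spaces\<close>

definition obox :: "nat \<Rightarrow> (nat \<Rightarrow> real) \<Rightarrow> (nat \<Rightarrow> real) \<Rightarrow> (nat \<Rightarrow> real) set" where
  "obox n lo hi = {y \<in> Eu n. \<forall>i<n. lo i < y i \<and> y i < hi i}"

lemma openin_obox: "eopen n (obox n lo hi)"
  unfolding openin_Eu_iff
proof (intro conjI ballI)
  show "obox n lo hi \<subseteq> Eu n" by (auto simp: obox_def)
  fix x assume x: "x \<in> obox n lo hi"
  define d where "d = Min (insert 1 ((\<lambda>i. min (x i - lo i) (hi i - x i)) ` {..<n}))"
  have "d > 0" using x by (auto simp: d_def obox_def)
  moreover have d: "d \<le> x i - lo i" "d \<le> hi i - x i" if "i < n" for i
  proof -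
    have "d \<le> min (x i - lo i) (hi i - x i)" unfolding d_def using that by (intro Min_le) auto
    then show "d \<le> x i - lo i" "d \<le> hi i - x i" by auto
  qed
  have "y \<in> obox n lo hi" if "y \<in> Eu n" "\<forall>i<n. \<bar>y i - x i\<bar> < d" for y
    unfolding obox_def
  proof (intro CollectI conjI allI impI that(1))
    fix i assume i: "i < n"
    then have "\<bar>y i - x i\<bar> < d" using that(2) by blast
    with d[OF i] show "lo i < y i" "y i < hi i" by linarith+
  qed
  ultimately show "\<exists>d>0. \<forall>y\<in>Eu n. (\<forall>i<n. \<bar>y i - x i\<bar> < d) \<longrightarrow> y \<in> obox n lo hi" by blast
qed

text \<open>The added condition is a diffeological form of local triviality: local sections exist
  after pulling back along a plot.\<close>

locale principal_bundle = principal_action +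
  assumes local_lift: "plot B n U p \<Longrightarrow> u \<in> U \<Longrightarrow>
    \<exists>V r. eopen n V \<and> u \<in> V \<and> V \<subseteq> U \<and> plot E n V r \<and> (\<forall>v\<in>V. q (r v) = p v)"
begin

definition "lift_on n p U r \<longleftrightarrow> plot E n U r \<and> (\<forall>u\<in>U. q (r u) = p u)"

lemma lift_on_subset:
  "lift_on n p U r \<Longrightarrow> eopen n V \<Longrightarrow> V \<subseteq> U \<Longrightarrow> lift_on n p V r"
  unfolding lift_on_def by (blast intro: plot_subset[OF dE])

text \<open>
  The section \<open>r2\<close> is translated so as to agree with \<open>r1\<close>, the transition function being extended
  from \<open>U1 \<inter> U2\<close> to \<open>U2\<close> by composition with \<open>\<rho>\<close>.
\<close>

lemma lift_on_glue:
  assumes r1: "lift_on n p U1 r1" and r2: "lift_on n p U2 r2"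
    and \<rho>: "smooth_euclid n U2 n \<rho>" "\<rho> ` U2 \<subseteq> U1 \<inter> U2"
    and W1: "eopen n W1" "W1 \<subseteq> U1" and id: "\<And>y. y \<in> W1 \<Longrightarrow> y \<in> U2 \<Longrightarrow> \<rho> y = y"
  shows "\<exists>r. lift_on n p (W1 \<union> U2) r \<and> (\<forall>u\<in>W1. r u = r1 u)"
proof -
  have p1: "plot E n U1 r1" "\<And>u. u \<in> U1 \<Longrightarrow> q (r1 u) = p u" and p2: "plot E n U2 r2" "\<And>u. u \<in> U2 \<Longrightarrow> q (r2 u) = p u"
    using r1 r2 by (auto simp: lift_on_def)
  have E1: "r1 u \<in> points E" if "u \<in> U1" for u by (rule plot_points[OF dE p1(1) that])
  have E2: "r2 u \<in> points E" if "u \<in> U2" for u by (rule plot_points[OF dE p2(1) that])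
  have \<rho>U: "\<rho> u \<in> U1" "\<rho> u \<in> U2" if "u \<in> U2" for u using \<rho>(2) that by blast+
  define g where "g u = dv (r2 (\<rho> u)) (r1 (\<rho> u))" for u
  define r where "r u = (if u \<in> W1 then r1 u else act (g u) (r2 u))" for u
  have U2: "eopen n U2" by (rule plot_openin[OF dE p2(1)])
  have "plot (subset_diff (prod_diff E E) {z. q (fst z) = q (snd z)}) n U2 (\<lambda>u. (r2 (\<rho> u), r1 (\<rho> u)))"
    using plot_compose[OF dE p2(1) \<rho>(1)] plot_compose[OF dE p1(1) \<rho>(1)] \<rho>(2) p1(2)[OF \<rho>U(1)] p2(2)[OF \<rho>U(2)]
    by (auto simp: plot_subset_iff plot_prod)
  from smooth_map_plot[OF dv this] have g: "plot G n U2 g" by (simp add: g_def[abs_def])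
  have gG: "g u \<in> points G" if "u \<in> U2" for u by (rule plot_points[OF dG g that])
  have "plot E n U2 (\<lambda>u. act (g u) (r2 u))"
    using smooth_map_plot[OF act, of n U2 "\<lambda>u. (g u, r2 u)"] g p2(1) by (simp add: plot_prod)
  moreover have eq: "act (g u) (r2 u) = r u" if "u \<in> U2" for u
    using that W1(2) E1[of u] E2[of u] p1(2)[of u] p2(2)[of u] id[of u]
    by (cases "u \<in> W1") (auto simp: r_def g_def subset_iff intro!: act_dv)
  ultimately have R2: "plot E n U2 r" by (rule plot_cong[OF dE])
  have R1: "plot E n W1 r" by (rule plot_cong[OF dE plot_subset[OF dE p1(1) W1]]) (simp add: r_def)
  have "plot E n (W1 \<union> U2) r"
  proof (rule plot_local[OF dE openin_Un[OF W1(1) U2]])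
    fix u assume "u \<in> W1 \<union> U2"
    then show "plot_near E n (W1 \<union> U2) r u"
      using R1 R2 W1(1) U2 by (cases "u \<in> W1") (intro exI[of _ W1] exI[of _ r], simp, intro exI[of _ U2] exI[of _ r], simp)
  qed
  moreover have "q (r u) = p u" if "u \<in> W1 \<union> U2" for u
  proof (cases "u \<in> W1")
    case True
    then show ?thesis using p1(2) W1(2) by (auto simp: r_def)
  next
    case False
    then have u: "u \<in> U2" using that by blast
    then show ?thesis using False p2(2) q_act[OF gG E2, OF u u] by (simp add: r_def)
  qed
  ultimately show ?thesis unfolding lift_on_def by (intro exI[of _ r]) (simp add: r_def)
qed

text \<open>The box has full width \<open>N\<close> in the first \<open>j\<close> directions and is
  thin around \<open>x\<close> in the others. For the induction step, thin boxes are joined along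
  direction \<open>j\<close> by \<open>lift_on_glue\<close>; \<open>Bolzano\<close> replaces the
  choice of a finite cover of [-N, N].\<close>

lemma lift_on_box:
  assumes p: "plot B n (Eu n) p" and N: "N > 0" and j: "j \<le> n" and x: "x \<in> Eu n"
  shows "\<exists>d>0. \<exists>r. lift_on n p (obox n (\<lambda>i. if i < j then - N else x i - d) (\<lambda>i. if i < j then N else x i + d)) r"
  using j x
proof (induction j arbitrary: x)
  case 0
  from local_lift[OF p 0(2)] obtain V r where V: "eopen n V" "x \<in> V" "plot E n V r" "\<forall>v\<in>V. q (r v) = p v"
    by blast
  obtain d where d: "d > 0" "\<And>y. y \<in> Eu n \<Longrightarrow> (\<And>i. i < n \<Longrightarrow> \<bar>y i - x i\<bar> < d) \<Longrightarrow> y \<in> V"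
    by (rule openin_EuE[OF V(1,2)]) blast
  have "obox n (\<lambda>i. x i - d) (\<lambda>i. x i + d) \<subseteq> V"
    by (intro subsetI d(2)) (auto simp: obox_def abs_less_iff algebra_simps)
  moreover have "lift_on n p V r" using V by (simp add: lift_on_def)
  ultimately have "lift_on n p (obox n (\<lambda>i. x i - d) (\<lambda>i. x i + d)) r"
    using lift_on_subset openin_obox by blast
  then show ?case using d(1) by auto
next
  case (Suc j)
  then have j: "j < n" by simp
  define S where "S lo hi d = obox n (\<lambda>i. if i < j then - N else if i = j then lo else x i - d)
      (\<lambda>i. if i < j then N else if i = j then hi else x i + d)" for lo hi d
  have S_iff: "y \<in> S lo hi d \<longleftrightarrow> y \<in> Eu n \<and> (\<forall>i<j. - N < y i \<and> y i < N) \<and> lo < y j \<and> y j < hi \<and>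
      (\<forall>i<n. j < i \<longrightarrow> x i - d < y i \<and> y i < x i + d)" for y lo hi d
  proof -
    have split: "(\<forall>i<n. Q i) \<longleftrightarrow> (\<forall>i<j. Q i) \<and> Q j \<and> (\<forall>i<n. j < i \<longrightarrow> Q i)" for Q
      using j by (metis less_trans linorder_neqE_nat)
    show ?thesis unfolding S_def obox_def mem_Collect_eq split[of "\<lambda>i. _ i < y i \<and> y i < _ i"] by simp
  qed
  have S_open: "eopen n (S lo hi d)" for lo hi d unfolding S_def by (rule openin_obox)
  have S_mono: "S lo hi d \<subseteq> S lo' hi' d'" if "lo' \<le> lo" "hi \<le> hi'" "d \<le> d'" for lo lo' hi hi' d d'
  proof
    fix y assume y: "y \<in> S lo hi d"
    have "x i - d' < y i \<and> y i < x i + d'" if "i < n" "j < i" for i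
    proof -
      have "x i - d < y i" "y i < x i + d" using y that by (simp_all add: S_iff)
      then show ?thesis using \<open>d \<le> d'\<close> by linarith
    qed
    then show "y \<in> S lo' hi' d'" using y that by (auto simp: S_iff)
  qed
  \<comment> \<open>One \<open>d\<close> is both the overhang beyond the interval and the thickness
    in the directions after \<open>j\<close>; two lifts can thus be restricted to a common smaller
    \<open>d\<close> before they are glued.\<close>
  define P where "P a b \<longleftrightarrow> (\<exists>d>0. \<exists>r. lift_on n p (S (a - d) (b + d) d) r)" for a b
  have "P (- N) N"
  proof (rule Bolzano)
    show "- N \<le> N" using N by simp
    fix a b c assume "P a b" "P b c" and abc: "a \<le> b" "b \<le> c"
    obtain d1 r1 where d1: "d1 > 0" "lift_on n p (S (a - d1) (b + d1) d1) r1" using \<open>P a b\<close> unfolding P_def by blast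
    obtain d2 r2 where d2: "d2 > 0" "lift_on n p (S (b - d2) (c + d2) d2) r2" using \<open>P b c\<close> unfolding P_def by blast
    define d where "d = min d1 d2"
    have d: "d > 0" "d \<le> d1" "d \<le> d2" using d1 d2 by (simp_all add: d_def)
    have r1: "lift_on n p (S (a - d) (b + d) d) r1"
      by (rule lift_on_subset[OF d1(2) S_open S_mono]) (use d in simp_all)
    have r2: "lift_on n p (S (b - d) (c + d) d) r2"
      by (rule lift_on_subset[OF d2(2) S_open S_mono]) (use d in simp_all)
    \<comment> \<open>The identity up to \<open>b + d/4\<close>, the constant \<open>b\<close> from
      \<open>b + 3/4 * d\<close> on, and in between within (b, b + d). It squeezes the second box
      into the overlap of the two and fixes the part that is kept of the first.\<close>
    define \<phi> where "\<phi> t = b + (t - b) * (1 - smashing_fun (1/d * (t - b)))" for t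
    have \<phi>_id: "\<phi> t = t" if "t < b + d/4" for t
    proof -
      have "1/d * (t - b) \<le> 1/4" using that d(1) by (simp add: field_simps)
      then show ?thesis by (simp add: \<phi>_def)
    qed
    have \<phi>_range: "b - d < \<phi> t" "\<phi> t < b + d" if t: "b - d < t" for t
    proof -
      consider "t \<le> b" | "b < t" "t < b + 3/4*d" | "t \<ge> b + 3/4*d" by linarith
      then have "b - d < \<phi> t \<and> \<phi> t < b + d"
      proof cases
        case 1
        then show ?thesis using \<phi>_id[of t] t d(1) by simp
      next
        case 2
        define v where "v = (t - b) * (1 - smashing_fun (1/d * (t - b)))"
        have "0 \<le> v" using 2 by (simp add: v_def)
        moreover have "v \<le> (t - b) * 1" unfolding v_def using 2 by (intro mult_left_mono) auto
        moreover have "\<phi> t = b + v" by (simp add: \<phi>_def v_def)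
        ultimately show ?thesis using 2 d(1) by auto
      next
        case 3
        have "1/d * (t - b) \<ge> 3/4" using 3 d(1) by (simp add: field_simps)
        then show ?thesis using d(1) by (simp add: \<phi>_def)
      qed
      then show "b - d < \<phi> t" "\<phi> t < b + d" by auto
    qed
    let ?U2 = "S (b - d) (c + d) d" and ?W1 = "S (a - d) (b + d/4) d"
    have "smooth_map (euclid_diff n) (euclid_diff n) (\<lambda>y. y(j := \<phi> (y j)))"
    proof (rule smooth_map_into_euclid[OF diffeology_euclid])
      show "y(j := \<phi> (y j)) \<in> Eu n" if "y \<in> points (euclid_diff n)" for y using that j by simp
      show "smooth_map (euclid_diff n) real_diff (\<lambda>y. (y(j := \<phi> (y j))) i)" for i
      proof (cases "i = j")
        case True
        have "smooth_map (euclid_diff n) real_diff (\<lambda>y. b + (y j - b) * (1 - smashing_fun (1/d * (y j - b))))"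
          by (rule smooth_map_coord smooth_real_intros)+
        then show ?thesis using True by (simp add: \<phi>_def)
      qed (simp add: smooth_map_coord)
    qed
    from smooth_map_plot[OF this, of n ?U2 "\<lambda>y. y"]
    have \<rho>: "smooth_euclid n ?U2 n (\<lambda>y. y(j := \<phi> (y j)))" by (simp add: plot_euclid smooth_euclid_id S_open)
    have \<rho>U: "(\<lambda>y. y(j := \<phi> (y j))) ` ?U2 \<subseteq> S (a - d) (b + d) d \<inter> ?U2"
    proof (intro image_subsetI IntI)
      fix y assume "y \<in> ?U2"
      then show "y(j := \<phi> (y j)) \<in> S (a - d) (b + d) d" "y(j := \<phi> (y j)) \<in> ?U2"
        using j \<phi>_range[of "y j"] abc d(1) unfolding S_iff by auto
    qed
    have W1: "?W1 \<subseteq> S (a - d) (b + d) d" by (rule S_mono) (use d(1) in auto)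
    have id: "y(j := \<phi> (y j)) = y" if "y \<in> ?W1" for y
      using \<phi>_id[of "y j"] that by (simp add: S_iff)
    from lift_on_glue[OF r1 r2 \<rho> \<rho>U S_open W1 id] obtain r where r: "lift_on n p (?W1 \<union> ?U2) r" by auto
    have "S (a - d) (c + d) d \<subseteq> ?W1 \<union> ?U2" using d(1) by (auto simp: S_iff)
    from lift_on_subset[OF r S_open this] show "P a c" unfolding P_def using d(1) by blast
  next
    fix x0
    from Suc.IH[OF less_imp_le[OF j] Eu_upd[OF Suc.prems(2) j]] obtain e r where e: "e > 0"
      "lift_on n p (obox n (\<lambda>i. if i < j then - N else (x(j := x0)) i - e) (\<lambda>i. if i < j then N else (x(j := x0)) i + e)) r"
      by blast
    \<comment> \<open>One half of \<open>e\<close> bounds the length of the interval, the other half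
      is left for the overhang.\<close>
    show "\<exists>d>0. \<forall>a b. a \<le> x0 \<and> x0 \<le> b \<and> b - a < d \<longrightarrow> P a b"
    proof (intro exI[of _ "e/2"] conjI allI impI)
      fix a b assume ab: "a \<le> x0 \<and> x0 \<le> b \<and> b - a < e/2"
      have "S (a - e/2) (b + e/2) (e/2) \<subseteq>
          obox n (\<lambda>i. if i < j then - N else (x(j := x0)) i - e) (\<lambda>i. if i < j then N else (x(j := x0)) i + e)"
      proof
        fix y assume y: "y \<in> S (a - e/2) (b + e/2) (e/2)"
        have "(if i < j then - N else (x(j := x0)) i - e) < y i \<and> y i < (if i < j then N else (x(j := x0)) i + e)"
          if "i < n" for i
        proof -
          consider "i < j" | "i = j" | "j < i" by linarith
          then show ?thesis
          proof cases
            case 1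
            then show ?thesis using y by (simp add: S_iff)
          next
            case 2
            have "a - e/2 < y j" "y j < b + e/2" using y by (simp_all add: S_iff)
            then show ?thesis using 2 ab by auto
          next
            case 3
            then have "x i - e/2 < y i" "y i < x i + e/2" using y that by (simp_all add: S_iff)
            then show ?thesis using 3 e(1) by auto
          qed
        qed
        then show "y \<in> obox n (\<lambda>i. if i < j then - N else (x(j := x0)) i - e) (\<lambda>i. if i < j then N else (x(j := x0)) i + e)"
          using y by (simp add: S_iff obox_def)
      qed
      from lift_on_subset[OF e(2) S_open this] show "P a b" unfolding P_def using e(1) by (intro exI[of _ "e/2"]) auto
    qed (use e(1) in simp)
  qed
  then obtain d r where d: "d > 0" "lift_on n p (S (- N - d) (N + d) d) r" unfolding P_def by blast
  let ?T = "obox n (\<lambda>i. if i < Suc j then - N else x i - d) (\<lambda>i. if i < Suc j then N else x i + d)"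
  have "?T \<subseteq> S (- N - d) (N + d) d"
  proof
    fix y assume y: "y \<in> ?T"
    have yi: "(if i < Suc j then - N else x i - d) < y i \<and> y i < (if i < Suc j then N else x i + d)" if "i < n" for i
      using y that by (simp add: obox_def)
    have "- N < y i \<and> y i < N" if "i < Suc j" for i using yi[of i] that j by simp
    moreover have "x i - d < y i \<and> y i < x i + d" if "j < i" "i < n" for i using yi[of i] that by simp
    moreover have "y \<in> Eu n" using y by (simp add: obox_def)
    ultimately show "y \<in> S (- N - d) (N + d) d" using d(1) unfolding S_iff by force
  qed
  from lift_on_subset[OF d(2) openin_obox this] show ?case using d(1) by blast
qed

text \<open>n-space is exhausted by cubes. The retraction used in glueing needs room, so passing
  from \<open>C (Suc N)\<close> to the next cube preserves the old lift only on \<open>C N\<close>.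
  On each cube the sequence of lifts nevertheless becomes constant.\<close>

lemma global_lift:
  assumes p: "plot B n (Eu n) p"
  obtains r where "plot E n (Eu n) r" "\<And>u. u \<in> Eu n \<Longrightarrow> q (r u) = p u"
proof -
  define C where "C N = obox n (\<lambda>_. - real N) (\<lambda>_. real N)" for N
  have C_iff: "y \<in> C N \<longleftrightarrow> y \<in> Eu n \<and> (\<forall>i<n. \<bar>y i\<bar> < real N)" for y N by (auto simp: C_def obox_def abs_less_iff)
  have C_open: "eopen n (C N)" for N unfolding C_def by (rule openin_obox)
  have C_mono: "C N \<subseteq> C M" if "N \<le> M" for N M
  proof
    fix y assume y: "y \<in> C N"
    have "\<bar>y i\<bar> < real M" if "i < n" for i
    proof -
      have "\<bar>y i\<bar> < real N" using y that by (simp add: C_iff)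
      then show ?thesis using \<open>N \<le> M\<close> by simp
    qed
    then show "y \<in> C M" using y by (simp add: C_iff)
  qed
  have ex: "\<exists>r. lift_on n p (C (Suc N)) r" for N
  proof -
    have "(\<lambda>_. 0) \<in> Eu n" by (simp add: mem_Eu)
    from lift_on_box[OF p _ order_refl this, of "real (Suc N)"] obtain d r where
      r: "lift_on n p (obox n (\<lambda>i. if i < n then - real (Suc N) else 0 - d) (\<lambda>i. if i < n then real (Suc N) else 0 + d)) r"
      using of_nat_0_less_iff zero_less_Suc by blast
    have "obox n (\<lambda>i. if i < n then - real (Suc N) else 0 - d) (\<lambda>i. if i < n then real (Suc N) else 0 + d) = C (Suc N)"
      unfolding C_def obox_def by (rule Collect_cong) simp
    with r show ?thesis by metis
  qed
  have step: "\<exists>r'. lift_on n p (C (Suc (Suc N))) r' \<and> (\<forall>u\<in>C N. r' u = r u)" if r: "lift_on n p (C (Suc N)) r" for r N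
  proof -
    obtain r2 where r2: "lift_on n p (C (Suc (Suc N))) r2" using ex by blast
    \<comment> \<open>The identity for \<open>\<bar>t\<bar> \<le> N\<close> and 0 from
      \<open>N + 3/4\<close> on in absolute value; applied to each coordinate it maps into
      \<open>C (Suc N)\<close>.\<close>
    define \<psi> where "\<psi> t = t * ((1 - smashing_fun (t - real N)) * (1 - smashing_fun (- t - real N)))" for t
    have \<psi>_id: "\<psi> t = t" if "\<bar>t\<bar> \<le> real N" for t using that by (simp add: \<psi>_def abs_le_iff)
    have \<psi>_range: "\<bar>\<psi> t\<bar> < real (Suc N)" for t
    proof (cases "\<bar>t\<bar> < real N + 3/4")
      case True
      have "(1 - smashing_fun (t - real N)) * (1 - smashing_fun (- t - real N)) \<le> 1 * 1"
        by (intro mult_mono) auto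
      then have "\<bar>\<psi> t\<bar> \<le> \<bar>t\<bar> * 1" unfolding \<psi>_def abs_mult by (intro mult_left_mono) auto
      then show ?thesis using True by simp
    next
      case False
      then have "smashing_fun (t - real N) = 1 \<or> smashing_fun (- t - real N) = 1" by (cases "t \<ge> 0") auto
      then show ?thesis by (auto simp: \<psi>_def)
    qed
    let ?\<rho> = "\<lambda>y i. \<psi> (y i)"
    have "smooth_map (euclid_diff n) (euclid_diff n) ?\<rho>"
    proof (rule smooth_map_into_euclid[OF diffeology_euclid])
      show "?\<rho> y \<in> Eu n" if "y \<in> points (euclid_diff n)" for y using that by (simp add: mem_Eu \<psi>_def)
      show "smooth_map (euclid_diff n) real_diff (\<lambda>y. \<psi> (y i))" for i
        unfolding \<psi>_def by (rule smooth_map_coord smooth_real_intros)+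
    qed
    from smooth_map_plot[OF this, of n "C (Suc (Suc N))" "\<lambda>y. y"]
    have \<rho>: "smooth_euclid n (C (Suc (Suc N))) n ?\<rho>" by (simp add: plot_euclid smooth_euclid_id C_open)
    have \<rho>U: "?\<rho> ` C (Suc (Suc N)) \<subseteq> C (Suc N) \<inter> C (Suc (Suc N))"
    proof -
      have "?\<rho> y \<in> C (Suc N)" if "y \<in> C (Suc (Suc N))" for y
        using that \<psi>_range unfolding C_iff by (auto simp: mem_Eu \<psi>_def)
      then show ?thesis using C_mono[of "Suc N" "Suc (Suc N)"] by auto
    qed
    have id: "?\<rho> y = y" if "y \<in> C N" for y
    proof
      fix i show "\<psi> (y i) = y i"
        using that by (cases "i < n") (simp_all add: C_iff mem_Eu \<psi>_id less_imp_le)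
    qed
    have "C N \<subseteq> C (Suc N)" by (rule C_mono) simp
    from lift_on_glue[OF r r2 \<rho> \<rho>U C_open this id]
    have "\<exists>r'. lift_on n p (C N \<union> C (Suc (Suc N))) r' \<and> (\<forall>u\<in>C N. r' u = r u)" by simp
    moreover have "C N \<union> C (Suc (Suc N)) = C (Suc (Suc N))" using C_mono[of N "Suc (Suc N)"] by auto
    ultimately show ?thesis by simp
  qed
  have "\<exists>f. \<forall>N. lift_on n p (C (Suc N)) (f N) \<and> (\<forall>u\<in>C N. f (Suc N) u = f N u)"
  proof (rule dependent_nat_choice)
    show "\<exists>r. lift_on n p (C (Suc 0)) r" by (rule ex)
    show "\<exists>r'. lift_on n p (C (Suc (Suc N))) r' \<and> (\<forall>u\<in>C N. r' u = r u)" if "lift_on n p (C (Suc N)) r" for r N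
      by (rule step[OF that])
  qed
  then obtain f where f: "\<And>N. lift_on n p (C (Suc N)) (f N)" "\<And>N. \<forall>u\<in>C N. f (Suc N) u = f N u"
    by blast
  have f_mono: "f M u = f N u" if "N \<le> M" "u \<in> C N" for M N u
    using that(1)
  proof (induction M rule: dec_induct)
    case (step M)
    then have "u \<in> C M" using subsetD[OF C_mono that(2)] by simp
    then show ?case using f(2)[of M] step by simp
  qed simp
  have cover: "\<exists>N. u \<in> C N" if "u \<in> Eu n" for u
  proof -
    obtain N where "Max (insert 0 ((\<lambda>i. \<bar>u i\<bar>) ` {..<n})) < real N" using reals_Archimedean2 by blast
    then have "u \<in> C N" using that by (auto simp: C_iff)
    then show ?thesis by blast
  qed
  define r where "r u = f (LEAST N. u \<in> C N) u" for u
  have r_eq: "r u = f N u" if "u \<in> C N" for u N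
    unfolding r_def using f_mono[OF Least_le[of "\<lambda>N. u \<in> C N", OF that] LeastI[of "\<lambda>N. u \<in> C N", OF that]] by simp
  have fC: "lift_on n p (C N) (f N)" for N by (rule lift_on_subset[OF f(1) C_open C_mono]) simp
  show ?thesis
  proof (rule that)
    show "plot E n (Eu n) r"
    proof (rule plot_local[OF dE plot_openin[OF dB p]])
      fix u assume "u \<in> Eu n"
      then obtain N where N: "u \<in> C N" using cover by blast
      show "plot_near E n (Eu n) r u"
      proof (intro exI[of _ "C N"] exI[of _ "f N"] conjI ballI)
        show "plot E n (C N) (f N)" using fC[of N] by (simp add: lift_on_def)
        show "f N v = r v" if "v \<in> C N" for v using r_eq[OF that] by simp
      qed (rule C_open, rule N, rule openin_Eu_sub[OF C_open])
    qed
    show "q (r u) = p u" if "u \<in> Eu n" for u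
    proof -
      from cover[OF that] obtain N where N: "u \<in> C N" by blast
      then show ?thesis using fC[of N] r_eq[OF N] by (simp add: lift_on_def)
    qed
  qed
qed

lemma smooth_map_iff_plot_Eu:
  assumes X: "diffeology X" shows "smooth_map (euclid_diff n) X p \<longleftrightarrow> plot X n (Eu n) p"
proof
  have "eopen n (Eu n)" by simp
  then show "smooth_map (euclid_diff n) X p \<Longrightarrow> plot X n (Eu n) p"
    using smooth_map_plot[of "euclid_diff n" X p n "Eu n" "\<lambda>x. x"] by (simp add: plot_euclid smooth_euclid_id)
  assume p: "plot X n (Eu n) p"
  show "smooth_map (euclid_diff n) X p"
  proof (rule smooth_mapI)
    show "plot X m U (\<lambda>u. p (r u))" if "plot (euclid_diff n) m U r" for m U r
      using plot_compose[OF X p, of m U r] that by (simp add: plot_euclid smooth_euclid_def)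
  qed (simp add: plot_points[OF X p])
qed

text \<open>R^m x R is again Euclidean, so the homotopy has a global lift. Its start is moved to the
  prescribed one by the element \<open>dv (H (u, 0)) (f u)\<close>, which does not depend on
  time.\<close>

sublocale pfib
proof
  fix m
  let ?P = "prod_diff (euclid_diff m) real_diff"
  have dP: "diffeology ?P" by (rule smooth_real_intros)+
  show "lifts_homotopies E B q (euclid_diff m)"
    unfolding lifts_homotopies_def
  proof (intro allI impI)
    fix h f assume h: "smooth_map ?P B h" and f: "smooth_map (euclid_diff m) E f"
      and qf: "\<forall>u\<in>points (euclid_diff m). q (f u) = h (u, 0)"
    have "smooth_map (euclid_diff (Suc m)) B (\<lambda>z. h (z(m := 0), z m))"
      by (rule smooth_map_compose[OF h smooth_map_euclid_split])
    then have "plot B (Suc m) (Eu (Suc m)) (\<lambda>z. h (z(m := 0), z m))"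
      by (simp add: smooth_map_iff_plot_Eu[OF dB])
    then obtain r where r: "plot E (Suc m) (Eu (Suc m)) r" "\<And>z. z \<in> Eu (Suc m) \<Longrightarrow> q (r z) = h (z(m := 0), z m)"
      by (rule global_lift) blast
    define H where "H z = r ((fst z)(m := snd z))" for z
    have "smooth_map (euclid_diff (Suc m)) E r" by (simp add: smooth_map_iff_plot_Eu[OF dE] r(1))
    from smooth_map_compose[OF this smooth_map_euclid_join] have H: "smooth_map ?P E H" by (simp add: H_def[abs_def])
    have qH: "q (H (u, s)) = h (u, s)" if "u \<in> Eu m" for u s
    proof -
      have "u(m := s) \<in> Eu (Suc m)" using that by (auto simp: mem_Eu)
      moreover have "u(m := 0) = u" using that by (auto simp: mem_Eu)
      ultimately show ?thesis using r(2)[of "u(m := s)"] by (simp add: H_def)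
    qed
    have z0: "smooth_map ?P ?P (\<lambda>z. (fst z, 0))" by (rule dP smooth_real_intros)+
    have "q (H (fst z, 0)) = q (f (fst z))" if "z \<in> points ?P" for z using that qf qH by auto
    from smooth_act[OF smooth_dv[OF dP smooth_map_compose[OF H z0] smooth_map_compose[OF f smooth_map_fst[OF smooth_map_id]] this] H]
    have "smooth_map ?P E (\<lambda>z. act (dv (H (fst z, 0)) (f (fst z))) (H z))" .
    moreover have HE: "H (u, s) \<in> points E" if "u \<in> Eu m" for u s
      using smooth_map_points[OF H, of "(u, s)"] that by simp
    moreover have fE: "f u \<in> points E" if "u \<in> Eu m" for u using smooth_map_points[OF f] that by simp
    ultimately show "\<exists>H. smooth_map ?P E H \<and> (\<forall>u\<in>points (euclid_diff m). H (u, 0) = f u \<and> (\<forall>s. q (H (u, s)) = h (u, s)))"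
      using qH qf by (intro exI[of _ "\<lambda>z. act (dv (H (fst z, 0)) (f (fst z))) (H z)"]) (simp add: act_dv q_act dv_in)
  qed
qed

end

section \<open>The Milnor construction\<close>

lemma plot_imageE:
  assumes "plot (image_diff A j) n U p" "u \<in> U"
  obtains V r where "eopen n V" "u \<in> V" "V \<subseteq> U" "plot A n V r" "\<And>v. v \<in> V \<Longrightarrow> p v = j (r v)"
proof -
  have "\<exists>V r. eopen n V \<and> u \<in> V \<and> V \<subseteq> U \<and> plot A n V r \<and> (\<forall>v\<in>V. p v = j (r v))"
    using assms by (simp add: image_diff_def)
  then show ?thesis using that by blast
qed

lemma smooth_map_into_power:
  assumes "diffeology A" "\<And>i. smooth_map A X (\<lambda>a. f a i)"
  shows "smooth_map A (power_diff X) f"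
  using smooth_map_points[OF assms(2)] smooth_map_plot[OF assms(2)]
  by (intro smooth_mapI) (simp_all add: power_diff_def)

lemma smooth_map_power_coord:
  assumes "smooth_map A (power_diff X) f" shows "smooth_map A X (\<lambda>a. f a i)"
  using smooth_map_points[OF assms] smooth_map_plot[OF assms]
  by (intro smooth_mapI) (simp_all add: power_diff_def)

text \<open>Summation over an initial segment, which can be enlarged freely, is better suited to
  convex combinations and telescoping sums than summation over the support; the bound by 1 is then a
  consequence.\<close>

definition milnor_weight :: "(nat \<Rightarrow> real) \<Rightarrow> bool" where
  "milnor_weight t \<longleftrightarrow> (\<forall>i. 0 \<le> t i) \<and> (\<exists>N. (\<forall>i\<ge>N. t i = 0) \<and> (\<Sum>i<N. t i) = 1)"

lemma milnor_weight_sum: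
  fixes N M :: nat
  assumes N: "\<And>i. i \<ge> N \<Longrightarrow> t i = (0::real)" and "N \<le> M" shows "(\<Sum>i<M. t i) = (\<Sum>i<N. t i)"
proof (rule sum.mono_neutral_right)
  show "\<forall>i\<in>{..<M} - {..<N}. t i = 0" using N by simp
qed (use \<open>N \<le> M\<close> in auto)

lemma milnor_weight_iff:
  "milnor_weight t \<longleftrightarrow> (\<forall>i. t i \<in> {0..1}) \<and> finite {i. t i \<noteq> 0} \<and> (\<Sum>i | t i \<noteq> 0. t i) = 1"
proof
  assume "milnor_weight t"
  then obtain N where t: "\<And>i. 0 \<le> t i" "\<And>i. i \<ge> N \<Longrightarrow> t i = 0" "(\<Sum>i<N. t i) = 1" unfolding milnor_weight_def by blast
  have sub: "{i. t i \<noteq> 0} \<subseteq> {..<N}" using t(2) by (auto simp: not_le[symmetric])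
  have "t i \<le> 1" for i
  proof (cases "i < N")
    case True
    have "t i \<le> (\<Sum>i<N. t i)" by (rule member_le_sum) (use True t(1) in auto)
    then show ?thesis using t(3) by simp
  qed (use t(2) in simp)
  moreover have "(\<Sum>i | t i \<noteq> 0. t i) = (\<Sum>i<N. t i)" by (rule sum.mono_neutral_left) (use sub in auto)
  ultimately show "(\<forall>i. t i \<in> {0..1}) \<and> finite {i. t i \<noteq> 0} \<and> (\<Sum>i | t i \<noteq> 0. t i) = 1"
    using t sub finite_subset[OF sub] by auto
next
  assume t: "(\<forall>i. t i \<in> {0..1}) \<and> finite {i. t i \<noteq> 0} \<and> (\<Sum>i | t i \<noteq> 0. t i) = 1"
  then obtain N where N: "{i. t i \<noteq> 0} \<subseteq> {..<N}" using finite_nat_iff_bounded by blast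
  have "(\<Sum>i<N. t i) = (\<Sum>i | t i \<noteq> 0. t i)" by (rule sum.mono_neutral_right) (use N in auto)
  moreover have "t i = 0" if "i \<ge> N" for i
  proof (rule ccontr)
    assume "t i \<noteq> 0"
    then have "i \<in> {..<N}" using N by blast
    then show False using that by simp
  qed
  ultimately show "milnor_weight t" unfolding milnor_weight_def using t by (intro conjI exI[of _ N]) auto
qed

lemma milnor_weight_convex:
  assumes t: "milnor_weight t" and u: "milnor_weight u" and s: "0 \<le> s" "s \<le> 1"
  shows "milnor_weight (\<lambda>i. (1 - s) * t i + s * u i)"
proof -
  obtain N where N: "\<And>i. 0 \<le> t i" "\<And>i. i \<ge> N \<Longrightarrow> t i = 0" "(\<Sum>i<N. t i) = 1" using t unfolding milnor_weight_def by blast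
  obtain M where M: "\<And>i. 0 \<le> u i" "\<And>i. i \<ge> M \<Longrightarrow> u i = 0" "(\<Sum>i<M. u i) = 1" using u unfolding milnor_weight_def by blast
  have "(\<Sum>i<max N M. (1 - s) * t i + s * u i) = (1 - s) * (\<Sum>i<max N M. t i) + s * (\<Sum>i<max N M. u i)"
    by (simp add: sum.distrib sum_distrib_left)
  also have "(\<Sum>i<max N M. t i) = 1" using milnor_weight_sum[of N t "max N M"] N by simp
  also have "(\<Sum>i<max N M. u i) = 1" using milnor_weight_sum[of M u "max N M"] M by simp
  finally have "(\<Sum>i<max N M. (1 - s) * t i + s * u i) = 1" by simp
  then show ?thesis
    unfolding milnor_weight_def using N(1,2) M(1,2) s by (intro conjI exI[of _ "max N M"]) auto
qed

lemma milnor_set_iff: "(t, g) \<in> milnor_set G \<longleftrightarrow> milnor_weight t \<and> (\<forall>i. g i \<in> carrier G)"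
  unfolding milnor_weight_iff milnor_set_def by auto

lemma milnor_weight_nonzero: "milnor_weight t \<Longrightarrow> \<exists>i. t i \<noteq> 0"
  unfolding milnor_weight_def by (metis sum.neutral zero_neq_one)

lemma milnor_rel_iff:
  "((t, g), (t', g')) \<in> milnor_rel G \<longleftrightarrow> (t, g) \<in> milnor_set G \<and> (t', g') \<in> milnor_set G \<and> t = t' \<and> (\<forall>i. t i \<noteq> 0 \<longrightarrow> g i = g' i)"
  by (auto simp: milnor_rel_def fun_eq_iff)

lemma equiv_milnor_rel: "equiv (milnor_set G) (milnor_rel G)"
proof (rule equivI)
  show "milnor_rel G \<subseteq> milnor_set G \<times> milnor_set G" by (auto simp: milnor_rel_def)
  show "refl_on (milnor_set G) (milnor_rel G)" by (rule refl_onI) (auto simp: milnor_rel_def)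
  show "sym (milnor_rel G)" by (rule symI) (auto simp: milnor_rel_def)
  show "trans (milnor_rel G)" by (rule transI) (auto simp: milnor_rel_def)
qed

abbreviation mcl :: "'a monoid \<Rightarrow> (nat \<Rightarrow> real) \<times> (nat \<Rightarrow> 'a) \<Rightarrow> 'a EG" where
  "mcl G x \<equiv> milnor_rel G `` {x}"

lemma mcl_eq_iff: "x \<in> milnor_set G \<Longrightarrow> y \<in> milnor_set G \<Longrightarrow> mcl G x = mcl G y \<longleftrightarrow> (x, y) \<in> milnor_rel G"
  by (rule eq_equiv_class_iff[OF equiv_milnor_rel])

lemma mcl_image:
  assumes x: "x \<in> milnor_set G" and f: "\<And>y. (x, y) \<in> milnor_rel G \<Longrightarrow> (f x, f y) \<in> milnor_rel H"
  shows "milnor_rel H `` (f ` mcl G x) = mcl H (f x)"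
proof -
  have tr: "trans (milnor_rel H)" using equiv_milnor_rel by (rule equivE)
  have "(x, x) \<in> milnor_rel G" using equiv_milnor_rel[of G] x by (blast dest: equivE refl_onD)
  then show ?thesis using f transD[OF tr] by blast
qed

section \<open>The bundle of a diffeological group\<close>

locale dgroup =
  fixes G :: "'a monoid" and D :: "'a diff_space"
  assumes dgroup: "diffeological_group G D"
begin

lemma G: "group G" and dD: "diffeology D" and points_D: "points D = carrier G"
  and smooth_mult: "smooth_map (prod_diff D D) D (\<lambda>z. fst z \<otimes>\<^bsub>G\<^esub> snd z)"
  and smooth_inv: "smooth_map D D (\<lambda>x. inv\<^bsub>G\<^esub> x)"
  using dgroup by (simp_all add: diffeological_group_def case_prod_unfold)

sublocale group G by (rule G)

lemma smooth_map_group_mult: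
  "smooth_map A D f \<Longrightarrow> smooth_map A D g \<Longrightarrow> smooth_map A D (\<lambda>a. f a \<otimes>\<^bsub>G\<^esub> g a)"
  using smooth_map_compose[OF smooth_mult smooth_map_pair] by fastforce

lemma smooth_map_group_inv: "smooth_map A D f \<Longrightarrow> smooth_map A D (\<lambda>a. inv\<^bsub>G\<^esub> (f a))"
  by (rule smooth_map_compose[OF smooth_inv])

lemma diffeology_milnor: "diffeology (milnor_diff G D)"
  unfolding milnor_diff_def by (intro diffeology_subset diffeology_prod diffeology_power diffeology_real dD)

lemma points_milnor: "points (milnor_diff G D) = milnor_set G"
  unfolding milnor_diff_def by (auto simp: power_diff_def points_D milnor_set_def)

lemma smooth_map_into_milnor:
  assumes A: "diffeology A" and t: "\<And>i. smooth_map A real_diff (\<lambda>a. t a i)" and g: "\<And>i. smooth_map A D (\<lambda>a. g a i)"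
    and m: "\<And>a. a \<in> points A \<Longrightarrow> milnor_weight (t a)"
  shows "smooth_map A (milnor_diff G D) (\<lambda>a. (t a, g a))"
  unfolding milnor_diff_def
proof (intro smooth_map_into_subset[OF A] smooth_map_pair smooth_map_into_power[OF A] g t)
  show "t a i \<in> {0..1}" if "a \<in> points A" for a i using m[OF that] unfolding milnor_weight_iff by blast
  show "(t a, g a) \<in> milnor_set G" if "a \<in> points A" for a
    using m[OF that] smooth_map_points[OF g that] by (simp add: milnor_set_iff points_D)
qed

lemma smooth_map_milnor_weight:
  assumes "smooth_map A (milnor_diff G D) f" shows "smooth_map A real_diff (\<lambda>a. fst (f a) i)"
  using smooth_map_out_subset[OF smooth_map_power_coord[OF smooth_map_fst[OF smooth_map_out_subset[OF assms[unfolded milnor_diff_def]]]]] .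

lemma smooth_map_milnor_coord:
  assumes "smooth_map A (milnor_diff G D) f" shows "smooth_map A D (\<lambda>a. snd (f a) i)"
  using smooth_map_power_coord[OF smooth_map_snd[OF smooth_map_out_subset[OF assms[unfolded milnor_diff_def]]]] .

lemma EG_eq: "EG_diff G D = image_diff (milnor_diff G D) (mcl G)"
  by (simp add: EG_diff_def quotient_diff_def)

lemma diffeology_EG: "diffeology (EG_diff G D)"
  unfolding EG_eq by (rule diffeology_image[OF diffeology_milnor])

lemma points_EG: "points (EG_diff G D) = mcl G ` milnor_set G"
  by (simp add: EG_eq points_milnor)

lemma EG_E:
  assumes "c \<in> points (EG_diff G D)"
  obtains t g where "milnor_weight t" "\<And>i. g i \<in> carrier G" "c = mcl G (t, g)" "(t, g) \<in> milnor_set G"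
proof -
  from assms obtain x where "x \<in> milnor_set G" "c = mcl G x" unfolding points_EG by blast
  then show ?thesis by (intro that[of "fst x" "snd x"]) (simp_all add: milnor_set_iff[symmetric], (metis milnor_set_iff prod.collapse)+)
qed

lemma EG_act_mcl:
  assumes x: "(t, g) \<in> milnor_set G" and h: "h \<in> carrier G"
  shows "EG_act G h (mcl G (t, g)) = mcl G (t, \<lambda>i. g i \<otimes>\<^bsub>G\<^esub> inv\<^bsub>G\<^esub> h)"
  unfolding EG_act_def
  by (subst mcl_image[OF x]) (use h x in \<open>auto simp: milnor_rel_iff milnor_set_iff split: prod.splits\<close>)

lemma EG_act_set:
  "(t, g) \<in> milnor_set G \<Longrightarrow> h \<in> carrier G \<Longrightarrow> (t, \<lambda>i. g i \<otimes>\<^bsub>G\<^esub> inv\<^bsub>G\<^esub> h) \<in> milnor_set G"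
  by (auto simp: milnor_set_iff)

lemma EG_act_in: "c \<in> points (EG_diff G D) \<Longrightarrow> h \<in> carrier G \<Longrightarrow> EG_act G h c \<in> points (EG_diff G D)"
  by (erule EG_E) (auto simp: EG_act_mcl points_EG intro!: imageI EG_act_set)

lemma EG_act_one: "c \<in> points (EG_diff G D) \<Longrightarrow> EG_act G \<one>\<^bsub>G\<^esub> c = c"
  by (erule EG_E) (simp add: EG_act_mcl)

lemma EG_act_mult:
  assumes "c \<in> points (EG_diff G D)" and gh: "g \<in> carrier G" "h \<in> carrier G"
  shows "EG_act G (g \<otimes>\<^bsub>G\<^esub> h) c = EG_act G g (EG_act G h c)"
proof -
  from assms(1) obtain t k where x: "milnor_weight t" "\<And>i. k i \<in> carrier G" "c = mcl G (t, k)" "(t, k) \<in> milnor_set G" by (rule EG_E) blast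
  show ?thesis using gh x(2) unfolding x(3)
    by (simp add: EG_act_mcl[OF x(4)] EG_act_mcl[OF EG_act_set[OF x(4)]] inv_mult_group m_assoc)
qed

text \<open>The weights sum to 1, so some weight is nonzero; at that index the group coordinate is
  determined by the class and can be cancelled.\<close>

lemma EG_act_inj:
  assumes "c \<in> points (EG_diff G D)" and gh: "g \<in> carrier G" "h \<in> carrier G" and eq: "EG_act G g c = EG_act G h c"
  shows "g = h"
proof -
  from assms(1) obtain t k where x: "milnor_weight t" "\<And>i. k i \<in> carrier G" "c = mcl G (t, k)" "(t, k) \<in> milnor_set G" by (rule EG_E) blast
  obtain i where i: "t i \<noteq> 0" using milnor_weight_nonzero[OF x(1)] by blast
  have "((t, \<lambda>i. k i \<otimes>\<^bsub>G\<^esub> inv\<^bsub>G\<^esub> g), (t, \<lambda>i. k i \<otimes>\<^bsub>G\<^esub> inv\<^bsub>G\<^esub> h)) \<in> milnor_rel G"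
    using eq unfolding x(3) EG_act_mcl[OF x(4) gh(1)] EG_act_mcl[OF x(4) gh(2)]
    by (subst (asm) mcl_eq_iff) (use EG_act_set[OF x(4)] gh in auto)
  then have "k i \<otimes>\<^bsub>G\<^esub> inv\<^bsub>G\<^esub> g = k i \<otimes>\<^bsub>G\<^esub> inv\<^bsub>G\<^esub> h" using i by (simp add: milnor_rel_iff)
  then show ?thesis using x(2) gh by (metis inv_closed inv_inv Units_eq Units_l_cancel)
qed

definition "EG_quot c = EG_orbit_rel G D `` {c}"

lemma BG_eq: "BG_diff G D = image_diff (EG_diff G D) EG_quot"
  by (simp add: BG_diff_def quotient_diff_def EG_quot_def[abs_def])

lemma orbit_iff: "(c, d) \<in> EG_orbit_rel G D \<longleftrightarrow> c \<in> points (EG_diff G D) \<and> (\<exists>h\<in>carrier G. d = EG_act G h c)"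
  by (simp add: EG_orbit_rel_def)

lemma equiv_orbit: "equiv (points (EG_diff G D)) (EG_orbit_rel G D)"
proof (rule equivI)
  show "EG_orbit_rel G D \<subseteq> points (EG_diff G D) \<times> points (EG_diff G D)"
    by (auto simp: orbit_iff EG_act_in)
  show "refl_on (points (EG_diff G D)) (EG_orbit_rel G D)"
    by (rule refl_onI) (auto simp: orbit_iff EG_act_one intro!: bexI[of _ "\<one>\<^bsub>G\<^esub>"])
  show "sym (EG_orbit_rel G D)"
  proof (rule symI)
    fix c d assume "(c, d) \<in> EG_orbit_rel G D"
    then obtain h where h: "c \<in> points (EG_diff G D)" "h \<in> carrier G" "d = EG_act G h c" by (auto simp: orbit_iff)
    have "c = EG_act G (inv\<^bsub>G\<^esub> h) d" using h by (simp add: EG_act_mult[symmetric] EG_act_one)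
    then show "(d, c) \<in> EG_orbit_rel G D" using h by (auto simp: orbit_iff EG_act_in)
  qed
  show "trans (EG_orbit_rel G D)"
  proof (rule transI)
    fix c d e assume "(c, d) \<in> EG_orbit_rel G D" "(d, e) \<in> EG_orbit_rel G D"
    then obtain g h where "c \<in> points (EG_diff G D)" "g \<in> carrier G" "d = EG_act G g c" "h \<in> carrier G" "e = EG_act G h d"
      by (auto simp: orbit_iff)
    then show "(c, e) \<in> EG_orbit_rel G D"
      by (auto simp: orbit_iff EG_act_mult[symmetric] intro!: bexI[of _ "h \<otimes>\<^bsub>G\<^esub> g"])
  qed
qed

lemma EG_quot_eq_iff:
  "c \<in> points (EG_diff G D) \<Longrightarrow> d \<in> points (EG_diff G D) \<Longrightarrow> EG_quot c = EG_quot d \<longleftrightarrow> (\<exists>h\<in>carrier G. d = EG_act G h c)"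
  unfolding EG_quot_def by (subst eq_equiv_class_iff[OF equiv_orbit]) (auto simp: orbit_iff)

definition "EG_div c d = (THE h. h \<in> carrier G \<and> d = EG_act G h c)"

lemma EG_div_eq: "c \<in> points (EG_diff G D) \<Longrightarrow> h \<in> carrier G \<Longrightarrow> EG_div c (EG_act G h c) = h"
  unfolding EG_div_def using EG_act_inj by (intro the_equality) auto

lemma EG_act_div:
  assumes "c \<in> points (EG_diff G D)" "d \<in> points (EG_diff G D)" "EG_quot c = EG_quot d"
  shows "EG_act G (EG_div c d) c = d" "EG_div c d \<in> carrier G"
  using assms EG_div_eq[OF assms(1)] by (auto simp: EG_quot_eq_iff)

lemma smooth_EG_act: "smooth_map (prod_diff D (EG_diff G D)) (EG_diff G D) (\<lambda>z. EG_act G (fst z) (snd z))"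
proof -
  let ?M = "milnor_diff G D" and ?P = "prod_diff D (milnor_diff G D)"
  have dP: "diffeology ?P" by (intro diffeology_prod dD diffeology_milnor)
  have m: "smooth_map ?P ?M (\<lambda>z. snd z)" by (rule smooth_map_snd[OF smooth_map_id])
  have "smooth_map ?P ?M (\<lambda>z. (fst (snd z), \<lambda>i. snd (snd z) i \<otimes>\<^bsub>G\<^esub> inv\<^bsub>G\<^esub> (fst z)))"
    by (intro smooth_map_into_milnor dP smooth_map_milnor_weight[OF m] smooth_map_group_mult
        smooth_map_milnor_coord[OF m] smooth_map_group_inv smooth_map_fst[OF smooth_map_id])
      (auto simp: points_milnor milnor_set_iff)
  note s = smooth_map_into_image[OF diffeology_milnor this, of "mcl G"]
  have "smooth_map ?P (image_diff ?M (mcl G)) (\<lambda>z. EG_act G (fst z) (mcl G (snd z)))"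
  proof (rule smooth_map_cong[OF dP diffeology_image[OF diffeology_milnor] s])
    fix z assume "z \<in> points ?P"
    then show "mcl G (fst (snd z), \<lambda>i. snd (snd z) i \<otimes>\<^bsub>G\<^esub> inv\<^bsub>G\<^esub> (fst z)) = EG_act G (fst z) (mcl G (snd z))"
      using EG_act_mcl[of "fst (snd z)" "snd (snd z)" "fst z"] by (auto simp: points_D points_milnor)
  qed
  then have "smooth_map (prod_diff (image_diff D (\<lambda>x. x)) (image_diff ?M (mcl G))) (image_diff ?M (mcl G))
      (\<lambda>z. EG_act G (fst z) (snd z))"
    by (intro smooth_map_from_prod_image dD diffeology_milnor diffeology_image) simp
  then show ?thesis by (simp add: EG_eq dD)
qed

text \<open>
  Where the \<open>i\<close>-th weight is nonzero, the \<open>i\<close>-th group coordinates of two points in the same orbit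
  determine the element of \<open>G\<close> that relates them.
\<close>

lemma smooth_EG_div:
  "smooth_map (subset_diff (prod_diff (EG_diff G D) (EG_diff G D)) {z. EG_quot (fst z) = EG_quot (snd z)}) D
     (\<lambda>z. EG_div (fst z) (snd z))"
proof (rule smooth_mapI)
  let ?E = "EG_diff G D" and ?M = "milnor_diff G D"
  let ?S = "subset_diff (prod_diff ?E ?E) {z. EG_quot (fst z) = EG_quot (snd z)}"
  show "EG_div (fst z) (snd z) \<in> points D" if "z \<in> points ?S" for z
  proof -
    have "fst z \<in> points ?E" "snd z \<in> points ?E" "EG_quot (fst z) = EG_quot (snd z)" using that by auto
    then show ?thesis unfolding points_D by (rule EG_act_div(2))
  qed
  fix n U p assume p: "plot ?S n U p"
  then have p1: "plot ?E n U (\<lambda>u. fst (p u))" and p2: "plot ?E n U (\<lambda>u. snd (p u))"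
    and "p ` U \<subseteq> {z. EG_quot (fst z) = EG_quot (snd z)}"
    by (simp_all add: plot_subset_iff plot_prod)
  then have pq: "EG_quot (fst (p u)) = EG_quot (snd (p u))" if "u \<in> U" for u using that by blast
  show "plot D n U (\<lambda>u. EG_div (fst (p u)) (snd (p u)))"
  proof (rule plot_local[OF dD])
    show "eopen n U" by (rule plot_openin[OF diffeology_EG p1])
    fix u assume u: "u \<in> U"
    obtain V r where V: "eopen n V" "u \<in> V" "V \<subseteq> U" "plot ?M n V r"
      "\<And>v. v \<in> V \<Longrightarrow> fst (p v) = mcl G (r v)" by (rule plot_imageE[OF p1[unfolded EG_eq] u]) blast
    obtain W s where W: "eopen n W" "u \<in> W" "W \<subseteq> U" "plot ?M n W s"
      "\<And>v. v \<in> W \<Longrightarrow> snd (p v) = mcl G (s v)" by (rule plot_imageE[OF p2[unfolded EG_eq] u]) blast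
    have rM: "r v \<in> milnor_set G" if "v \<in> V" for v using plot_points[OF diffeology_milnor V(4) that] by (simp only: points_milnor)
    have sM: "s v \<in> milnor_set G" if "v \<in> W" for v using plot_points[OF diffeology_milnor W(4) that] by (simp only: points_milnor)
    have "(fst (r u), snd (r u)) \<in> milnor_set G" using rM[OF V(2)] by simp
    then have "milnor_weight (fst (r u))" unfolding milnor_set_iff by (rule conjunct1)
    then obtain i where i: "fst (r u) i \<noteq> 0" using milnor_weight_nonzero by blast
    have "smooth_fun n V (\<lambda>v. fst (r v) i)"
      by (rule smooth_map_realD[OF smooth_map_milnor_weight[OF smooth_map_id] V(4)])
    from smooth_fun_preimage[OF this open_Compl[OF closed_singleton, of 0]]
    have O: "eopen n {v \<in> V. fst (r v) i \<noteq> 0}" by simp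
    define T where "T = {v \<in> V. fst (r v) i \<noteq> 0} \<inter> W"
    have T: "eopen n T" "u \<in> T" "T \<subseteq> V" "T \<subseteq> W" "\<And>v. v \<in> T \<Longrightarrow> fst (r v) i \<noteq> 0"
      using O W(1,2) V(2) i by (auto simp: T_def)
    have ri: "plot D n T (\<lambda>v. snd (r v) i)"
      by (rule plot_subset[OF dD smooth_map_plot[OF smooth_map_milnor_coord[OF smooth_map_id] V(4)] T(1,3)])
    have si: "plot D n T (\<lambda>v. snd (s v) i)"
      by (rule plot_subset[OF dD smooth_map_plot[OF smooth_map_milnor_coord[OF smooth_map_id] W(4)] T(1,4)])
    \<comment> \<open>Solving \<open>s_i = r_i h^-1\<close> for \<open>h\<close> gives
      \<open>s_i^-1 r_i\<close>.\<close>
    have "plot D n T (\<lambda>v. inv\<^bsub>G\<^esub> (snd (s v) i) \<otimes>\<^bsub>G\<^esub> snd (r v) i)"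
      using smooth_map_plot[OF smooth_mult, of n T "\<lambda>v. (inv\<^bsub>G\<^esub> (snd (s v) i), snd (r v) i)"]
        smooth_map_plot[OF smooth_inv si] ri by (simp add: plot_prod)
    moreover have "inv\<^bsub>G\<^esub> (snd (s v) i) \<otimes>\<^bsub>G\<^esub> snd (r v) i = EG_div (fst (p v)) (snd (p v))" if v: "v \<in> T" for v
    proof -
      have vV: "v \<in> V" "v \<in> W" "v \<in> U" using v T V by auto
      have x: "(fst (r v), snd (r v)) \<in> milnor_set G" "(fst (s v), snd (s v)) \<in> milnor_set G" using rM sM vV by simp_all
      have eq: "fst (p v) = mcl G (fst (r v), snd (r v))" "snd (p v) = mcl G (fst (s v), snd (s v))" using V(5) W(5) vV by simp_all
      have c: "fst (p v) \<in> points ?E" "snd (p v) \<in> points ?E" using eq x by (auto simp: points_EG)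
      let ?h = "EG_div (fst (p v)) (snd (p v))"
      have h: "?h \<in> carrier G" "EG_act G ?h (fst (p v)) = snd (p v)" using EG_act_div[OF c pq[OF vV(3)]] by auto
      have "((fst (r v), \<lambda>i. snd (r v) i \<otimes>\<^bsub>G\<^esub> inv\<^bsub>G\<^esub> ?h), (fst (s v), snd (s v))) \<in> milnor_rel G"
        using h(2) unfolding eq EG_act_mcl[OF x(1) h(1)[unfolded eq]]
        by (subst (asm) mcl_eq_iff) (use EG_act_set[OF x(1) h(1)] x(2) eq in auto)
      then have "snd (s v) i = snd (r v) i \<otimes>\<^bsub>G\<^esub> inv\<^bsub>G\<^esub> ?h" using T(5)[OF v] unfolding milnor_rel_iff by simp
      moreover have "snd (r v) i \<in> carrier G" using x(1) unfolding milnor_set_iff by simp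
      ultimately show ?thesis using h(1) by (simp add: inv_mult_group m_assoc)
    qed
    ultimately show "plot_near D n U (\<lambda>v. EG_div (fst (p v)) (snd (p v))) u"
      using T(1,2) subset_trans[OF T(3) V(3)]
      by (intro exI[of _ T] exI[of _ "\<lambda>v. inv\<^bsub>G\<^esub> (snd (s v) i) \<otimes>\<^bsub>G\<^esub> snd (r v) i"]) simp
  qed
qed

text \<open>Local lifts exist by the definition of the quotient diffeology; the substantial
  condition is the smoothness of division.\<close>

sublocale EG: principal_bundle D "(\<otimes>\<^bsub>G\<^esub>)" "\<one>\<^bsub>G\<^esub>" "EG_diff G D" "BG_diff G D" "EG_act G" EG_div EG_quot
proof
  show "diffeology D" "diffeology (EG_diff G D)" by (rule dD diffeology_EG)+
  show "diffeology (BG_diff G D)" unfolding BG_eq by (rule diffeology_image[OF diffeology_EG])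
  show "smooth_map (EG_diff G D) (BG_diff G D) EG_quot" unfolding BG_eq by (rule smooth_map_proj_image[OF diffeology_EG])
  show "smooth_map (prod_diff D (EG_diff G D)) (EG_diff G D) (\<lambda>z. EG_act G (fst z) (snd z))" by (rule smooth_EG_act)
  show "smooth_map (subset_diff (prod_diff (EG_diff G D) (EG_diff G D)) {z. EG_quot (fst z) = EG_quot (snd z)}) D
     (\<lambda>z. EG_div (fst z) (snd z))" by (rule smooth_EG_div)
  show "\<one>\<^bsub>G\<^esub> \<in> points D" by (simp add: points_D)
  show "g \<otimes>\<^bsub>G\<^esub> h \<in> points D" if "g \<in> points D" "h \<in> points D" for g h using that by (simp add: points_D)
  show "EG_act G \<one>\<^bsub>G\<^esub> x = x" if "x \<in> points (EG_diff G D)" for x using that by (rule EG_act_one)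
  show "EG_act G (g \<otimes>\<^bsub>G\<^esub> h) x = EG_act G g (EG_act G h x)" if "g \<in> points D" "h \<in> points D" "x \<in> points (EG_diff G D)" for g h x
    using that by (simp add: EG_act_mult points_D)
  show "EG_quot (EG_act G g x) = EG_quot x" if "g \<in> points D" "x \<in> points (EG_diff G D)" for g x
    using that EG_quot_eq_iff[OF that(2) EG_act_in[OF that(2)]] by (auto simp: points_D)
  show "EG_act G (EG_div x y) x = y" if "x \<in> points (EG_diff G D)" "y \<in> points (EG_diff G D)" "EG_quot x = EG_quot y" for x y
    using that by (rule EG_act_div)
  show "EG_div x (EG_act G g x) = g" if "g \<in> points D" "x \<in> points (EG_diff G D)" for g x
    using that by (simp add: EG_div_eq points_D)
  fix n U p u assume "plot (BG_diff G D) n U p" "u \<in> U"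
  then obtain V r where "eopen n V" "u \<in> V" "V \<subseteq> U" "plot (EG_diff G D) n V r" "\<forall>v\<in>V. p v = EG_quot (r v)"
    unfolding BG_eq image_diff_def by auto
  then show "\<exists>V r. eopen n V \<and> u \<in> V \<and> V \<subseteq> U \<and> plot (EG_diff G D) n V r \<and> (\<forall>v\<in>V. EG_quot (r v) = p v)"
    by (intro exI[of _ V] exI[of _ r]) simp
qed

end

section \<open>Contractibility of the total space\<close>

abbreviation psum :: "(nat \<Rightarrow> real) \<Rightarrow> nat \<Rightarrow> real" where
  "psum t n \<equiv> (\<Sum>j<n. t j)"

lemma milnor_weight_psum:
  assumes "milnor_weight t"
  shows "m \<le> n \<Longrightarrow> psum t m \<le> psum t n" and "\<exists>N. \<forall>n\<ge>N. psum t n = 1"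
proof -
  obtain N where N: "\<And>i. 0 \<le> t i" "\<And>i. i \<ge> N \<Longrightarrow> t i = 0" "psum t N = 1" using assms unfolding milnor_weight_def by blast
  show "m \<le> n \<Longrightarrow> psum t m \<le> psum t n" by (rule sum_mono2) (use N(1) in auto)
  show "\<exists>N. \<forall>n\<ge>N. psum t n = 1" using milnor_weight_sum[of N t] N(2,3) by (intro exI[of _ N]) simp
qed

text \<open>A monotone function that fixes 0 and 1 redistributes the total mass among the indices,
  and the sum of the new weights telescopes.\<close>

lemma milnor_weight_increments:
  assumes t: "milnor_weight t" and mono: "\<And>x y. x \<le> y \<Longrightarrow> \<kappa> x \<le> \<kappa> y" and \<kappa>: "\<kappa> 0 = 0" "\<kappa> 1 = 1"
  shows "milnor_weight (\<lambda>n. \<kappa> (psum t (Suc n)) - \<kappa> (psum t n))"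
proof -
  obtain N where N: "\<And>n. n \<ge> N \<Longrightarrow> psum t n = 1" using milnor_weight_psum(2)[OF t] by blast
  have "psum t n \<le> psum t (Suc n)" for n by (rule milnor_weight_psum(1)[OF t]) simp
  then have "0 \<le> \<kappa> (psum t (Suc n)) - \<kappa> (psum t n)" for n using mono by (simp only: diff_ge_0_iff_ge)
  moreover have "\<kappa> (psum t (Suc n)) - \<kappa> (psum t n) = 0" if "n \<ge> N" for n using N[of n] N[of "Suc n"] that by simp
  moreover have "(\<Sum>n<N. \<kappa> (psum t (Suc n)) - \<kappa> (psum t n)) = 1"
    using sum_lessThan_telescope[of "\<lambda>n. \<kappa> (psum t n)" N] N[of N] \<kappa> by simp
  ultimately show ?thesis unfolding milnor_weight_def by blast
qed

text \<open>
  Along a plot of \<open>S_G\<close> infinitely many weights \<open>t i\<close> may be nonzero near a given point. The weights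
  \<open>early t\<close> and \<open>late t\<close> are locally finite, and their supports are separated by the value of the
  partial sum: below \<open>3/4\<close> for the former, above \<open>13/16\<close> for the latter. Hence \<open>(early t, g)\<close> can be
  joined to \<open>(late t, 1)\<close> by a line segment, whatever \<open>g\<close> is.
\<close>

definition early :: "(nat \<Rightarrow> real) \<Rightarrow> nat \<Rightarrow> real" where
  "early t n = smashing_fun (psum t (Suc n)) - smashing_fun (psum t n)"

definition late :: "(nat \<Rightarrow> real) \<Rightarrow> nat \<Rightarrow> real" where
  "late t n = (case n of 0 \<Rightarrow> 0 | Suc k \<Rightarrow> smashing_fun (4 * psum t (Suc k) - 3) - smashing_fun (4 * psum t k - 3))"

lemma milnor_weight_early: "milnor_weight t \<Longrightarrow> milnor_weight (early t)"
  unfolding early_def[abs_def] by (rule milnor_weight_increments) (simp_all add: smashing_mono)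

lemma milnor_weight_late:
  assumes "milnor_weight t" shows "milnor_weight (late t)"
proof -
  have "milnor_weight (\<lambda>n. smashing_fun (4 * psum t (Suc n) - 3) - smashing_fun (4 * psum t n - 3))" (is "milnor_weight ?v")
    using milnor_weight_increments[OF assms, of "\<lambda>x. smashing_fun (4 * x - 3)"] by (simp add: smashing_mono)
  then obtain N where N: "\<And>i. 0 \<le> ?v i" "\<And>i. i \<ge> N \<Longrightarrow> ?v i = 0" "(\<Sum>i<N. ?v i) = 1" unfolding milnor_weight_def by blast
  have late: "late t 0 = 0" "late t (Suc i) = ?v i" for i by (simp_all only: late_def nat.case)
  have "0 \<le> late t i" for i by (cases i) (simp_all only: late N(1) order_refl)
  moreover have "late t i = 0" if "i \<ge> Suc N" for i using that N(2) by (cases i) (simp_all only: late Suc_le_mono)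
  moreover have "(\<Sum>i<Suc N. late t i) = late t 0 + (\<Sum>i<N. late t (Suc i))" by (rule sum.lessThan_Suc_shift)
  then have "(\<Sum>i<Suc N. late t i) = 1" unfolding late N(3) by simp
  ultimately show ?thesis unfolding milnor_weight_def by blast
qed

text \<open>From 3/4 on \<open>smashing_fun\<close> is constant, so no nonzero increment starts
  there. That early weights vanish where \<open>t\<close> does makes the class of
  \<open>(early t, g)\<close> independent of the representative.\<close>

lemma early_nonzero:
  assumes t: "milnor_weight t" and n: "early t n \<noteq> 0"
  shows "t n \<noteq> 0" and "psum t n < 3/4"
proof -
  show "t n \<noteq> 0" using n by (auto simp: early_def)
  show "psum t n < 3/4"
  proof (rule ccontr)
    assume "\<not> psum t n < 3/4"
    moreover have "psum t n \<le> psum t (Suc n)" by (rule milnor_weight_psum(1)[OF t]) simp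
    ultimately show False using n unfolding early_def by simp
  qed
qed

text \<open>The map 4x - 3 stretches [3/4, 1] to [0, 1], and it exceeds 1/4 exactly for x above
  13/16. Because of the index shift in \<open>late\<close>, the increment of index \<open>n\<close>
  ends at \<open>psum t n\<close>, the value at which the increment in \<open>early\<close> begins.
  One quantity thus separates the two supports.\<close>

lemma late_nonzero:
  assumes t: "milnor_weight t" and n: "late t n \<noteq> 0"
  shows "psum t n > 13/16"
proof -
  obtain k where k: "n = Suc k" using n by (cases n) (simp_all add: late_def)
  have "psum t k \<le> psum t n" by (rule milnor_weight_psum(1)[OF t]) (simp add: k)
  then have "4 * psum t k - 3 \<le> 4 * psum t n - 3" by simp
  show ?thesis
  proof (rule ccontr)
    assume "\<not> psum t n > 13/16"
    then have "4 * psum t n - 3 \<le> 1/4" "4 * psum t k - 3 \<le> 1/4" using \<open>4 * psum t k - 3 \<le> 4 * psum t n - 3\<close> by linarith+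
    then show False using n unfolding late_def k nat.case by simp
  qed
qed

text \<open>At 15/16 the argument 4x - 3 reaches 3/4, beyond which all increments vanish. The
  hypothesis on \<open>psum t J\<close> is an open condition, so this is local finiteness with a
  bound \<open>J\<close> valid nearby.\<close>

lemma early_late_zero:
  assumes t: "milnor_weight t" and J: "psum t J > 15/16" and n: "n > J"
  shows "early t n = 0" "late t n = 0"
proof -
  have ge: "psum t m > 15/16" if "m \<ge> J" for m using milnor_weight_psum(1)[OF t that] J by linarith
  show "early t n = 0" using early_nonzero(2)[OF t, of n] ge[of n] n by force
  obtain k where k: "n = Suc k" using n by (cases n) auto
  have "4 * psum t (Suc k) - 3 \<ge> 3/4" "4 * psum t k - 3 \<ge> 3/4" using ge[of "Suc k"] ge[of k] n k by simp_all
  then show "late t n = 0" unfolding late_def k nat.case by simp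
qed

lemma smooth_map_psum:
  assumes A: "diffeology A" and t: "\<And>i. smooth_map A real_diff (\<lambda>a. t a i)"
  shows "smooth_map A real_diff (\<lambda>a. psum (t a) n)"
  by (induction n) (simp_all add: smooth_map_real_const[OF A] smooth_map_add t del: sum.lessThan_Suc add: sum.lessThan_Suc)

lemma smooth_map_early:
  assumes A: "diffeology A" and t: "\<And>i. smooth_map A real_diff (\<lambda>a. t a i)"
  shows "smooth_map A real_diff (\<lambda>a. early (t a) n)"
  unfolding early_def by (intro smooth_map_diff smooth_map_smashing smooth_map_psum A t)

lemma smooth_map_late:
  assumes A: "diffeology A" and t: "\<And>i. smooth_map A real_diff (\<lambda>a. t a i)"
  shows "smooth_map A real_diff (\<lambda>a. late (t a) n)"
proof (cases n)
  case (Suc k)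
  show ?thesis unfolding late_def Suc nat.case
    by (intro smooth_map_diff smooth_map_smashing smooth_map_mult smooth_map_real_const smooth_map_psum A t)
qed (simp add: late_def smooth_map_real_const[OF A])

context dgroup
begin

lemma smooth_map_milnor_weights:
  "smooth_map (prod_diff (milnor_diff G D) real_diff) real_diff (\<lambda>z. fst (fst z) i)"
  "smooth_map (prod_diff (milnor_diff G D) real_diff) D (\<lambda>z. snd (fst z) i)"
  by (rule smooth_map_milnor_weight smooth_map_milnor_coord, rule smooth_map_fst[OF smooth_map_id])+

text \<open>A homotopy given on representatives descends: invariance makes the choice by
  \<open>SOME\<close> immaterial, and smoothness passes down because the product of the quotient map
  with the identity of R is again a quotient map.\<close>

lemma EG_homotopic:
  assumes F: "smooth_map (prod_diff (milnor_diff G D) real_diff) (EG_diff G D) (\<lambda>z. F (fst z) (snd z))"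
    and inv: "\<And>x y s. (x, y) \<in> milnor_rel G \<Longrightarrow> F x s = F y s"
    and f: "\<And>x. x \<in> milnor_set G \<Longrightarrow> f (mcl G x) = F x 0" and g: "\<And>x. x \<in> milnor_set G \<Longrightarrow> g (mcl G x) = F x 1"
  shows "smoothly_homotopic (EG_diff G D) (EG_diff G D) f g"
proof -
  define H where "H c = F (SOME x. x \<in> c)" for c
  have H: "H (mcl G x) s = F x s" if "x \<in> milnor_set G" for x s
  proof -
    have "x \<in> mcl G x" using that equiv_milnor_rel by (rule equiv_class_self[rotated])
    then have "(SOME y. y \<in> mcl G x) \<in> mcl G x" by (rule someI)
    then show ?thesis unfolding H_def using inv by (metis Image_singleton_iff)
  qed
  let ?M = "milnor_diff G D"
  have dM: "diffeology (prod_diff ?M real_diff)" by (intro diffeology_prod diffeology_milnor diffeology_real)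
  have "smooth_map (prod_diff ?M real_diff) (EG_diff G D) (\<lambda>z. H (mcl G (fst z)) (snd z))"
    by (rule smooth_map_cong[OF dM diffeology_EG F]) (auto simp: H points_milnor)
  then have "smooth_map (prod_diff (image_diff ?M (mcl G)) (image_diff real_diff (\<lambda>x. x))) (EG_diff G D) (\<lambda>z. H (fst z) (snd z))"
    by (intro smooth_map_from_prod_image diffeology_milnor diffeology_real diffeology_EG) simp
  then have "smooth_map (prod_diff (EG_diff G D) real_diff) (EG_diff G D) (\<lambda>z. H (fst z) (snd z))"
    by (simp add: diffeology_real flip: EG_eq)
  then show ?thesis
    by (rule smoothly_homotopicI) (auto simp: points_EG H f g)
qed

text \<open>Homotopies are parametrised by all real \<open>s\<close>; \<open>smashing_fun\<close>
  keeps the coefficients of the combination in [0, 1].\<close>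

lemma milnor_weight_convex_smashing:
  "milnor_weight t \<Longrightarrow> milnor_weight u \<Longrightarrow> milnor_weight (\<lambda>i. (1 - smashing_fun s) * t i + smashing_fun s * u i)"
  by (rule milnor_weight_convex) simp_all

text \<open>Only the weights move. Where \<open>t\<close> vanishes so does the mixture, hence the
  group coordinates that matter are those fixed by the class.\<close>

lemma EG_homotopic_early:
  assumes g: "\<And>x. x \<in> milnor_set G \<Longrightarrow> g (mcl G x) = mcl G (early (fst x), snd x)"
  shows "smoothly_homotopic (EG_diff G D) (EG_diff G D) (\<lambda>c. c) g"
proof (rule EG_homotopic[where F = "\<lambda>x s. mcl G (\<lambda>i. (1 - smashing_fun s) * fst x i + smashing_fun s * early (fst x) i, snd x)"])
  let ?P = "prod_diff (milnor_diff G D) real_diff"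
  have dP: "diffeology ?P" by (intro diffeology_prod diffeology_milnor diffeology_real)
  have w: "milnor_weight (fst x)" "\<And>i. snd x i \<in> carrier G" if "x \<in> milnor_set G" for x
    using that milnor_set_iff[of "fst x" "snd x" G] by simp_all
  have s: "smooth_map ?P real_diff (\<lambda>z. snd z)" by (rule smooth_map_snd[OF smooth_map_id])
  have "smooth_map ?P (milnor_diff G D) (\<lambda>z. (\<lambda>i. (1 - smashing_fun (snd z)) * fst (fst z) i + smashing_fun (snd z) * early (fst (fst z)) i, snd (fst z)))"
    by (intro smooth_map_into_milnor dP smooth_map_add smooth_map_mult smooth_map_diff smooth_map_smashing s smooth_map_real_const
        smooth_map_early smooth_map_milnor_weights milnor_weight_convex_smashing milnor_weight_early w) (auto simp: points_milnor)
  from smooth_map_into_image[OF diffeology_milnor this, of "mcl G"]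
  show "smooth_map ?P (EG_diff G D)
     (\<lambda>z. mcl G (\<lambda>i. (1 - smashing_fun (snd z)) * fst (fst z) i + smashing_fun (snd z) * early (fst (fst z)) i, snd (fst z)))"
    by (simp add: EG_eq)
  show "mcl G (\<lambda>i. (1 - smashing_fun s) * fst x i + smashing_fun s * early (fst x) i, snd x) =
      mcl G (\<lambda>i. (1 - smashing_fun s) * fst y i + smashing_fun s * early (fst y) i, snd y)"
    if xy: "(x, y) \<in> milnor_rel G" for x y s
  proof -
    have x: "x \<in> milnor_set G" "y \<in> milnor_set G" "fst x = fst y" "\<And>i. fst x i \<noteq> 0 \<Longrightarrow> snd x i = snd y i"
      using xy milnor_rel_iff[of "fst x" "snd x" "fst y" "snd y" G] by simp_all
    have nz: "fst x i \<noteq> 0" if "(1 - smashing_fun s) * fst x i + smashing_fun s * early (fst x) i \<noteq> 0" for i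
      using that early_nonzero(1)[OF w(1)[OF x(1)], of i] by (cases "fst x i = 0") auto
    show ?thesis
    proof (subst mcl_eq_iff)
      show "((\<lambda>i. (1 - smashing_fun s) * fst x i + smashing_fun s * early (fst x) i, snd x),
          (\<lambda>i. (1 - smashing_fun s) * fst y i + smashing_fun s * early (fst y) i, snd y)) \<in> milnor_rel G"
        unfolding milnor_rel_iff milnor_set_iff
        using w[OF x(1)] w[OF x(2)] x(3) x(4)[OF nz]
        by (auto intro!: milnor_weight_convex_smashing milnor_weight_early)
    qed (use w[OF x(1)] w[OF x(2)] in \<open>auto simp: milnor_set_iff intro!: milnor_weight_convex_smashing milnor_weight_early\<close>)
  qed
qed (simp_all add: g)

text \<open>\<open>K\<close> switches from the old coordinates to the unit element where the partial
  sum reaches 13/16. It jumps, but only at indices of weight zero, since no weight is carried by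
  partial sums from 3/4 to 13/16; the class is therefore smooth although \<open>K\<close> is
  not.\<close>

lemma EG_homotopic_late:
  assumes f: "\<And>x. x \<in> milnor_set G \<Longrightarrow> f (mcl G x) = mcl G (early (fst x), snd x)"
    and g: "\<And>x. x \<in> milnor_set G \<Longrightarrow> g (mcl G x) = mcl G (late (fst x), \<lambda>_. \<one>\<^bsub>G\<^esub>)"
  shows "smoothly_homotopic (EG_diff G D) (EG_diff G D) f g"
proof -
  define W where "W x s = (\<lambda>i. (1 - smashing_fun s) * early (fst x) i + smashing_fun s * late (fst x) i)" for x :: "(nat \<Rightarrow> real) \<times> (nat \<Rightarrow> 'a)" and s
  define K where "K x = (\<lambda>i. if psum (fst x) i < 13/16 then snd x i else \<one>\<^bsub>G\<^esub>)" for x :: "(nat \<Rightarrow> real) \<times> (nat \<Rightarrow> 'a)"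
  let ?P = "prod_diff (milnor_diff G D) real_diff"
  have dP: "diffeology ?P" by (intro diffeology_prod diffeology_milnor diffeology_real)
  have w: "milnor_weight (fst x)" "\<And>i. snd x i \<in> carrier G" if "x \<in> milnor_set G" for x
    using that milnor_set_iff[of "fst x" "snd x" G] by simp_all
  have WW: "milnor_weight (W x s)" if "x \<in> milnor_set G" for x s
    unfolding W_def using that by (intro milnor_weight_convex_smashing milnor_weight_early milnor_weight_late w)
  have WK: "(W x s, K x) \<in> milnor_set G" if "x \<in> milnor_set G" for x s
    unfolding milnor_set_iff using WW[OF that] w(2)[OF that] by (simp add: K_def)
  have W0: "psum (fst x) i < 3/4 \<or> psum (fst x) i > 13/16" if "x \<in> milnor_set G" "W x s i \<noteq> 0" for x s i
  proof (cases "early (fst x) i = 0")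
    case True
    then have "late (fst x) i \<noteq> 0" using that(2) by (auto simp: W_def)
    then show ?thesis using late_nonzero[OF w(1)[OF that(1)]] by blast
  next
    case False
    then show ?thesis using early_nonzero(2)[OF w(1)[OF that(1)]] by blast
  qed
  have s: "smooth_map ?P real_diff (\<lambda>z. snd z)" by (rule smooth_map_snd[OF smooth_map_id])
  have sW: "smooth_map ?P real_diff (\<lambda>z. W (fst z) (snd z) i)" for i
    unfolding W_def by (intro dP smooth_map_add smooth_map_mult smooth_map_diff smooth_map_smashing s smooth_map_real_const
        smooth_map_early smooth_map_late smooth_map_milnor_weights)
  have sT: "smooth_map ?P real_diff (\<lambda>z. psum (fst (fst z)) i)" for i
    by (intro smooth_map_psum dP smooth_map_milnor_weights)
  show ?thesis
  proof (rule EG_homotopic[where F = "\<lambda>x s. mcl G (W x s, K x)"])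
    show "smooth_map ?P (EG_diff G D) (\<lambda>z. mcl G (W (fst z) (snd z), K (fst z)))"
    proof (rule smooth_map_local[OF dP diffeology_EG])
      fix z0 assume "z0 \<in> points ?P"
      then have x0: "fst z0 \<in> milnor_set G" by (auto simp: points_milnor)
      let ?T = "\<lambda>z i. psum (fst (fst z)) i"
      obtain J where J: "?T z0 J = 1" using milnor_weight_psum(2)[OF w(1)[OF x0]] by blast
      \<comment> \<open>The two ranges overlap between 3/4 and 13/16, so each is an open
        neighbourhood of the value at \<open>z0\<close>. Inside the overlap the weight vanishes and
        either choice of coordinate gives the same class.\<close>
      define R where "R i = (if ?T z0 i < 13/16 then {..<13/16::real} else {3/4<..})" for i
      define S :: "(((nat \<Rightarrow> real) \<times> (nat \<Rightarrow> 'a)) \<times> real) set" where "S = {z. ?T z J \<in> {15/16<..}} \<inter> (\<Inter>i\<in>{..J}. {z. ?T z i \<in> R i})"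
      have oS: "dopen ?P S"
        unfolding S_def by (intro dopen_Int dopen_INT dP dopen_preimage sT) (simp_all add: R_def)
      have zS: "z0 \<in> S" unfolding S_def using J by (auto simp: R_def)
      \<comment> \<open>The choice of coordinate, frozen at its value for \<open>z0\<close>. On
        \<open>S\<close> no index beyond \<open>J\<close> carries weight, so finitely many choices
        suffice.\<close>
      define c where "c i \<longleftrightarrow> i \<le> J \<and> ?T z0 i < 13/16" for i
      have dS: "diffeology (subset_diff ?P S)" by (rule diffeology_subset[OF dP])
      have "smooth_map (subset_diff ?P S) (milnor_diff G D) (\<lambda>z. (W (fst z) (snd z), \<lambda>i. if c i then snd (fst z) i else \<one>\<^bsub>G\<^esub>))"
      proof (rule smooth_map_into_milnor[OF dS])
        show "smooth_map (subset_diff ?P S) real_diff (\<lambda>z. W (fst z) (snd z) i)" for i by (rule smooth_map_from_subset[OF sW])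
        show "smooth_map (subset_diff ?P S) D (\<lambda>z. if c i then snd (fst z) i else \<one>\<^bsub>G\<^esub>)" for i
          by (cases "c i") (simp_all add: smooth_map_from_subset smooth_map_milnor_weights smooth_map_const[OF dS dD] points_D)
        show "milnor_weight (W (fst z) (snd z))" if "z \<in> points (subset_diff ?P S)" for z
          using that by (intro WW) (auto simp: points_milnor)
      qed
      note sm = smooth_map_into_image[OF diffeology_milnor this, of "mcl G"]
      have "smooth_map (subset_diff ?P S) (EG_diff G D) (\<lambda>z. mcl G (W (fst z) (snd z), K (fst z)))"
        unfolding EG_eq
      proof (rule smooth_map_cong[OF dS diffeology_image[OF diffeology_milnor] sm])
        fix z assume "z \<in> points (subset_diff ?P S)"
        then have x: "fst z \<in> milnor_set G" and zS: "z \<in> S" by (auto simp: points_milnor)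
        have TJ: "?T z J > 15/16" and TR: "\<And>i. i \<le> J \<Longrightarrow> ?T z i \<in> R i" using zS by (auto simp: S_def)
        have eq: "(if c i then snd (fst z) i else \<one>\<^bsub>G\<^esub>) = K (fst z) i" if "W (fst z) (snd z) i \<noteq> 0" for i
        proof -
          have iJ: "i \<le> J"
            using early_late_zero[OF w(1)[OF x] TJ, of i] that by (cases "J < i") (auto simp: W_def)
          show ?thesis
          proof (cases "?T z0 i < 13/16")
            case True
            then show ?thesis using TR[OF iJ] iJ by (simp add: R_def c_def K_def)
          next
            case False
            then have "?T z i > 13/16" using TR[OF iJ] W0[OF x that] by (auto simp: R_def)
            then show ?thesis using False by (simp add: c_def K_def)
          qed
        qed
        have m: "(W (fst z) (snd z), \<lambda>i. if c i then snd (fst z) i else \<one>\<^bsub>G\<^esub>) \<in> milnor_set G"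
          unfolding milnor_set_iff using WW[OF x] w(2)[OF x] by simp
        show "mcl G (W (fst z) (snd z), \<lambda>i. if c i then snd (fst z) i else \<one>\<^bsub>G\<^esub>) = mcl G (W (fst z) (snd z), K (fst z))"
          unfolding mcl_eq_iff[OF m WK[OF x]] milnor_rel_iff using m WK[OF x] eq by blast
      qed
      with zS oS show "\<exists>S. z0 \<in> S \<and> dopen ?P S \<and> smooth_map (subset_diff ?P S) (EG_diff G D) (\<lambda>z. mcl G (W (fst z) (snd z), K (fst z)))"
        by blast
    qed
    show "mcl G (W x s, K x) = mcl G (W y s, K y)" if xy: "(x, y) \<in> milnor_rel G" for x y s
    proof -
      have x: "x \<in> milnor_set G" "y \<in> milnor_set G" "fst x = fst y" "\<And>i. fst x i \<noteq> 0 \<Longrightarrow> snd x i = snd y i"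
        using xy milnor_rel_iff[of "fst x" "snd x" "fst y" "snd y" G] by simp_all
      have "K x i = K y i" if "W x s i \<noteq> 0" for i
      proof (cases "early (fst x) i = 0")
        case True
        then have "psum (fst x) i > 13/16" using that late_nonzero[OF w(1)[OF x(1)], of i] by (auto simp: W_def)
        then show ?thesis using x(3) by (simp add: K_def)
      next
        case False
        then show ?thesis using x(3,4) early_nonzero(1)[OF w(1)[OF x(1)] False] by (simp add: K_def)
      qed
      moreover have "W x s = W y s" using x(3) by (simp add: W_def)
      ultimately show ?thesis
        unfolding mcl_eq_iff[OF WK[OF x(1)] WK[OF x(2)]] milnor_rel_iff using WK[OF x(1), of s] WK[OF x(2), of s] by blast
    qed
    show "f (mcl G x) = mcl G (W x 0, K x)" if x: "x \<in> milnor_set G" for x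
    proof -
      have W: "W x 0 = early (fst x)" by (simp add: W_def)
      have e: "(early (fst x), snd x) \<in> milnor_set G" unfolding milnor_set_iff using w[OF x] milnor_weight_early by blast
      have "snd x i = K x i" if "early (fst x) i \<noteq> 0" for i
        using early_nonzero(2)[OF w(1)[OF x] that] by (simp add: K_def)
      then show ?thesis
        unfolding f[OF x] mcl_eq_iff[OF e WK[OF x]] unfolding W milnor_rel_iff using e WK[OF x, of 0] W by simp
    qed
    show "g (mcl G x) = mcl G (W x 1, K x)" if x: "x \<in> milnor_set G" for x
    proof -
      have W: "W x 1 = late (fst x)" by (simp add: W_def)
      have e: "(late (fst x), \<lambda>_. \<one>\<^bsub>G\<^esub>) \<in> milnor_set G" unfolding milnor_set_iff using w[OF x] milnor_weight_late by blast
      have "\<one>\<^bsub>G\<^esub> = K x i" if "late (fst x) i \<noteq> 0" for i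
        using late_nonzero[OF w(1)[OF x] that] by (simp add: K_def)
      then show ?thesis
        unfolding g[OF x] mcl_eq_iff[OF e WK[OF x]] unfolding W milnor_rel_iff using e WK[OF x, of 1] W by simp
    qed
  qed
qed

text \<open>With all group coordinates equal to the unit, a straight segment in the weights leads to
  the vertex with index 0.\<close>

lemma EG_homotopic_const:
  assumes f: "\<And>x. x \<in> milnor_set G \<Longrightarrow> f (mcl G x) = mcl G (late (fst x), \<lambda>_. \<one>\<^bsub>G\<^esub>)"
  shows "smoothly_homotopic (EG_diff G D) (EG_diff G D) f (\<lambda>_. mcl G (\<lambda>i. if i = 0 then 1 else 0, \<lambda>_. \<one>\<^bsub>G\<^esub>))"
proof (rule EG_homotopic[where F = "\<lambda>x s. mcl G (\<lambda>i. (1 - smashing_fun s) * late (fst x) i + smashing_fun s * (if i = 0 then 1 else 0), \<lambda>_. \<one>\<^bsub>G\<^esub>)"])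
  let ?P = "prod_diff (milnor_diff G D) real_diff"
  have dP: "diffeology ?P" by (intro diffeology_prod diffeology_milnor diffeology_real)
  have w: "milnor_weight (fst x)" if "x \<in> milnor_set G" for x
    using that milnor_set_iff[of "fst x" "snd x" G] by simp
  have e: "milnor_weight (\<lambda>i. if i = 0 then 1 else 0)"
    unfolding milnor_weight_def by (intro conjI exI[of _ 1]) simp_all
  have s: "smooth_map ?P real_diff (\<lambda>z. snd z)" by (rule smooth_map_snd[OF smooth_map_id])
  have "smooth_map ?P (milnor_diff G D) (\<lambda>z. (\<lambda>i. (1 - smashing_fun (snd z)) * late (fst (fst z)) i + smashing_fun (snd z) * (if i = 0 then 1 else 0), \<lambda>_. \<one>\<^bsub>G\<^esub>))"
    by (intro smooth_map_into_milnor dP smooth_map_add smooth_map_mult smooth_map_diff smooth_map_smashing s smooth_map_real_const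
        smooth_map_late smooth_map_milnor_weights milnor_weight_convex_smashing milnor_weight_late w e smooth_map_const[OF dP dD])
      (auto simp: points_milnor points_D)
  from smooth_map_into_image[OF diffeology_milnor this, of "mcl G"]
  show "smooth_map ?P (EG_diff G D)
     (\<lambda>z. mcl G (\<lambda>i. (1 - smashing_fun (snd z)) * late (fst (fst z)) i + smashing_fun (snd z) * (if i = 0 then 1 else 0), \<lambda>_. \<one>\<^bsub>G\<^esub>))"
    by (simp add: EG_eq)
  show "mcl G (\<lambda>i. (1 - smashing_fun s) * late (fst x) i + smashing_fun s * (if i = 0 then 1 else 0), \<lambda>_. \<one>\<^bsub>G\<^esub>) =
      mcl G (\<lambda>i. (1 - smashing_fun s) * late (fst y) i + smashing_fun s * (if i = 0 then 1 else 0), \<lambda>_. \<one>\<^bsub>G\<^esub>)"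
    if "(x, y) \<in> milnor_rel G" for x y s
    using that milnor_rel_iff[of "fst x" "snd x" "fst y" "snd y" G] by simp
qed (simp_all add: f)

lemma contractible_EG: "contractible_diff (EG_diff G D)"
proof -
  \<comment> \<open>The intermediate stages must be maps on classes in order to be ends of two
    homotopies; they are defined through a chosen representative and shown to be independent of
    it.\<close>
  define h where "h c = mcl G (early (fst (SOME x. x \<in> c)), snd (SOME x. x \<in> c))" for c
  define k where "k c = mcl G (late (fst (SOME x. x \<in> c)), \<lambda>_. \<one>\<^bsub>G\<^esub>)" for c :: "'a EG"
  have rep: "(x, SOME y. y \<in> mcl G x) \<in> milnor_rel G" if "x \<in> milnor_set G" for x
  proof -
    have "x \<in> mcl G x" using that equiv_milnor_rel by (rule equiv_class_self[rotated])
    then have "(SOME y. y \<in> mcl G x) \<in> mcl G x" by (rule someI)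
    then show ?thesis by simp
  qed
  have h: "h (mcl G x) = mcl G (early (fst x), snd x)" if "x \<in> milnor_set G" for x
  proof -
    let ?y = "SOME y. y \<in> mcl G x"
    have y: "x \<in> milnor_set G" "?y \<in> milnor_set G" "fst x = fst ?y" "\<And>i. fst x i \<noteq> 0 \<Longrightarrow> snd x i = snd ?y i"
      using rep[OF that] milnor_rel_iff[of "fst x" "snd x" "fst ?y" "snd ?y" G] by simp_all
    have t: "milnor_weight (fst x)" "\<And>i. snd x i \<in> carrier G" "\<And>i. snd ?y i \<in> carrier G"
      using y(1,2) milnor_set_iff[of "fst x" "snd x" G] milnor_set_iff[of "fst ?y" "snd ?y" G] by simp_all
    have m: "(early (fst x), snd x) \<in> milnor_set G" "(early (fst x), snd ?y) \<in> milnor_set G"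
      unfolding milnor_set_iff using t milnor_weight_early by blast+
    have "mcl G (early (fst x), snd x) = mcl G (early (fst x), snd ?y)"
      unfolding mcl_eq_iff[OF m] milnor_rel_iff using m early_nonzero(1)[OF t(1)] y(4) by blast
    then show ?thesis unfolding h_def using y(3) by simp
  qed
  have k: "k (mcl G x) = mcl G (late (fst x), \<lambda>_. \<one>\<^bsub>G\<^esub>)" if "x \<in> milnor_set G" for x
    using rep[OF that] milnor_rel_iff[of "fst x" "snd x" "fst (SOME y. y \<in> mcl G x)" "snd (SOME y. y \<in> mcl G x)" G]
    by (simp add: k_def)
  show ?thesis
    unfolding contractible_diff_def
    using smoothly_homotopic_trans[OF diffeology_EG diffeology_EG
        smoothly_homotopic_trans[OF diffeology_EG diffeology_EG EG_homotopic_early[OF h] EG_homotopic_late[OF h k]] EG_homotopic_const[OF k]]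
    by blast
qed

end

section \<open>Functoriality of the Milnor construction\<close>

lemma image_equiv_class:
  assumes R: "equiv A R" and a: "(a, a) \<in> S" and f: "\<And>b. (a, b) \<in> S \<Longrightarrow> (f a, f b) \<in> R"
  shows "R `` (f ` (S `` {a})) = R `` {f a}"
proof -
  have tr: "trans R" using R by (rule equivE)
  show ?thesis using a f transD[OF tr] by blast
qed

locale dgroup_hom = D1: dgroup G D + D2: dgroup G' D'
  for G :: "'a monoid" and D :: "'a diff_space" and G' :: "'b monoid" and D' :: "'b diff_space" +
  fixes f :: "'a \<Rightarrow> 'b"
  assumes hom: "f \<in> hom G G'" and smooth: "smooth_map D D' f"
begin

lemma hom_closed: "x \<in> carrier G \<Longrightarrow> f x \<in> carrier G'"
  using hom by (auto simp: hom_def)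

lemma hom_mult: "x \<in> carrier G \<Longrightarrow> y \<in> carrier G \<Longrightarrow> f (x \<otimes>\<^bsub>G\<^esub> y) = f x \<otimes>\<^bsub>G'\<^esub> f y"
  using hom by (auto simp: hom_def)

lemma group_hom: "group_hom G G' f"
  using hom by (simp add: group_hom_def group_hom_axioms_def D1.G D2.G)

lemma hom_one: "f \<one>\<^bsub>G\<^esub> = \<one>\<^bsub>G'\<^esub>"
  by (rule group_hom.hom_one[OF group_hom])

lemma hom_inv: "x \<in> carrier G \<Longrightarrow> f (inv\<^bsub>G\<^esub> x) = inv\<^bsub>G'\<^esub> (f x)"
  by (rule group_hom.hom_inv[OF group_hom])

lemma milnor_hom: "(t, g) \<in> milnor_set G \<Longrightarrow> (t, f \<circ> g) \<in> milnor_set G'"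
  by (auto simp: milnor_set_iff hom_closed)

lemma EG_map_mcl:
  assumes x: "(t, g) \<in> milnor_set G"
  shows "EG_map G' f (mcl G (t, g)) = mcl G' (t, f \<circ> g)"
  unfolding EG_map_def
  by (subst mcl_image[OF x]) (use milnor_hom in \<open>auto simp: milnor_rel_iff split: prod.splits\<close>)

lemma smooth_EG_map: "smooth_map (EG_diff G D) (EG_diff G' D') (EG_map G' f)"
proof -
  let ?M = "milnor_diff G D"
  note M = D1.diffeology_milnor and M' = D2.diffeology_milnor
  have "smooth_map ?M (milnor_diff G' D') (\<lambda>x. (fst x, \<lambda>i. f (snd x i)))"
    by (intro D2.smooth_map_into_milnor M D1.smooth_map_milnor_weight[OF smooth_map_id]
        smooth_map_compose[OF smooth D1.smooth_map_milnor_coord[OF smooth_map_id]])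
      (auto simp: D1.points_milnor milnor_set_iff)
  note s = smooth_map_into_image[OF M' this, of "mcl G'"]
  have "smooth_map ?M (image_diff (milnor_diff G' D') (mcl G')) (\<lambda>x. EG_map G' f (mcl G x))"
  proof (rule smooth_map_cong[OF M diffeology_image[OF M'] s])
    fix x assume "x \<in> points ?M"
    then show "mcl G' (fst x, \<lambda>i. f (snd x i)) = EG_map G' f (mcl G x)"
      using EG_map_mcl[of "fst x" "snd x"] by (simp add: D1.points_milnor comp_def)
  qed
  then show ?thesis
    unfolding D1.EG_eq D2.EG_eq by (rule smooth_map_from_image[OF M diffeology_image[OF M']])
qed

lemma EG_map_act:
  assumes c: "c \<in> points (EG_diff G D)" and h: "h \<in> carrier G"
  shows "EG_map G' f (EG_act G h c) = EG_act G' (f h) (EG_map G' f c)"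
proof -
  from c obtain t k where x: "milnor_weight t" "\<And>i. k i \<in> carrier G" "c = mcl G (t, k)" "(t, k) \<in> milnor_set G"
    by (rule D1.EG_E) blast
  show ?thesis
    unfolding x(3) D1.EG_act_mcl[OF x(4) h] EG_map_mcl[OF x(4)] EG_map_mcl[OF D1.EG_act_set[OF x(4) h]]
      D2.EG_act_mcl[OF milnor_hom[OF x(4)] hom_closed[OF h]]
    using h x(2) by (simp add: comp_def hom_mult hom_inv)
qed

lemma BG_map_quot:
  assumes c: "c \<in> points (EG_diff G D)"
  shows "BG_map G' D' f (D1.EG_quot c) = D2.EG_quot (EG_map G' f c)"
  unfolding BG_map_def D1.EG_quot_def D2.EG_quot_def
proof (rule image_equiv_class[OF D2.equiv_orbit])
  show "(c, c) \<in> EG_orbit_rel G D"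
    unfolding D1.orbit_iff using c D1.EG_act_one[OF c] by (intro conjI bexI[of _ "\<one>\<^bsub>G\<^esub>"]) simp_all
  show "(EG_map G' f c, EG_map G' f d) \<in> EG_orbit_rel G' D'" if "(c, d) \<in> EG_orbit_rel G D" for d
  proof -
    have "\<exists>h\<in>carrier G. d = EG_act G h c" using that by (simp only: D1.orbit_iff)
    then obtain h where h: "h \<in> carrier G" and d: "d = EG_act G h c" by (rule bexE)
    show ?thesis
      unfolding D2.orbit_iff d EG_map_act[OF c h]
      using smooth_map_points[OF smooth_EG_map c] hom_closed[OF h] by (intro conjI bexI[of _ "f h"]) simp_all
  qed
qed

lemma smooth_BG_map: "smooth_map (BG_diff G D) (BG_diff G' D') (BG_map G' D' f)"
  unfolding D1.BG_eq
proof (rule smooth_map_from_image[OF D1.diffeology_EG D2.EG.dB])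
  show "smooth_map (EG_diff G D) (BG_diff G' D') (\<lambda>c. BG_map G' D' f (D1.EG_quot c))"
    by (rule smooth_map_cong[OF D1.diffeology_EG D2.EG.dB smooth_map_compose[OF D2.EG.q smooth_EG_map]])
      (simp add: BG_map_quot)
qed

end

section \<open>Delooping\<close>

lemma homotopy_map_unit:
  assumes "diffeology X" "diffeology Y" "smooth_map X Y f" "x \<in> points X"
  shows "homotopy_map Y f x k (homotopy_unit X x k) = homotopy_unit Y (f x) k"
  unfolding homotopy_unit_eq using homotopy_map_hcls[OF assms(1-3) const_loop_in[OF assms(1,4)]] by simp

lemma homotopy_unit_in: "diffeology X \<Longrightarrow> x \<in> points X \<Longrightarrow> homotopy_unit X x k \<in> homotopy_set X x k"
  unfolding homotopy_unit_eq by (intro hcls_in const_loop_in)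

lemma homotopy_map_cong_points:
  assumes X: "diffeology X" and Y: "diffeology Y" and f: "smooth_map X Y f" and x: "x \<in> points X"
    and eq: "\<And>a. a \<in> points X \<Longrightarrow> f a = g a" and c: "c \<in> homotopy_set X x k"
  shows "homotopy_map Y f x k c = homotopy_map Y g x k c"
proof -
  obtain u where u: "u \<in> points (iter_loop_diff X x k)" "c = hcls X x k u" using c by (rule homotopy_setE)
  have g: "smooth_map X Y g" by (rule smooth_map_cong[OF X Y f eq])
  have "map_iter_loop f u = map_iter_loop g u" by (rule map_iter_loop_cong_points[OF u(1) eq])
  then show ?thesis
    unfolding u(2) homotopy_map_hcls[OF X Y f u(1)] homotopy_map_hcls[OF X Y g u(1)] using eq[OF x] by simp
qed

context pfib
begin

lemma connecting_unit:
  assumes e: "e \<in> points E"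
  shows "connecting e k (homotopy_unit B (q e) (Suc k)) = homotopy_unit G one k"
proof -
  have "homotopy_unit B (q e) (Suc k) = homotopy_map B q e (Suc k) (homotopy_unit E e (Suc k))"
    by (rule homotopy_map_unit[OF dE dB q e, symmetric])
  then show ?thesis
    using connecting_unit_iff[OF e homotopy_unit_in[OF dB smooth_map_points[OF q e]]] homotopy_unit_in[OF dE e] by blast
qed

text \<open>For contractible \<open>E\<close> exactness yields surjectivity and a trivial kernel.
  Injectivity then follows from \<open>connecting_mult\<close> and inverses in the source, an
  argument that also works in degree 0, where \<pi>_0(G) is equipped only with
  \<open>pointwise_mult\<close>.\<close>

lemma connecting_bij:
  assumes e: "e \<in> points E" and c: "contractible_diff E"
  shows "bij_betw (connecting e k) (homotopy_set B (q e) (Suc k)) (homotopy_set G one k)"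
  unfolding bij_betw_def
proof
  let ?P = "homotopy_group B (q e) (Suc k)"
  have b: "q e \<in> points B" by (rule smooth_map_points[OF q e])
  interpret P: group ?P by (rule group_homotopy_group[OF dB b])
  note E = homotopy_set_contractible[OF dE c e]
  have one_P: "\<one>\<^bsub>?P\<^esub> = homotopy_unit B (q e) (Suc k)" by (simp add: homotopy_group_def)
  show "inj_on (connecting e k) (homotopy_set B (q e) (Suc k))"
  proof (rule inj_onI)
    fix x y assume xy: "x \<in> homotopy_set B (q e) (Suc k)" "y \<in> homotopy_set B (q e) (Suc k)" "connecting e k x = connecting e k y"
    have x: "x \<in> carrier ?P" and y: "y \<in> carrier ?P" using xy by simp_all
    have iy: "inv\<^bsub>?P\<^esub> y \<in> homotopy_set B (q e) (Suc k)" using P.inv_closed[OF y] by simp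
    have "connecting e k (x \<otimes>\<^bsub>?P\<^esub> inv\<^bsub>?P\<^esub> y) = connecting e k (y \<otimes>\<^bsub>?P\<^esub> inv\<^bsub>?P\<^esub> y)"
      unfolding connecting_mult[OF e xy(1) iy] connecting_mult[OF e xy(2) iy] xy(3) ..
    also have "\<dots> = homotopy_unit G one k" using connecting_unit[OF e] P.r_inv[OF y] by (simp add: one_P)
    finally have "x \<otimes>\<^bsub>?P\<^esub> inv\<^bsub>?P\<^esub> y \<in> homotopy_map B q e (Suc k) ` homotopy_set E e (Suc k)"
      using connecting_unit_iff[OF e] P.m_closed[OF x P.inv_closed[OF y]] by simp
    then have "x \<otimes>\<^bsub>?P\<^esub> inv\<^bsub>?P\<^esub> y = \<one>\<^bsub>?P\<^esub>" unfolding E one_P using homotopy_map_unit[OF dE dB q e] by simp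
    then show "x = y" using x y by (metis P.inv_closed P.inv_equality P.inv_inv)
  qed
  show "connecting e k ` homotopy_set B (q e) (Suc k) = homotopy_set G one k"
    unfolding connecting_image[OF e]
  proof (intro equalityI subsetI)
    fix d assume d: "d \<in> homotopy_set G one k"
    have "homotopy_map E (\<lambda>g. act g e) one k d \<in> homotopy_set E (act one e) k"
      by (rule homotopy_map_in[OF dG dE smooth_orbit[OF e] d])
    then show "d \<in> {d \<in> homotopy_set G one k. homotopy_map E (\<lambda>g. act g e) one k d = homotopy_unit E e k}"
      using d by (simp add: act_one[OF e] E)
  qed blast
qed

end

context dgroup
begin

lemma BG_E:
  assumes "b \<in> points (BG_diff G D)"
  obtains e where "e \<in> points (EG_diff G D)" "b = EG_quot e"
  using assms unfolding BG_eq by auto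

lemma homotopy_set_BG_0:
  assumes b: "b \<in> points (BG_diff G D)"
  shows "homotopy_set (BG_diff G D) b 0 = {homotopy_unit (BG_diff G D) b 0}"
proof -
  obtain e where e: "e \<in> points (EG_diff G D)" "b = EG_quot e" using b by (rule BG_E)
  have "d = homotopy_unit (BG_diff G D) b 0" if "d \<in> homotopy_set (BG_diff G D) b 0" for d
  proof -
    from that obtain u where u: "u \<in> points (iter_loop_diff (BG_diff G D) b 0)" "d = hcls (BG_diff G D) b 0 u"
      by (rule homotopy_setE)
    from u(1) obtain x where "x \<in> points (BG_diff G D)" "u = Point x" by auto
    with u(2) have x: "x \<in> points (BG_diff G D)" "d = hcls (BG_diff G D) b 0 (Point x)" by simp_all
    obtain c where c: "c \<in> points (EG_diff G D)" "x = EG_quot c" using x(1) by (rule BG_E)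
    have "(x, b) \<in> path_rel (BG_diff G D)"
      unfolding c(2) e(2) by (rule path_rel_smooth_map[OF EG.q contractible_path_rel[OF diffeology_EG contractible_EG c(1) e(1)]])
    from path_rel_smooth_map[OF smooth_map_proj_image[OF EG.dB] this, of Point]
    have "(Point x, Point b) \<in> path_rel (iter_loop_diff (BG_diff G D) b 0)" by simp
    then show ?thesis unfolding x(2) homotopy_unit_eq by (intro path_class_eq diffeology_iter_loop EG.dB) simp
  qed
  then show ?thesis using homotopy_unit_in[OF EG.dB b] by blast
qed

end

section \<open>The long exact sequence\<close>

locale extension =
  fixes G :: "'a monoid" and D :: "'a diff_space" and G' :: "'b monoid" and D' :: "'b diff_space"
    and G'' :: "'c monoid" and D'' :: "'c diff_space" and i :: "'a \<Rightarrow> 'b" and p :: "'b \<Rightarrow> 'c"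
  assumes ext: "diffeological_extension G D G' D' G'' D'' i p"
begin

sublocale I: dgroup_hom G D G' D' i
  using ext by unfold_locales (simp_all add: diffeological_extension_def)

sublocale P: dgroup_hom G' D' G'' D'' p
  using ext by unfold_locales (simp_all add: diffeological_extension_def)

lemma ker: "i ` carrier G = kernel G' G'' p"
  and surj: "p ` carrier G' = carrier G''"
  and inj: "inj_on i (carrier G)"
  and quot: "image_diff D' p = D''"
  and inv_smooth: "smooth_map (subset_diff D' (i ` points D)) D (inv_into (points D) i)"
  using ext by (simp_all add: diffeological_extension_def diff_subduction_def diff_induction_def diffeomorphism_def)

lemma p_i: "g \<in> carrier G \<Longrightarrow> p (i g) = \<one>\<^bsub>G''\<^esub>"
  using ker by (auto simp: kernel_def)

lemma div_in_image:
  assumes x: "x \<in> carrier G'" and y: "y \<in> carrier G'" and eq: "p x = p y"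
  shows "y \<otimes>\<^bsub>G'\<^esub> inv\<^bsub>G'\<^esub> x \<in> i ` carrier G"
proof -
  have "p (y \<otimes>\<^bsub>G'\<^esub> inv\<^bsub>G'\<^esub> x) = \<one>\<^bsub>G''\<^esub>"
    using x y P.hom_closed[OF y] by (simp add: P.hom_mult P.hom_inv eq)
  then show ?thesis unfolding ker kernel_def using x y by simp
qed

text \<open>The subduction provides local lifts. The induction provides smooth division: for
  \<open>x\<close>, \<open>y\<close> in one fibre the quotient of \<open>y\<close> by
  \<open>x\<close> lies in the kernel, which is the image of \<open>i\<close>, and there the inverse
  of \<open>i\<close> is smooth.\<close>

sublocale B: principal_bundle D "(\<otimes>\<^bsub>G\<^esub>)" "\<one>\<^bsub>G\<^esub>" D' D'' "\<lambda>g x. i g \<otimes>\<^bsub>G'\<^esub> x"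
  "\<lambda>x y. inv_into (carrier G) i (y \<otimes>\<^bsub>G'\<^esub> inv\<^bsub>G'\<^esub> x)" p
proof
  note c = I.hom_closed
  show "diffeology D" "diffeology D'" "diffeology D''" by (rule I.D1.dD I.D2.dD P.D2.dD)+
  show "smooth_map D' D'' p" by (rule P.smooth)
  show "smooth_map (prod_diff D D') D' (\<lambda>z. i (fst z) \<otimes>\<^bsub>G'\<^esub> snd z)"
    by (intro I.D2.smooth_map_group_mult smooth_map_compose[OF I.smooth smooth_map_fst[OF smooth_map_id]] smooth_map_snd[OF smooth_map_id])
  let ?S = "subset_diff (prod_diff D' D') {z. p (fst z) = p (snd z)}"
  have dS: "diffeology ?S" by (intro diffeology_subset diffeology_prod I.D2.dD)
  have s: "smooth_map ?S (prod_diff D' D') (\<lambda>z. z)" by (rule smooth_map_from_subset[OF smooth_map_id])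
  have "smooth_map ?S (subset_diff D' (i ` points D)) (\<lambda>z. snd z \<otimes>\<^bsub>G'\<^esub> inv\<^bsub>G'\<^esub> (fst z))"
    by (intro smooth_map_into_subset[OF dS] I.D2.smooth_map_group_mult I.D2.smooth_map_group_inv smooth_map_fst[OF s] smooth_map_snd[OF s])
      (auto simp: I.D1.points_D I.D2.points_D intro!: div_in_image)
  from smooth_map_compose[OF inv_smooth this]
  show "smooth_map ?S D (\<lambda>z. inv_into (carrier G) i (snd z \<otimes>\<^bsub>G'\<^esub> inv\<^bsub>G'\<^esub> (fst z)))" by (simp add: I.D1.points_D)
  show "\<one>\<^bsub>G\<^esub> \<in> points D" by (simp add: I.D1.points_D)
  show "g \<otimes>\<^bsub>G\<^esub> h \<in> points D" if "g \<in> points D" "h \<in> points D" for g h using that by (simp add: I.D1.points_D)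
  show "i \<one>\<^bsub>G\<^esub> \<otimes>\<^bsub>G'\<^esub> x = x" if "x \<in> points D'" for x using that by (simp add: I.hom_one I.D2.points_D)
  show "i (g \<otimes>\<^bsub>G\<^esub> h) \<otimes>\<^bsub>G'\<^esub> x = i g \<otimes>\<^bsub>G'\<^esub> (i h \<otimes>\<^bsub>G'\<^esub> x)" if "g \<in> points D" "h \<in> points D" "x \<in> points D'" for g h x
    using that c by (simp add: I.hom_mult I.D1.points_D I.D2.points_D I.D2.m_assoc)
  show "p (i g \<otimes>\<^bsub>G'\<^esub> x) = p x" if "g \<in> points D" "x \<in> points D'" for g x
    using that c P.hom_closed by (simp add: P.hom_mult p_i I.D1.points_D I.D2.points_D)
  show "i (inv_into (carrier G) i (y \<otimes>\<^bsub>G'\<^esub> inv\<^bsub>G'\<^esub> x)) \<otimes>\<^bsub>G'\<^esub> x = y" if "x \<in> points D'" "y \<in> points D'" "p x = p y" for x y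
    using that f_inv_into_f[OF div_in_image[of x y]] by (simp add: I.D2.points_D I.D2.m_assoc)
  show "inv_into (carrier G) i (i g \<otimes>\<^bsub>G'\<^esub> x \<otimes>\<^bsub>G'\<^esub> inv\<^bsub>G'\<^esub> x) = g" if "g \<in> points D" "x \<in> points D'" for g x
    using that c inj by (simp add: I.D1.points_D I.D2.points_D I.D2.m_assoc)
  fix n U r u assume "plot D'' n U r" "u \<in> U"
  then have "plot (image_diff D' p) n U r" "u \<in> U" by (simp_all add: quot)
  then obtain V s where "eopen n V" "u \<in> V" "V \<subseteq> U" "plot D' n V s" "\<And>v. v \<in> V \<Longrightarrow> r v = p (s v)"
    by (rule plot_imageE) blast
  then show "\<exists>V s. eopen n V \<and> u \<in> V \<and> V \<subseteq> U \<and> plot D' n V s \<and> (\<forall>v\<in>V. p (s v) = r v)"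
    by (intro exI[of _ V] exI[of _ s]) simp
qed

lemma one_D': "\<one>\<^bsub>G'\<^esub> \<in> points D'" by (simp add: I.D2.points_D)

text \<open>The orbit map through the unit equals \<open>i\<close> on the points of
  \<open>D\<close>, though not as a function on the whole type.\<close>

lemma orbit_eq:
  assumes "c \<in> homotopy_set D \<one>\<^bsub>G\<^esub> k"
  shows "homotopy_map D' (\<lambda>g. i g \<otimes>\<^bsub>G'\<^esub> \<one>\<^bsub>G'\<^esub>) \<one>\<^bsub>G\<^esub> k c = homotopy_map D' i \<one>\<^bsub>G\<^esub> k c"
  by (rule homotopy_map_cong_points[OF I.D1.dD I.D2.dD B.smooth_orbit[OF one_D'] _ _ assms])
    (simp_all add: I.D1.points_D I.hom_closed)

end

lemma bij_betw_preimage: "bij_betw h A B \<Longrightarrow> y \<in> B \<Longrightarrow> \<exists>x\<in>A. h x = y"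
  by (auto simp: bij_betw_def)

text \<open>The base point of \<open>BG\<close> is given by a point \<open>e\<close> above it
  because a connecting map needs a base point in the total space.\<close>

locale based_extension = extension +
  fixes e
  assumes e: "e \<in> points (EG_diff G D)"
begin

abbreviation "e' \<equiv> EG_map G' i e"
abbreviation "e'' \<equiv> EG_map G'' p e'"
abbreviation "b \<equiv> I.D1.EG_quot e"
abbreviation "b' \<equiv> BG_map G' D' i b"
abbreviation "b'' \<equiv> BG_map G'' D'' p b'"
abbreviation "BG \<equiv> BG_diff G D"
abbreviation "BG' \<equiv> BG_diff G' D'"
abbreviation "BG'' \<equiv> BG_diff G'' D''"
abbreviation "f n \<equiv> homotopy_map BG' (BG_map G' D' i) b n"
abbreviation "g n \<equiv> homotopy_map BG'' (BG_map G'' D'' p) b' n"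
abbreviation "\<theta> n \<equiv> I.D1.EG.connecting e n"
abbreviation "\<theta>' n \<equiv> I.D2.EG.connecting e' n"
abbreviation "\<theta>'' n \<equiv> P.D2.EG.connecting e'' n"
abbreviation "u n \<equiv> homotopy_unit D \<one>\<^bsub>G\<^esub> n"
abbreviation "u' n \<equiv> homotopy_unit D' \<one>\<^bsub>G'\<^esub> n"
abbreviation "u'' n \<equiv> homotopy_unit D'' \<one>\<^bsub>G''\<^esub> n"
abbreviation "i_map n \<equiv> homotopy_map D' i \<one>\<^bsub>G\<^esub> n"
abbreviation "p_map n \<equiv> homotopy_map D'' p \<one>\<^bsub>G'\<^esub> n"
abbreviation "bd n \<equiv> B.connecting \<one>\<^bsub>G'\<^esub> n"

lemma e': "e' \<in> points (EG_diff G' D')" and e'': "e'' \<in> points (EG_diff G'' D'')"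
  using smooth_map_points[OF I.smooth_EG_map e] smooth_map_points[OF P.smooth_EG_map] by blast+

lemma b': "b' = I.D2.EG_quot e'" and b'_p: "BG_map G'' D'' p (I.D2.EG_quot e') = P.D2.EG_quot e''"
  by (simp_all add: I.BG_map_quot P.BG_map_quot e e')

lemma b'': "b'' = P.D2.EG_quot e''"
  unfolding b' by (rule b'_p)

lemma bs: "b \<in> points BG" "b' \<in> points BG'" "b'' \<in> points BG''"
  using smooth_map_points[OF I.D1.EG.q e] smooth_map_points[OF I.D2.EG.q e'] smooth_map_points[OF P.D2.EG.q e'']
  by (simp_all only: b' b'_p)

lemma \<theta>_bij: "bij_betw (\<theta> n) (homotopy_set BG b (Suc n)) (homotopy_set D \<one>\<^bsub>G\<^esub> n)"
  "bij_betw (\<theta>' n) (homotopy_set BG' b' (Suc n)) (homotopy_set D' \<one>\<^bsub>G'\<^esub> n)"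
  "bij_betw (\<theta>'' n) (homotopy_set BG'' b'' (Suc n)) (homotopy_set D'' \<one>\<^bsub>G''\<^esub> n)"
  unfolding b' b'_p
  by (rule I.D1.EG.connecting_bij I.D2.EG.connecting_bij P.D2.EG.connecting_bij
      I.D1.contractible_EG I.D2.contractible_EG P.D2.contractible_EG e e' e'')+

lemma \<theta>_in: "c \<in> homotopy_set BG b (Suc n) \<Longrightarrow> \<theta> n c \<in> homotopy_set D \<one>\<^bsub>G\<^esub> n"
  "c' \<in> homotopy_set BG' b' (Suc n) \<Longrightarrow> \<theta>' n c' \<in> homotopy_set D' \<one>\<^bsub>G'\<^esub> n"
  "c'' \<in> homotopy_set BG'' b'' (Suc n) \<Longrightarrow> \<theta>'' n c'' \<in> homotopy_set D'' \<one>\<^bsub>G''\<^esub> n"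
  by (rule bij_betw_apply[OF \<theta>_bij(1)] bij_betw_apply[OF \<theta>_bij(2)] bij_betw_apply[OF \<theta>_bij(3)], assumption)+

lemma \<theta>_eq: "x \<in> homotopy_set BG b (Suc n) \<Longrightarrow> y \<in> homotopy_set BG b (Suc n) \<Longrightarrow> \<theta> n x = \<theta> n y \<longleftrightarrow> x = y"
  "x' \<in> homotopy_set BG' b' (Suc n) \<Longrightarrow> y' \<in> homotopy_set BG' b' (Suc n) \<Longrightarrow> \<theta>' n x' = \<theta>' n y' \<longleftrightarrow> x' = y'"
  "x'' \<in> homotopy_set BG'' b'' (Suc n) \<Longrightarrow> y'' \<in> homotopy_set BG'' b'' (Suc n) \<Longrightarrow> \<theta>'' n x'' = \<theta>'' n y'' \<longleftrightarrow> x'' = y''"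
  by (rule inj_on_eq_iff[OF \<theta>_bij(1)[THEN bij_betw_imp_inj_on]] inj_on_eq_iff[OF \<theta>_bij(2)[THEN bij_betw_imp_inj_on]]
      inj_on_eq_iff[OF \<theta>_bij(3)[THEN bij_betw_imp_inj_on]], assumption+)+

lemma \<theta>_surj:
  "d \<in> homotopy_set D \<one>\<^bsub>G\<^esub> n \<Longrightarrow> \<exists>c\<in>homotopy_set BG b (Suc n). \<theta> n c = d"
  "d' \<in> homotopy_set D' \<one>\<^bsub>G'\<^esub> n \<Longrightarrow> \<exists>c\<in>homotopy_set BG' b' (Suc n). \<theta>' n c = d'"
  "d'' \<in> homotopy_set D'' \<one>\<^bsub>G''\<^esub> n \<Longrightarrow> \<exists>c\<in>homotopy_set BG'' b'' (Suc n). \<theta>'' n c = d''"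
  by (rule bij_betw_preimage[OF \<theta>_bij(1)] bij_betw_preimage[OF \<theta>_bij(2)] bij_betw_preimage[OF \<theta>_bij(3)], assumption)+

lemma \<theta>_unit: "\<theta> n (homotopy_unit BG b (Suc n)) = u n" "\<theta>' n (homotopy_unit BG' b' (Suc n)) = u' n"
  "\<theta>'' n (homotopy_unit BG'' b'' (Suc n)) = u'' n"
  unfolding b' b'_p
  by (rule I.D1.EG.connecting_unit[OF e] I.D2.EG.connecting_unit[OF e'] P.D2.EG.connecting_unit[OF e''])+

text \<open>The squares given here and in \<open>\<theta>_g\<close> carry the maps between
  classifying spaces over to \<open>i\<close> and \<open>p\<close>.\<close>

lemma \<theta>_f: "c \<in> homotopy_set BG b (Suc n) \<Longrightarrow> \<theta>' n (f (Suc n) c) = i_map n (\<theta> n c)"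
  by (rule connecting_natural[OF I.D1.EG.pfib_axioms I.D2.EG.pfib_axioms I.smooth I.smooth_EG_map I.smooth_BG_map _ _ e])
    (simp_all add: I.EG_map_act I.BG_map_quot I.hom_one I.D1.points_D)

lemma \<theta>_g:
  assumes "c \<in> homotopy_set BG' b' (Suc n)" shows "\<theta>'' n (g (Suc n) c) = p_map n (\<theta>' n c)"
  using assms unfolding b'
  by (intro connecting_natural[OF I.D2.EG.pfib_axioms P.D2.EG.pfib_axioms P.smooth P.smooth_EG_map P.smooth_BG_map _ _ e'])
    (simp_all add: P.EG_map_act P.BG_map_quot P.hom_one I.D2.points_D)

lemma f_in: "c \<in> homotopy_set BG b n \<Longrightarrow> f n c \<in> homotopy_set BG' b' n"
  by (rule homotopy_map_in[OF I.D1.EG.dB I.D2.EG.dB I.smooth_BG_map])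

lemma g_in: "c \<in> homotopy_set BG' b' n \<Longrightarrow> g n c \<in> homotopy_set BG'' b'' n"
  by (rule homotopy_map_in[OF I.D2.EG.dB P.D2.EG.dB P.smooth_BG_map])

lemma units_in: "homotopy_unit BG b n \<in> homotopy_set BG b n" "homotopy_unit BG' b' n \<in> homotopy_set BG' b' n"
  "homotopy_unit BG'' b'' n \<in> homotopy_set BG'' b'' n"
  by (rule homotopy_unit_in I.D1.EG.dB I.D2.EG.dB P.D2.EG.dB bs)+

section \<open>The exact sequence of the extension itself\<close>

lemma i_p_exact: "i_map n ` homotopy_set D \<one>\<^bsub>G\<^esub> n = {c \<in> homotopy_set D' \<one>\<^bsub>G'\<^esub> n. p_map n c = u'' n}"
  using B.orbit_image[OF one_D', of n] by (simp add: orbit_eq P.hom_one cong: image_cong_simp)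

lemma bd_i_exact: "bd n ` homotopy_set D'' \<one>\<^bsub>G''\<^esub> (Suc n) = {d \<in> homotopy_set D \<one>\<^bsub>G\<^esub> n. i_map n d = u' n}"
  using B.connecting_image[OF one_D', of n] orbit_eq by (auto simp: P.hom_one)

lemma p_bd_exact: "c \<in> homotopy_set D'' \<one>\<^bsub>G''\<^esub> (Suc n) \<Longrightarrow>
    bd n c = u n \<longleftrightarrow> c \<in> p_map (Suc n) ` homotopy_set D' \<one>\<^bsub>G'\<^esub> (Suc n)"
  using B.connecting_unit_iff[OF one_D', of c n] by (simp add: P.hom_one)

lemma bd_in: "c \<in> homotopy_set D'' \<one>\<^bsub>G''\<^esub> (Suc n) \<Longrightarrow> bd n c \<in> homotopy_set D \<one>\<^bsub>G\<^esub> n"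
  using bd_i_exact by blast

text \<open>This closes the sequence at its lower end: \<pi>_1(BG'') corresponds to \<pi>_0(G''),
  and the connecting map from there has the one-point set \<pi>_0(BG) as target.\<close>

lemma p_surj_0:
  assumes "c \<in> homotopy_set D'' \<one>\<^bsub>G''\<^esub> 0" shows "c \<in> p_map 0 ` homotopy_set D' \<one>\<^bsub>G'\<^esub> 0"
proof -
  from assms obtain v where v: "v \<in> points (iter_loop_diff D'' \<one>\<^bsub>G''\<^esub> 0)" "c = hcls D'' \<one>\<^bsub>G''\<^esub> 0 v" by (rule homotopy_setE)
  then obtain y where y: "y \<in> carrier G''" "v = Point y" by (auto simp: P.D2.points_D)
  then obtain x where x: "x \<in> carrier G'" "y = p x" using surj by blast
  have P: "Point x \<in> points (iter_loop_diff D' \<one>\<^bsub>G'\<^esub> 0)" using x by (simp add: I.D2.points_D)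
  have "c = p_map 0 (hcls D' \<one>\<^bsub>G'\<^esub> 0 (Point x))"
    using homotopy_map_hcls[OF I.D2.dD P.D2.dD P.smooth P] v(2) y(2) x(2) by (simp add: P.hom_one)
  then show ?thesis using hcls_in[OF P] by blast
qed

text \<open>The connecting map of the extension, conjugated by the degree-shifting bijections
  \<open>\<theta>''\<close> and \<open>\<theta>\<close>; in degree 0 the target has a single
  element.\<close>

definition "delta n c = (case n of 0 \<Rightarrow> homotopy_unit BG b 0
  | Suc m \<Rightarrow> inv_into (homotopy_set BG b (Suc m)) (\<theta> m) (bd m (\<theta>'' (Suc m) c)))"

lemma delta_0: "delta 0 c = homotopy_unit BG b 0"
  by (simp add: delta_def)

lemma delta_Suc:
  assumes "c \<in> homotopy_set BG'' b'' (Suc (Suc m))"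
  shows "delta (Suc m) c \<in> homotopy_set BG b (Suc m)" "\<theta> m (delta (Suc m) c) = bd m (\<theta>'' (Suc m) c)"
proof -
  have "bd m (\<theta>'' (Suc m) c) \<in> \<theta> m ` homotopy_set BG b (Suc m)"
    unfolding \<theta>_bij(1)[THEN bij_betw_imp_surj_on] by (intro bd_in \<theta>_in assms)
  then show "delta (Suc m) c \<in> homotopy_set BG b (Suc m)" "\<theta> m (delta (Suc m) c) = bd m (\<theta>'' (Suc m) c)"
    by (simp_all add: delta_def inv_into_into f_inv_into_f)
qed

lemma delta_in: "c \<in> homotopy_set BG'' b'' (Suc n) \<Longrightarrow> delta n c \<in> homotopy_set BG b n"
  using delta_Suc(1) units_in(1) by (cases n) (simp_all add: delta_0)

text \<open>Concatenation in \<open>BG''\<close> becomes the pointwise product in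
  \<open>G''\<close>, which in degree \<open>m + 1\<close> equals concatenation. The connecting map
  of the extension turns this into the pointwise product in \<open>G\<close>, and that is also what
  \<open>\<theta>\<close> makes of concatenation in \<open>BG\<close>.\<close>

lemma group_hom_delta:
  "group_hom (homotopy_group BG'' b'' (Suc (Suc m))) (homotopy_group BG b (Suc m)) (delta (Suc m))"
proof (intro group_hom.intro group_hom_axioms.intro)
  let ?A = "homotopy_group BG'' b'' (Suc (Suc m))" and ?C = "homotopy_group BG b (Suc m)"
  show A: "group ?A" and C: "group ?C"
    by (rule group_homotopy_group P.D2.EG.dB I.D1.EG.dB bs)+
  show "delta (Suc m) \<in> hom ?A ?C"
  proof (rule homI)
    show "delta (Suc m) c \<in> carrier ?C" if "c \<in> carrier ?A" for c using delta_in that by simp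
    fix x y assume x: "x \<in> carrier ?A" and y: "y \<in> carrier ?A"
    then have xy: "x \<in> homotopy_set BG'' b'' (Suc (Suc m))" "y \<in> homotopy_set BG'' b'' (Suc (Suc m))" by simp_all
    have xy': "x \<otimes>\<^bsub>?A\<^esub> y \<in> homotopy_set BG'' b'' (Suc (Suc m))"
      using monoid.m_closed[OF group.is_monoid[OF A] x y] by simp
    have dxy: "delta (Suc m) x \<otimes>\<^bsub>?C\<^esub> delta (Suc m) y \<in> homotopy_set BG b (Suc m)"
      using monoid.m_closed[OF group.is_monoid[OF C], of "delta (Suc m) x" "delta (Suc m) y"] delta_Suc(1) xy by simp
    have "\<theta>'' (Suc m) (x \<otimes>\<^bsub>?A\<^esub> y) = \<theta>'' (Suc m) x \<otimes>\<^bsub>homotopy_group D'' \<one>\<^bsub>G''\<^esub> (Suc m)\<^esub> \<theta>'' (Suc m) y"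
      using P.D2.EG.connecting_mult[OF e'', of x "Suc m" y] P.D2.EG.pointwise_mult_eq[OF e'' \<theta>_in(3)[OF xy(1)] \<theta>_in(3)[OF xy(2)]] xy
      by (simp only: b'')
    then have "bd m (\<theta>'' (Suc m) (x \<otimes>\<^bsub>?A\<^esub> y)) =
        pointwise_mult D \<one>\<^bsub>G\<^esub> (\<otimes>\<^bsub>G\<^esub>) m (bd m (\<theta>'' (Suc m) x)) (bd m (\<theta>'' (Suc m) y))"
      using B.connecting_mult[OF one_D', of "\<theta>'' (Suc m) x" m "\<theta>'' (Suc m) y"] \<theta>_in(3)[OF xy(1)] \<theta>_in(3)[OF xy(2)]
      by (simp add: P.hom_one)
    also have "\<dots> = \<theta> m (delta (Suc m) x \<otimes>\<^bsub>?C\<^esub> delta (Suc m) y)"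
      using I.D1.EG.connecting_mult[OF e delta_Suc(1)[OF xy(1)] delta_Suc(1)[OF xy(2)]] delta_Suc(2) xy by simp
    finally have "\<theta> m (delta (Suc m) (x \<otimes>\<^bsub>?A\<^esub> y)) = \<theta> m (delta (Suc m) x \<otimes>\<^bsub>?C\<^esub> delta (Suc m) y)"
      using delta_Suc(2)[OF xy'] by simp
    then show "delta (Suc m) (x \<otimes>\<^bsub>?A\<^esub> y) = delta (Suc m) x \<otimes>\<^bsub>?C\<^esub> delta (Suc m) y"
      using \<theta>_eq(1)[OF delta_Suc(1)[OF xy'] dxy] by simp
  qed
qed

lemma pi_0: "homotopy_set BG b 0 = {homotopy_unit BG b 0}" "homotopy_set BG' b' 0 = {homotopy_unit BG' b' 0}"
  "homotopy_set BG'' b'' 0 = {homotopy_unit BG'' b'' 0}"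
  by (rule I.D1.homotopy_set_BG_0[OF bs(1)] I.D2.homotopy_set_BG_0[OF bs(2)] P.D2.homotopy_set_BG_0[OF bs(3)])+

lemma f_unit: "f n (homotopy_unit BG b n) = homotopy_unit BG' b' n"
  by (rule homotopy_map_unit[OF I.D1.EG.dB I.D2.EG.dB I.smooth_BG_map bs(1)])

lemma g_unit: "g n (homotopy_unit BG' b' n) = homotopy_unit BG'' b'' n"
  by (rule homotopy_map_unit[OF I.D2.EG.dB P.D2.EG.dB P.smooth_BG_map bs(2)])

text \<open>A chase through the squares, using that the \<open>\<theta>\<close> maps are bijections;
  for \<open>n = 0\<close> every set has one element.\<close>

lemma exact_f_g: "f n ` homotopy_set BG b n = {c \<in> homotopy_set BG' b' n. g n c = homotopy_unit BG'' b'' n}"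
proof (cases n)
  case 0
  show ?thesis unfolding 0 pi_0 using f_unit[of 0] g_unit[of 0] by auto
next
  case (Suc m)
  show ?thesis
    unfolding Suc
  proof (intro equalityI subsetI)
    fix c assume "c \<in> f (Suc m) ` homotopy_set BG b (Suc m)"
    then obtain a where a: "a \<in> homotopy_set BG b (Suc m)" "c = f (Suc m) a" by blast
    have c: "c \<in> homotopy_set BG' b' (Suc m)" unfolding a(2) by (rule f_in[OF a(1)])
    have "i_map m (\<theta> m a) \<in> i_map m ` homotopy_set D \<one>\<^bsub>G\<^esub> m" using \<theta>_in(1)[OF a(1)] by blast
    then have "p_map m (\<theta>' m c) = u'' m" unfolding i_p_exact a(2) \<theta>_f[OF a(1)] by blast
    then have "\<theta>'' m (g (Suc m) c) = \<theta>'' m (homotopy_unit BG'' b'' (Suc m))" by (simp only: \<theta>_g[OF c] \<theta>_unit)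
    then show "c \<in> {c \<in> homotopy_set BG' b' (Suc m). g (Suc m) c = homotopy_unit BG'' b'' (Suc m)}"
      using c \<theta>_eq(3)[OF g_in[OF c] units_in(3)] by blast
  next
    fix c assume "c \<in> {c \<in> homotopy_set BG' b' (Suc m). g (Suc m) c = homotopy_unit BG'' b'' (Suc m)}"
    then have c: "c \<in> homotopy_set BG' b' (Suc m)" "g (Suc m) c = homotopy_unit BG'' b'' (Suc m)" by blast+
    have "p_map m (\<theta>' m c) = u'' m" using \<theta>_g[OF c(1)] unfolding c(2) \<theta>_unit by simp
    then have "\<theta>' m c \<in> i_map m ` homotopy_set D \<one>\<^bsub>G\<^esub> m" unfolding i_p_exact using \<theta>_in(2)[OF c(1)] by blast
    then obtain d where d: "d \<in> homotopy_set D \<one>\<^bsub>G\<^esub> m" "\<theta>' m c = i_map m d" by blast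
    from \<theta>_surj(1)[OF d(1)] obtain a where a: "a \<in> homotopy_set BG b (Suc m)" "\<theta> m a = d" by blast
    have "\<theta>' m (f (Suc m) a) = \<theta>' m c" unfolding \<theta>_f[OF a(1)] a(2) d(2) ..
    then have "f (Suc m) a = c" using \<theta>_eq(2)[OF f_in[OF a(1)] c(1)] by blast
    then show "c \<in> f (Suc m) ` homotopy_set BG b (Suc m)" using a(1) by blast
  qed
qed

text \<open>Shared by both cases of \<open>exact_g_delta\<close>, which differ in how membership in
  the image of \<open>p_map\<close> is decided.\<close>

lemma g_image_iff:
  assumes c: "c \<in> homotopy_set BG'' b'' (Suc n)"
  shows "c \<in> g (Suc n) ` homotopy_set BG' b' (Suc n) \<longleftrightarrow> \<theta>'' n c \<in> p_map n ` homotopy_set D' \<one>\<^bsub>G'\<^esub> n"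
proof
  assume "c \<in> g (Suc n) ` homotopy_set BG' b' (Suc n)"
  then obtain a where "a \<in> homotopy_set BG' b' (Suc n)" "c = g (Suc n) a" by blast
  then show "\<theta>'' n c \<in> p_map n ` homotopy_set D' \<one>\<^bsub>G'\<^esub> n" using \<theta>_g \<theta>_in(2) by blast
next
  assume "\<theta>'' n c \<in> p_map n ` homotopy_set D' \<one>\<^bsub>G'\<^esub> n"
  then obtain d where d: "d \<in> homotopy_set D' \<one>\<^bsub>G'\<^esub> n" "\<theta>'' n c = p_map n d" by blast
  from \<theta>_surj(2)[OF d(1)] obtain a where a: "a \<in> homotopy_set BG' b' (Suc n)" "\<theta>' n a = d" by blast
  have "\<theta>'' n (g (Suc n) a) = \<theta>'' n c" unfolding \<theta>_g[OF a(1)] a(2) d(2) ..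
  then have "g (Suc n) a = c" using \<theta>_eq(3)[OF g_in[OF a(1)] c] by blast
  then show "c \<in> g (Suc n) ` homotopy_set BG' b' (Suc n)" using a(1) by blast
qed

lemma exact_g_delta:
  "g (Suc n) ` homotopy_set BG' b' (Suc n) = {c \<in> homotopy_set BG'' b'' (Suc n). delta n c = homotopy_unit BG b n}"
proof -
  have "c \<in> g (Suc n) ` homotopy_set BG' b' (Suc n) \<longleftrightarrow> delta n c = homotopy_unit BG b n"
    if c: "c \<in> homotopy_set BG'' b'' (Suc n)" for c
  proof (cases n)
    case 0
    \<comment> \<open>Both sides are always true: \<open>p_map 0\<close> is surjective and
      \<open>delta 0\<close> is constant.\<close>
    then show ?thesis using g_image_iff[OF c] p_surj_0 \<theta>_in(3)[OF c] by (simp add: delta_0)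
  next
    case (Suc m)
    have c': "c \<in> homotopy_set BG'' b'' (Suc (Suc m))" using c Suc by simp
    have "delta n c = homotopy_unit BG b n \<longleftrightarrow> \<theta> m (delta (Suc m) c) = \<theta> m (homotopy_unit BG b (Suc m))"
      unfolding Suc using \<theta>_eq(1)[OF delta_Suc(1)[OF c'] units_in(1)] by blast
    also have "\<dots> \<longleftrightarrow> bd m (\<theta>'' (Suc m) c) = u m" unfolding delta_Suc(2)[OF c'] \<theta>_unit ..
    also have "\<dots> \<longleftrightarrow> \<theta>'' (Suc m) c \<in> p_map (Suc m) ` homotopy_set D' \<one>\<^bsub>G'\<^esub> (Suc m)"
      by (rule p_bd_exact[OF \<theta>_in(3)[OF c']])
    finally show ?thesis using g_image_iff[OF c'] Suc by blast
  qed
  then show ?thesis using g_in by blast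
qed

lemma exact_delta_f: "delta n ` homotopy_set BG'' b'' (Suc n) = {c \<in> homotopy_set BG b n. f n c = homotopy_unit BG' b' n}"
proof (cases n)
  case 0
  show ?thesis unfolding 0 pi_0 using units_in(3)[of "Suc 0"] f_unit[of 0] by (auto simp: delta_0)
next
  case (Suc m)
  show ?thesis
    unfolding Suc
  proof (intro equalityI subsetI)
    fix c assume "c \<in> delta (Suc m) ` homotopy_set BG'' b'' (Suc (Suc m))"
    then obtain a where a: "a \<in> homotopy_set BG'' b'' (Suc (Suc m))" "c = delta (Suc m) a" by blast
    have c: "c \<in> homotopy_set BG b (Suc m)" unfolding a(2) by (rule delta_Suc(1)[OF a(1)])
    have "\<theta> m c \<in> bd m ` homotopy_set D'' \<one>\<^bsub>G''\<^esub> (Suc m)" unfolding a(2) delta_Suc(2)[OF a(1)] using \<theta>_in(3)[OF a(1)] by blast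
    then have "i_map m (\<theta> m c) = u' m" unfolding bd_i_exact by blast
    then have "\<theta>' m (f (Suc m) c) = \<theta>' m (homotopy_unit BG' b' (Suc m))" by (simp only: \<theta>_f[OF c] \<theta>_unit)
    then show "c \<in> {c \<in> homotopy_set BG b (Suc m). f (Suc m) c = homotopy_unit BG' b' (Suc m)}"
      using c \<theta>_eq(2)[OF f_in[OF c] units_in(2)] by blast
  next
    fix c assume "c \<in> {c \<in> homotopy_set BG b (Suc m). f (Suc m) c = homotopy_unit BG' b' (Suc m)}"
    then have c: "c \<in> homotopy_set BG b (Suc m)" "f (Suc m) c = homotopy_unit BG' b' (Suc m)" by blast+
    have "i_map m (\<theta> m c) = u' m" using \<theta>_f[OF c(1)] unfolding c(2) \<theta>_unit by simp
    then have "\<theta> m c \<in> bd m ` homotopy_set D'' \<one>\<^bsub>G''\<^esub> (Suc m)" unfolding bd_i_exact using \<theta>_in(1)[OF c(1)] by blast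
    then obtain d where d: "d \<in> homotopy_set D'' \<one>\<^bsub>G''\<^esub> (Suc m)" "\<theta> m c = bd m d" by blast
    from \<theta>_surj(3)[OF d(1)] obtain a where a: "a \<in> homotopy_set BG'' b'' (Suc (Suc m))" "\<theta>'' (Suc m) a = d" by blast
    have "\<theta> m (delta (Suc m) a) = \<theta> m c" unfolding delta_Suc(2)[OF a(1)] a(2) d(2) ..
    then have "delta (Suc m) a = c" using \<theta>_eq(1)[OF delta_Suc(1)[OF a(1)] c(1)] by blast
    then show "c \<in> delta (Suc m) ` homotopy_set BG'' b'' (Suc (Suc m))" using a(1) by blast
  qed
qed

lemma long_exact: "long_exact_homotopy_sequence BG BG' BG'' (BG_map G' D' i) (BG_map G'' D'' p) b delta"
  unfolding long_exact_homotopy_sequence_def exact_at_def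
proof (intro conjI allI impI)
  fix n :: nat
  show "f n \<in> homotopy_set BG b n \<rightarrow> homotopy_set BG' b' n" using f_in by blast
  show "g n \<in> homotopy_set BG' b' n \<rightarrow> homotopy_set BG'' b'' n" using g_in by blast
  show "delta n \<in> homotopy_set BG'' b'' (n + 1) \<rightarrow> homotopy_set BG b n" using delta_in by simp
  show "f n ` homotopy_set BG b n = {c \<in> homotopy_set BG' b' n. g n c = homotopy_unit BG'' b'' n}" by (rule exact_f_g)
  show "g (n + 1) ` homotopy_set BG' b' (n + 1) = {c \<in> homotopy_set BG'' b'' (n + 1). delta n c = homotopy_unit BG b n}"
    using exact_g_delta[of n] by simp
  show "delta n ` homotopy_set BG'' b'' (n + 1) = {c \<in> homotopy_set BG b n. f n c = homotopy_unit BG' b' n}"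
    using exact_delta_f[of n] by simp
  assume "1 \<le> n"
  then obtain m where m: "n = Suc m" by (cases n) auto
  show "group_hom (homotopy_group BG b n) (homotopy_group BG' b' n) (f n)"
    unfolding m by (rule group_hom_homotopy_map[OF I.D1.EG.dB I.D2.EG.dB I.smooth_BG_map bs(1)])
  show "group_hom (homotopy_group BG' b' n) (homotopy_group BG'' b'' n) (g n)"
    unfolding m by (rule group_hom_homotopy_map[OF I.D2.EG.dB P.D2.EG.dB P.smooth_BG_map bs(2)])
  show "group_hom (homotopy_group BG'' b'' (n + 1)) (homotopy_group BG b n) (delta n)"
    using group_hom_delta[of m] by (simp add: m)
qed

end

theorem proposition5p19:
  fixes G :: "'a monoid" and D :: "'a diff_space"
    and G' :: "'b monoid" and D' :: "'b diff_space"
    and G'' :: "'c monoid" and D'' :: "'c diff_space"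
    and i :: "'a \<Rightarrow> 'b" and p :: "'b \<Rightarrow> 'c"
    and b :: "'a BG"
  assumes "diffeological_extension G D G' D' G'' D'' i p"
    and "b \<in> points (BG_diff G D)"
  shows "\<exists>\<delta>. long_exact_homotopy_sequence
           (BG_diff G D) (BG_diff G' D') (BG_diff G'' D'')
           (BG_map G' D' i) (BG_map G'' D'' p) b \<delta>"
proof -
  interpret extension G D G' D' G'' D'' i p by unfold_locales (rule assms(1))
  obtain c where c: "c \<in> points (EG_diff G D)" "b = I.D1.EG_quot c" by (rule I.D1.BG_E[OF assms(2)])
  interpret based_extension G D G' D' G'' D'' i p c by unfold_locales (rule c(1))
  show ?thesis unfolding c(2) by (rule exI, rule long_exact)
qed

end
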